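(* Let $k,s,m$ be positive integers. Then the Macdonald function $Q_{(k^s)}(q,q^m)$ of rectangular shape $(k^s)=(k,\dots,k)$ ($s$ parts) is, up to a scalar factor, a $2m$-dimensional $\lambda$-hyperdeterminant with $\lambda=q$: $$\frac{(q;q)_{sm}}{(q;q)_m^{s}}\,Q_{(k^s)}(q,q^m)=\frac{(q;q)_s}{(1-q)^s}\,\mathrm{det}^{[2m]}_{q}\Big(Q_{k+\sum_{r=1}^m(i_{m+r}-i_r)}(q,q^m)\Big)_{1\le i_1,\dots,i_{2m}\le s}.$$
   Context: Macdonald functions: let $\Lambda$ be the ring of symmetric functions in $x_1,x_2,\dots$ over $\mathbb{Q}(q,t)$, with the scalar product $\langle p_\lambda,p_\mu\rangle=\delta_{\lambda\mu}z_\lambda\prod_i\frac{1-q^{\lambda_i}}{1-t^{\lambda_i}}$ on power sums, where $z_\lambda=\prod_{i\ge1}i^{m_i}m_i!$ and $m_i$ is the number of parts of $\lambda$ equal to $i$. $P_\mu(q,t)$ are the Macdonald symmetric functions (orthogonal for this product, and unitriangular in the monomial symmetric functions with respect to dominance order), and $Q_\mu(q,t)=P_\mu(q,t)/\langle P_\mu,P_\mu\rangle$ is the dual basis. Here $t=q^m$. For an integer $j\ge 1$, $Q_j(q,q^m)$ denotes $Q_{(j)}(q,q^m)$ for the one-row partition $(j)$; $Q_0=1$ and $Q_j=0$ for $j<0$. Notation: $(a;q)_n=(1-a)(1-aq)\cdots(1-aq^{n-1})$, and $0^0=1$ by convention. Alternating sign matrices: $\mathrm{Alt}_n$ is the set of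 $n\times n$ matrices with entries in $\{0,1,-1\}$ such that each row and each column sums to $1$ and the nonzero entries in each row and each column alternate in sign. For $X=(x_{ij})\in\mathrm{Alt}_n$: - the inversion number is $i(X)=\sum x_{ij}x_{ab}$, summed over all $1\le i,j,a,b\le n$ with $a>i$ and $b<j$; - $n(X)$ is the number of entries of $X$ equal to $-1$; - $X(i)=\sum_{j=1}^n j\,x_{ij}$ for $1\le i\le n$ (the generalized permutation of $X$); one always has $1\le X(i)\le n$. The $\lambda$-hyperdeterminant of a $2m$-dimensional hypermatrix $M=(M(i_1,\dots,i_{2m}))_{1\le i_1,\dots,i_{2m}\le n}$ with commuting entries is $$\mathrm{det}^{[2m]}_{\lambda}(M)=\frac{(1-\lambda)^n}{(\lambda;\lambda)_n}\sum_{X_1,\dots,X_{2m}\in\mathrm{Alt}_n}\phi_\lambda(X_1,\dots,X_{2m})\prod_{i=1}^n M(X_1(i),X_2(i),\dots,X_{2m}(i)),$$ where $$\phi_\lambda(X_1,\dots,X_{2m})=\prod_{r=1}^m(-\lambda^{r-1})^{i(X_r)}(1-\lambda^{-(r-1)})^{n(X_r)}(-\lambda^{r})^{i(X_{m+r})}(1-\lambda^{-r})^{n(X_{m+r})}.$$ In the claim this is used with $n=s$, $\lambda=q$ and $M(i_1,\dots,i_{2m})=Q_{k+\sum_{r=1}^m(i_{m+r}-i_r)}(q,q^m)$. *)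

theory Defs
  imports
    "HOL-Library.Multiset"
    "HOL-Library.FuncSet"
    "HOL-Computational_Algebra.Polynomial"
    "HOL-Computational_Algebra.Fraction_Field"
    "Jordan_Normal_Form.Matrix"
begin

section \<open>The ring of symmetric functions\<close>

text \<open>
  A monomial in the variables \<open>x\<^sub>0, x\<^sub>1, \<dots>\<close> is the finite multiset of the indices of its
  variables: \<open>{#0, 0, 3#}\<close> is \<open>x\<^sub>0\<^sup>2 x\<^sub>3\<close>.  Multiplication is \<open>+\<close>, the degree is \<open>size\<close>, and a
  permutation \<open>\<pi>\<close> of the variables acts by \<open>image_mset \<pi>\<close>.  A symmetric function is a formal
  power series of bounded degree, given by its coefficients, that is invariant under all
  permutations of the variables.
\<close>

typedef (overloaded) 'a symfun =
  "{f :: nat multiset \<Rightarrow> 'a::comm_ring_1.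
      (\<forall>\<pi> a. bij \<pi> \<longrightarrow> f (image_mset \<pi> a) = f a) \<and> (\<exists>d. \<forall>a. f a \<noteq> 0 \<longrightarrow> size a \<le> d)}"
  morphisms sf_coeff Abs_symfun
  by (rule exI[of _ "\<lambda>_. 0"]) auto

setup_lifting type_definition_symfun

lemma finite_submultisets: "finite {a :: 'b multiset. a \<subseteq># c}"
proof (induction c)
  case empty
  then show ?case by simp
next
  case (add x c)
  have "{a. a \<subseteq># add_mset x c} \<subseteq> {a. a \<subseteq># c} \<union> add_mset x ` {a. a \<subseteq># c}"
  proof
    fix a assume "a \<in> {a. a \<subseteq># add_mset x c}"
    then have a: "a \<subseteq># add_mset x c" by simp
    show "a \<in> {a. a \<subseteq># c} \<union> add_mset x ` {a. a \<subseteq># c}"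
    proof (cases "x \<in># a")
      case True
      then obtain b where b: "a = add_mset x b" by (meson multi_member_split)
      then show ?thesis using a by auto
    next
      case False
      then have "a \<subseteq># c"
        using a by (metis diff_single_trivial subset_eq_diff_conv add_mset_add_single)
      then show ?thesis by simp
    qed
  qed
  then show ?case using add by (meson finite_UnI finite_imageI finite_subset)
qed

lemma finite_mset_splits: "finite {(a, b). a + b = (c :: 'b multiset)}"
  by (rule finite_subset[of _ "{a. a \<subseteq># c} \<times> {a. a \<subseteq># c}"])
    (auto simp: finite_submultisets)

lemma finite_mset_splits': "finite {p. fst p + snd p = (c :: 'b multiset)}"
  using finite_mset_splits[of c] by (simp add: case_prod_unfold)

instantiation symfun :: (comm_ring_1) comm_ring_1
begin

lift_definition zero_symfun :: "'a symfun" is "\<lambda>_. 0" by simp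

lift_definition one_symfun :: "'a symfun" is "\<lambda>a. if a = {#} then 1 else 0"
  by auto

lift_definition plus_symfun :: "'a symfun \<Rightarrow> 'a symfun \<Rightarrow> 'a symfun" is "\<lambda>f g a. f a + g a"
proof -
  fix f g :: "nat multiset \<Rightarrow> 'a"
  assume *: "(\<forall>\<pi> a. bij \<pi> \<longrightarrow> f (image_mset \<pi> a) = f a) \<and> (\<exists>d. \<forall>a. f a \<noteq> 0 \<longrightarrow> size a \<le> d)"
    "(\<forall>\<pi> a. bij \<pi> \<longrightarrow> g (image_mset \<pi> a) = g a) \<and> (\<exists>d. \<forall>a. g a \<noteq> 0 \<longrightarrow> size a \<le> d)"
  then obtain d e where d: "\<And>a. f a \<noteq> 0 \<Longrightarrow> size a \<le> d" and e: "\<And>a. g a \<noteq> 0 \<Longrightarrow> size a \<le> e"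
    by blast
  have "size a \<le> max d e" if "f a + g a \<noteq> 0" for a
    using that d[of a] e[of a] by (cases "f a = 0") auto
  then show "(\<forall>\<pi> a. bij \<pi> \<longrightarrow> f (image_mset \<pi> a) + g (image_mset \<pi> a) = f a + g a) \<and>
      (\<exists>d. \<forall>a. f a + g a \<noteq> 0 \<longrightarrow> size a \<le> d)"
    using * by auto
qed

lift_definition uminus_symfun :: "'a symfun \<Rightarrow> 'a symfun" is "\<lambda>f a. - f a"
  by auto

definition minus_symfun :: "'a symfun \<Rightarrow> 'a symfun \<Rightarrow> 'a symfun" where
  "minus_symfun f g = f + - g"

lift_definition times_symfun :: "'a symfun \<Rightarrow> 'a symfun \<Rightarrow> 'a symfun" is
  "\<lambda>f g c. \<Sum>(a, b) \<in> {(a, b). a + b = c}. f a * g b"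
proof -
  fix f g :: "nat multiset \<Rightarrow> 'a"
  assume *: "(\<forall>\<pi> a. bij \<pi> \<longrightarrow> f (image_mset \<pi> a) = f a) \<and> (\<exists>d. \<forall>a. f a \<noteq> 0 \<longrightarrow> size a \<le> d)"
    "(\<forall>\<pi> a. bij \<pi> \<longrightarrow> g (image_mset \<pi> a) = g a) \<and> (\<exists>d. \<forall>a. g a \<noteq> 0 \<longrightarrow> size a \<le> d)"
  then obtain d e where d: "\<And>a. f a \<noteq> 0 \<Longrightarrow> size a \<le> d" and e: "\<And>a. g a \<noteq> 0 \<Longrightarrow> size a \<le> e"
    by blast
  let ?h = "\<lambda>c. \<Sum>(a, b) \<in> {(a, b). a + b = c}. f a * g b"
  have "?h (image_mset \<pi> c) = ?h c" if \<pi>: "bij \<pi>" for \<pi> c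
  proof -
    have inv: "image_mset \<pi> (image_mset (inv_into UNIV \<pi>) a) = a"
      "image_mset (inv_into UNIV \<pi>) (image_mset \<pi> a) = a" for a
      using \<pi> by (simp_all add: multiset.map_comp bij_is_inj surj_iff[THEN iffD1, OF bij_is_surj])
    show ?thesis
      by (rule sum.reindex_bij_witness[of _
            "map_prod (image_mset \<pi>) (image_mset \<pi>)"
            "map_prod (image_mset (inv_into UNIV \<pi>)) (image_mset (inv_into UNIV \<pi>))"])
        (use * \<pi> inv in \<open>auto simp: bij_imp_bij_inv simp flip: image_mset_union\<close>)
  qed
  moreover have "size c \<le> d + e" if nz: "?h c \<noteq> 0" for c
  proof -
    obtain x where "x \<in> {(a, b). a + b = c}" "(case x of (a, b) \<Rightarrow> f a * g b) \<noteq> 0"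
      using nz by (rule sum.not_neutral_contains_not_neutral)
    then obtain a b where "a + b = c" "f a * g b \<noteq> 0"
      by auto
    then show ?thesis using d[of a] e[of b] by fastforce
  qed
  ultimately show "(\<forall>\<pi> a. bij \<pi> \<longrightarrow> ?h (image_mset \<pi> a) = ?h a) \<and> (\<exists>d. \<forall>a. ?h a \<noteq> 0 \<longrightarrow> size a \<le> d)"
    by blast
qed

instance
proof
  fix f g h :: "'a symfun"
  show "f + g + h = f + (g + h)" "f + g = g + f" "0 + f = f" "- f + f = 0" "f - g = f + - g"
    unfolding minus_symfun_def by (transfer, force simp: algebra_simps)+
  show "(0 :: 'a symfun) \<noteq> 1"
    by transfer (metis (full_types) zero_neq_one)
  show "1 * f = f"
  proof (transfer, rule ext)
    fix f :: "nat multiset \<Rightarrow> 'a" and c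
    have "(\<Sum>(a, b) \<in> {(a, b). a + b = c}. (if a = {#} then 1 else 0) * f b) =
        (\<Sum>(a, b) \<in> {({#} :: nat multiset, c)}. f b)"
      by (rule sum.mono_neutral_cong_right) (auto simp: finite_mset_splits split: if_splits)
    then show "(\<Sum>(a, b) \<in> {(a, b). a + b = c}. (if a = {#} then 1 else 0) * f b) = f c"
      by simp
  qed
  show "f * g = g * f"
  proof (transfer, rule ext)
    fix f g :: "nat multiset \<Rightarrow> 'a" and c
    show "(\<Sum>(a, b) \<in> {(a, b). a + b = c}. f a * g b) = (\<Sum>(a, b) \<in> {(a, b). a + b = c}. g a * f b)"
      by (rule sum.reindex_bij_witness[of _ prod.swap prod.swap]) (auto simp: algebra_simps)
  qed
  show "(f + g) * h = f * h + g * h"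
    by transfer (simp add: algebra_simps sum.distrib case_prod_unfold)
  show "f * g * h = f * (g * h)"
  proof (transfer, rule ext)
    fix f g h :: "nat multiset \<Rightarrow> 'a" and c
    have "(\<Sum>(d, e) \<in> {(a, b). a + b = c}. (\<Sum>(a, b) \<in> {(a, b). a + b = d}. f a * g b) * h e) =
        (\<Sum>((d, e), (a, b)) \<in> (SIGMA (d, e) : {(a, b). a + b = c}. {(a, b). a + b = d}).
          f a * g b * h e)"
      by (subst sum.Sigma[symmetric])
        (auto simp: finite_mset_splits' case_prod_unfold sum_distrib_right)
    also have "\<dots> = (\<Sum>((a, d), (b, e)) \<in> (SIGMA (a, d) : {(a, b). a + b = c}. {(b, e). b + e = d}).
          f a * (g b * h e))"
      by (rule sum.reindex_bij_witness[of _
            "\<lambda>((a, d), (b, e)). ((a + b, e), (a, b))" "\<lambda>((d, e), (a, b)). ((a, b + e), (b, e))"])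
        (auto simp: algebra_simps)
    also have "\<dots> = (\<Sum>(a, d) \<in> {(a, b). a + b = c}. f a * (\<Sum>(b, e) \<in> {(b, e). b + e = d}. g b * h e))"
      by (subst sum.Sigma[symmetric])
        (auto simp: finite_mset_splits' case_prod_unfold sum_distrib_left)
    finally show "(\<Sum>(d, e) \<in> {(a, b). a + b = c}. (\<Sum>(a, b) \<in> {(a, b). a + b = d}. f a * g b) * h e) =
        (\<Sum>(a, d) \<in> {(a, b). a + b = c}. f a * (\<Sum>(b, e) \<in> {(b, e). b + e = d}. g b * h e))" .
  qed
qed

end

lift_definition sf_scale :: "'a::comm_ring_1 \<Rightarrow> 'a symfun \<Rightarrow> 'a symfun" is "\<lambda>c f a. c * f a"
proof -
  fix c :: 'a and f :: "nat multiset \<Rightarrow> 'a"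
  assume "(\<forall>\<pi> a. bij \<pi> \<longrightarrow> f (image_mset \<pi> a) = f a) \<and> (\<exists>d. \<forall>a. f a \<noteq> 0 \<longrightarrow> size a \<le> d)"
  then show "(\<forall>\<pi> a. bij \<pi> \<longrightarrow> c * f (image_mset \<pi> a) = c * f a) \<and> (\<exists>d. \<forall>a. c * f a \<noteq> 0 \<longrightarrow> size a \<le> d)"
    by (metis mult_zero_right)
qed

lemma vector_space_sf_scale: "vector_space (sf_scale :: 'a::field \<Rightarrow> _)"
  by unfold_locales (transfer; simp add: algebra_simps)+

section \<open>Partitions, monomial symmetric functions, power sums\<close>

definition is_partition :: "nat list \<Rightarrow> bool" where
  "is_partition \<mu> \<longleftrightarrow> sorted_wrt (\<ge>) \<mu> \<and> (\<forall>x\<in>set \<mu>. 0 < x)"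

definition dominance_le :: "nat list \<Rightarrow> nat list \<Rightarrow> bool" where
  "dominance_le \<nu> \<mu> \<longleftrightarrow>
     sum_list \<nu> = sum_list \<mu> \<and> (\<forall>k. sum_list (take k \<nu>) \<le> sum_list (take k \<mu>))"

definition exponents :: "nat multiset \<Rightarrow> nat multiset" where
  "exponents a = image_mset (count a) (mset_set (set_mset a))"

lift_definition monomial_sf :: "nat list \<Rightarrow> 'a::comm_ring_1 symfun" is
  "\<lambda>\<mu> a. if exponents a = mset \<mu> then 1 else 0"
proof -
  fix \<mu> :: "nat list"
  have 1: "exponents (image_mset \<pi> a) = exponents a" if "bij \<pi>" for \<pi> a
  proof -
    have "inj \<pi>" using that by (rule bij_is_inj)
    then have count: "count (image_mset \<pi> a) (\<pi> x) = count a x" for x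
      by (induction a) (auto simp: inj_eq)
    have "exponents (image_mset \<pi> a)
        = image_mset (count (image_mset \<pi> a)) (image_mset \<pi> (mset_set (set_mset a)))"
      using \<open>inj \<pi>\<close> by (simp add: exponents_def image_mset_mset_set inj_on_subset)
    also have "\<dots> = exponents a"
      using count by (simp add: exponents_def multiset.map_comp comp_def)
    finally show ?thesis .
  qed
  have 2: "sum_mset (exponents a) = size a" for a
    by (simp add: exponents_def size_multiset_overloaded_eq sum_unfold_sum_mset)
  have "size a \<le> sum_list \<mu>" if "exponents a = mset \<mu>" for a
    using 2[of a] that by (simp add: sum_mset_sum_list)
  then show "(\<forall>\<pi> a. bij \<pi> \<longrightarrow> (if exponents (image_mset \<pi> a) = mset \<mu> then 1 else (0::'a)) =
        (if exponents a = mset \<mu> then 1 else 0)) \<and>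
      (\<exists>d. \<forall>a. (if exponents a = mset \<mu> then 1 else (0::'a)) \<noteq> 0 \<longrightarrow> size a \<le> d)"
    using 1 by auto
qed

lift_definition power_sum :: "nat \<Rightarrow> 'a::comm_ring_1 symfun" is
  "\<lambda>r a. if \<exists>i. a = replicate_mset r i then 1 else 0"
proof -
  fix r :: nat
  have iff: "(\<exists>i. image_mset \<pi> a = replicate_mset r i) \<longleftrightarrow> (\<exists>i. a = replicate_mset r i)"
    if \<pi>: "bij \<pi>" for \<pi> :: "nat \<Rightarrow> nat" and a
  proof
    assume "\<exists>i. image_mset \<pi> a = replicate_mset r i"
    then obtain i where "image_mset (inv_into UNIV \<pi>) (image_mset \<pi> a) = image_mset (inv_into UNIV \<pi>) (replicate_mset r i)"
      by auto
    then show "\<exists>i. a = replicate_mset r i"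
      using \<pi> by (auto simp: multiset.map_comp bij_is_inj)
  qed auto
  have bound: "\<exists>d. \<forall>a. (if \<exists>i. a = replicate_mset r i then 1 else (0::'a)) \<noteq> 0 \<longrightarrow> size a \<le> d"
    by (auto intro!: exI[of _ r])
  show "(\<forall>(\<pi> :: nat \<Rightarrow> nat) a. bij \<pi> \<longrightarrow> (if \<exists>i. image_mset \<pi> a = replicate_mset r i then 1 else (0::'a)) =
        (if \<exists>i. a = replicate_mset r i then 1 else 0)) \<and>
      (\<exists>d. \<forall>a. (if \<exists>i. a = replicate_mset r i then 1 else (0::'a)) \<noteq> 0 \<longrightarrow> size a \<le> d)"
    by (intro conjI allI impI bound if_cong[OF iff refl refl])
qed

definition power_sum_part :: "nat list \<Rightarrow> 'a::comm_ring_1 symfun" where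
  "power_sum_part \<mu> = prod_list (map power_sum \<mu>)"

section \<open>Macdonald functions with parameters in a field\<close>

definition z_part :: "nat list \<Rightarrow> nat" where
  "z_part \<mu> = (\<Prod>i\<in>set \<mu>. i ^ count_list \<mu> i * fact (count_list \<mu> i))"

text \<open>
  The power sum products form a basis when the field has characteristic 0, so the bilinear form
  is determined by its values on them.
\<close>

definition macdonald_form ::
    "'a::field \<Rightarrow> 'a \<Rightarrow> 'a symfun \<Rightarrow> 'a symfun \<Rightarrow> 'a" where
  "macdonald_form q t = (THE B.
     (\<forall>f. Vector_Spaces.linear sf_scale (*) (B f)) \<and>
     (\<forall>g. Vector_Spaces.linear sf_scale (*) (\<lambda>f. B f g)) \<and>
     (\<forall>\<nu> \<mu>. is_partition \<nu> \<longrightarrow> is_partition \<mu> \<longrightarrow>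
        B (power_sum_part \<nu>) (power_sum_part \<mu>) =
          (if \<nu> = \<mu>
           then of_nat (z_part \<nu>) * prod_list (map (\<lambda>i. (1 - q ^ i) / (1 - t ^ i)) \<nu>)
           else 0)))"

definition is_macdonald_family :: "'a::field \<Rightarrow> 'a \<Rightarrow> (nat list \<Rightarrow> 'a symfun) \<Rightarrow> bool" where
  "is_macdonald_family q t P \<longleftrightarrow>
     (\<forall>\<mu>. is_partition \<mu> \<longrightarrow> (\<exists>u. P \<mu> = monomial_sf \<mu> +
        (\<Sum>\<nu> | is_partition \<nu> \<and> dominance_le \<nu> \<mu> \<and> \<nu> \<noteq> \<mu>. sf_scale (u \<nu>) (monomial_sf \<nu>)))) \<and>
     (\<forall>\<nu> \<mu>. is_partition \<nu> \<longrightarrow> is_partition \<mu> \<longrightarrow> \<nu> \<noteq> \<mu> \<longrightarrow> macdonald_form q t (P \<nu>) (P \<mu>) = 0)"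

text \<open>
  Only the values at partitions are determined, hence \<open>SOME\<close> rather than \<open>THE\<close>.
\<close>

definition macdonald_P :: "'a::field \<Rightarrow> 'a \<Rightarrow> nat list \<Rightarrow> 'a symfun" where
  "macdonald_P q t = (SOME P. is_macdonald_family q t P)"

definition macdonald_Q :: "'a::field \<Rightarrow> 'a \<Rightarrow> nat list \<Rightarrow> 'a symfun" where
  "macdonald_Q q t \<mu> =
     sf_scale (inverse (macdonald_form q t (macdonald_P q t \<mu>) (macdonald_P q t \<mu>)))
       (macdonald_P q t \<mu>)"

section \<open>The specialization \<open>t = q\<^sup>m\<close>\<close>

text \<open>\<open>\<rat>(q)\<close> is the fraction field of \<open>\<rat>[q]\<close>, and \<open>\<rat>(q,t)\<close> that of \<open>\<rat>[q][t]\<close>.\<close>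

type_synonym Qq = "rat poly fract"
type_synonym Qqt = "rat poly poly fract"

definition var_q :: Qq where
  "var_q = Fract [:0, 1:] 1"

definition var_q2 :: Qqt where
  "var_q2 = Fract [:[:0, 1:]:] 1"

definition var_t2 :: Qqt where
  "var_t2 = Fract [:0, 1:] 1"

text \<open>
  Substitution of \<open>t = q\<^sup>m\<close> in a rational function \<open>a/b\<close>; it is defined only if some such
  representation has \<open>b(q, q\<^sup>m) \<noteq> 0\<close>.
\<close>

definition spec_t :: "nat \<Rightarrow> Qqt \<Rightarrow> Qq" where
  "spec_t m r = (THE v. \<exists>a b. r = Fract a b \<and> poly b (monom 1 m) \<noteq> 0 \<and>
     v = Fract (poly a (monom 1 m)) (poly b (monom 1 m)))"

lemma spec_t_Fract:
  assumes "poly b (monom 1 m) \<noteq> 0"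
  shows "spec_t m (Fract a b) = Fract (poly a (monom 1 m)) (poly b (monom 1 m))"
  unfolding spec_t_def
proof (rule the_equality)
  fix v assume "\<exists>a' b'. Fract a b = Fract a' b' \<and> poly b' (monom 1 m) \<noteq> 0 \<and>
     v = Fract (poly a' (monom 1 m)) (poly b' (monom 1 m))"
  then obtain a' b' where *: "Fract a b = Fract a' b'" "poly b' (monom 1 m) \<noteq> 0"
    "v = Fract (poly a' (monom 1 m)) (poly b' (monom 1 m))" by blast
  have "b \<noteq> 0" "b' \<noteq> 0" using assms * by auto
  then have "a * b' = a' * b" using * by (simp add: eq_fract)
  then have "poly a (monom 1 m) * poly b' (monom 1 m) = poly a' (monom 1 m) * poly b (monom 1 m)"
    by (metis poly_mult)
  then show "v = Fract (poly a (monom 1 m)) (poly b (monom 1 m))"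
    using * assms by (simp add: eq_fract)
qed (use assms in blast)

lemma spec_t_0 [simp]: "spec_t m 0 = 0"
  using spec_t_Fract[of 1 m 0] by (simp add: Zero_fract_def)

lemma spec_t_q: "spec_t m var_q2 = var_q"
  using spec_t_Fract[of 1 m "[:[:0, 1:]:]"] by (simp add: var_q_def var_q2_def)

lemma spec_t_t: "spec_t m var_t2 = var_q ^ m"
proof -
  have "var_q ^ m = Fract ([:0, 1:] ^ m) 1"
    by (induction m) (simp_all add: var_q_def One_fract_def)
  then show ?thesis
    using spec_t_Fract[of 1 m "[:0, 1:]"] by (simp add: var_t2_def monom_altdef)
qed

lift_definition spec_sf :: "nat \<Rightarrow> Qqt symfun \<Rightarrow> Qq symfun" is "\<lambda>m f a. spec_t m (f a)"
proof -
  fix m and f :: "nat multiset \<Rightarrow> Qqt"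
  assume "(\<forall>\<pi> a. bij \<pi> \<longrightarrow> f (image_mset \<pi> a) = f a) \<and> (\<exists>d. \<forall>a. f a \<noteq> 0 \<longrightarrow> size a \<le> d)"
  then show "(\<forall>\<pi> a. bij \<pi> \<longrightarrow> spec_t m (f (image_mset \<pi> a)) = spec_t m (f a)) \<and>
      (\<exists>d. \<forall>a. spec_t m (f a) \<noteq> 0 \<longrightarrow> size a \<le> d)"
    by (metis spec_t_0)
qed

definition Q_spec :: "nat \<Rightarrow> nat list \<Rightarrow> Qq symfun" where
  "Q_spec m \<mu> = spec_sf m (macdonald_Q var_q2 var_t2 \<mu>)"

definition Q_row :: "nat \<Rightarrow> int \<Rightarrow> Qq symfun" where
  "Q_row m j = (if j < 0 then 0 else if j = 0 then 1 else Q_spec m [nat j])"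

section \<open>Alternating sign matrices and hyperdeterminants\<close>

definition alt_signs :: "int list \<Rightarrow> bool" where
  "alt_signs xs \<longleftrightarrow>
     (\<forall>j k. j < k \<longrightarrow> k < length xs \<longrightarrow> xs ! j \<noteq> 0 \<longrightarrow> xs ! k \<noteq> 0 \<longrightarrow>
        (\<forall>l. j < l \<longrightarrow> l < k \<longrightarrow> xs ! l = 0) \<longrightarrow> sgn (xs ! k) = - sgn (xs ! j))"

definition Alt :: "nat \<Rightarrow> int mat set" where
  "Alt n = {X \<in> carrier_mat n n.
     (\<forall>i<n. \<forall>j<n. X $$ (i, j) \<in> {0, 1, -1}) \<and>
     (\<forall>i<n. (\<Sum>j<n. X $$ (i, j)) = 1) \<and>
     (\<forall>j<n. (\<Sum>i<n. X $$ (i, j)) = 1) \<and>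
     (\<forall>i<n. alt_signs (list_of_vec (row X i))) \<and>
     (\<forall>j<n. alt_signs (list_of_vec (col X j)))}"

definition asm_inv :: "nat \<Rightarrow> int mat \<Rightarrow> int" where
  "asm_inv n X =
     (\<Sum>((i, j), (a, b)) \<in> {((i, j), (a, b)). i < n \<and> j < n \<and> a < n \<and> b < n \<and> i < a \<and> b < j}.
        X $$ (i, j) * X $$ (a, b))"

definition asm_neg :: "nat \<Rightarrow> int mat \<Rightarrow> nat" where
  "asm_neg n X = card {(i, j). i < n \<and> j < n \<and> X $$ (i, j) = -1}"

text \<open>
  Matrix positions count from 0, but the values of the generalized permutation, which are the
  indices of the hypermatrix, run from 1 to \<open>n\<close>.
\<close>

definition gen_perm :: "nat \<Rightarrow> int mat \<Rightarrow> nat \<Rightarrow> int" where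
  "gen_perm n X i = (\<Sum>j<n. (int j + 1) * X $$ (i, j))"

definition qpoch :: "'a::comm_ring_1 \<Rightarrow> 'a \<Rightarrow> nat \<Rightarrow> 'a" where
  "qpoch a q n = (\<Prod>i<n. 1 - a * q ^ i)"

definition phi_weight :: "'a::field \<Rightarrow> nat \<Rightarrow> nat \<Rightarrow> (nat \<Rightarrow> int mat) \<Rightarrow> 'a" where
  "phi_weight l m n X = (\<Prod>r = 1..m.
     (- (l ^ (r - 1))) powi asm_inv n (X r) * (1 - inverse (l ^ (r - 1))) ^ asm_neg n (X r) *
     (- (l ^ r)) powi asm_inv n (X (m + r)) * (1 - inverse (l ^ r)) ^ asm_neg n (X (m + r)))"

text \<open>
  A \<open>2m\<close>-dimensional hypermatrix is a function of index tuples
  \<open>i \<in> {1..2m} \<rightarrow>\<^sub>E {1..n}\<close>.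
\<close>

definition hyperdet ::
    "'a::field \<Rightarrow> nat \<Rightarrow> nat \<Rightarrow> ((nat \<Rightarrow> int) \<Rightarrow> 'a symfun) \<Rightarrow> 'a symfun" where
  "hyperdet l m n M =
     sf_scale ((1 - l) ^ n / qpoch l l n)
       (\<Sum>X \<in> {1..2*m} \<rightarrow>\<^sub>E Alt n.
          sf_scale (phi_weight l m n X)
            (\<Prod>i<n. M (\<lambda>r\<in>{1..2*m}. gen_perm n (X r) i)))"

end

theory Submission
  imports Defs "HOL-Library.Poly_Mapping" "HOL-Computational_Algebra.Formal_Power_Series"
    "HOL-Computational_Algebra.Polynomial_Factorial" "HOL-Computational_Algebra.Polynomial_FPS"
    "Jordan_Normal_Form.Determinant"
begin

text \<open>
  Both sides of the identity are values of one linear map. Let \<open>G s\<close> send a Laurent monomial in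
  \<open>y\<^sub>0, \<dots>, y\<^sub>s\<^sub>-\<^sub>1\<close> to the product of the one-row functions whose indices are its exponents. Both sides are the image of
  \<open>(y\<^sub>0 \<dots> y\<^sub>s\<^sub>-\<^sub>1)\<^sup>k\<close> times the \<open>q\<close>-Dyson product
  \<open>\<Prod>\<^sub>i\<^sub><\<^sub>j (y\<^sub>j / y\<^sub>i; q)\<^sub>m (q y\<^sub>i / y\<^sub>j; q)\<^sub>m\<close>.

  For the hyperdeterminant (\<open>hyperdeterminant_as_constant_term\<close>) the weight of a tuple of alternating sign matrices is a
  product over its members. The sum over each member is the \<open>\<lambda>\<close>-determinant of a Vandermonde matrix, which is
  \<open>\<Prod>\<^sub>i\<^sub><\<^sub>j (x\<^sub>j + l x\<^sub>i)\<close> (\<open>robbins_rumsey\<close>); the variables are the inverses of the \<open>y\<^sub>i\<close> for the first \<open>m\<close> members and the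
  \<open>y\<^sub>i\<close> for the others, and the \<open>2 m\<close> products multiply to the \<open>q\<close>-Dyson product. The identity for one matrix follows
  from a branching rule for alternants along chains of interlacing sets, which encode alternating sign matrices.

  For the Macdonald function (\<open>rectangle_as_constant_term\<close>) there is a self-adjoint operator \<open>Dop\<close> that is triangular in
  dominance order on products of one-row functions (\<open>Dop_gl\<close>) and has distinct eigenvalues; its normalized eigenvectors
  are the functions \<open>Q\<^sub>\<kappa>\<close> (\<open>macdonald_Q_eq\<close>). An element of the span of \<open>g\<^sub>\<kappa>\<close> and larger products is thus a multiple of
  \<open>Q\<^sub>\<kappa>\<close> as soon as it is an eigenvector with the right eigenvalue. Since \<open>G\<close> is symmetric in the variables, the
  \<open>q\<close>-Dyson product may be replaced, up to a scalar, by the symmetric weight \<open>\<Prod>\<^sub>i\<^sub>\<noteq>\<^sub>j (y\<^sub>i / y\<^sub>j; q)\<^sub>m\<close> (\<open>G_DP\<close>), and for this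
  weight the eigenvalue equation is a direct consequence of its behaviour under \<open>q\<close>-shifts (\<open>Dop_symmetric_weight\<close>). The
  leading coefficient is the constant term \<open>(q; q)\<^sub>s\<^sub>m / (q; q)\<^sub>m\<^sup>s\<close> of the \<open>q\<close>-Dyson product, found by Lagrange
  interpolation on a grid of which a single point contributes (\<open>q_dyson\<close>).

  The functions of the statement are built over \<open>\<rat>(q, t)\<close> and specialized afterwards. They have no pole at
  \<open>t = q\<^sup>m\<close>, because Gram--Schmidt expresses each of them by larger ones with denominators that specialize to nonzero
  norms (\<open>Q_spec_eq\<close>).
\<close>

section \<open>Symmetric functions in power sums\<close>

subsection \<open>Coefficients and scalars\<close>

lemmas sf_coeff_add = plus_symfun.rep_eq
lemmas sf_coeff_zero = zero_symfun.rep_eq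
lemmas sf_coeff_one = one_symfun.rep_eq
lemmas sf_coeff_times = times_symfun.rep_eq
lemmas sf_coeff_scale = sf_scale.rep_eq
lemmas sf_coeff_monomial = monomial_sf.rep_eq

lemma sf_eqI: "(\<And>a. sf_coeff f a = sf_coeff g a) \<Longrightarrow> f = g"
  by (simp add: sf_coeff_inject[symmetric] fun_eq_iff)

lemma sf_coeff_uminus: "sf_coeff (- f) a = - sf_coeff f a"
  by (simp add: uminus_symfun.rep_eq)

lemma sf_coeff_diff: "sf_coeff (f - g) a = sf_coeff f a - sf_coeff g a"
  unfolding minus_symfun_def sf_coeff_add sf_coeff_uminus by simp

lemma sf_coeff_sum: "sf_coeff (sum f A) a = (\<Sum>x\<in>A. sf_coeff (f x) a)"
  by (induction A rule: infinite_finite_induct) (auto simp: sf_coeff_add sf_coeff_zero)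

interpretation sf: vector_space "sf_scale :: 'a::field \<Rightarrow> 'a symfun \<Rightarrow> 'a symfun"
  by (rule vector_space_sf_scale)

lemma sf_scale_mult: "sf_scale c f * h = sf_scale c (f * h)"
  by (rule sf_eqI) (auto simp: sf_coeff_scale sf_coeff_times sum_distrib_left case_prod_unfold mult.assoc)

lemma mult_sf_scale: "h * sf_scale c f = sf_scale c (h * f)"
  by (metis sf_scale_mult mult.commute)

lemma sf_scale_of_nat: "sf_scale (of_nat n :: 'a::field) f = of_nat n * f"
  by (induction n) (auto simp: sf.scale_left_distrib algebra_simps)

text \<open>
  Two monomials with the same multiset of exponents differ by a permutation of the variables.
\<close>

lemma sf_coeff_cong_exponents:
  assumes "exponents a = exponents b"
  shows "sf_coeff f a = sf_coeff f b"
proof -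
  have ab: "image_mset (count a) (mset_set (set_mset a)) = image_mset (count b) (mset_set (set_mset b))"
    using assms by (simp add: exponents_def)
  have *: "\<exists>\<sigma>. bij_betw \<sigma> A B \<and> (\<forall>x\<in>A. g (\<sigma> x) = f x)"
    if "finite A" "finite B" "image_mset f (mset_set A) = image_mset g (mset_set B)" for A B :: "nat set" and f g :: "nat \<Rightarrow> nat"
    using that
  proof (induction A arbitrary: B rule: finite_induct)
    case empty
    then show ?case by (auto simp: bij_betw_def mset_set_empty_iff)
  next
    case (insert x A)
    have e: "add_mset (f x) (image_mset f (mset_set A)) = image_mset g (mset_set B)"
      using insert by simp
    then have "f x \<in># image_mset g (mset_set B)" by (metis union_single_eq_member)
    then obtain y where y: "y \<in> B" "g y = f x" using insert.prems by auto
    have "mset_set B = add_mset y (mset_set (B - {y}))"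
      using y insert.prems by (simp add: mset_set.remove)
    with e y have "image_mset f (mset_set A) = image_mset g (mset_set (B - {y}))" by simp
    with insert.IH[of "B - {y}"] insert.prems obtain \<sigma> where \<sigma>: "bij_betw \<sigma> A (B - {y})" "\<forall>x\<in>A. g (\<sigma> x) = f x"
      by auto
    have "bij_betw (\<sigma>(x := y)) A (B - {y})"
      using \<sigma>(1) insert.hyps by (subst bij_betw_cong[of _ _ \<sigma>]) auto
    then have "bij_betw (\<sigma>(x := y)) (insert x A) (insert y (B - {y}))"
      using bij_betw_combine[of "\<sigma>(x := y)" "{x}" "{y}" A "B - {y}"] by auto
    moreover have "insert y (B - {y}) = B" using y by auto
    moreover have "\<forall>z\<in>insert x A. g ((\<sigma>(x := y)) z) = f z" using \<sigma> y insert.hyps by auto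
    ultimately show ?case by metis
  qed
  obtain \<sigma> where \<sigma>: "bij_betw \<sigma> (set_mset a) (set_mset b)" "\<forall>x\<in>set_mset a. count b (\<sigma> x) = count a x"
    using *[OF _ _ ab] by auto
  let ?A = "set_mset a" and ?B = "set_mset b"
  have "card ?A = card ?B" using \<sigma>(1) by (rule bij_betw_same_card)
  then have "card (?B - ?A) = card (?A - ?B)"
    by (simp add: card_Diff_subset_Int Int_commute)
  then obtain \<tau> where \<tau>: "bij_betw \<tau> (?B - ?A) (?A - ?B)"
    by (metis finite_Diff finite_same_card_bij finite_set_mset)
  define \<pi> where "\<pi> x = (if x \<in> ?A then \<sigma> x else if x \<in> ?B then \<tau> x else x)" for x
  have b1: "bij_betw \<pi> ?A ?B" using \<sigma>(1) by (subst bij_betw_cong[of _ _ \<sigma>]) (auto simp: \<pi>_def)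
  have b2: "bij_betw \<pi> (?B - ?A) (?A - ?B)" using \<tau> by (subst bij_betw_cong[of _ _ \<tau>]) (auto simp: \<pi>_def)
  have b3: "bij_betw \<pi> (- (?A \<union> ?B)) (- (?A \<union> ?B))"
    by (subst bij_betw_cong[of _ _ id]) (auto simp: \<pi>_def)
  have b12: "bij_betw \<pi> (?A \<union> (?B - ?A)) (?B \<union> (?A - ?B))"
    by (rule bij_betw_combine[OF b1 b2]) auto
  have "bij_betw \<pi> ((?A \<union> (?B - ?A)) \<union> - (?A \<union> ?B)) ((?B \<union> (?A - ?B)) \<union> - (?A \<union> ?B))"
    by (rule bij_betw_combine[OF b12 b3]) auto
  moreover have "(?A \<union> (?B - ?A)) \<union> - (?A \<union> ?B) = UNIV" "(?B \<union> (?A - ?B)) \<union> - (?A \<union> ?B) = UNIV"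
    by auto
  ultimately have bij: "bij \<pi>" by (metis (no_types, lifting))
  have "image_mset \<pi> a = b"
  proof (rule multiset_eqI)
    fix y
    obtain x where x: "y = \<pi> x" using bij by (metis bij_pointE)
    have "count (image_mset \<pi> a) (\<pi> x) = count a x"
      using bij_is_inj[OF bij] by (induction a) (auto simp: inj_eq)
    also have "\<dots> = count b (\<pi> x)"
    proof (cases "x \<in> ?A")
      case True then show ?thesis using \<sigma>(2) by (simp add: \<pi>_def)
    next
      case False
      then have "\<pi> x \<notin> ?B"
        using \<tau> by (auto simp: \<pi>_def bij_betw_def)
      then show ?thesis using False by (simp add: not_in_iff)
    qed
    finally show "count (image_mset \<pi> a) y = count b y" using x by simp
  qed
  moreover have "sf_coeff f (image_mset \<pi> a) = sf_coeff f a" using sf_coeff[of f] bij by simp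
  ultimately show ?thesis by simp
qed

lemma sf_coeff_bounded: "\<exists>d. \<forall>a. sf_coeff f a \<noteq> 0 \<longrightarrow> size a \<le> d"
  using sf_coeff[of f] by simp

lemma sum_mset_exponents: "sum_mset (exponents a) = size a"
  by (simp add: exponents_def size_multiset_overloaded_eq sum_unfold_sum_mset)

lemma size_exponents: "size (exponents a) = card (set_mset a)"
  by (simp add: exponents_def)

lemma zero_notin_exponents: "0 \<notin># exponents a"
  by (auto simp: exponents_def count_eq_zero_iff)

lemma exponents_add_replicate:
  assumes "i \<notin># a" "r > 0"
  shows "exponents (a + replicate_mset r i) = add_mset r (exponents a)"
proof -
  have s: "set_mset (a + replicate_mset r i) = insert i (set_mset a)"
    using assms by auto
  have "mset_set (insert i (set_mset a)) = add_mset i (mset_set (set_mset a))"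
    using assms by simp
  moreover have "image_mset (count (a + replicate_mset r i)) (mset_set (set_mset a))
     = image_mset (count a) (mset_set (set_mset a))"
    using assms by (intro image_mset_cong) auto
  ultimately show ?thesis unfolding exponents_def s using assms by (simp add: not_in_iff)
qed

lemma exponents_surj: "0 \<notin># M \<Longrightarrow> \<exists>a. exponents a = M"
proof (induction M)
  case empty
  then show ?case by (intro exI[of _ "{#}"]) (simp add: exponents_def)
next
  case (add r M)
  then obtain a where a: "exponents a = M" by auto
  obtain i where "i \<notin> set_mset a" by (meson ex_new_if_finite finite_set_mset infinite_UNIV_nat)
  then show ?case using exponents_add_replicate[of i a r] a add.prems by (intro exI) auto
qed

subsection \<open>Products of power sums\<close>

definition psum :: "nat multiset \<Rightarrow> 'a::comm_ring_1 symfun" where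
  "psum M = prod_mset (image_mset power_sum M)"

lemma psum_empty [simp]: "psum {#} = 1" by (simp add: psum_def)
lemma psum_add_mset: "psum (add_mset r M) = power_sum r * psum M" by (simp add: psum_def)
lemma psum_union: "psum (M + N) = psum M * psum N" by (simp add: psum_def)

lemma power_sum_part_eq: "power_sum_part \<mu> = psum (mset \<mu>)"
  unfolding power_sum_part_def psum_def by (induction \<mu>) auto

lemma sf_coeff_power_sum_times:
  assumes "r > 0"
  shows "sf_coeff (power_sum r * f) c = (\<Sum>i\<in>{i. r \<le> count c i}. sf_coeff f (c - replicate_mset r i))"
proof -
  have fin: "finite {i. r \<le> count c i}"
    by (rule finite_subset[of _ "set_mset c"]) (use assms in \<open>auto simp: count_greater_zero_iff[symmetric] simp del: count_greater_zero_iff\<close>)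
  have "sf_coeff (power_sum r * f) c = (\<Sum>(a, b) \<in> {(a, b). a + b = c}. sf_coeff (power_sum r) a * sf_coeff f b)"
    by (simp add: sf_coeff_times)
  also have "\<dots> = (\<Sum>(a, b) \<in> (\<lambda>i. (replicate_mset r i, c - replicate_mset r i)) ` {i. r \<le> count c i}. sf_coeff (power_sum r) a * sf_coeff f b)"
  proof (rule sum.mono_neutral_right)
    show "finite {(a, b). a + b = c}" by (rule finite_mset_splits)
    show "(\<lambda>i. (replicate_mset r i, c - replicate_mset r i)) ` {i. r \<le> count c i} \<subseteq> {(a, b). a + b = c}"
      by (auto simp: count_le_replicate_mset_subset_eq)
    show "\<forall>x\<in>{(a, b). a + b = c} - (\<lambda>i. (replicate_mset r i, c - replicate_mset r i)) ` {i. r \<le> count c i}.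
       (case x of (a, b) \<Rightarrow> sf_coeff (power_sum r) a * sf_coeff f b) = 0"
    proof (rule ballI, rule ccontr)
      fix x assume x: "x \<in> {(a, b). a + b = c} - (\<lambda>i. (replicate_mset r i, c - replicate_mset r i)) ` {i. r \<le> count c i}"
        "(case x of (a, b) \<Rightarrow> sf_coeff (power_sum r) a * sf_coeff f b) \<noteq> 0"
      obtain a b where ab: "x = (a, b)" by force
      then have "sf_coeff (power_sum r :: 'a symfun) a \<noteq> 0" using x(2) by auto
      then obtain i where i: "a = replicate_mset r i" by (auto simp: power_sum.rep_eq split: if_splits)
      have "c = replicate_mset r i + b" using x(1) ab i by auto
      then show False using x(1) ab i by auto
    qed
  qed
  also have "\<dots> = (\<Sum>i\<in>{i. r \<le> count c i}. sf_coeff f (c - replicate_mset r i))"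
    by (subst sum.reindex)
       (use assms in \<open>auto simp: inj_on_def power_sum.rep_eq replicate_mset_eq_empty_iff dest!: arg_cong[of "replicate_mset _ _" _ set_mset] intro!: sum.cong\<close>)
  finally show ?thesis .
qed

text \<open>
  A monomial of \<open>psum M\<close> arises by assigning a variable to each part of \<open>M\<close>, so it has at most \<open>size M\<close>
  variables, and it has that many only if no two parts meet. The number of variables therefore orders the monomial
  functions so that the power sum products are triangular. The coefficients are natural numbers, which is what makes
  the diagonal entries invertible in characteristic 0.
\<close>

lemma sf_coeff_psum:
  assumes "0 \<notin># M"
  shows "\<exists>n. sf_coeff (psum M :: 'a::comm_ring_1 symfun) c = of_nat n \<and>
     (n \<noteq> 0 \<longrightarrow> size c = sum_mset M \<and> card (set_mset c) \<le> size M \<and> (card (set_mset c) = size M \<longrightarrow> exponents c = M)) \<and>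
     (exponents c = M \<longrightarrow> n \<noteq> 0)"
  using assms
proof (induction M arbitrary: c)
  case empty
  have "exponents c = {#} \<longleftrightarrow> c = {#}" by (metis size_exponents card_0_eq finite_set_mset set_mset_eq_empty_iff size_eq_0_iff_empty)
  then show ?case
    by (intro exI[of _ "if c = {#} then 1 else 0"]) (auto simp: sf_coeff_one exponents_def)
next
  case (add r M)
  then have r: "r > 0" by auto
  let ?I = "{i. r \<le> count c i}"
  have fin: "finite ?I"
    by (rule finite_subset[of _ "set_mset c"]) (use r in \<open>auto simp: count_greater_zero_iff[symmetric] simp del: count_greater_zero_iff\<close>)
  let ?c = "\<lambda>i. c - replicate_mset r i"
  have "\<forall>i. \<exists>n. sf_coeff (psum M :: 'a symfun) (?c i) = of_nat n \<and>
     (n \<noteq> 0 \<longrightarrow> size (?c i) = sum_mset M \<and> card (set_mset (?c i)) \<le> size M \<and> (card (set_mset (?c i)) = size M \<longrightarrow> exponents (?c i) = M)) \<and>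
     (exponents (?c i) = M \<longrightarrow> n \<noteq> 0)"
    using add.IH add.prems by auto
  then obtain n where n: "\<And>i. sf_coeff (psum M :: 'a symfun) (?c i) = of_nat (n i)"
    "\<And>i. n i \<noteq> 0 \<Longrightarrow> size (?c i) = sum_mset M \<and> card (set_mset (?c i)) \<le> size M"
    "\<And>i. n i \<noteq> 0 \<Longrightarrow> card (set_mset (?c i)) = size M \<Longrightarrow> exponents (?c i) = M"
    "\<And>i. exponents (?c i) = M \<Longrightarrow> n i \<noteq> 0"
    by metis
  have split: "?c i + replicate_mset r i = c" if "i \<in> ?I" for i
    using that by (simp add: count_le_replicate_mset_subset_eq)
  have set: "set_mset c = insert i (set_mset (?c i))" if "i \<in> ?I" for i
    using arg_cong[OF split[OF that], of set_mset] r by auto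
  show ?case
  proof (intro exI[of _ "sum n ?I"] conjI impI)
    show "sf_coeff (psum (add_mset r M) :: 'a symfun) c = of_nat (sum n ?I)"
      using n(1) by (simp add: psum_add_mset sf_coeff_power_sum_times[OF r])
    assume nz: "sum n ?I \<noteq> 0"
    then obtain i where i: "i \<in> ?I" "n i \<noteq> 0" by (meson sum.not_neutral_contains_not_neutral)
    note * = n(2)[OF i(2)]
    show "size c = sum_mset (add_mset r M)"
      using * arg_cong[OF split[OF i(1)], of size] unfolding size_union by simp
    have ca: "card (set_mset c) \<le> Suc (card (set_mset (?c i)))"
      unfolding set[OF i(1)] by (simp add: card_insert_if)
    then show "card (set_mset c) \<le> size (add_mset r M)" using * by simp
    assume e: "card (set_mset c) = size (add_mset r M)"
    then have "card (set_mset (?c i)) = size M" using ca * by simp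
    moreover have "i \<notin># ?c i"
    proof
      assume "i \<in># ?c i"
      then have "set_mset c = set_mset (?c i)" using set[OF i(1)] by auto
      then show False using * e by simp
    qed
    ultimately show "exponents c = add_mset r M"
      using exponents_add_replicate[of i "?c i" r] split[OF i(1)] n(3)[OF i(2)] r by simp
  next
    assume e: "exponents c = add_mset r M"
    then have "r \<in># image_mset (count c) (mset_set (set_mset c))" by (simp add: exponents_def)
    then obtain i where i: "count c i = r" "i \<in># c" by auto
    then have iI: "i \<in> ?I" by simp
    have "i \<notin># ?c i" using i by (simp add: not_in_iff)
    from exponents_add_replicate[OF this r] have "exponents (?c i) = M"
      using split[OF iI] e by simp
    then have "n i \<noteq> 0" by (rule n(4))
    then show "sum n ?I \<noteq> 0" using fin iI by (metis sum_eq_0_iff)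
  qed
qed

subsection \<open>Partitions as multisets\<close>

definition part_of :: "nat multiset \<Rightarrow> nat list" where
  "part_of M = rev (sorted_list_of_multiset M)"

lemma mset_part_of [simp]: "mset (part_of M) = M"
  by (simp add: part_of_def)

lemma is_partition_part_of: "0 \<notin># M \<Longrightarrow> is_partition (part_of M)"
  using sorted_sorted_list_of_multiset[of M] unfolding is_partition_def part_of_def
  by (simp add: sorted_wrt_rev) (metis neq0_conv)

lemma part_of_mset: "is_partition \<mu> \<Longrightarrow> part_of (mset \<mu>) = \<mu>"
proof -
  assume "is_partition \<mu>"
  then have "sorted (rev \<mu>)" unfolding is_partition_def by (simp add: sorted_wrt_rev)
  then have "sorted_list_of_multiset (mset (rev \<mu>)) = rev \<mu>"
    by (metis sorted_list_of_multiset_mset sorted_sort_id)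
  then show ?thesis by (simp add: part_of_def)
qed

lemma zero_notin_partition: "is_partition \<mu> \<Longrightarrow> 0 \<notin># mset \<mu>"
  by (auto simp: is_partition_def)

lemma partition_eq_iff: "is_partition \<mu> \<Longrightarrow> is_partition \<nu> \<Longrightarrow> mset \<mu> = mset \<nu> \<longleftrightarrow> \<mu> = \<nu>"
  by (metis part_of_mset)

lemma finite_psets: "finite {M :: nat multiset. 0 \<notin># M \<and> sum_mset M \<le> d}"
proof -
  have s: "size M \<le> sum_mset M" if "0 \<notin># M" for M :: "nat multiset"
    using that by (induction M) auto
  have e: "x \<le> sum_mset M" if "x \<in># M" for x and M :: "nat multiset"
    using that by (induction M) auto
  have "{M :: nat multiset. 0 \<notin># M \<and> sum_mset M \<le> d} \<subseteq> mset ` {xs. set xs \<subseteq> {..d} \<and> length xs \<le> d}"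
  proof
    fix M :: "nat multiset" assume M: "M \<in> {M. 0 \<notin># M \<and> sum_mset M \<le> d}"
    then have "set (part_of M) \<subseteq> {..d}" using e[of _ M] by (auto simp flip: set_mset_mset) (meson le_trans)
    moreover have "length (part_of M) \<le> d" using M s[of M] by (simp flip: size_mset)
    ultimately show "M \<in> mset ` {xs. set xs \<subseteq> {..d} \<and> length xs \<le> d}"
      by (intro image_eqI[of _ _ "part_of M"]) auto
  qed
  then show ?thesis by (rule finite_subset) (intro finite_imageI finite_lists_length_le, simp)
qed

text \<open>
  The function \<open>c\<close> chooses one monomial for each type of exponents.
\<close>

lemma sf_monomial_expansion:
  fixes f :: "'a::field symfun"
  assumes rep: "\<And>M. 0 \<notin># M \<Longrightarrow> exponents (c M) = M"
    and d: "\<And>a. sf_coeff f a \<noteq> 0 \<Longrightarrow> size a \<le> d"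
  shows "f = (\<Sum>M | 0 \<notin># M \<and> sum_mset M \<le> d. sf_scale (sf_coeff f (c M)) (monomial_sf (part_of M)))"
proof (rule sf_eqI)
  fix a
  let ?S = "{M :: nat multiset. 0 \<notin># M \<and> sum_mset M \<le> d}"
  have "sf_coeff (\<Sum>M\<in>?S. sf_scale (sf_coeff f (c M)) (monomial_sf (part_of M))) a
     = (\<Sum>M\<in>?S. if M = exponents a then sf_coeff f (c M) else 0)"
    by (simp add: sf_coeff_sum sf_coeff_scale sf_coeff_monomial) (auto intro!: sum.cong)
  also have "\<dots> = (if exponents a \<in> ?S then sf_coeff f (c (exponents a)) else 0)"
    using finite_psets by (simp add: sum.delta')
  also have "\<dots> = sf_coeff f a"
  proof (cases "exponents a \<in> ?S")
    case True
    then show ?thesis using rep[of "exponents a"] by (auto intro!: sf_coeff_cong_exponents)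
  next
    case False
    then have "\<not> size a \<le> d" using zero_notin_exponents[of a] by (auto simp: sum_mset_exponents)
    then show ?thesis using d[of a] False by auto
  qed
  finally show "sf_coeff f a = sf_coeff (\<Sum>M\<in>?S. sf_scale (sf_coeff f (c M)) (monomial_sf (part_of M))) a" by simp
qed

subsection \<open>Power sums form a basis in characteristic 0\<close>

definition char0 :: "'a::comm_ring_1 itself \<Rightarrow> bool" where
  "char0 _ \<longleftrightarrow> (\<forall>n. n > 0 \<longrightarrow> (of_nat n :: 'a) \<noteq> 0)"

abbreviation psets :: "nat multiset set" where "psets \<equiv> {M. 0 \<notin># M}"

text \<open>
  Triangularity of the power sum products with respect to the number of variables is inverted here.
\<close>

lemma monomial_in_span_psum:
  assumes c0: "char0 TYPE('a::field)" and M: "0 \<notin># M"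
  shows "(monomial_sf (part_of M) :: 'a symfun) \<in> sf.span (psum ` psets)"
  using M
proof (induction "size M" arbitrary: M rule: less_induct)
  case less
  obtain c :: "nat multiset \<Rightarrow> nat multiset" where c: "\<And>M. 0 \<notin># M \<Longrightarrow> exponents (c M) = M"
    using exponents_surj by metis
  let ?p = "psum M :: 'a symfun"
  obtain n where n: "\<And>a. sf_coeff ?p a = of_nat (n a)"
     "\<And>a. n a \<noteq> 0 \<Longrightarrow> size a = sum_mset M \<and> card (set_mset a) \<le> size M"
     "\<And>a. n a \<noteq> 0 \<Longrightarrow> card (set_mset a) = size M \<Longrightarrow> exponents a = M"
     "\<And>a. exponents a = M \<Longrightarrow> n a \<noteq> 0"
    using sf_coeff_psum[OF less.prems, where 'a='a] by metis
  let ?S = "{M' :: nat multiset. 0 \<notin># M' \<and> sum_mset M' \<le> sum_mset M}"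
  let ?t = "\<lambda>M'. sf_scale (sf_coeff ?p (c M')) (monomial_sf (part_of M')) :: 'a symfun"
  have "?p = (\<Sum>M'\<in>?S. ?t M')"
  proof (rule sf_monomial_expansion[OF c])
    show "sf_coeff ?p a \<noteq> 0 \<Longrightarrow> size a \<le> sum_mset M" for a
      using n(1,2)[of a] by (cases "n a = 0") auto
  qed
  also have "\<dots> = ?t M + (\<Sum>M'\<in>?S - {M}. ?t M')"
    using less.prems finite_psets by (intro sum.remove) auto
  finally have e: "?t M = ?p - (\<Sum>M'\<in>?S - {M}. ?t M')" unfolding eq_diff_eq by (rule sym)
  have "?t M' \<in> sf.span (psum ` psets)" if M': "M' \<in> ?S - {M}" for M'
  proof (cases "n (c M') = 0")
    case True
    then show ?thesis using n(1)[of "c M'"] by (simp add: sf.span_zero)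
  next
    case False
    have "card (set_mset (c M')) = size M'" using M' c[of M'] by (simp flip: size_exponents)
    moreover have "exponents (c M') \<noteq> M" using M' c[of M'] by auto
    ultimately have "size M' < size M" using n(2,3)[OF False] by fastforce
    then show ?thesis using less.hyps[of M'] M' by (intro sf.span_scale) auto
  qed
  then have "?t M \<in> sf.span (psum ` psets)"
    unfolding e by (intro sf.span_diff[OF sf.span_base sf.span_sum]) (use less.prems in auto)
  moreover have "sf_coeff ?p (c M) \<noteq> 0"
    using n(1)[of "c M"] n(4)[of "c M"] c[OF less.prems] c0 by (simp add: char0_def)
  ultimately show ?case
    using sf.span_scale[of "?t M" "psum ` psets" "inverse (sf_coeff ?p (c M))"] by simp
qed

lemma span_psum:
  assumes "char0 TYPE('a::field)"
  shows "sf.span (psum ` psets) = (UNIV :: 'a symfun set)"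
proof -
  obtain c :: "nat multiset \<Rightarrow> nat multiset" where c: "\<And>M. 0 \<notin># M \<Longrightarrow> exponents (c M) = M"
    using exponents_surj by metis
  have "f \<in> sf.span (psum ` psets)" for f :: "'a symfun"
  proof -
    obtain d where "\<And>a. sf_coeff f a \<noteq> 0 \<Longrightarrow> size a \<le> d" using sf_coeff_bounded[of f] by auto
    then have e: "f = (\<Sum>M | 0 \<notin># M \<and> sum_mset M \<le> d. sf_scale (sf_coeff f (c M)) (monomial_sf (part_of M)))"
      using sf_monomial_expansion[of c f d] c by blast
    show ?thesis
      by (subst e) (intro sf.span_sum sf.span_scale monomial_in_span_psum[OF assms], simp)
  qed
  then show ?thesis by auto
qed

text \<open>
  In a linear relation a term with the largest number of parts contains a monomial that no other term contains.
\<close>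

lemma psum_lin_indep:
  fixes a :: "nat multiset \<Rightarrow> 'a::field"
  assumes c0: "char0 TYPE('a)" and S: "finite S" "S \<subseteq> psets"
    and z: "(\<Sum>M\<in>S. sf_scale (a M) (psum M)) = 0" and M: "M \<in> S"
  shows "a M = 0"
proof (rule ccontr)
  assume nz: "a M \<noteq> 0"
  let ?T = "{M\<in>S. a M \<noteq> 0}"
  have T: "finite ?T" "?T \<noteq> {}" using S M nz by auto
  define l where "l = Max (size ` ?T)"
  have "l \<in> size ` ?T" unfolding l_def by (rule Max_in) (use T in auto)
  then obtain K where K: "K \<in> ?T" "size K = l" by auto
  have lmax: "size M \<le> l" if "M \<in> ?T" for M unfolding l_def using T that by auto
  obtain b where b: "exponents b = K" using exponents_surj[of K] K S by auto
  have "sf_coeff (psum N :: 'a symfun) b = 0" if N: "N \<in> ?T" "N \<noteq> K" for N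
  proof -
    obtain n where "sf_coeff (psum N :: 'a symfun) b = of_nat n"
      "n \<noteq> 0 \<longrightarrow> card (set_mset b) \<le> size N" "n \<noteq> 0 \<longrightarrow> card (set_mset b) = size N \<longrightarrow> exponents b = N"
      using sf_coeff_psum[of N b, where 'a='a] N S by blast
    moreover have "card (set_mset b) = l" using b K by (metis size_exponents)
    ultimately show ?thesis using lmax[OF N(1)] N(2) b by (cases "n = 0") auto
  qed
  then have "(\<Sum>N\<in>?T. a N * sf_coeff (psum N :: 'a symfun) b) = a K * sf_coeff (psum K) b"
    using T K by (subst sum.remove[of _ K]) (auto intro!: sum.neutral)
  moreover have "(\<Sum>N\<in>?T. a N * sf_coeff (psum N :: 'a symfun) b) = (\<Sum>N\<in>S. a N * sf_coeff (psum N :: 'a symfun) b)"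
    using S by (intro sum.mono_neutral_left) auto
  moreover have "(\<Sum>N\<in>S. a N * sf_coeff (psum N :: 'a symfun) b) = 0"
    using arg_cong[OF z, of "\<lambda>f. sf_coeff f b"] by (simp add: sf_coeff_sum sf_coeff_scale sf_coeff_zero)
  moreover have "sf_coeff (psum K :: 'a symfun) b \<noteq> 0"
  proof -
    obtain n where "sf_coeff (psum K :: 'a symfun) b = of_nat n" "n \<noteq> 0"
      using sf_coeff_psum[of K b, where 'a='a] K S b by blast
    then show ?thesis using c0 by (simp add: char0_def)
  qed
  ultimately show False using K by auto
qed

lemma inj_psum:
  assumes "char0 TYPE('a::field)"
  shows "inj_on (psum :: _ \<Rightarrow> 'a symfun) psets"
proof (rule inj_onI, rule ccontr)
  fix M N assume MN: "M \<in> psets" "N \<in> psets" "psum M = (psum N :: 'a symfun)" "M \<noteq> N"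
  have "(\<Sum>K\<in>{M,N}. sf_scale (if K = M then 1 else -1) (psum K :: 'a symfun)) = 0"
    using MN by simp
  from psum_lin_indep[OF assms _ _ this, of M] MN show False by simp
qed

lemma independent_psum:
  assumes c0: "char0 TYPE('a::field)"
  shows "sf.independent (psum ` psets :: 'a symfun set)"
  unfolding sf.independent_explicit_module
proof (intro allI impI)
  fix t :: "'a symfun set" and u v
  assume *: "finite t" "t \<subseteq> psum ` psets" "(\<Sum>v\<in>t. sf_scale (u v) v) = 0" "v \<in> t"
  then obtain S where S: "S \<subseteq> psets" "t = psum ` S" by (meson subset_imageE)
  have inj: "inj_on (psum :: _ \<Rightarrow> 'a symfun) S" by (rule inj_on_subset[OF inj_psum[OF c0] S(1)])
  have fin: "finite S" using *(1) S inj by (simp add: finite_image_iff)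
  have "(\<Sum>M\<in>S. sf_scale (u (psum M)) (psum M)) = 0"
    using *(3) unfolding S(2) by (subst (asm) sum.reindex[OF inj]) simp
  from psum_lin_indep[OF c0 fin S(1) this] *(4) S show "u v = 0" by auto
qed

section \<open>The scalar product\<close>

subsection \<open>Coordinates in the power sum basis\<close>

lemma psum_induct [consumes 1, case_names psum add scale]:
  fixes f :: "'a::field symfun"
  assumes c0: "char0 TYPE('a)"
    and 1: "\<And>M. 0 \<notin># M \<Longrightarrow> P (psum M)"
    and 2: "\<And>f g. P f \<Longrightarrow> P g \<Longrightarrow> P (f + g)"
    and 3: "\<And>c f. P f \<Longrightarrow> P (sf_scale c f)"
  shows "P f"
proof -
  have "f \<in> sf.span (psum ` psets)" using span_psum[OF c0] by simp
  then show ?thesis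
  proof (induction rule: sf.span_induct_alt)
    case base
    show ?case using 3[OF 1[of "{#}"], of 0] by simp
  next
    case (step c x y)
    then show ?case using 1 2 3 by auto
  qed
qed

lemma vector_space_pair_sf: "vector_space_pair (sf_scale :: 'a::field \<Rightarrow> _) (sf_scale :: 'a \<Rightarrow> _)"
  by (rule vector_space_pair.intro) (rule vector_space_sf_scale)+

lemma linear_extension:
  assumes c0: "char0 TYPE('a::field)"
  shows "\<exists>D. Vector_Spaces.linear (sf_scale :: 'a \<Rightarrow> _) (sf_scale :: 'a \<Rightarrow> _) D \<and> (\<forall>M. 0 \<notin># M \<longrightarrow> D (psum M) = \<phi> M)"
proof -
  have inj: "inj_on (psum :: _ \<Rightarrow> 'a symfun) psets" by (rule inj_psum[OF c0])
  obtain D where "Vector_Spaces.linear (sf_scale :: 'a \<Rightarrow> _) sf_scale D"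
    "\<forall>x\<in>psum ` psets. D x = \<phi> (the_inv_into psets psum x)"
    using vector_space_pair.linear_independent_extend[OF vector_space_pair_sf independent_psum[OF c0], of "\<lambda>x. \<phi> (the_inv_into psets psum x)"]
    by blast
  then show ?thesis using the_inv_into_f_f[OF inj] by (intro exI[of _ D]) auto
qed

text \<open>
  Coordinates with respect to the basis of power sum products. A multiset that contains 0 gets the coordinate 0,
  because \<open>power_sum 0 = 1\<close> and only multisets of positive numbers index the basis.
\<close>

definition pc :: "'a::field symfun \<Rightarrow> nat multiset \<Rightarrow> 'a" where
  "pc f M = (if 0 \<in># M then 0 else sf.representation (psum ` psets) f (psum M))"

lemma pc_linear:
  assumes c0: "char0 TYPE('a::field)"
  shows pc_add: "pc (f + g) M = pc f M + (pc g M :: 'a)"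
    and pc_scale: "pc (sf_scale c f) M = c * (pc f M :: 'a)"
  using sf.representation_add[OF independent_psum[OF c0], of g f]
    sf.representation_scale[OF independent_psum[OF c0], of f c]
  by (auto simp: pc_def span_psum[OF c0])

lemma pc_psum:
  assumes c0: "char0 TYPE('a::field)" and N: "0 \<notin># N"
  shows "pc (psum N) M = (if M = N then 1 else 0 :: 'a)"
  using sf.representation_basis[OF independent_psum[OF c0], of "psum N"] N inj_onD[OF inj_psum[OF c0], of N M]
  by (auto simp: pc_def)

lemma finite_pc:
  assumes c0: "char0 TYPE('a::field)"
  shows "finite {M. pc (f :: 'a symfun) M \<noteq> 0}"
proof -
  have "finite ((psum :: _ \<Rightarrow> 'a symfun) ` {M. pc f M \<noteq> 0})"
    using sf.finite_representation[of "psum ` psets" f] by (rule rev_finite_subset) (auto simp: pc_def split: if_splits)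
  moreover have "inj_on (psum :: _ \<Rightarrow> 'a symfun) {M. pc f M \<noteq> 0}"
    by (rule inj_on_subset[OF inj_psum[OF c0]]) (auto simp: pc_def split: if_splits)
  ultimately show ?thesis by (simp add: finite_image_iff)
qed

subsection \<open>Differentiation with respect to a power sum\<close>

text \<open>
  The partial derivative \<open>\<partial> / \<partial>p\<^sub>k\<close>.
\<close>

definition dps :: "nat \<Rightarrow> 'a::field symfun \<Rightarrow> 'a symfun" where
  "dps k = (SOME D. Vector_Spaces.linear sf_scale sf_scale D \<and>
     (\<forall>M. 0 \<notin># M \<longrightarrow> D (psum M) = sf_scale (of_nat (count M k)) (psum (M - {#k#}))))"

lemma dps_props:
  assumes c0: "char0 TYPE('a::field)"
  shows dps_psum: "0 \<notin># M \<Longrightarrow> dps k (psum M :: 'a symfun) = sf_scale (of_nat (count M k)) (psum (M - {#k#}))"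
    and dps_add: "dps k (f + g :: 'a symfun) = dps k f + dps k g"
    and dps_scale: "dps k (sf_scale c f :: 'a symfun) = sf_scale c (dps k f)"
proof -
  have "Vector_Spaces.linear sf_scale sf_scale (dps k :: 'a symfun \<Rightarrow> _) \<and>
     (\<forall>M. 0 \<notin># M \<longrightarrow> dps k (psum M :: 'a symfun) = sf_scale (of_nat (count M k)) (psum (M - {#k#})))"
    using someI_ex[OF linear_extension[OF c0, of "\<lambda>M. sf_scale (of_nat (count M k)) (psum (M - {#k#}))"]]
    unfolding dps_def .
  then show "0 \<notin># M \<Longrightarrow> dps k (psum M :: 'a symfun) = sf_scale (of_nat (count M k)) (psum (M - {#k#}))"
    "dps k (f + g :: 'a symfun) = dps k f + dps k g" "dps k (sf_scale c f :: 'a symfun) = sf_scale c (dps k f)"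
    by (auto simp: Vector_Spaces.linear_iff)
qed

lemma dps_zero: "char0 TYPE('a::field) \<Longrightarrow> dps k (0 :: 'a symfun) = 0"
  using dps_scale[of k 0 0] by simp

lemma dps_one: "char0 TYPE('a::field) \<Longrightarrow> dps k (1 :: 'a symfun) = 0"
  using dps_psum[of "{#}" k] by simp

lemma dps_sum: "char0 TYPE('a::field) \<Longrightarrow> dps k (sum f A :: 'a symfun) = (\<Sum>x\<in>A. dps k (f x))"
  by (induction A rule: infinite_finite_induct) (auto simp: dps_add dps_zero)

lemma dps_mult:
  assumes c0: "char0 TYPE('a::field)"
  shows "dps k (f * h :: 'a symfun) = dps k f * h + f * dps k h"
  using c0
proof (induction f rule: psum_induct)
  case (psum M)
  show ?case using c0
  proof (induction h rule: psum_induct)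
    case (psum N)
    have *: "sf_scale (of_nat (count M k)) (psum (M + N - {#k#})) = sf_scale (of_nat (count M k)) (psum (M - {#k#}) * psum N :: 'a symfun)"
      if "0 \<notin># M" for M N
      by (cases "k \<in># M") (auto simp: psum_union[symmetric] not_in_iff)
    have "dps k (psum M * psum N :: 'a symfun) = sf_scale (of_nat (count M k) + of_nat (count N k)) (psum (M + N - {#k#}))"
      using psum \<open>0 \<notin># M\<close> by (simp add: psum_union[symmetric] dps_psum[OF c0])
    also have "\<dots> = sf_scale (of_nat (count M k)) (psum (M - {#k#}) * psum N) + sf_scale (of_nat (count N k)) (psum (N - {#k#}) * psum M)"
      using *[OF \<open>0 \<notin># M\<close>, of N] *[OF psum, of M] by (simp only: sf.scale_left_distrib add.commute[of N M])
    finally show ?case using psum \<open>0 \<notin># M\<close>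
      by (simp add: dps_psum[OF c0] sf_scale_mult mult_sf_scale mult.commute)
  next
    case (add f g)
    then show ?case by (simp add: distrib_left dps_add[OF c0] algebra_simps)
  next
    case (scale c f)
    then show ?case by (simp add: mult_sf_scale dps_scale[OF c0] sf.scale_right_distrib)
  qed
next
  case (add f g)
  then show ?case by (simp add: distrib_right dps_add[OF c0] algebra_simps)
next
  case (scale c f)
  then show ?case by (simp add: sf_scale_mult dps_scale[OF c0] sf.scale_right_distrib)
qed

lemma dps_power_sum:
  assumes "char0 TYPE('a::field)" "j > 0"
  shows "dps k (power_sum j :: 'a symfun) = (if j = k then 1 else 0)"
  using dps_psum[OF assms(1), of "{#j#}" k] assms(2) by (auto simp: psum_def)

lemma dps_prod:
  assumes c0: "char0 TYPE('a::field)" and "finite A"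
  shows "dps k (\<Prod>i\<in>A. f i :: 'a symfun) = (\<Sum>i\<in>A. \<Prod>j\<in>A. if j = i then dps k (f i) else f j)"
  using assms(2)
proof (induction A rule: finite_induct)
  case empty
  then show ?case by (simp add: dps_one[OF c0])
next
  case (insert a A)
  have "(\<Prod>j\<in>A. if j = a then dps k (f a) else f j) = (\<Prod>j\<in>A. f j)"
    using insert by (intro prod.cong) auto
  moreover have "(\<Sum>i\<in>A. (if a = i then dps k (f i) else f a) * (\<Prod>j\<in>A. if j = i then dps k (f i) else f j)) =
     f a * (\<Sum>i\<in>A. \<Prod>j\<in>A. if j = i then dps k (f i) else f j)"
    using insert by (auto simp: sum_distrib_left intro!: sum.cong)
  ultimately show ?case using insert by (simp add: dps_mult[OF c0])
qed

subsection \<open>The scalar product\<close>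

definition zm :: "nat multiset \<Rightarrow> nat" where
  "zm M = (\<Prod>i\<in>set_mset M. i ^ count M i * fact (count M i))"

lemma zm_mset: "zm (mset \<mu>) = z_part \<mu>"
  by (simp add: zm_def z_part_def count_mset count_list_eq_length_filter) 

lemma zm_add_mset: "zm (add_mset k M) = zm M * (k * Suc (count M k))"
proof -
  have s: "zm N = (\<Prod>i\<in>insert k (set_mset M). i ^ count N i * fact (count N i))"
    if "set_mset N \<subseteq> insert k (set_mset M)" for N
    unfolding zm_def by (rule prod.mono_neutral_left) (use that in \<open>auto simp: not_in_iff\<close>)
  have *: "zm N = k ^ count N k * fact (count N k) * (\<Prod>i\<in>insert k (set_mset M) - {k}. i ^ count N i * fact (count N i))"
    if "set_mset N \<subseteq> insert k (set_mset M)" for N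
    unfolding s[OF that] by (rule prod.remove) auto
  have "(\<Prod>i\<in>insert k (set_mset M) - {k}. i ^ count (add_mset k M) i * fact (count (add_mset k M) i)) =
     (\<Prod>i\<in>insert k (set_mset M) - {k}. i ^ count M i * fact (count M i))"
    by (intro prod.cong) auto
  with *[of M] *[of "add_mset k M"] show ?thesis
    unfolding count_add_mset by (simp add: algebra_simps subset_insertI)
qed

text \<open>
  The weights of the power sums in the generating function of the one-row functions:
  \<open>\<Sum> Q\<^sub>n z\<^sup>n = exp (\<Sum> wt q t k p\<^sub>k z\<^sup>k / k)\<close>.
\<close>

definition wt :: "'a::field \<Rightarrow> 'a \<Rightarrow> nat \<Rightarrow> 'a" where
  "wt q t k = (1 - t ^ k) / (1 - q ^ k)"

definition zeta :: "'a::field \<Rightarrow> 'a \<Rightarrow> nat multiset \<Rightarrow> 'a" where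
  "zeta q t M = of_nat (zm M) * prod_mset (image_mset (\<lambda>i. (1 - q ^ i) / (1 - t ^ i)) M)"

lemma zeta_add_mset: "zeta q t (add_mset k M) = zeta q t M * (of_nat k / wt q t k) * of_nat (Suc (count M k))"
  by (simp add: zeta_def zm_add_mset wt_def algebra_simps)

locale macdonald_params =
  fixes q t :: "'a::field"
  assumes c0: "char0 TYPE('a)"
    and q1: "\<And>i. i > 0 \<Longrightarrow> q ^ i \<noteq> 1"
    and t1: "\<And>i. i > 0 \<Longrightarrow> t ^ i \<noteq> 1"
    and t0: "t \<noteq> 0" and q0: "q \<noteq> 0"
begin

abbreviation "w \<equiv> wt q t"
abbreviation "B \<equiv> macdonald_form q t"

lemma w_nz: "k > 0 \<Longrightarrow> w k \<noteq> 0"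
  using q1[of k] t1[of k] by (auto simp: wt_def)

lemma of_nat_nz: "n > 0 \<Longrightarrow> (of_nat n :: 'a) \<noteq> 0"
  using c0 by (auto simp: char0_def)

definition form :: "'a symfun \<Rightarrow> 'a symfun \<Rightarrow> 'a" where
  "form f h = (\<Sum>M | pc f M \<noteq> 0. pc f M * pc h M * zeta q t M)"

lemma form_sym: "form f h = form h f"
proof -
  have "form f h = (\<Sum>M\<in>{M. pc f M \<noteq> 0} \<inter> {M. pc h M \<noteq> 0}. pc f M * pc h M * zeta q t M)" for f h
    unfolding form_def using finite_pc[OF c0] by (intro sum.mono_neutral_right) auto
  from this[of f h] this[of h f] show ?thesis by (simp add: Int_commute mult.commute)
qed

lemma form_add_right: "form f (g + h) = form f g + form f h"
  by (simp add: form_def pc_add[OF c0] algebra_simps sum.distrib)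

lemma form_scale_right: "form f (sf_scale c h) = c * form f h"
  by (simp add: form_def pc_scale[OF c0] algebra_simps sum_distrib_left)

lemma form_add_left: "form (g + h) f = form g f + form h f"
  using form_add_right form_sym by metis

lemma form_scale_left: "form (sf_scale c h) f = c * form h f"
  using form_scale_right form_sym by metis

lemma form_psum:
  assumes "0 \<notin># M" "0 \<notin># N"
  shows "form (psum M) (psum N) = (if M = N then zeta q t M else 0)"
proof -
  have "{K. pc (psum M :: 'a symfun) K \<noteq> 0} = {M}" using assms by (auto simp: pc_psum[OF c0])
  then show ?thesis using assms by (simp add: form_def pc_psum[OF c0])
qed

lemma linear_mult_iff: "Vector_Spaces.linear sf_scale (*) (\<phi> :: 'a symfun \<Rightarrow> 'a) \<longleftrightarrow>
   (\<forall>f g. \<phi> (f + g) = \<phi> f + \<phi> g) \<and> (\<forall>c f. \<phi> (sf_scale c f) = c * \<phi> f)"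
proof -
  have "vector_space ((*) :: 'a \<Rightarrow> 'a \<Rightarrow> 'a)" by unfold_locales (auto simp: algebra_simps)
  then show ?thesis by (auto simp: Vector_Spaces.linear_iff vector_space_sf_scale)
qed

text \<open>
  The values on the basis of power sum products determine a bilinear form, so the definite description
  in \<open>macdonald_form\<close> picks the form given by coordinates.
\<close>

lemma macdonald_form_eq: "B = form"
  unfolding macdonald_form_def
proof (rule the_equality)
  have z: "of_nat (z_part \<nu>) * prod_list (map (\<lambda>i. (1 - q ^ i) / (1 - t ^ i)) \<nu>) = zeta q t (mset \<nu>)" for \<nu>
  proof -
    have "prod_list (map f \<nu>) = prod_mset (image_mset f (mset \<nu>))" for f :: "nat \<Rightarrow> 'a"
      by (induction \<nu>) auto
    then show ?thesis by (simp add: zeta_def zm_mset)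
  qed
  let ?P = "\<lambda>B. (\<forall>f. Vector_Spaces.linear sf_scale (*) (B f)) \<and>
     (\<forall>g. Vector_Spaces.linear sf_scale (*) (\<lambda>f. B f g)) \<and>
     (\<forall>\<nu> \<mu>. is_partition \<nu> \<longrightarrow> is_partition \<mu> \<longrightarrow>
        B (power_sum_part \<nu>) (power_sum_part \<mu>) =
          (if \<nu> = \<mu> then of_nat (z_part \<nu>) * prod_list (map (\<lambda>i. (1 - q ^ i) / (1 - t ^ i)) \<nu>) else 0))"
  show P: "?P form"
    unfolding linear_mult_iff z power_sum_part_eq
    by (auto simp: form_add_right form_scale_right form_add_left form_scale_left form_psum zero_notin_partition[simplified] partition_eq_iff)
  fix B' assume B': "?P B'"
  have agree: "B1 f h = B2 f h" if "?P B1" "?P B2" for B1 B2 :: "'a symfun \<Rightarrow> 'a symfun \<Rightarrow> 'a" and f h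
    using c0
  proof (induction f rule: psum_induct)
    case (psum M)
    show ?case using c0
    proof (induction h rule: psum_induct)
      case (psum N)
      have "is_partition (part_of M)" "is_partition (part_of N)" using psum \<open>0 \<notin># M\<close> by (auto intro: is_partition_part_of)
      then have "B1 (power_sum_part (part_of M)) (power_sum_part (part_of N)) = B2 (power_sum_part (part_of M)) (power_sum_part (part_of N))"
        using that by auto
      then show ?case by (simp add: power_sum_part_eq)
    qed (use that in \<open>auto simp: linear_mult_iff\<close>)
  qed (use that in \<open>auto simp: linear_mult_iff\<close>)
  show "B' = form" by (intro ext) (rule agree[OF B' P])
qed

lemma B_sym: "B f h = B h f" by (simp add: macdonald_form_eq form_sym)
lemma B_add_right: "B f (g + h) = B f g + B f h" by (simp add: macdonald_form_eq form_add_right)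
lemma B_add_left: "B (f + g) h = B f h + B g h" using B_add_right B_sym by metis
lemma B_scale_right: "B f (sf_scale c h) = c * B f h" by (simp add: macdonald_form_eq form_scale_right)
lemma B_scale_left: "B (sf_scale c f) h = c * B f h" using B_scale_right B_sym by metis
lemma B_zero_right: "B f 0 = 0" using B_scale_right[of f 0 0] by simp
lemma B_zero_left: "B 0 f = 0" using B_zero_right B_sym by metis
lemma B_minus_right: "B f (- h) = - B f h"
  using B_add_right[of f h "- h"] by (simp add: B_zero_right eq_neg_iff_add_eq_0 add.commute)
lemma B_diff_right: "B f (g - h) = B f g - B f h"
  using B_add_right[of f g "- h"] by (simp add: B_minus_right)
lemma B_diff_left: "B (g - h) f = B g f - B h f" using B_diff_right B_sym by metis
lemma B_sum_right: "B f (sum h A) = (\<Sum>x\<in>A. B f (h x))"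
  by (induction A rule: infinite_finite_induct) (auto simp: B_zero_right B_add_right)
lemma B_sum_left: "B (sum h A) f = (\<Sum>x\<in>A. B (h x) f)"
  by (induction A rule: infinite_finite_induct) (auto simp: B_zero_left B_add_left)
lemma B_psum: "0 \<notin># M \<Longrightarrow> 0 \<notin># N \<Longrightarrow> B (psum M) (psum N) = (if M = N then zeta q t M else 0)"
  by (simp add: macdonald_form_eq form_psum)

lemmas B_simps = B_add_right B_add_left B_scale_right B_scale_left B_zero_right B_zero_left
  B_diff_right B_diff_left B_minus_right B_sum_right B_sum_left

text \<open>
  The adjoint of multiplication by a power sum is a multiple of the derivative in its direction. On products of
  one-row functions this derivative shifts indices, so adjoints become multiplications of Laurent polynomials.
\<close>

lemma B_power_sum_mult:
  assumes k: "k > 0"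
  shows "B (power_sum k * f) h = of_nat k / w k * B f (dps k h)"
  using c0
proof (induction f rule: psum_induct)
  case (psum M)
  show ?case using c0
  proof (induction h rule: psum_induct)
    case (psum N)
    have l: "B (power_sum k * psum M) (psum N) = (if add_mset k M = N then zeta q t N else 0)"
      using B_psum[of "add_mset k M" N] psum \<open>0 \<notin># M\<close> k by (simp add: psum_add_mset)
    have r: "B (psum M) (dps k (psum N)) = of_nat (count N k) * (if M = N - {#k#} then zeta q t M else 0)"
      using psum \<open>0 \<notin># M\<close> B_psum[of M "N - {#k#}"] by (simp add: dps_psum[OF c0] B_simps in_diffD) (metis in_diffD)
    show ?case
    proof (cases "k \<in># N")
      case True
      then obtain N' where "N = add_mset k N'" by (meson multi_member_split)
      then show ?thesis unfolding l r using k by (simp add: zeta_add_mset algebra_simps add_divide_distrib)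
    next
      case False
      then show ?thesis unfolding l r by (auto simp: not_in_iff)
    qed
  qed (simp_all add: B_simps dps_add[OF c0] dps_scale[OF c0] algebra_simps)
qed (simp_all add: B_simps distrib_left mult_sf_scale algebra_simps)

end

section \<open>Hall--Littlewood partial fractions\<close>

lemma coeff_prod_linear:
  fixes c :: "'b \<Rightarrow> 'a::field"
  assumes "finite A"
  shows "degree (\<Prod>i\<in>A. [:1, - c i:]) \<le> card A \<and> coeff (\<Prod>i\<in>A. [:1, - c i:]) (card A) = (\<Prod>i\<in>A. - c i)"
  using assms
proof (induction A rule: finite_induct)
  case (insert a A)
  let ?p = "\<Prod>i\<in>A. [:1, - c i:]"
  have "[:1, - c a:] * ?p = ?p + Polynomial.smult (- c a) (pCons 0 ?p)" by simp
  moreover have "coeff ?p (Suc (card A)) = 0" using insert by (intro coeff_eq_0) auto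
  moreover have "degree ([:1, - c a:] * ?p) \<le> Suc (card A)"
    using degree_mult_le[of "[:1, - c a:]" ?p] insert by (simp split: if_splits)
  ultimately show ?case using insert by simp
qed simp

lemma degree_less_if_coeff_0:
  assumes "degree p \<le> n" "coeff p n = 0" "n > 0"
  shows "degree p < n"
proof (rule ccontr)
  assume "\<not> degree p < n"
  then have "degree p = n" using assms by simp
  then have "p = 0" using assms(2) by (metis leading_coeff_0_iff)
  then show False using \<open>degree p = n\<close> assms(3) by simp
qed

lemma poly_eq_0_if_roots:
  fixes p :: "'a::field poly"
  assumes "finite S" "degree p < card S" "\<And>x. x \<in> S \<Longrightarrow> poly p x = 0"
  shows "p = 0"
proof (rule ccontr)
  assume p: "p \<noteq> 0"
  have "card S \<le> card {x. poly p x = 0}"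
    using assms poly_roots_finite[OF p] by (intro card_mono) auto
  also have "\<dots> \<le> degree p" using p by (rule card_poly_roots_bound)
  finally show False using assms by simp
qed

text \<open>
  The coefficients of the Hall--Littlewood partial fraction expansion.
\<close>

definition HL_A :: "'a::field \<Rightarrow> nat \<Rightarrow> (nat \<Rightarrow> 'a) \<Rightarrow> nat \<Rightarrow> 'a" where
  "HL_A u n Y i = (\<Prod>j\<in>{..<n} - {i}. (Y i - u * Y j) / (Y i - Y j))"

text \<open>
  Both sides are polynomials of degree at most \<open>n\<close> that agree at the \<open>n\<close> points \<open>1 / (T Y\<^sub>i)\<close> and in the
  leading coefficient.
\<close>

lemma HL_partial_fraction:
  fixes Y :: "nat \<Rightarrow> 'a::field"
  assumes T: "T * u = 1" and inj: "inj_on Y {..<n}" and nz: "\<And>i. i < n \<Longrightarrow> Y i \<noteq> 0"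
  shows "(\<Prod>i<n. [:1, - Y i:]) = Polynomial.smult (u ^ n) (\<Prod>i<n. [:1, - (T * Y i):]) +
     (\<Sum>i<n. Polynomial.smult ((1 - u) * HL_A u n Y i) (\<Prod>j\<in>{..<n} - {i}. [:1, - (T * Y j):]))"
    (is "?N = ?R")
proof (cases "n = 0")
  case False
  have T0: "T \<noteq> 0" "u \<noteq> 0" using T by auto
  have "?N - ?R = 0"
  proof (rule poly_eq_0_if_roots[of "(\<lambda>i. inverse (T * Y i)) ` {..<n}"])
    have inj2: "inj_on (\<lambda>i. inverse (T * Y i)) {..<n}"
      using inj T0 by (auto simp: inj_on_def)
    have d1: "degree ?N \<le> n" "coeff ?N n = (\<Prod>i<n. - Y i)"
      using coeff_prod_linear[of "{..<n}" Y] by auto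
    have d2: "degree (\<Prod>i<n. [:1, - (T * Y i):]) \<le> n" "coeff (\<Prod>i<n. [:1, - (T * Y i):]) n = (\<Prod>i<n. - (T * Y i))"
      using coeff_prod_linear[of "{..<n}" "\<lambda>i. T * Y i"] by auto
    have d3: "degree (\<Prod>j\<in>{..<n} - {i}. [:1, - (T * Y j):]) < n" if "i < n" for i
      using coeff_prod_linear[of "{..<n} - {i}" "\<lambda>i. T * Y i"] that by auto
    have "degree (?N - ?R) \<le> n"
      by (intro degree_diff_le degree_add_le degree_sum_le d1 order.trans[OF degree_smult_le] d2)
         (use d3 in \<open>auto intro: less_imp_le\<close>)
    moreover have "coeff (?N - ?R) n = 0"
    proof -
      have "coeff (\<Prod>j\<in>{..<n} - {i}. [:1, - (T * Y j):]) n = 0" if "i < n" for i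
        by (intro coeff_eq_0 d3 that)
      then have "coeff ?R n = u ^ n * (\<Prod>i<n. - (T * Y i))" by (simp add: d2 coeff_sum)
      also have "\<dots> = (\<Prod>i<n. u * - (T * Y i))" by (simp only: prod.distrib prod_constant card_lessThan)
      also have "\<dots> = (\<Prod>i<n. - Y i)" using T by (intro prod.cong) (auto simp: mult.assoc[symmetric] mult.commute)
      finally show ?thesis by (simp add: d1)
    qed
    ultimately have "degree (?N - ?R) < n"
      using False by (intro degree_less_if_coeff_0) auto
    then show "degree (?N - ?R) < card ((\<lambda>i. inverse (T * Y i)) ` {..<n})"
      using inj2 by (simp add: card_image)
    fix x assume "x \<in> (\<lambda>i. inverse (T * Y i)) ` {..<n}"
    then obtain i where i: "i < n" "x = inverse (T * Y i)" by auto
    have Yi: "Y i \<noteq> 0" using nz i by auto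
    have xi: "x * (T * Y i) = 1" using i Yi T0 by (simp add: field_simps)
    have xu: "x = u / Y i"
    proof -
      have "u = inverse T" using T by (metis inverse_unique)
      then show ?thesis by (simp add: i(2) divide_inverse)
    qed
    have z: "poly (\<Prod>j\<in>A. [:1, - (T * Y j):]) x = 0" if "i \<in> A" "finite A" for A
      using that xi by (auto simp: poly_prod intro!: bexI[of _ i])
    have "poly ?R x = (\<Sum>k<n. if k = i then (1 - u) * HL_A u n Y i * (\<Prod>j\<in>{..<n} - {i}. 1 - x * (T * Y j)) else 0)"
    proof -
      have "poly (\<Prod>j<n. [:1, - (T * Y j):]) x = 0" using z[of "{..<n}"] i by simp
      then have "poly ?R x = (\<Sum>k<n. (1 - u) * HL_A u n Y k * poly (\<Prod>j\<in>{..<n} - {k}. [:1, - (T * Y j):]) x)"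
        by (simp only: poly_add poly_smult poly_sum mult_zero_right add_0)
      also have "\<dots> = (\<Sum>k<n. if k = i then (1 - u) * HL_A u n Y i * (\<Prod>j\<in>{..<n} - {i}. 1 - x * (T * Y j)) else 0)"
      proof (rule sum.cong)
        fix k assume "k \<in> {..<n}"
        show "(1 - u) * HL_A u n Y k * poly (\<Prod>j\<in>{..<n} - {k}. [:1, - (T * Y j):]) x
          = (if k = i then (1 - u) * HL_A u n Y i * (\<Prod>j\<in>{..<n} - {i}. 1 - x * (T * Y j)) else 0)"
        proof (cases "k = i")
          case True then show ?thesis by (simp add: poly_prod)
        next
          case False then show ?thesis using z[of "{..<n} - {k}"] i(1) by simp
        qed
      qed simp
      finally show ?thesis .
    qed
    also have "\<dots> = (1 - u) * (HL_A u n Y i * (\<Prod>j\<in>{..<n} - {i}. 1 - x * (T * Y j)))" using i by simp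
    also have "HL_A u n Y i * (\<Prod>j\<in>{..<n} - {i}. 1 - x * (T * Y j)) = (\<Prod>j\<in>{..<n} - {i}. 1 - x * Y j)"
      unfolding HL_A_def prod.distrib[symmetric]
    proof (rule prod.cong)
      fix j assume j: "j \<in> {..<n} - {i}"
      then have "Y i - Y j \<noteq> 0" using inj i by (auto simp: inj_on_def)
      moreover have "1 - x * (T * Y j) = (Y i - Y j) / Y i"
      proof -
        have "u * (T * Y j) = Y j" using T by (simp add: mult.assoc[symmetric] mult.commute[of u])
        then show ?thesis using Yi by (simp add: xu diff_divide_distrib)
      qed
      moreover have "1 - x * Y j = (Y i - u * Y j) / Y i" using Yi by (simp add: xu diff_divide_distrib)
      ultimately show "(Y i - u * Y j) / (Y i - Y j) * (1 - x * (T * Y j)) = 1 - x * Y j"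
        by simp
    qed simp
    also have "(1 - u) * (\<Prod>j\<in>{..<n} - {i}. 1 - x * Y j) = (\<Prod>j<n. 1 - x * Y j)"
    proof -
      have "1 - x * Y i = 1 - u" using Yi by (simp add: xu)
      then show ?thesis using i by (subst (2) prod.remove[of _ i]) auto
    qed
    also have "\<dots> = poly ?N x" by (simp add: poly_prod)
    finally show "poly (?N - ?R) x = 0" by simp
  qed simp
  then show ?thesis by simp
qed simp

definition fgeom :: "'a::field \<Rightarrow> 'a fps" where
  "fgeom c = Abs_fps (\<lambda>k. c ^ k)"

lemma fgeom_inverse: "(1 - fps_const c * fps_X) * fgeom c = 1"
proof (rule fps_ext)
  fix k show "fps_nth ((1 - fps_const c * fps_X) * fgeom c) k = fps_nth 1 k"
    by (cases k) (simp_all add: fgeom_def algebra_simps mult.assoc)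
qed

lemma fps_X_deriv_prod_linear:
  assumes "finite A"
  shows "fps_X * fps_deriv (\<Prod>i\<in>A. 1 - fps_const (c i) * fps_X) =
    - (\<Prod>i\<in>A. 1 - fps_const (c i) * fps_X) * (\<Sum>i\<in>A. fgeom (c i) - 1)"
  using assms
proof (induction A rule: finite_induct)
  case (insert a A)
  let ?p = "\<Prod>i\<in>A. 1 - fps_const (c i) * fps_X" and ?l = "1 - fps_const (c a) * fps_X"
  have l: "?l * (fgeom (c a) - 1) = fps_const (c a) * fps_X"
    using fgeom_inverse[of "c a"] by (simp add: algebra_simps)
  have "fps_X * fps_deriv (?l * ?p) = ?l * (fps_X * fps_deriv ?p) - fps_const (c a) * fps_X * ?p"
    by (simp add: algebra_simps)
  also have "\<dots> = - (?l * ?p) * (\<Sum>i\<in>A. fgeom (c i) - 1) - ?l * (fgeom (c a) - 1) * ?p"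
    unfolding insert.IH l by (simp add: algebra_simps)
  also have "\<dots> = - (?l * ?p) * ((fgeom (c a) - 1) + (\<Sum>i\<in>A. fgeom (c i) - 1))"
    by (simp add: algebra_simps)
  finally show ?case using insert by simp
qed simp

lemma fps_prod_linear_nth0: "fps_nth (\<Prod>i\<in>A. 1 - fps_const (c i :: 'a::field) * fps_X) 0 = 1"
  by (induction A rule: infinite_finite_induct) auto

lemma fps_of_poly_linear: "fps_of_poly [:1, - c :: 'a::field:] = 1 - fps_const c * fps_X"
proof (rule fps_ext)
  fix k show "fps_nth (fps_of_poly [:1, - c:]) k = fps_nth (1 - fps_const c * fps_X) k"
    by (cases k; cases "k - 1") (auto simp: coeff_pCons split: nat.splits)
qed

text \<open>
  Expand the partial fraction identity as power series after division by \<open>\<Prod> (1 - T Y\<^sub>i z)\<close>; the recursion for \<open>b\<close>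
  is the logarithmic derivative of \<open>\<Prod> (1 - Y\<^sub>i z) / (1 - T Y\<^sub>i z)\<close>.
\<close>

lemma HL_sum:
  fixes Y :: "nat \<Rightarrow> 'a::field"
  assumes T: "T * u = 1" and inj: "inj_on Y {..<n}" and nz: "\<And>i. i < n \<Longrightarrow> Y i \<noteq> 0"
    and char: "\<And>k. k > 0 \<Longrightarrow> (of_nat k :: 'a) \<noteq> 0"
    and b0: "b 0 = 1"
    and b: "\<And>k. k > 0 \<Longrightarrow> of_nat k * b k = (\<Sum>j=1..k. (T ^ j - 1) * (\<Sum>i<n. Y i ^ j) * b (k - j))"
  shows "k > 0 \<Longrightarrow> (1 - u) * T ^ k * (\<Sum>i<n. HL_A u n Y i * Y i ^ k) = b k"
    and "(1 - u) * (\<Sum>i<n. HL_A u n Y i) = 1 - u ^ n"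
proof -
  let ?N = "\<Prod>i<n. 1 - fps_const (Y i) * fps_X" and ?D = "\<Prod>i<n. 1 - fps_const (T * Y i) * fps_X"
  define S where "S = fps_const (u ^ n) + (\<Sum>i<n. fps_const ((1 - u) * HL_A u n Y i) * fgeom (T * Y i))"
  have S_nth: "fps_nth S k = (if k = 0 then u ^ n else 0) + (1 - u) * T ^ k * (\<Sum>i<n. HL_A u n Y i * Y i ^ k)" for k
    by (simp add: S_def fps_sum_nth fgeom_def sum_distrib_left power_mult_distrib mult_ac)
  have "?N = fps_of_poly (\<Prod>i<n. [:1, - Y i:])"
    by (simp only: fps_of_poly_prod fps_of_poly_linear)
  also have "\<dots> = fps_const (u ^ n) * ?D + (\<Sum>i<n. fps_const ((1 - u) * HL_A u n Y i) * (\<Prod>j\<in>{..<n} - {i}. 1 - fps_const (T * Y j) * fps_X))"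
    using arg_cong[OF HL_partial_fraction[OF T inj nz], of fps_of_poly]
    by (simp only: fps_of_poly_add fps_of_poly_sum fps_of_poly_smult fps_of_poly_prod fps_of_poly_linear)
  also have "\<dots> = fps_const (u ^ n) * ?D + (\<Sum>i<n. fps_const ((1 - u) * HL_A u n Y i) * fgeom (T * Y i) * ?D)"
  proof -
    have "fgeom (T * Y i) * ?D = (\<Prod>j\<in>{..<n} - {i}. 1 - fps_const (T * Y j) * fps_X)" if "i < n" for i
    proof -
      have "?D = (1 - fps_const (T * Y i) * fps_X) * (\<Prod>j\<in>{..<n} - {i}. 1 - fps_const (T * Y j) * fps_X)"
        by (rule prod.remove) (use that in auto)
      then have "fgeom (T * Y i) * ?D = ((1 - fps_const (T * Y i) * fps_X) * fgeom (T * Y i)) * (\<Prod>j\<in>{..<n} - {i}. 1 - fps_const (T * Y j) * fps_X)"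
        by (simp only: mult_ac)
      then show ?thesis unfolding fgeom_inverse by simp
    qed
    then show ?thesis by (simp add: mult.assoc)
  qed
  also have "\<dots> = ?D * S" by (simp add: S_def algebra_simps sum_distrib_left sum_distrib_right)
  finally have NS: "?N = ?D * S" .
  obtain N D P1 P2 where *: "N = ?N" "D = ?D" "P1 = (\<Sum>i<n. fgeom (Y i) - 1)" "P2 = (\<Sum>i<n. fgeom (T * Y i) - 1)"
    by blast
  have NS': "N = D * S" using NS by (simp only: *)
  have N': "fps_X * fps_deriv N = - N * P1" and D': "fps_X * fps_deriv D = - D * P2"
    by (simp_all only: * fps_X_deriv_prod_linear[OF finite_lessThan])
  have "D * (fps_X * fps_deriv S) + (fps_X * fps_deriv D) * S = fps_X * fps_deriv N"
    unfolding NS' by (simp add: algebra_simps)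
  then have "D * (fps_X * fps_deriv S) = fps_X * fps_deriv N - (fps_X * fps_deriv D) * S"
    by (metis add_diff_cancel_right')
  also have "\<dots> = - (D * S) * P1 - (- D * P2) * S" unfolding N' D' by (simp only: NS')
  also have "\<dots> = D * (S * (P2 - P1))" by (simp add: algebra_simps)
  finally have "D * (fps_X * fps_deriv S) = D * (S * (P2 - P1))" .
  then have "?D * (fps_X * fps_deriv S) = ?D * (S * ((\<Sum>i<n. fgeom (T * Y i) - 1) - (\<Sum>i<n. fgeom (Y i) - 1)))"
    by (simp only: *)
  moreover have "?D \<noteq> 0"
  proof -
    have "fps_nth (1 - fps_const c * fps_X) 0 = 1" for c :: 'a by simp
    then have "1 - fps_const c * fps_X \<noteq> 0" for c :: 'a by (metis fps_zero_nth zero_neq_one)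
    then show ?thesis by (simp add: prod_zero_iff)
  qed
  ultimately have der: "fps_X * fps_deriv S = S * (\<Sum>i<n. fgeom (T * Y i) - fgeom (Y i))"
    by (simp add: sum_subtractf)
  have S0: "fps_nth S 0 = 1"
    using arg_cong[OF NS, of "\<lambda>f. fps_nth f 0"] by (simp add: fps_prod_linear_nth0)
  have rec: "of_nat k * fps_nth S k = (\<Sum>j=1..k. (T ^ j - 1) * (\<Sum>i<n. Y i ^ j) * fps_nth S (k - j))" if "k > 0" for k
  proof -
    have "of_nat k * fps_nth S k = fps_nth (fps_X * fps_deriv S) k"
      using that by (cases k) auto
    also have "\<dots> = fps_nth ((\<Sum>i<n. fgeom (T * Y i) - fgeom (Y i)) * S) k" unfolding der by (simp add: mult.commute)
    also have "\<dots> = (\<Sum>j=0..k. (\<Sum>i<n. (T * Y i) ^ j - Y i ^ j) * fps_nth S (k - j))"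
      by (simp add: fps_mult_nth fps_sum_nth fgeom_def)
    also have "\<dots> = (\<Sum>j=0..k. (T ^ j - 1) * (\<Sum>i<n. Y i ^ j) * fps_nth S (k - j))"
      by (simp add: sum_distrib_left power_mult_distrib algebra_simps)
    also have "\<dots> = (\<Sum>j=1..k. (T ^ j - 1) * (\<Sum>i<n. Y i ^ j) * fps_nth S (k - j))"
      by (simp add: sum.atLeast_Suc_atMost)
    finally show ?thesis .
  qed
  have Sb: "fps_nth S k = b k" for k
  proof (induction k rule: less_induct)
    case (less k)
    show ?case
    proof (cases "k = 0")
      case False
      then have "of_nat k * fps_nth S k = of_nat k * b k"
        unfolding rec[OF False[unfolded neq0_conv]] b[OF False[unfolded neq0_conv]]
        by (intro sum.cong) (auto simp: less)
      then show ?thesis using char False by simp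
    qed (simp add: S0 b0)
  qed
  show "k > 0 \<Longrightarrow> (1 - u) * T ^ k * (\<Sum>i<n. HL_A u n Y i * Y i ^ k) = b k"
    using Sb[of k] by (simp add: S_nth)
  show "(1 - u) * (\<Sum>i<n. HL_A u n Y i) = 1 - u ^ n"
    using S0 by (simp add: S_nth algebra_simps)
qed

section \<open>Laurent polynomials and Newton recursions\<close>

type_synonym 'a laurent = "(nat \<Rightarrow>\<^sub>0 int) \<Rightarrow>\<^sub>0 'a"

definition lcst :: "'a::comm_ring_1 \<Rightarrow> 'a laurent" where
  "lcst c = Poly_Mapping.single 0 c"

definition yv :: "nat \<Rightarrow> int \<Rightarrow> 'a::comm_ring_1 laurent" where
  "yv i e = Poly_Mapping.single (Poly_Mapping.single i e) 1"

lemma lcst_simps [simp]: "lcst 0 = 0" "lcst 1 = 1"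
  by (simp_all add: lcst_def)

lemma lcst_add: "lcst (a + b) = lcst a + lcst b" by (simp add: lcst_def single_add)
lemma lcst_mult: "lcst (a * b) = lcst a * lcst b" by (simp add: lcst_def mult_single)
lemma lcst_diff: "lcst (a - b) = lcst a - lcst b" by (simp add: lcst_def single_diff)
lemma lcst_uminus: "lcst (- a) = - lcst a" by (simp add: lcst_def single_uminus)
lemma lcst_of_nat: "lcst (of_nat k) = of_nat k" by (simp add: lcst_def)
lemma lcst_power: "lcst (a ^ k) = lcst a ^ k" by (induction k) (auto simp: lcst_mult)
lemma lcst_prod: "lcst (prod f A) = (\<Prod>x\<in>A. lcst (f x))"
  by (induction A rule: infinite_finite_induct) (auto simp: lcst_mult)
lemma lcst_eq_iff [simp]: "lcst a = lcst b \<longleftrightarrow> a = b" unfolding lcst_def by (metis lookup_single_eq)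

lemma yv_add: "yv i (a + b) = yv i a * yv i b"
  by (simp add: yv_def mult_single single_add)
lemma yv_0 [simp]: "yv i 0 = 1" by (simp add: yv_def)
lemma yv_inverse: "yv i a * yv i (- a) = 1" by (simp add: yv_add[symmetric])
lemma yv_power: "yv i a ^ k = yv i (int k * a)"
  by (induction k) (auto simp: yv_add algebra_simps)

lemma lookup_lcst_mult: "Poly_Mapping.lookup (lcst c * P) \<beta> = c * Poly_Mapping.lookup P \<beta>"
  unfolding lcst_def mult_map_scale_conv_mult[symmetric] by transfer (auto simp: when_def)

lemma laurent_induct [case_names single add]:
  assumes "\<And>\<beta> c. Q (Poly_Mapping.single \<beta> c)" "\<And>P R. Q P \<Longrightarrow> Q R \<Longrightarrow> Q (P + R)"
  shows "Q (P :: 'a::comm_ring_1 laurent)"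
proof (induction P rule: update_induct)
  case const
  then show ?case using assms(1)[of 0 0] by simp
next
  case (update P a b)
  have "Poly_Mapping.update a b P = P + Poly_Mapping.single a b"
    using update by (intro poly_mapping_eqI) (auto simp: lookup_update lookup_add lookup_single when_def in_keys_iff)
  then show ?case using assms(2)[OF update(3) assms(1)[of a b]] by simp
qed

text \<open>Additive maps out of the Laurent polynomials, given monomial by monomial.\<close>

definition lsum :: "((nat \<Rightarrow>\<^sub>0 int) \<Rightarrow> 'a::comm_ring_1 \<Rightarrow> 'b::ab_group_add) \<Rightarrow> 'a laurent \<Rightarrow> 'b" where
  "lsum \<psi> P = (\<Sum>\<beta>\<in>Poly_Mapping.keys P. \<psi> \<beta> (Poly_Mapping.lookup P \<beta>))"

lemma lsum_superset:
  assumes "\<And>\<beta>. \<psi> \<beta> 0 = 0" "finite S" "Poly_Mapping.keys P \<subseteq> S"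
  shows "lsum \<psi> P = (\<Sum>\<beta>\<in>S. \<psi> \<beta> (Poly_Mapping.lookup P \<beta>))"
  unfolding lsum_def by (rule sum.mono_neutral_left) (use assms in \<open>auto simp: in_keys_iff\<close>)

lemma lsum_add:
  assumes 0: "\<And>\<beta>. \<psi> \<beta> 0 = 0" and a: "\<And>\<beta> a b. \<psi> \<beta> (a + b) = \<psi> \<beta> a + \<psi> \<beta> b"
  shows "lsum \<psi> (P + R) = lsum \<psi> P + lsum \<psi> R"
proof -
  let ?S = "Poly_Mapping.keys P \<union> Poly_Mapping.keys R"
  have "lsum \<psi> (P + R) = (\<Sum>\<beta>\<in>?S. \<psi> \<beta> (Poly_Mapping.lookup (P + R) \<beta>))"
    by (rule lsum_superset[of \<psi>, OF 0]) (use Poly_Mapping.keys_add[of P R] in auto)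
  also have "\<dots> = (\<Sum>\<beta>\<in>?S. \<psi> \<beta> (Poly_Mapping.lookup P \<beta>)) + (\<Sum>\<beta>\<in>?S. \<psi> \<beta> (Poly_Mapping.lookup R \<beta>))"
    by (simp add: lookup_add a sum.distrib)
  also have "\<dots> = lsum \<psi> P + lsum \<psi> R"
    using lsum_superset[of \<psi> ?S P, OF 0] lsum_superset[of \<psi> ?S R, OF 0] by auto
  finally show ?thesis .
qed

lemma lsum_single:
  assumes 0: "\<And>\<beta>. \<psi> \<beta> 0 = 0"
  shows "lsum \<psi> (Poly_Mapping.single \<beta> c) = \<psi> \<beta> c"
  using lsum_superset[of \<psi> "{\<beta>}" "Poly_Mapping.single \<beta> c", OF 0] by simp

text \<open>Ring homomorphisms out of the Laurent polynomials.\<close>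

locale laurent_hom =
  fixes \<iota> :: "'a::comm_ring_1 \<Rightarrow> 'b::comm_ring_1" and \<chi> :: "(nat \<Rightarrow>\<^sub>0 int) \<Rightarrow> 'b"
  assumes i0: "\<iota> 0 = 0" and i1: "\<iota> 1 = 1" and iadd: "\<iota> (a + b) = \<iota> a + \<iota> b" and imult: "\<iota> (a * b) = \<iota> a * \<iota> b"
    and x0: "\<chi> 0 = 1" and xadd: "\<chi> (\<alpha> + \<beta>) = \<chi> \<alpha> * \<chi> \<beta>"
begin

definition lev :: "'a laurent \<Rightarrow> 'b" where
  "lev = lsum (\<lambda>\<beta> c. \<iota> c * \<chi> \<beta>)"

lemma lev_add: "lev (P + R) = lev P + lev R"
  unfolding lev_def by (rule lsum_add) (auto simp: i0 iadd distrib_right)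

lemma lev_single: "lev (Poly_Mapping.single \<beta> c) = \<iota> c * \<chi> \<beta>"
  unfolding lev_def by (rule lsum_single) (simp add: i0)

lemma lev_mult: "lev (P * R) = lev P * lev R"
proof (induction P rule: laurent_induct)
  case (single \<beta> c)
  show ?case
    by (induction R rule: laurent_induct)
       (simp_all add: mult_single lev_single imult xadd lev_add distrib_left distrib_right mult_ac)
qed (simp add: distrib_right lev_add)

lemma lev_0 [simp]: "lev 0 = 0" using lev_add[of 0 0] by simp
lemma lev_1 [simp]: "lev 1 = 1" using lev_single[of 0 1] by (simp add: i1 x0)
lemma lev_uminus: "lev (- P) = - lev P"
  using lev_add[of P "- P"] by (simp add: eq_neg_iff_add_eq_0 add.commute)
lemma lev_diff: "lev (P - R) = lev P - lev R"
  using lev_add[of P "- R"] by (simp add: lev_uminus)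
lemma lev_prod: "lev (prod f A) = (\<Prod>x\<in>A. lev (f x))"
  by (induction A rule: infinite_finite_induct) (auto simp: lev_mult)
lemma lev_power: "lev (P ^ k) = lev P ^ k"
  by (induction k) (auto simp: lev_mult)
lemma lev_lcst: "lev (lcst c) = \<iota> c" by (simp add: lcst_def lev_single x0)
lemma lev_yv: "lev (yv i e) = \<chi> (Poly_Mapping.single i e)" by (simp add: yv_def lev_single i1)

end

text \<open>
  The linear map that sends the monomial with exponents \<open>\<beta>\<close> to \<open>\<phi> \<beta>\<close>.
\<close>

definition lext :: "((nat \<Rightarrow>\<^sub>0 int) \<Rightarrow> 'a symfun) \<Rightarrow> 'a::field laurent \<Rightarrow> 'a symfun" where
  "lext \<phi> = lsum (\<lambda>\<beta> c. sf_scale c (\<phi> \<beta>))"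

lemma lext_add: "lext \<phi> (P + R) = lext \<phi> P + lext \<phi> R"
  unfolding lext_def by (rule lsum_add) (auto simp: sf.scale_left_distrib)

lemma lext_single: "lext \<phi> (Poly_Mapping.single \<beta> c) = sf_scale c (\<phi> \<beta>)"
  unfolding lext_def by (rule lsum_single) simp

lemma lext_0 [simp]: "lext \<phi> 0 = 0" using lext_add[of \<phi> 0 0] by simp
lemma lext_sum: "lext \<phi> (sum f A) = (\<Sum>x\<in>A. lext \<phi> (f x))"
  by (induction A rule: infinite_finite_induct) (auto simp: lext_add)

lemma lext_lcst_mult: "lext \<phi> (lcst c * P) = sf_scale c (lext \<phi> P)"
  by (induction P rule: laurent_induct)
     (simp_all add: lcst_def mult_single lext_single distrib_left lext_add sf.scale_right_distrib)

lemma lext_shift: "lext \<phi> (Poly_Mapping.single \<gamma> 1 * P) = lext (\<lambda>\<beta>. \<phi> (\<gamma> + \<beta>)) P"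
  by (induction P rule: laurent_induct)
     (simp_all add: mult_single lext_single distrib_left lext_add)

lemma lext_cong: "(\<And>\<beta>. \<beta> \<in> Poly_Mapping.keys P \<Longrightarrow> \<phi> \<beta> = \<phi>' \<beta>) \<Longrightarrow> lext \<phi> P = lext \<phi>' P"
  unfolding lext_def lsum_def by (auto intro!: sum.cong)

lemma lext_fun_sum: "lext (\<lambda>\<beta>. \<Sum>x\<in>A. \<phi> x \<beta>) P = (\<Sum>x\<in>A. lext (\<phi> x) P)"
  unfolding lext_def lsum_def by (subst sum.swap) (simp add: sf.scale_sum_right)

lemma lext_fun_scale: "lext (\<lambda>\<beta>. sf_scale a (\<phi> \<beta>)) P = sf_scale a (lext \<phi> P)"
  unfolding lext_def lsum_def by (simp add: sf.scale_sum_right mult.commute)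

lemma lext_fun_mult: "lext (\<lambda>\<beta>. f * \<phi> \<beta>) P = f * lext \<phi> P"
  unfolding lext_def lsum_def by (simp add: sum_distrib_left mult_sf_scale)

lemma lext_eq_sum: "lext \<phi> P = (\<Sum>\<beta>\<in>Poly_Mapping.keys P. sf_scale (Poly_Mapping.lookup P \<beta>) (\<phi> \<beta>))"
  by (simp add: lext_def lsum_def)

subsection \<open>Newton recursions\<close>

text \<open>
  Newton's recursion for the coefficients of \<open>exp (\<Sum> v\<^sub>k p\<^sub>k z\<^sup>k / k)\<close>. The recursion avoids the exponential of a
  power series over the ring of symmetric functions.
\<close>

function newton :: "(nat \<Rightarrow> 'a::field) \<Rightarrow> nat \<Rightarrow> 'a symfun" where
  "newton v n = (if n = 0 then 1 else
     sf_scale (1 / of_nat n) (\<Sum>k\<in>{1..n}. sf_scale (v k) (power_sum k * newton v (n - k))))"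
  by auto
termination by (relation "measure snd") auto

declare newton.simps [simp del]

lemma newton_0 [simp]: "newton v 0 = 1"
  by (simp add: newton.simps)

lemma newton_rec:
  assumes "char0 TYPE('a::field)" "n > 0"
  shows "of_nat n * newton v n = (\<Sum>k\<in>{1..n}. sf_scale (v k :: 'a) (power_sum k * newton v (n - k)))"
proof -
  have "(of_nat n :: 'a) \<noteq> 0" using assms by (auto simp: char0_def)
  then show ?thesis using assms unfolding sf_scale_of_nat[symmetric]
    by (subst newton.simps) simp
qed

definition fps_psum :: "(nat \<Rightarrow> 'a::field) \<Rightarrow> 'a symfun fps" where
  "fps_psum v = Abs_fps (\<lambda>k. if k = 0 then 0 else sf_scale (v k) (power_sum k))"

lemma newton_fps_deriv:
  assumes "char0 TYPE('a::field)"
  shows "fps_X * fps_deriv (Abs_fps (newton (v :: nat \<Rightarrow> 'a))) = fps_psum v * Abs_fps (newton v)"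
proof (rule fps_ext)
  fix n
  show "fps_nth (fps_X * fps_deriv (Abs_fps (newton v))) n = fps_nth (fps_psum v * Abs_fps (newton v)) n"
  proof (cases "n = 0")
    case False
    then have "fps_nth (fps_X * fps_deriv (Abs_fps (newton v))) n = of_nat n * newton v n" by (cases n) auto
    also have "\<dots> = fps_nth (fps_psum v * Abs_fps (newton v)) n"
      using False newton_rec[OF assms, of n v]
      by (simp add: fps_mult_nth fps_psum_def sum.atLeast_Suc_atMost[of 0] sf_scale_mult)
    finally show ?thesis .
  qed (simp add: fps_psum_def)
qed

text \<open>
  The recursion is the differential equation \<open>z f' = (\<Sum> v\<^sub>k p\<^sub>k z\<^sup>k) f\<close>, which has one solution with
  constant term 1. Products and rescalings of such series are recognized through it.
\<close>

lemma newton_unique: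
  assumes c0: "char0 TYPE('a::field)" and 1: "fps_nth f 0 = 1" and d: "fps_X * fps_deriv f = fps_psum (v :: nat \<Rightarrow> 'a) * f"
  shows "fps_nth f n = newton v n"
proof (induction n rule: less_induct)
  case (less n)
  show ?case
  proof (cases "n = 0")
    case False
    then have nz: "(of_nat n :: 'a) \<noteq> 0" using c0 by (auto simp: char0_def)
    have "of_nat n * fps_nth f n = fps_nth (fps_X * fps_deriv f) n" using False by (cases n) auto
    also have "\<dots> = (\<Sum>k\<in>{1..n}. sf_scale (v k) (power_sum k * fps_nth f (n - k)))"
      unfolding d by (simp add: fps_mult_nth fps_psum_def sum.atLeast_Suc_atMost[of 0] sf_scale_mult)
    also have "\<dots> = of_nat n * newton v n"
      unfolding newton_rec[OF c0 False[unfolded neq0_conv]] by (intro sum.cong) (auto simp: less)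
    finally have "sf_scale (of_nat n) (fps_nth f n) = sf_scale (of_nat n) (newton v n)"
      by (simp add: sf_scale_of_nat)
    then show ?thesis using nz by simp
  qed (simp add: 1)
qed

lemma newton_add:
  assumes c0: "char0 TYPE('a::field)"
  shows "newton (\<lambda>k. v k + v' k :: 'a) n = (\<Sum>k=0..n. newton v k * newton v' (n - k))"
proof -
  let ?f = "Abs_fps (newton v) * Abs_fps (newton v')"
  have "fps_X * fps_deriv ?f = (fps_X * fps_deriv (Abs_fps (newton v))) * Abs_fps (newton v') + Abs_fps (newton v) * (fps_X * fps_deriv (Abs_fps (newton v')))"
    by (simp add: algebra_simps)
  also have "\<dots> = (fps_psum v + fps_psum v') * ?f"
    unfolding newton_fps_deriv[OF c0] by (simp add: algebra_simps)
  also have "fps_psum v + fps_psum v' = fps_psum (\<lambda>k. v k + v' k)"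
    by (rule fps_ext) (simp add: fps_psum_def sf.scale_left_distrib)
  finally show ?thesis
    using newton_unique[OF c0, of ?f "\<lambda>k. v k + v' k" n] by (simp add: fps_mult_nth)
qed

lemma newton_scale:
  assumes c0: "char0 TYPE('a::field)"
  shows "newton (\<lambda>k. v k * a ^ k :: 'a) n = sf_scale (a ^ n) (newton v n)"
proof (induction n rule: less_induct)
  case (less n)
  show ?case
  proof (cases "n = 0")
    case False
    have "(\<Sum>k\<in>{1..n}. sf_scale (v k * a ^ k) (power_sum k * newton (\<lambda>k. v k * a ^ k) (n - k))) =
       (\<Sum>k\<in>{1..n}. sf_scale (a ^ n) (sf_scale (v k) (power_sum k * newton v (n - k))))"
      by (intro sum.cong) (auto simp: less mult_sf_scale mult_ac power_add[symmetric])
    then show ?thesis using False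
      by (simp add: newton.simps[of _ n] sf.scale_sum_right mult.commute)
  qed simp
qed

lemma dps_newton:
  assumes c0: "char0 TYPE('a::field)" and j: "j > 0"
  shows "dps j (newton (v :: nat \<Rightarrow> 'a) n) = (if j \<le> n then sf_scale (v j / of_nat j) (newton v (n - j)) else 0)"
proof (induction n rule: less_induct)
  case (less n)
  have nz: "k > 0 \<Longrightarrow> (of_nat k :: 'a) \<noteq> 0" for k using c0 by (auto simp: char0_def)
  show ?case
  proof (cases "n = 0")
    case True
    then show ?thesis using j by (simp add: dps_one[OF c0])
  next
    case False
    have "of_nat n * dps j (newton v n) = dps j (of_nat n * newton v n)"
      unfolding sf_scale_of_nat[symmetric] dps_scale[OF c0] ..
    also have "\<dots> = (\<Sum>k\<in>{1..n}. sf_scale (v k) (dps j (power_sum k) * newton v (n - k))) +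
        (\<Sum>k\<in>{1..n}. sf_scale (v k) (power_sum k * dps j (newton v (n - k))))"
      unfolding newton_rec[OF c0 False[unfolded neq0_conv]] dps_sum[OF c0]
      by (simp add: dps_scale[OF c0] dps_mult[OF c0] sf.scale_right_distrib sum.distrib)
    also have "(\<Sum>k\<in>{1..n}. sf_scale (v k) (dps j (power_sum k) * newton v (n - k))) =
       (\<Sum>k\<in>{1..n}. if k = j then sf_scale (v j) (newton v (n - j)) else 0)"
      by (intro sum.cong) (auto simp: dps_power_sum[OF c0])
    also have "\<dots> = (if j \<le> n then sf_scale (v j) (newton v (n - j)) else 0)"
      using j by (simp add: sum.delta)
    also have "(\<Sum>k\<in>{1..n}. sf_scale (v k) (power_sum k * dps j (newton v (n - k)))) =
       (if j \<le> n then sf_scale (v j / of_nat j) (of_nat (n - j) * newton v (n - j)) else 0)"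
    proof (cases "j \<le> n")
      case True
      have "(\<Sum>k\<in>{1..n}. sf_scale (v k) (power_sum k * dps j (newton v (n - k)))) =
         (\<Sum>k\<in>{1..n-j}. sf_scale (v j / of_nat j) (sf_scale (v k) (power_sum k * newton v (n - j - k))))"
      proof (rule sum.mono_neutral_cong_right)
        show "\<forall>k\<in>{1..n} - {1..n - j}. sf_scale (v k) (power_sum k * dps j (newton v (n - k))) = 0"
          using less by auto
        fix k assume k: "k \<in> {1..n - j}"
        then have "j \<le> n - k" "n - k < n" "n - k - j = n - j - k" using True j by auto
        then show "sf_scale (v k) (power_sum k * dps j (newton v (n - k))) = sf_scale (v j / of_nat j) (sf_scale (v k) (power_sum k * newton v (n - j - k)))"
          using less[of "n - k"] by (simp add: mult_sf_scale mult.commute)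
      qed auto
      also have "\<dots> = sf_scale (v j / of_nat j) (of_nat (n - j) * newton v (n - j))"
      proof (cases "n - j = 0")
        case True
        show ?thesis unfolding True by simp
      next
        case False
        show ?thesis unfolding newton_rec[OF c0 False[unfolded neq0_conv], of v] by (rule sf.scale_sum_right[symmetric])
      qed
      finally show ?thesis using True by simp
    next
      case False
      then have "dps j (newton v (n - k)) = 0" if "k \<in> {1..n}" for k using less[of "n - k"] that by auto
      then show ?thesis using False by (simp add: sum.neutral)
    qed
    finally have e: "of_nat n * dps j (newton v n) = (if j \<le> n then sf_scale (v j) (newton v (n - j)) else 0) +
       (if j \<le> n then sf_scale (v j / of_nat j) (of_nat (n - j) * newton v (n - j)) else 0)" .
    have "sf_scale (of_nat n) (dps j (newton v n)) = sf_scale (of_nat n) (if j \<le> n then sf_scale (v j / of_nat j) (newton v (n - j)) else 0)"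
    proof (cases "j \<le> n")
      case True
      have "v j + v j / of_nat j * of_nat (n - j) = of_nat n * (v j / of_nat j)"
        using True nz[OF j] by (simp add: of_nat_diff field_simps)
      then have "sf_scale (v j) (newton v (n - j)) + sf_scale (v j / of_nat j * of_nat (n - j)) (newton v (n - j)) = sf_scale (of_nat n * (v j / of_nat j)) (newton v (n - j))"
        by (simp only: sf.scale_left_distrib[symmetric])
      then show ?thesis using e True
        by (simp only: if_True sf_scale_of_nat[symmetric] sf.scale_scale)
    next
      case False
      then show ?thesis using e by (simp only: if_False sf_scale_of_nat[symmetric]) simp
    qed
    then show ?thesis using nz[of n] False by simp
  qed
qed

section \<open>A self-adjoint \<open>q\<close>-difference operator\<close>

subsection \<open>Pairs of indices\<close>

definition prs :: "nat \<Rightarrow> (nat \<times> nat) set" where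
  "prs n = {(a, b). a < b \<and> b < n}"

lemma finite_prs [simp]: "finite (prs n)"
  by (rule finite_subset[of _ "{..<n} \<times> {..<n}"]) (auto simp: prs_def)

text \<open>
  The difference operators treat one variable \<open>i\<close> separately, so products over pairs are split into the
  pairs that avoid \<open>i\<close> and those that meet it.
\<close>

lemma prod_prs_split:
  assumes "i < n"
  shows "(\<Prod>p\<in>prs n. f p) = (\<Prod>p\<in>{p \<in> prs n. fst p \<noteq> i \<and> snd p \<noteq> i}. f p) * (\<Prod>j\<in>{..<n} - {i}. f (min i j, max i j) :: 'b::comm_monoid_mult)"
proof -
  let ?R = "{p \<in> prs n. fst p \<noteq> i \<and> snd p \<noteq> i}" and ?h = "\<lambda>j. (min i j, max i j)"
  have "prs n = ?R \<union> ?h ` ({..<n} - {i})"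
  proof (intro equalityI subsetI)
    fix p assume "p \<in> prs n"
    then obtain a b where p: "p = (a, b)" "a < b" "b < n" by (auto simp: prs_def)
    consider "a = i" | "b = i" | "a \<noteq> i" "b \<noteq> i" by blast
    then show "p \<in> ?R \<union> ?h ` ({..<n} - {i})"
    proof cases
      case 1
      then have "p = ?h b" "b \<in> {..<n} - {i}" using p by auto
      then show ?thesis by blast
    next
      case 2
      then have "p = ?h a" "a \<in> {..<n} - {i}" using p by auto
      then show ?thesis by blast
    qed (use p in \<open>auto simp: prs_def\<close>)
  next
    fix p assume "p \<in> ?R \<union> ?h ` ({..<n} - {i})"
    then show "p \<in> prs n" using assms by (auto simp: prs_def min_def max_def)
  qed
  moreover have "?R \<inter> ?h ` ({..<n} - {i}) = {}" by (auto simp: min_def max_def split: if_splits)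
  moreover have "inj_on ?h ({..<n} - {i})" by (auto simp: inj_on_def min_def max_def split: if_splits)
  ultimately show ?thesis
    by (subst (1) \<open>prs n = _\<close>, subst prod.union_disjoint) (auto simp: prod.reindex)
qed

text \<open>
  The monomial \<open>y\<^sub>a / y\<^sub>b\<close>.
\<close>

definition rt :: "nat \<Rightarrow> nat \<Rightarrow> 'a::comm_ring_1 laurent" where
  "rt a b = yv a 1 * yv b (- 1)"

definition lvand :: "nat \<Rightarrow> 'a::comm_ring_1 laurent" where
  "lvand n = (\<Prod>(a, b)\<in>prs n. 1 - rt a b)"

definition lcf :: "'a::comm_ring_1 \<Rightarrow> nat \<Rightarrow> nat \<Rightarrow> 'a laurent" where
  "lcf u i j = (if i < j then 1 - lcst u * rt i j else lcst u - rt j i)"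

text \<open>
  The Laurent polynomial \<open>lvand n\<close> times the rational function \<open>\<Prod>\<^sub>j (y\<^sub>j - u y\<^sub>i) / (y\<^sub>j - y\<^sub>i)\<close>, whose denominators
  cancel against factors of \<open>lvand n\<close>.
\<close>

definition lvandA :: "'a::comm_ring_1 \<Rightarrow> nat \<Rightarrow> nat \<Rightarrow> 'a laurent" where
  "lvandA u n i = (\<Prod>(a, b)\<in>{p \<in> prs n. fst p \<noteq> i \<and> snd p \<noteq> i}. 1 - rt a b) * (\<Prod>j\<in>{..<n} - {i}. lcf u i j)"

definition pinv :: "nat \<Rightarrow> nat \<Rightarrow> 'a::comm_ring_1 laurent" where
  "pinv n k = (\<Sum>i<n. yv i (- int k))"

lemma to_fract_prod: "to_fract (prod f A) = (\<Prod>x\<in>A. to_fract (f x))"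
  by (induction A rule: infinite_finite_induct) auto
lemma to_fract_sum: "to_fract (sum f A) = (\<Sum>x\<in>A. to_fract (f x))"
  by (induction A rule: infinite_finite_induct) auto
lemma to_fract_power: "to_fract (x ^ k) = to_fract x ^ k"
  by (induction k) auto
lemma to_fract_of_nat: "to_fract (of_nat k) = of_nat k"
  by (induction k) auto

lemma inj_yv: "yv i e = (yv j e :: 'a::comm_ring_1 laurent) \<Longrightarrow> e \<noteq> 0 \<Longrightarrow> i = j"
  unfolding yv_def by (metis keys_single singleton_inject zero_neq_one)

lemma yv_nz: "(yv i e :: 'a::field laurent) \<noteq> 0"
  using yv_inverse[of i e] by (metis mult_zero_left zero_neq_one)

lemma to_fract_yv_inverse: "to_fract (yv i (- e) :: 'a::field laurent) = inverse (to_fract (yv i e))"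
proof -
  have "to_fract (yv i e) * to_fract (yv i (- e) :: 'a laurent) = 1"
    by (simp add: yv_inverse flip: to_fract_mult)
  then show ?thesis by (metis inverse_unique)
qed

lemma to_fract_lvandA:
  assumes i: "i < n"
  shows "to_fract (lvandA u n i :: 'a::field laurent) =
     to_fract (lvand n) * HL_A (to_fract (lcst u)) n (\<lambda>i. to_fract (yv i (- 1))) i"
proof -
  define Y where "Y i = to_fract (yv i (- 1) :: 'a laurent)" for i
  have Yn: "Y i \<noteq> 0" for i by (simp add: Y_def yv_nz)
  have y: "to_fract (yv i 1 :: 'a laurent) = inverse (Y i)" for i
    unfolding Y_def by (metis inverse_inverse_eq to_fract_yv_inverse)
  have Yd: "Y i - Y j \<noteq> 0" if "i \<noteq> j" for i j using that inj_yv[of i "- 1" j] by (auto simp: Y_def)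
  have rt: "to_fract (rt a b :: 'a laurent) = Y b / Y a" for a b
    by (simp add: rt_def y divide_inverse mult.commute) (simp add: Y_def)
  have f: "to_fract (lcf u i j) = to_fract (1 - rt (min i j) (max i j)) * ((Y i - to_fract (lcst u) * Y j) / (Y i - Y j))"
    if "j \<noteq> i" for j
  proof (cases "i < j")
    case True
    have "to_fract (lcf u i j) = (Y i - to_fract (lcst u) * Y j) / Y i"
      using True Yn by (simp add: lcf_def rt diff_divide_distrib)
    moreover have "to_fract (1 - rt (min i j) (max i j) :: 'a laurent) = (Y i - Y j) / Y i"
      using True Yn by (simp add: rt diff_divide_distrib)
    ultimately show ?thesis using Yd[of i j] that by simp
  next
    case False
    then have l: "j < i" using that by simp
    have "to_fract (lcf u i j) = - ((Y i - to_fract (lcst u) * Y j) / Y j)"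
      using l Yn by (simp add: lcf_def rt diff_divide_distrib)
    moreover have "to_fract (1 - rt (min i j) (max i j) :: 'a laurent) = - ((Y i - Y j) / Y j)"
      using l Yn by (simp add: rt diff_divide_distrib)
    ultimately show ?thesis using Yd[of i j] that by simp
  qed
  have "to_fract (lvandA u n i) = to_fract (\<Prod>(a, b)\<in>{p \<in> prs n. fst p \<noteq> i \<and> snd p \<noteq> i}. 1 - rt a b) * (\<Prod>j\<in>{..<n} - {i}. to_fract (lcf u i j))"
    by (simp add: lvandA_def to_fract_prod)
  also have "(\<Prod>j\<in>{..<n} - {i}. to_fract (lcf u i j)) =
     (\<Prod>j\<in>{..<n} - {i}. to_fract (1 - rt (min i j) (max i j))) * HL_A (to_fract (lcst u)) n Y i"
    unfolding HL_A_def prod.distrib[symmetric] by (intro prod.cong) (use f in auto)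
  also have "to_fract (\<Prod>(a, b)\<in>{p \<in> prs n. fst p \<noteq> i \<and> snd p \<noteq> i}. 1 - rt a b :: 'a laurent) *
     ((\<Prod>j\<in>{..<n} - {i}. to_fract (1 - rt (min i j) (max i j))) * HL_A (to_fract (lcst u)) n Y i) =
     to_fract (lvand n) * HL_A (to_fract (lcst u)) n Y i"
    unfolding lvand_def prod_prs_split[OF i, of "\<lambda>(a, b). 1 - rt a b"] by (simp add: to_fract_prod mult.assoc)
  finally show ?thesis unfolding Y_def .
qed

subsection \<open>Homogeneous Laurent polynomials\<close>

definition homog :: "nat \<Rightarrow> int \<Rightarrow> 'a::comm_ring_1 laurent \<Rightarrow> bool" where
  "homog n d P \<longleftrightarrow> (\<forall>\<beta>\<in>Poly_Mapping.keys P. (\<Sum>i<n. Poly_Mapping.lookup \<beta> i) = d)"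

lemma homog_mult: "homog n a P \<Longrightarrow> homog n b R \<Longrightarrow> homog n (a + b) (P * R)"
  unfolding homog_def using Poly_Mapping.keys_mult[of P R]
  by (fastforce simp: lookup_add sum.distrib)

lemma homog_mult0: "homog n 0 P \<Longrightarrow> homog n b R \<Longrightarrow> homog n b (P * R)"
  using homog_mult[of n 0 P b R] by simp

lemma homog_add: "homog n a P \<Longrightarrow> homog n a R \<Longrightarrow> homog n a (P + R)"
  unfolding homog_def using Poly_Mapping.keys_add[of P R] by blast

lemma homog_uminus: "homog n a P \<Longrightarrow> homog n a (- P)"
  unfolding homog_def by simp

lemma homog_diff: "homog n a P \<Longrightarrow> homog n a R \<Longrightarrow> homog n a (P - R)"
  using homog_add[of n a P "- R"] homog_uminus[of n a R] by simp

lemma homog_single: "(\<Sum>i<n. Poly_Mapping.lookup \<beta> i) = d \<Longrightarrow> homog n d (Poly_Mapping.single \<beta> c)"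
  unfolding homog_def by simp

lemma homog_lcst: "homog n 0 (lcst c)"
  unfolding lcst_def by (rule homog_single) simp

lemma homog_1: "homog n 0 1"
  using homog_lcst[of n 1] by simp

lemma homog_yv: "i < n \<Longrightarrow> homog n e (yv i e)"
  unfolding yv_def by (rule homog_single) (simp add: lookup_single when_def)

lemma homog_rt: "a < n \<Longrightarrow> b < n \<Longrightarrow> homog n 0 (rt a b)"
  unfolding rt_def using homog_mult[OF homog_yv[of a n 1] homog_yv[of b n "- 1"]] by simp

lemma homog_prod: "(\<And>x. x \<in> A \<Longrightarrow> homog n 0 (f x)) \<Longrightarrow> homog n 0 (prod f A)"
  by (induction A rule: infinite_finite_induct) (auto intro: homog_1 homog_mult0)

lemma homog_lvandA: "i < n \<Longrightarrow> homog n 0 (lvandA u n i)"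
  unfolding lvandA_def lcf_def
  by (intro homog_mult0 homog_prod)
     (auto simp: prs_def intro!: homog_diff homog_1 homog_rt homog_lcst homog_mult0)

subsection \<open>The functions \<open>Q\<^sub>j\<close> and their products\<close>

context macdonald_params
begin

abbreviation "u \<equiv> inverse t"

lemma u_neq_1: "u \<noteq> 1" using t1[of 1] by simp

text \<open>
  The one-row functions, extended by 0 to negative indices.
\<close>

definition gi :: "int \<Rightarrow> 'a symfun" where
  "gi j = (if j < 0 then 0 else newton w (nat j))"

text \<open>
  The coefficients of the quotient \<open>g (q z) / g (z)\<close> for the generating function \<open>g\<close> of the \<open>gi\<close>; this is why a
  \<open>q\<close>-shift of a variable can be expressed by multiplications.
\<close>

definition bn :: "nat \<Rightarrow> 'a symfun" where
  "bn = newton (\<lambda>k. t ^ k - 1)"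

lemma gi_neg: "a < 0 \<Longrightarrow> gi a = 0" by (simp add: gi_def)
lemma gi_nat: "gi (int k) = newton w k" by (simp add: gi_def)
lemma gi_0 [simp]: "gi 0 = 1" by (simp add: gi_def)

lemma dps_gi:
  assumes "j > 0"
  shows "dps j (gi a) = sf_scale (w j / of_nat j) (gi (a - int j))"
proof (cases "a < 0")
  case True
  then show ?thesis by (simp add: gi_def dps_zero[OF c0])
next
  case False
  then obtain k where k: "a = int k" using zero_le_imp_eq_int by (metis not_less)
  show ?thesis
  proof (cases "j \<le> k")
    case True
    then have "a - int j = int (k - j)" using k by simp
    then have "gi (a - int j) = newton w (k - j)" by (simp only: gi_nat)
    then show ?thesis using True dps_newton[OF c0 assms, of w k] unfolding k gi_nat by simp
  next
    case False
    then show ?thesis using k dps_newton[OF c0 assms, of w k] by (simp add: gi_nat gi_neg)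
  qed
qed

text \<open>
  Compare coefficients in \<open>g (q z) = b (z) g (z)\<close>.
\<close>

lemma gi_qshift:
  assumes "a \<le> int N"
  shows "sf_scale (q powi a) (gi a) = (\<Sum>k=0..N. bn k * gi (a - int k))"
proof (cases "a < 0")
  case True
  then show ?thesis by (simp add: gi_neg)
next
  case False
  then obtain n where n: "a = int n" using zero_le_imp_eq_int by (metis not_less)
  have "(\<Sum>k=0..N. bn k * gi (a - int k)) = (\<Sum>k=0..n. bn k * newton w (n - k))"
  proof (rule sum.mono_neutral_cong_right)
    show "{0..n} \<subseteq> {0..N}" using assms n by auto
    show "\<forall>k\<in>{0..N} - {0..n}. bn k * gi (a - int k) = 0" using n by (auto simp: gi_neg)
    fix k assume "k \<in> {0..n}"
    then have "a - int k = int (n - k)" using n by auto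
    then show "bn k * gi (a - int k) = bn k * newton w (n - k)" by (simp add: gi_nat)
  qed simp
  also have "\<dots> = newton (\<lambda>k. (t ^ k - 1) + w k) n"
    unfolding bn_def newton_add[OF c0] ..
  also have "(\<lambda>k. (t ^ k - 1) + w k) = (\<lambda>k. w k * q ^ k)"
  proof
    fix k show "(t ^ k - 1) + w k = w k * q ^ k"
    proof (cases "k = 0")
      case False
      then have "w k * (1 - q ^ k) = 1 - t ^ k" using q1[of k] by (simp add: wt_def)
      then show ?thesis by (simp add: algebra_simps)
    qed (simp add: wt_def)
  qed
  also have "newton (\<lambda>k. w k * q ^ k) n = sf_scale (q ^ n) (newton w n)" by (rule newton_scale[OF c0])
  finally show ?thesis using n by (simp add: gi_nat)
qed

definition gm :: "nat \<Rightarrow> (nat \<Rightarrow>\<^sub>0 int) \<Rightarrow> 'a symfun" where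
  "gm n \<beta> = (\<Prod>i<n. gi (Poly_Mapping.lookup \<beta> i))"

text \<open>
  Coefficient extraction written backwards: \<open>G n P\<close> is the constant term of \<open>P\<close> times the product of the generating
  functions of the \<open>gi\<close> in the inverse variables.
\<close>

definition G :: "nat \<Rightarrow> 'a laurent \<Rightarrow> 'a symfun" where
  "G n = lext (gm n)"

lemma lookup_single_plus: "Poly_Mapping.lookup (Poly_Mapping.single i e + \<beta>) j = (if j = i then e + Poly_Mapping.lookup \<beta> j else Poly_Mapping.lookup \<beta> j)"
  by (simp add: lookup_add lookup_single when_def)

lemma gm_remove: "i < n \<Longrightarrow> gm n \<beta> = gi (Poly_Mapping.lookup \<beta> i) * (\<Prod>j\<in>{..<n} - {i}. gi (Poly_Mapping.lookup \<beta> j))"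
  unfolding gm_def by (rule prod.remove) auto

lemma gm_shift_remove: "i < n \<Longrightarrow> gm n (Poly_Mapping.single i e + \<beta>) = gi (e + Poly_Mapping.lookup \<beta> i) * (\<Prod>j\<in>{..<n} - {i}. gi (Poly_Mapping.lookup \<beta> j))"
  by (subst gm_remove[of i]) (auto simp: lookup_single_plus intro!: prod.cong)

lemma dps_gm:
  assumes k: "k > 0"
  shows "dps k (gm n \<beta>) = sf_scale (w k / of_nat k) (\<Sum>i<n. gm n (Poly_Mapping.single i (- int k) + \<beta>))"
proof -
  have "dps k (gm n \<beta>) = (\<Sum>i<n. \<Prod>j<n. if j = i then dps k (gi (Poly_Mapping.lookup \<beta> i)) else gi (Poly_Mapping.lookup \<beta> j))"
    unfolding gm_def by (rule dps_prod[OF c0]) simp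
  also have "\<dots> = (\<Sum>i<n. sf_scale (w k / of_nat k) (gm n (Poly_Mapping.single i (- int k) + \<beta>)))"
  proof (rule sum.cong)
    fix i assume "i \<in> {..<n}"
    then have i: "i < n" by simp
    have "(\<Prod>j<n. if j = i then dps k (gi (Poly_Mapping.lookup \<beta> i)) else gi (Poly_Mapping.lookup \<beta> j)) =
       dps k (gi (Poly_Mapping.lookup \<beta> i)) * (\<Prod>j\<in>{..<n} - {i}. gi (Poly_Mapping.lookup \<beta> j))"
      using i by (subst prod.remove[of _ i]) (auto intro!: prod.cong)
    then show "(\<Prod>j<n. if j = i then dps k (gi (Poly_Mapping.lookup \<beta> i)) else gi (Poly_Mapping.lookup \<beta> j)) =
       sf_scale (w k / of_nat k) (gm n (Poly_Mapping.single i (- int k) + \<beta>))"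
      using i by (simp add: dps_gi[OF k] gm_shift_remove sf_scale_mult)
  qed simp
  finally show ?thesis by (simp add: sf.scale_sum_right)
qed

lemma dps_lext: "dps k (lext \<phi> (P :: 'a laurent)) = lext (\<lambda>\<beta>. dps k (\<phi> \<beta>)) P"
  by (simp add: lext_eq_sum dps_sum[OF c0] dps_scale[OF c0])

lemma G_yv: "G n (yv i e * P) = lext (\<lambda>\<beta>. gm n (Poly_Mapping.single i e + \<beta>)) P"
  unfolding G_def yv_def by (rule lext_shift)

lemma G_add: "G n (P + R) = G n P + G n R" by (simp add: G_def lext_add)
lemma G_sum: "G n (sum f A) = (\<Sum>x\<in>A. G n (f x))" by (simp add: G_def lext_sum)
lemma G_lcst: "G n (lcst c * P) = sf_scale c (G n P)" by (simp add: G_def lext_lcst_mult)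
lemma G_single: "G n (Poly_Mapping.single \<beta> c) = sf_scale c (gm n \<beta>)" by (simp add: G_def lext_single)

lemma dps_G:
  assumes k: "k > 0"
  shows "dps k (G n P) = sf_scale (w k / of_nat k) (G n (pinv n k * P))"
  unfolding pinv_def sum_distrib_right G_sum G_yv lext_fun_sum[symmetric] lext_fun_scale[symmetric]
  by (simp add: G_def dps_lext dps_gm[OF k])

text \<open>
  The Laurent polynomial by which \<open>bs k\<close>, the adjoint of multiplication by \<open>bn k\<close>, acts on the argument of \<open>G\<close>.
\<close>

function bl :: "nat \<Rightarrow> nat \<Rightarrow> 'a laurent" where
  "bl n k = (if k = 0 then 1 else lcst (1 / of_nat k) * (\<Sum>j\<in>{1..k}. lcst (t ^ j - 1) * pinv n j * bl n (k - j)))"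
  by auto
termination by (relation "measure snd") auto

function bs :: "nat \<Rightarrow> 'a symfun \<Rightarrow> 'a symfun" where
  "bs k f = (if k = 0 then f else sf_scale (1 / of_nat k) (\<Sum>j\<in>{1..k}. sf_scale ((t ^ j - 1) * of_nat j / w j) (dps j (bs (k - j) f))))"
  by auto
termination by (relation "measure fst") auto

declare bl.simps [simp del] bs.simps [simp del]

lemma bs_G: "bs k (G n P) = G n (bl n k * P)"
proof (induction k rule: less_induct)
  case (less k)
  show ?case
  proof (cases "k = 0")
    case False
    have "bs k (G n P) = sf_scale (1 / of_nat k) (\<Sum>j\<in>{1..k}. sf_scale (t ^ j - 1) (G n (pinv n j * (bl n (k - j) * P))))"
    proof -
      have "sf_scale ((t ^ j - 1) * of_nat j / w j) (dps j (bs (k - j) (G n P))) =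
        sf_scale (t ^ j - 1) (G n (pinv n j * (bl n (k - j) * P)))" if "j \<in> {1..k}" for j
      proof -
        have j: "j > 0" using that by simp
        show ?thesis using less[of "k - j"] that w_nz[OF j] of_nat_nz[OF j]
          by (simp add: dps_G[OF j])
      qed
      then show ?thesis using False by (simp add: bs.simps[of k])
    qed
    also have "\<dots> = G n (bl n k * P)"
      using False by (simp add: bl.simps[of n k] G_lcst G_sum sum_distrib_right mult.assoc)
    finally show ?thesis .
  qed (simp add: bs.simps[of 0] bl.simps[of n 0])
qed

lemma B_bn: "B (bn k * f) h = B f (bs k h)"
proof (induction k arbitrary: f rule: less_induct)
  case (less k)
  show ?case
  proof (cases "k = 0")
    case False
    have e: "bn k = sf_scale (1 / of_nat k) (\<Sum>j\<in>{1..k}. sf_scale (t ^ j - 1) (power_sum j * bn (k - j)))"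
      unfolding bn_def by (subst newton.simps) (use False in simp)
    have "B (bn k * f) h = (1 / of_nat k) * (\<Sum>j\<in>{1..k}. (t ^ j - 1) * B (bn (k - j) * (power_sum j * f)) h)"
      unfolding e sf_scale_mult sum_distrib_right B_simps by (simp add: mult.assoc mult.left_commute)
    also have "(\<Sum>j\<in>{1..k}. (t ^ j - 1) * B (bn (k - j) * (power_sum j * f)) h) =
       (\<Sum>j\<in>{1..k}. ((t ^ j - 1) * of_nat j / w j) * B f (dps j (bs (k - j) h)))"
      by (intro sum.cong) (auto simp: less B_power_sum_mult)
    also have "(1 / of_nat k) * \<dots> = B f (bs k h)"
      using False by (simp add: bs.simps[of k] B_simps)
    finally show ?thesis .
  qed (simp add: bs.simps[of 0] bn_def)
qed

text \<open>
  A generating operator for Macdonald's first operator. It is a sum of terms \<open>b b\<^sup>*\<close>, one operator followed by its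
  adjoint, hence self-adjoint. For arguments of degree at most \<open>N\<close> the bound does not matter; a finite sum avoids a completion.
\<close>

definition Dop :: "nat \<Rightarrow> 'a symfun \<Rightarrow> 'a symfun" where
  "Dop N h = (\<Sum>k\<in>{1..N}. sf_scale (u ^ k) (bn k * bs k h))"

lemma bs_linear: "bs k (f + h) = bs k f + bs k h" "bs k (sf_scale c f) = sf_scale c (bs k f)"
proof (induction k rule: less_induct)
  case (less k)
  {
    case 1
    show ?case using less by (simp add: bs.simps[of k] dps_add[OF c0] sf.scale_right_distrib sum.distrib)
  next
    case 2
    show ?case using less by (simp add: bs.simps[of k] dps_scale[OF c0] sf.scale_sum_right mult_ac)
  }
qed

lemma Dop_add: "Dop N (f + h) = Dop N f + Dop N h"
  by (simp add: Dop_def bs_linear distrib_left sf.scale_right_distrib sum.distrib)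

lemma Dop_scale: "Dop N (sf_scale c f) = sf_scale c (Dop N f)"
  by (simp add: Dop_def bs_linear mult_sf_scale sf.scale_sum_right mult.commute)

lemma Dop_zero: "Dop N 0 = 0" using Dop_scale[of N 0 0] by simp

lemma Dop_sum: "Dop N (sum f A) = (\<Sum>x\<in>A. Dop N (f x))"
  by (induction A rule: infinite_finite_induct) (auto simp: Dop_add Dop_zero)

lemma Dop_selfadjoint: "B (Dop N f) h = B f (Dop N h)"
proof -
  have "B (bn k * bs k f) h = B f (bn k * bs k h)" for k
    using B_bn[of k "bs k f" h] B_bn[of k "bs k h" f] B_sym by metis
  then show ?thesis by (simp add: Dop_def B_simps)
qed

subsection \<open>The action on products of generating functions\<close>

text \<open>
  The \<open>q\<close>-shift of the variable \<open>y\<^sub>i\<close>.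
\<close>

definition tw :: "nat \<Rightarrow> 'a laurent \<Rightarrow> 'a laurent" where
  "tw i = laurent_hom.lev lcst (\<lambda>\<beta>. Poly_Mapping.single \<beta> (q powi Poly_Mapping.lookup \<beta> i))"

lemma laurent_hom_tw: "laurent_hom lcst (\<lambda>\<beta>. Poly_Mapping.single \<beta> (q powi Poly_Mapping.lookup \<beta> i))"
  by unfold_locales (auto simp: lcst_add lcst_mult lookup_add power_int_add q0 mult_single)

lemmas tw_single = laurent_hom.lev_single[OF laurent_hom_tw, folded tw_def]
lemmas tw_add = laurent_hom.lev_add[OF laurent_hom_tw, folded tw_def]
lemmas tw_1 = laurent_hom.lev_1[OF laurent_hom_tw, folded tw_def]

lemma lext_tw: "lext \<phi> (tw i P) = lext (\<lambda>\<beta>. sf_scale (q powi Poly_Mapping.lookup \<beta> i) (\<phi> \<beta>)) P"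
  by (induction P rule: laurent_induct)
     (simp_all add: tw_single tw_add lext_add lcst_def mult_single lext_single)

lemma G_tw:
  assumes i: "i < n" and P: "homog n (int N) P"
  shows "G n (tw i P) = (\<Sum>k=0..N. bn k * G n (yv i (- int k) * P))"
proof -
  have "sf_scale (q powi Poly_Mapping.lookup \<beta> i) (gm n \<beta>) = (\<Sum>k=0..N. bn k * gm n (Poly_Mapping.single i (- int k) + \<beta>))"
    if b: "\<beta> \<in> Poly_Mapping.keys P" for \<beta>
  proof -
    let ?R = "\<Prod>j\<in>{..<n} - {i}. gi (Poly_Mapping.lookup \<beta> j)"
    show ?thesis
    proof (cases "\<exists>j\<in>{..<n} - {i}. Poly_Mapping.lookup \<beta> j < 0")
      case True
      then have "\<exists>j\<in>{..<n} - {i}. gi (Poly_Mapping.lookup \<beta> j) = 0" using gi_neg by blast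
      then have "?R = 0" by (intro prod_zero) auto
      then have "gm n \<beta> = 0" "\<And>e. gm n (Poly_Mapping.single i e + \<beta>) = 0"
        by (simp_all only: gm_remove[OF i, of \<beta>] gm_shift_remove[OF i] mult_zero_right)
      then show ?thesis by simp
    next
      case False
      have "int N = Poly_Mapping.lookup \<beta> i + (\<Sum>j\<in>{..<n} - {i}. Poly_Mapping.lookup \<beta> j)"
        using P b i by (auto simp: homog_def sum.remove)
      moreover have "(\<Sum>j\<in>{..<n} - {i}. Poly_Mapping.lookup \<beta> j) \<ge> 0" using False by (intro sum_nonneg) (simp add: not_less)
      ultimately have le: "Poly_Mapping.lookup \<beta> i \<le> int N" by simp
      have "sf_scale (q powi Poly_Mapping.lookup \<beta> i) (gm n \<beta>) = sf_scale (q powi Poly_Mapping.lookup \<beta> i) (gi (Poly_Mapping.lookup \<beta> i)) * ?R"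
        unfolding gm_remove[OF i] by (simp add: sf_scale_mult)
      also have "\<dots> = (\<Sum>k=0..N. bn k * gm n (Poly_Mapping.single i (- int k) + \<beta>))"
        unfolding gi_qshift[OF le] gm_shift_remove[OF i] by (simp add: sum_distrib_right mult.assoc)
      finally show ?thesis .
    qed
  qed
  then have "G n (tw i P) = lext (\<lambda>\<beta>. \<Sum>k=0..N. bn k * gm n (Poly_Mapping.single i (- int k) + \<beta>)) P"
    unfolding G_def lext_tw by (rule lext_cong)
  then show ?thesis by (simp add: lext_fun_sum lext_fun_mult G_yv)
qed

lemma lvandA_sum:
  shows "k > 0 \<Longrightarrow> (\<Sum>i<n. yv i (- int k) * lvandA u n i) = lcst (u ^ k / (1 - u)) * (bl n k * lvand n)"
    and "(\<Sum>i<n. lvandA u n i) = lcst ((1 - u ^ n) / (1 - u)) * lvand n"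
proof -
  define Y where "Y i = to_fract (yv i (- 1) :: 'a laurent)" for i
  let ?T = "to_fract (lcst t)" and ?u = "to_fract (lcst u)"
  have T: "?T * ?u = 1" using t0 by (simp flip: to_fract_mult lcst_mult)
  have inj: "inj_on Y {..<n}" using inj_yv[of _ "- 1"] by (auto simp: Y_def inj_on_def)
  have nz: "Y i \<noteq> 0" if "i < n" for i by (simp add: Y_def yv_nz)
  have char: "(of_nat k :: 'a laurent fract) \<noteq> 0" if "k > 0" for k
    using of_nat_nz[OF that] by (metis lcst_eq_iff lcst_of_nat lcst_simps(1) to_fract_0 to_fract_eq_iff to_fract_of_nat)
  have b0: "to_fract (bl n 0) = 1" by (simp add: bl.simps[of n 0])
  have pY: "to_fract (pinv n j :: 'a laurent) = (\<Sum>i<n. Y i ^ j)" for j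
    by (simp add: pinv_def Y_def to_fract_sum flip: to_fract_power yv_power) (simp add: yv_power)
  have b: "of_nat k * to_fract (bl n k) = (\<Sum>j=1..k. (?T ^ j - 1) * (\<Sum>i<n. Y i ^ j) * to_fract (bl n (k - j)))" if "k > 0" for k
  proof -
    have "of_nat k * bl n k = lcst (of_nat k * (1 / of_nat k)) * (\<Sum>j\<in>{1..k}. lcst (t ^ j - 1) * pinv n j * bl n (k - j))"
      unfolding lcst_mult lcst_of_nat by (subst bl.simps) (use that in \<open>simp add: mult.assoc\<close>)
    then have "of_nat k * bl n k = (\<Sum>j\<in>{1..k}. lcst (t ^ j - 1) * pinv n j * bl n (k - j))"
      using of_nat_nz[OF that] by simp
    from arg_cong[OF this, of to_fract] show ?thesis
      by (simp add: to_fract_of_nat to_fract_sum pY lcst_diff lcst_power to_fract_power)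
  qed
  have HL1: "(1 - ?u) * ?T ^ k * (\<Sum>i<n. HL_A ?u n Y i * Y i ^ k) = to_fract (bl n k)" if "k > 0" for k
    by (rule HL_sum(1)[of ?T ?u Y n "\<lambda>k. to_fract (bl n k)"]) (rule T inj b0 that | erule nz char b)+
  have HL2: "(1 - ?u) * (\<Sum>i<n. HL_A ?u n Y i) = 1 - ?u ^ n"
    by (rule HL_sum(2)[of ?T ?u Y n "\<lambda>k. to_fract (bl n k)"]) (rule T inj b0 | erule nz char b)+
  have A: "to_fract (lvandA u n i) = to_fract (lvand n) * HL_A ?u n Y i" if "i < n" for i
    using to_fract_lvandA[OF that, of u] unfolding Y_def .
  have u1: "1 - u \<noteq> 0" using u_neq_1 by simp
  show "(\<Sum>i<n. yv i (- int k) * lvandA u n i) = lcst (u ^ k / (1 - u)) * (bl n k * lvand n)" if k: "k > 0"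
  proof -
    have yk: "to_fract (yv i (- int k) :: 'a laurent) = Y i ^ k" for i
      unfolding Y_def to_fract_power[symmetric] yv_power by simp
    have "to_fract (lcst ((1 - u) * t ^ k) * (\<Sum>i<n. yv i (- int k) * lvandA u n i)) =
       to_fract (lvand n) * ((1 - ?u) * ?T ^ k * (\<Sum>i<n. HL_A ?u n Y i * Y i ^ k))"
      by (simp add: to_fract_sum A yk lcst_mult lcst_diff lcst_power to_fract_power sum_distrib_left mult_ac)
    also have "\<dots> = to_fract (bl n k * lvand n)" using HL1[OF k] by simp
    finally have e: "lcst ((1 - u) * t ^ k) * (\<Sum>i<n. yv i (- int k) * lvandA u n i) = bl n k * lvand n" by (simp only: to_fract_eq_iff)
    have "lcst (u ^ k / (1 - u)) * (lcst ((1 - u) * t ^ k) * (\<Sum>i<n. yv i (- int k) * lvandA u n i)) =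
       lcst ((u ^ k / (1 - u)) * ((1 - u) * t ^ k)) * (\<Sum>i<n. yv i (- int k) * lvandA u n i)"
      unfolding lcst_mult by (simp only: mult_ac)
    also have "(u ^ k / (1 - u)) * ((1 - u) * t ^ k) = 1" using u1 t0 by (simp add: power_inverse)
    finally show ?thesis unfolding e by simp
  qed
  show "(\<Sum>i<n. lvandA u n i) = lcst ((1 - u ^ n) / (1 - u)) * lvand n"
  proof -
    have "to_fract (lcst (1 - u) * (\<Sum>i<n. lvandA u n i)) = to_fract (lvand n) * ((1 - ?u) * (\<Sum>i<n. HL_A ?u n Y i))"
      by (simp add: to_fract_sum A lcst_diff sum_distrib_left mult_ac)
    also have "\<dots> = to_fract (lcst (1 - u ^ n) * lvand n)"
      using HL2 by (simp add: lcst_diff lcst_power to_fract_power)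
    finally have e: "lcst (1 - u) * (\<Sum>i<n. lvandA u n i) = lcst (1 - u ^ n) * lvand n" by (simp only: to_fract_eq_iff)
    have "lcst (1 / (1 - u)) * (lcst (1 - u) * (\<Sum>i<n. lvandA u n i)) = lcst ((1 / (1 - u)) * (1 - u)) * (\<Sum>i<n. lvandA u n i)"
      unfolding lcst_mult by (simp only: mult_ac)
    also have "(1 / (1 - u)) * (1 - u) = 1" using u1 by simp
    finally have "(\<Sum>i<n. lvandA u n i) = lcst (1 / (1 - u)) * (lcst (1 - u ^ n) * lvand n)" unfolding e by simp
    then show ?thesis by (simp add: mult.assoc[symmetric] lcst_mult[symmetric])
  qed
qed

text \<open>
  The action of the operator on a product of generating functions: applying the \<open>q\<close>-shift of \<open>y\<^sub>i\<close> multiplies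
  \<open>G\<close> by the \<open>bn k\<close>, and summing over \<open>i\<close> with the coefficients of the partial fraction expansion turns the powers of
  \<open>y\<^sub>i\<close> into the Laurent polynomials \<open>bl n k\<close>, that is, into the adjoints \<open>bs k\<close>.
\<close>

lemma Dop_G:
  assumes P: "homog n (int N) P"
  shows "(\<Sum>i<n. G n (tw i (lvandA u n i * P))) =
     sf_scale ((1 - u ^ n) / (1 - u)) (G n (lvand n * P)) + sf_scale (1 / (1 - u)) (Dop N (G n (lvand n * P)))"
proof -
  have "(\<Sum>i<n. G n (tw i (lvandA u n i * P))) = (\<Sum>i<n. \<Sum>k=0..N. bn k * G n (yv i (- int k) * (lvandA u n i * P)))"
    by (intro sum.cong refl G_tw homog_mult0 homog_lvandA P) auto
  also have "\<dots> = (\<Sum>k=0..N. bn k * G n ((\<Sum>i<n. yv i (- int k) * lvandA u n i) * P))"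
    by (subst sum.swap) (simp add: G_sum sum_distrib_left sum_distrib_right mult.assoc)
  also have "\<dots> = bn 0 * G n ((\<Sum>i<n. yv i (- int 0) * lvandA u n i) * P) +
     (\<Sum>k\<in>{1..N}. bn k * G n ((\<Sum>i<n. yv i (- int k) * lvandA u n i) * P))"
    by (simp add: sum.atLeast_Suc_atMost[of 0])
  also have "bn 0 * G n ((\<Sum>i<n. yv i (- int 0) * lvandA u n i) * P) = sf_scale ((1 - u ^ n) / (1 - u)) (G n (lvand n * P))"
    by (simp add: bn_def lvandA_sum(2) mult.assoc G_lcst)
  also have "(\<Sum>k\<in>{1..N}. bn k * G n ((\<Sum>i<n. yv i (- int k) * lvandA u n i) * P)) = sf_scale (1 / (1 - u)) (Dop N (G n (lvand n * P)))"
    by (simp add: lvandA_sum(1) mult.assoc G_lcst Dop_def bs_G mult_sf_scale sf.scale_sum_right)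
  finally show ?thesis .
qed

end

section \<open>Dominance order\<close>

text \<open>
  The first \<open>k\<close> entries of a decreasing list have the largest sum among \<open>k\<close> of its entries.
\<close>

lemma sum_mset_le_take:
  assumes "sorted_wrt (\<ge>) ys" "M \<subseteq># mset ys" "size M \<le> k"
  shows "sum_mset M \<le> sum_list (take k (ys :: nat list))"
  using assms
proof (induction ys arbitrary: M k)
  case (Cons y ys)
  show ?case
  proof (cases "M = {#}")
    case False
    then obtain k' where k: "k = Suc k'" using Cons.prems(3) by (cases k) auto
    obtain z where z: "z \<in># M" and z_def: "y \<in># M \<Longrightarrow> z = y" using False by (metis multiset_nonemptyE)
    have sub: "M - {#z#} \<subseteq># mset ys"
    proof (cases "y \<in># M")
      case True
      then show ?thesis using Cons.prems(2) by (simp add: z_def subset_eq_diff_conv)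
    next
      case False
      then have "M \<subseteq># mset ys" using Cons.prems(2)
        by (metis add_mset_add_single diff_single_trivial mset.simps(2) subset_eq_diff_conv)
      then show ?thesis by (meson diff_subset_eq_self subset_mset.order_trans)
    qed
    have "z \<in># add_mset y (mset ys)" using z Cons.prems(2) by (metis mset.simps(2) mset_subset_eqD)
    then have "z \<le> y" using Cons.prems(1) by auto
    moreover have "sum_mset (M - {#z#}) \<le> sum_list (take k' ys)"
      using Cons.prems z k by (intro Cons.IH sub) (auto simp: size_Diff_singleton)
    moreover have "sum_mset M = z + sum_mset (M - {#z#})" using multi_member_split[OF z] by auto
    ultimately show ?thesis unfolding k by (simp only: take_Suc_Cons sum_list.Cons)
  qed simp
qed simp

lemma sum_take_Suc: "sum_list (take (Suc k) xs) = sum_list (take k xs) + (if k < length xs then xs ! k else 0 :: nat)"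
  by (simp add: take_Suc_conv_app_nth)

lemma partition_eqI:
  assumes p: "is_partition \<kappa>" "is_partition \<mu>" and eq: "\<And>k. sum_list (take k \<kappa>) = sum_list (take k \<mu>)"
  shows "\<kappa> = \<mu>"
proof -
  have n: "(if k < length \<kappa> then \<kappa> ! k else 0) = (if k < length \<mu> then \<mu> ! k else 0)" for k
    using eq[of k] eq[of "Suc k"] by (simp only: sum_take_Suc add_left_cancel)
  have pos: "k < length \<kappa> \<Longrightarrow> \<kappa> ! k > 0" "k < length \<mu> \<Longrightarrow> \<mu> ! k > 0" for k
    using p by (auto simp: is_partition_def)
  have "k < length \<kappa> \<longleftrightarrow> k < length \<mu>" for k using n[of k] pos[of k] by (auto split: if_splits)
  then have l: "length \<kappa> = length \<mu>" by (meson linorder_neqE_nat less_irrefl)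
  show ?thesis
  proof (rule nth_equalityI[OF l])
    fix k assume "k < length \<kappa>"
    then show "\<kappa> ! k = \<mu> ! k" using n[of k] l by simp
  qed
qed

definition ups :: "nat list \<Rightarrow> nat list set" where
  "ups \<kappa> = {\<mu>. is_partition \<mu> \<and> dominance_le \<kappa> \<mu> \<and> \<mu> \<noteq> \<kappa>}"

lemma finite_partitions: "finite {\<mu>. is_partition \<mu> \<and> sum_list \<mu> = d}"
proof (rule finite_subset)
  show "{\<mu>. is_partition \<mu> \<and> sum_list \<mu> = d} \<subseteq> part_of ` {M. 0 \<notin># M \<and> sum_mset M \<le> d}"
  proof
    fix \<mu> assume "\<mu> \<in> {\<mu>. is_partition \<mu> \<and> sum_list \<mu> = d}"
    then show "\<mu> \<in> part_of ` {M. 0 \<notin># M \<and> sum_mset M \<le> d}"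
      by (intro image_eqI[of _ _ "mset \<mu>"]) (auto simp: part_of_mset zero_notin_partition[simplified] sum_mset_sum_list)
  qed
qed (intro finite_imageI finite_psets)

lemma ups_sum: "\<mu> \<in> ups \<kappa> \<Longrightarrow> sum_list \<mu> = sum_list \<kappa>"
  by (simp add: ups_def dominance_le_def)

lemma ups_partition: "\<mu> \<in> ups \<kappa> \<Longrightarrow> is_partition \<mu>"
  by (simp add: ups_def)

lemma finite_ups: "finite (ups \<kappa>)"
  by (rule finite_subset[OF _ finite_partitions[of "sum_list \<kappa>"]]) (auto simp: ups_sum ups_partition)

lemma ups_trans: "is_partition \<kappa> \<Longrightarrow> \<mu> \<in> ups \<kappa> \<Longrightarrow> \<nu> \<in> ups \<mu> \<Longrightarrow> \<nu> \<in> ups \<kappa>"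
proof -
  assume *: "is_partition \<kappa>" "\<mu> \<in> ups \<kappa>" "\<nu> \<in> ups \<mu>"
  have "\<nu> \<noteq> \<kappa>"
  proof
    assume "\<nu> = \<kappa>"
    then have "sum_list (take k \<kappa>) = sum_list (take k \<mu>)" for k
      using * by (intro order.antisym) (auto simp: ups_def dominance_le_def)
    then have "\<kappa> = \<mu>" using * by (intro partition_eqI) (auto simp: ups_def)
    then show False using * by (auto simp: ups_def)
  qed
  then show "\<nu> \<in> ups \<kappa>" using * by (auto simp: ups_def dominance_le_def intro: order.trans)
qed

lemma ups_irrefl: "\<kappa> \<notin> ups \<kappa>" by (simp add: ups_def)

lemma card_ups_less: "is_partition \<kappa> \<Longrightarrow> \<mu> \<in> ups \<kappa> \<Longrightarrow> card (ups \<mu>) < card (ups \<kappa>)"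
  by (rule psubset_card_mono[OF finite_ups]) (use ups_trans ups_irrefl in blast)

lemma partition_induct_up [consumes 1, case_names step]:
  assumes "is_partition \<kappa>" "\<And>\<kappa>. is_partition \<kappa> \<Longrightarrow> (\<And>\<mu>. \<mu> \<in> ups \<kappa> \<Longrightarrow> P \<mu>) \<Longrightarrow> P \<kappa>"
  shows "P \<kappa>"
  using assms(1)
proof (induction "card (ups \<kappa>)" arbitrary: \<kappa> rule: less_induct)
  case less
  then show ?case using assms(2) card_ups_less ups_partition by blast
qed

text \<open>The exponent vector of a partition, and the partition underlying a vector of exponents.\<close>

definition pvec :: "nat list \<Rightarrow> (nat \<Rightarrow>\<^sub>0 int)" where
  "pvec \<kappa> = (\<Sum>i<length \<kappa>. Poly_Mapping.single i (int (\<kappa> ! i)))"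

lemma lookup_pvec: "Poly_Mapping.lookup (pvec \<kappa>) i = (if i < length \<kappa> then int (\<kappa> ! i) else 0)"
  by (simp add: pvec_def lookup_sum lookup_single when_def)

lemma sum_pvec: "(\<Sum>i<k. Poly_Mapping.lookup (pvec \<kappa>) i) = int (sum_list (take k \<kappa>))"
  by (induction k) (auto simp: sum_take_Suc lookup_pvec simp del: take_Suc)

text \<open>
  The partition with the positive entries of an exponent vector as parts.
\<close>

definition pof :: "nat \<Rightarrow> (nat \<Rightarrow>\<^sub>0 int) \<Rightarrow> nat list" where
  "pof n \<beta> = rev (sort (filter (\<lambda>x. x > 0) (map (\<lambda>i. nat (Poly_Mapping.lookup \<beta> i)) [0..<n])))"

lemma is_partition_pof: "is_partition (pof n \<beta>)"
proof -
  have "sorted (sort (filter (\<lambda>x. x > 0) (map (\<lambda>i. nat (Poly_Mapping.lookup \<beta> i)) [0..<n])))"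
    by (rule sorted_sort)
  then show ?thesis unfolding is_partition_def pof_def by (auto simp: sorted_wrt_rev)
qed

lemma sum_mset_filter_pos: "sum_mset (filter_mset (\<lambda>x. x > 0) M) = sum_mset (M :: nat multiset)"
  by (induction M) auto

lemma sum_mset_map_upt: "sum_mset (mset (map f [0..<k])) = (\<Sum>i<k. f i :: nat)"
  by (induction k) auto

lemma pof_ge:
  assumes nn: "\<And>i. i < n \<Longrightarrow> Poly_Mapping.lookup \<beta> i \<ge> 0" and k: "k \<le> n"
  shows "(\<Sum>i<k. Poly_Mapping.lookup \<beta> i) \<le> int (sum_list (take k (pof n \<beta>)))"
proof -
  let ?f = "\<lambda>i. nat (Poly_Mapping.lookup \<beta> i)"
  let ?M = "filter_mset (\<lambda>x. x > 0) (mset (map ?f [0..<k]))"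
  have split: "[0..<n] = [0..<k] @ [k..<n]" using k by (metis le_add_diff_inverse upt_add_eq_append zero_le)
  have "?M \<subseteq># mset (pof n \<beta>)" unfolding pof_def split by simp
  moreover have "size ?M \<le> k" using size_filter_mset_lesseq[of "\<lambda>x. x > 0" "mset (map ?f [0..<k])"] by simp
  moreover have "sorted_wrt (\<ge>) (pof n \<beta>)" using is_partition_pof[of n \<beta>] by (simp add: is_partition_def)
  ultimately have "sum_mset ?M \<le> sum_list (take k (pof n \<beta>))" by (intro sum_mset_le_take)
  moreover have "int (sum_mset ?M) = (\<Sum>i<k. Poly_Mapping.lookup \<beta> i)"
  proof -
    have "sum_mset ?M = (\<Sum>i<k. ?f i)"
      unfolding sum_mset_filter_pos by (rule sum_mset_map_upt)
    also have "int \<dots> = (\<Sum>i<k. Poly_Mapping.lookup \<beta> i)" using nn k by (simp add: int_sum)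
    finally show ?thesis .
  qed
  ultimately show ?thesis by linarith
qed

lemma pof_sum:
  assumes nn: "\<And>i. i < n \<Longrightarrow> Poly_Mapping.lookup \<beta> i \<ge> 0"
  shows "int (sum_list (pof n \<beta>)) = (\<Sum>i<n. Poly_Mapping.lookup \<beta> i)"
proof -
  let ?f = "\<lambda>i. nat (Poly_Mapping.lookup \<beta> i)"
  have "sum_list (pof n \<beta>) = sum_mset (filter_mset (\<lambda>x. x > 0) (mset (map ?f [0..<n])))"
    unfolding pof_def by (simp add: sum_mset_sum_list[symmetric])
  also have "\<dots> = (\<Sum>i<n. ?f i)"
    unfolding sum_mset_filter_pos by (rule sum_mset_map_upt)
  also have "int \<dots> = (\<Sum>i<n. Poly_Mapping.lookup \<beta> i)" using nn by (simp add: int_sum)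
  finally show ?thesis .
qed

lemma length_pof: "length (pof n \<beta>) \<le> n"
  unfolding pof_def using length_filter_le[of "\<lambda>x. x > 0" "map (\<lambda>i. nat (Poly_Mapping.lookup \<beta> i)) [0..<n]"] by simp

text \<open>The cone spanned by the positive roots.\<close>

definition rcone :: "nat \<Rightarrow> (nat \<Rightarrow>\<^sub>0 int) set" where
  "rcone n = {\<beta>. Poly_Mapping.keys \<beta> \<subseteq> {..<n} \<and> (\<forall>k. (\<Sum>i<k. Poly_Mapping.lookup \<beta> i) \<ge> 0) \<and> (\<Sum>i<n. Poly_Mapping.lookup \<beta> i) = 0}"

lemma rcone_add: "\<alpha> \<in> rcone n \<Longrightarrow> \<beta> \<in> rcone n \<Longrightarrow> \<alpha> + \<beta> \<in> rcone n"
  using Poly_Mapping.keys_add[of \<alpha> \<beta>] by (auto simp: rcone_def lookup_add sum.distrib)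

lemma rcone_0: "0 \<in> rcone n" by (simp add: rcone_def)

lemma rcone_eq_0:
  assumes "\<And>k :: nat. (\<Sum>i<k. Poly_Mapping.lookup \<beta> i) = (0 :: int)"
  shows "\<beta> = 0"
proof (rule poly_mapping_eqI)
  fix k show "Poly_Mapping.lookup \<beta> k = Poly_Mapping.lookup 0 k"
    using assms[of k] assms[of "Suc k"] by simp
qed

text \<open>
  Partial sums are nonnegative on the cone, so they vanish for both summands.
\<close>

lemma rcone_pointed:
  assumes "\<alpha> \<in> rcone n" "\<beta> \<in> rcone n" "\<alpha> + \<beta> = 0"
  shows "\<alpha> = 0"
proof (rule rcone_eq_0)
  fix k
  have "(\<Sum>i<k. Poly_Mapping.lookup (\<alpha> + \<beta>) i) = 0" using assms(3) by simp
  moreover have "(\<Sum>i<k. Poly_Mapping.lookup \<alpha> i) \<ge> 0" "(\<Sum>i<k. Poly_Mapping.lookup \<beta> i) \<ge> 0"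
    using assms by (auto simp: rcone_def)
  ultimately show "(\<Sum>i<k. Poly_Mapping.lookup \<alpha> i) = 0" by (simp add: lookup_add sum.distrib)
qed

text \<open>
  Moving along positive roots increases all partial sums, and sorting increases them further.
\<close>

lemma pof_in_ups:
  assumes l: "is_partition \<kappa>" "length \<kappa> \<le> n" and b: "\<beta> \<in> rcone n" "\<beta> \<noteq> 0"
    and nn: "\<And>i. i < n \<Longrightarrow> Poly_Mapping.lookup (pvec \<kappa> + \<beta>) i \<ge> 0"
  shows "pof n (pvec \<kappa> + \<beta>) \<in> ups \<kappa>"
proof -
  let ?\<gamma> = "pvec \<kappa> + \<beta>"
  have s: "(\<Sum>i<k. Poly_Mapping.lookup ?\<gamma> i) = int (sum_list (take k \<kappa>)) + (\<Sum>i<k. Poly_Mapping.lookup \<beta> i)" for k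
    by (simp add: lookup_add sum.distrib sum_pvec)
  have tot: "sum_list (pof n ?\<gamma>) = sum_list \<kappa>"
    using pof_sum[of n ?\<gamma>, OF nn] s[of n] b l by (simp add: rcone_def)
  have ge: "int (sum_list (take k \<kappa>)) + (\<Sum>i<k. Poly_Mapping.lookup \<beta> i) \<le> int (sum_list (take k (pof n ?\<gamma>)))" for k
  proof (cases "k \<le> n")
    case True
    then show ?thesis using pof_ge[of n ?\<gamma> k, OF nn] s[of k] by simp
  next
    case False
    have "(\<Sum>i<k. Poly_Mapping.lookup \<beta> i) = (\<Sum>i<n. Poly_Mapping.lookup \<beta> i)"
      using False b by (intro sum.mono_neutral_right) (auto simp: rcone_def in_keys_iff)
    then show ?thesis using False l b length_pof[of n ?\<gamma>] tot by (simp add: rcone_def)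
  qed
  obtain k where "(\<Sum>i<k. Poly_Mapping.lookup \<beta> i) \<noteq> 0" using rcone_eq_0[of \<beta>] b by blast
  then have "(\<Sum>i<k. Poly_Mapping.lookup \<beta> i) > 0" using b by (auto simp: rcone_def order.strict_iff_order)
  then have "pof n ?\<gamma> \<noteq> \<kappa>" using ge[of k] by auto
  moreover have "sum_list (take k \<kappa>) \<le> sum_list (take k (pof n ?\<gamma>))" for k
  proof -
    have "(\<Sum>i<k. Poly_Mapping.lookup \<beta> i) \<ge> 0" using b by (auto simp: rcone_def)
    then show ?thesis using ge[of k] by linarith
  qed
  ultimately show ?thesis using tot is_partition_pof by (simp add: ups_def dominance_le_def)
qed

text \<open>Laurent polynomials with constant term \<open>c\<close> and all other exponents in the cone.\<close>

definition coned :: "nat \<Rightarrow> 'a::comm_ring_1 \<Rightarrow> 'a laurent \<Rightarrow> bool" where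
  "coned n c P \<longleftrightarrow> Poly_Mapping.lookup P 0 = c \<and> Poly_Mapping.keys P \<subseteq> rcone n"

lemma coned_single: "\<beta> \<in> rcone n \<Longrightarrow> coned n (if \<beta> = 0 then c else 0) (Poly_Mapping.single \<beta> c)"
  by (auto simp: coned_def lookup_single when_def)

lemma coned_lcst: "coned n c (lcst c)"
  using coned_single[OF rcone_0, of n c] by (simp add: lcst_def)

lemma coned_1: "coned n 1 1" using coned_lcst[of n 1] by simp

lemma coned_add: "coned n a P \<Longrightarrow> coned n b R \<Longrightarrow> coned n (a + b) (P + R)"
  using Poly_Mapping.keys_add[of P R] by (auto simp: coned_def lookup_add)

lemma coned_uminus: "coned n a P \<Longrightarrow> coned n (- a) (- P)"
  by (auto simp: coned_def)

lemma coned_diff: "coned n a P \<Longrightarrow> coned n b R \<Longrightarrow> coned n (a - b) (P - R)"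
  using coned_add[of n a P "- b" "- R"] coned_uminus[of n b R] by simp

text \<open>
  Because the cone is pointed, only the constant terms contribute to the constant term of a product.
\<close>

lemma coned_mult:
  assumes "coned n a P" "coned n b R"
  shows "coned n (a * b) (P * R)"
proof -
  have expand: "X = (\<Sum>\<beta>\<in>Poly_Mapping.keys X. Poly_Mapping.single \<beta> (Poly_Mapping.lookup X \<beta>))" for X :: "'a laurent"
    by (rule poly_mapping_eqI) (simp add: lookup_sum lookup_single when_def in_keys_iff sum.delta' cong: if_cong)
  have split: "\<exists>R'. X = lcst c + R' \<and> coned n 0 R'" if "coned n c X" for X and c :: 'a
  proof (intro exI conjI)
    show "X = lcst c + (X - lcst c)" by simp
    show "coned n 0 (X - lcst c)" using coned_diff[OF that coned_lcst[of n c]] by simp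
  qed
  have zero: "coned n 0 (X * Y)" if X: "coned n 0 X" and Y: "Poly_Mapping.keys Y \<subseteq> rcone n" for X Y :: "'a laurent"
  proof -
    have k: "Poly_Mapping.keys (X * Y) \<subseteq> rcone n"
      using Poly_Mapping.keys_mult[of X Y] X Y rcone_add by (fastforce simp: coned_def)
    have "0 \<notin> Poly_Mapping.keys (X * Y)"
    proof
      assume "0 \<in> Poly_Mapping.keys (X * Y)"
      then obtain a b where ab: "0 = a + b" "a \<in> Poly_Mapping.keys X" "b \<in> Poly_Mapping.keys Y"
        using Poly_Mapping.keys_mult[of X Y] by blast
      then have "a = 0" using rcone_pointed[of a n b] X Y by (auto simp: coned_def)
      then show False using ab X by (auto simp: coned_def in_keys_iff)
    qed
    then show ?thesis using k by (simp add: coned_def in_keys_iff)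
  qed
  obtain P' where P': "P = lcst a + P'" "coned n 0 P'" using split[OF assms(1)] by blast
  obtain R' where R': "R = lcst b + R'" "coned n 0 R'" using split[OF assms(2)] by blast
  have "P * R = lcst (a * b) + (P' * R + R' * lcst a)"
    unfolding P'(1) R'(1) lcst_mult by (simp add: algebra_simps)
  moreover have "coned n 0 (P' * R)" using zero[OF P'(2)] assms(2) by (simp add: coned_def)
  moreover have "coned n 0 (R' * lcst a)" using zero[OF R'(2)] coned_lcst[of n a] by (simp add: coned_def)
  ultimately show ?thesis using coned_add[OF coned_lcst[of n "a * b"] coned_add[of n 0 "P' * R" 0 "R' * lcst a"]] by simp
qed

lemma coned_prod: "(\<And>x. x \<in> A \<Longrightarrow> coned n (c x) (f x)) \<Longrightarrow> coned n (prod c A) (prod f A)"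
  by (induction A rule: infinite_finite_induct) (auto intro: coned_1 coned_mult)

lemma rcone_root:
  assumes "a < b" "b < n"
  shows "Poly_Mapping.single a 1 + Poly_Mapping.single b (- 1) \<in> rcone n" (is "?r \<in> _")
    and "Poly_Mapping.single a 1 + Poly_Mapping.single b (- 1 :: int) \<noteq> 0"
proof -
  have l: "Poly_Mapping.lookup ?r i = (if i = a then 1 else 0) - (if i = b then 1 else (0::int))" for i
    by (simp add: lookup_add lookup_single when_def)
  have "(\<Sum>i<k. Poly_Mapping.lookup ?r i) = (if a < k then 1 else 0) - (if b < k then 1 else 0)" for k
    by (simp add: l sum_subtractf)
  then show "?r \<in> rcone n" using assms Poly_Mapping.keys_add[of "Poly_Mapping.single a 1" "Poly_Mapping.single b (- 1 :: int)"]
    by (auto simp: rcone_def split: if_splits)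
  show "?r \<noteq> 0" using l[of a] assms by (metis lookup_zero diff_zero less_irrefl zero_neq_one)
qed

lemma coned_rt: "a < b \<Longrightarrow> b < n \<Longrightarrow> coned n 0 (rt a b)"
  using coned_single[OF rcone_root(1), of a b n 1] rcone_root(2)[of a b n]
  by (simp add: rt_def yv_def mult_single)

lemma coned_lvand: "coned n 1 (lvand n)"
proof -
  have "coned n (\<Prod>p\<in>prs n. 1) (lvand n)" unfolding lvand_def
    by (intro coned_prod) (use coned_diff[OF coned_1 coned_rt] in \<open>auto simp: prs_def\<close>)
  then show ?thesis by simp
qed

section \<open>Triangularity of the operator\<close>

lemma span_image_finite:
  assumes "x \<in> sf.span (f ` A)" "finite A"
  shows "\<exists>a. x = (\<Sum>m\<in>A. sf_scale (a m) (f m))"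
  using assms(1)
proof (induction rule: sf.span_induct_alt)
  case base
  show ?case by (intro exI[of _ "\<lambda>_. 0"]) simp
next
  case (step c x y)
  then obtain m a where m: "x = f m" "m \<in> A" "y = (\<Sum>m\<in>A. sf_scale (a m) (f m))" by auto
  have "(\<Sum>k\<in>A. sf_scale (a k + (if k = m then c else 0)) (f k)) = y + (\<Sum>k\<in>A. if k = m then sf_scale c (f m) else 0)"
    unfolding m(3) sum.distrib[symmetric] by (intro sum.cong) (auto simp: sf.scale_left_distrib)
  also have "\<dots> = sf_scale c x + y" using assms(2) m by (simp add: add.commute)
  finally show ?case by (intro exI[of _ "\<lambda>k. a k + (if k = m then c else 0)"]) simp
qed

lemma span_subset_span: "(\<And>x. x \<in> S \<Longrightarrow> x \<in> sf.span T) \<Longrightarrow> y \<in> sf.span S \<Longrightarrow> y \<in> sf.span T"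
  using sf.span_minimal[of S "sf.span T"] sf.subspace_span by blast

subsection \<open>Degrees\<close>

definition sf_deg :: "nat \<Rightarrow> 'a::comm_ring_1 symfun \<Rightarrow> bool" where
  "sf_deg d f \<longleftrightarrow> (\<forall>a. sf_coeff f a \<noteq> 0 \<longrightarrow> size a = d)"

lemma sf_deg_mult:
  assumes "sf_deg d f" "sf_deg e g" shows "sf_deg (d + e) (f * g)"
  unfolding sf_deg_def
proof (intro allI impI)
  fix a assume "sf_coeff (f * g) a \<noteq> 0"
  then obtain x where "x \<in> {(b, c). b + c = a}" "(case x of (b, c) \<Rightarrow> sf_coeff f b * sf_coeff g c) \<noteq> 0"
    unfolding sf_coeff_times by (rule sum.not_neutral_contains_not_neutral)
  then obtain b c where "b + c = a" "sf_coeff f b * sf_coeff g c \<noteq> 0" by auto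
  moreover from this(2) have "sf_coeff f b \<noteq> 0" "sf_coeff g c \<noteq> 0" by (metis mult_zero_left, metis mult_zero_right)
  ultimately show "size a = d + e" using assms by (auto simp: sf_deg_def)
qed

lemma sf_deg_1: "sf_deg 0 1" by (simp add: sf_deg_def sf_coeff_one)
lemma sf_deg_0: "sf_deg d 0" by (simp add: sf_deg_def sf_coeff_zero)
lemma sf_deg_add: "sf_deg d f \<Longrightarrow> sf_deg d g \<Longrightarrow> sf_deg d (f + g)"
  unfolding sf_deg_def sf_coeff_add by (metis add.right_neutral)
lemma sf_deg_scale: "sf_deg d f \<Longrightarrow> sf_deg d (sf_scale c f)"
  unfolding sf_deg_def sf_coeff_scale by (metis mult_zero_right)
lemma sf_deg_sum: "(\<And>x. x \<in> A \<Longrightarrow> sf_deg d (f x)) \<Longrightarrow> sf_deg d (sum f A)"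
  by (induction A rule: infinite_finite_induct) (auto intro: sf_deg_0 sf_deg_add)
lemma sf_deg_power_sum: "sf_deg k (power_sum k)"
  unfolding sf_deg_def power_sum.rep_eq by auto

lemma sf_deg_newton: "sf_deg n (newton v n)"
proof (induction n rule: less_induct)
  case (less n)
  show ?case
  proof (cases "n = 0")
    case False
    have "sf_deg n (power_sum k * newton v (n - k))" if "k \<in> {1..n}" for k
      using sf_deg_mult[OF sf_deg_power_sum[of k] less[of "n - k"]] that by auto
    then show ?thesis using False by (subst newton.simps) (auto intro!: sf_deg_scale sf_deg_sum)
  qed (simp add: sf_deg_1)
qed

lemma sf_deg_span:
  assumes S: "\<And>x. x \<in> S \<Longrightarrow> sf_deg d x" and y: "y \<in> sf.span S"
  shows "sf_deg d y"
  using y by (induction rule: sf.span_induct_alt) (auto intro: sf_deg_0 sf_deg_add sf_deg_scale S)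

subsection \<open>Coefficients as scalar products\<close>

definition vm :: "nat \<Rightarrow> (nat \<Rightarrow>\<^sub>0 int) \<Rightarrow> nat multiset" where
  "vm n \<beta> = (\<Sum>i<n. replicate_mset (nat (Poly_Mapping.lookup \<beta> i)) i)"

lemma count_vm: "count (vm n \<beta>) i = (if i < n then nat (Poly_Mapping.lookup \<beta> i) else 0)"
  by (simp add: vm_def count_sum)

text \<open>
  The monomial with exponents \<open>\<kappa>\<close> in the first variables.
\<close>

definition pmon :: "nat list \<Rightarrow> nat multiset" where
  "pmon \<kappa> = vm (length \<kappa>) (pvec \<kappa>)"

lemma exponents_mon:
  assumes "is_partition \<kappa>"
  shows "exponents (pmon \<kappa>) = mset \<kappa>"
proof -
  have c: "count (pmon \<kappa>) i = (if i < length \<kappa> then \<kappa> ! i else 0)" for i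
    by (simp add: pmon_def count_vm lookup_pvec)
  have "i < length \<kappa> \<Longrightarrow> \<kappa> ! i > 0" for i using assms by (simp add: is_partition_def)
  then have s: "set_mset (pmon \<kappa>) = {..<length \<kappa>}"
    using c by (auto simp flip: count_greater_zero_iff split: if_splits)
  have "exponents (pmon \<kappa>) = image_mset (\<lambda>i. \<kappa> ! i) (mset_set {..<length \<kappa>})"
    unfolding exponents_def s by (intro image_mset_cong) (auto simp: c)
  also have "\<dots> = mset (map (\<lambda>i. \<kappa> ! i) [0..<length \<kappa>])"
    by (simp flip: mset_set_upto_eq_mset_upto add: lessThan_atLeast0)
  finally show ?thesis by (simp add: map_nth)
qed

lemma sf_coeff_eq_mon: "exponents a = mset \<kappa> \<Longrightarrow> is_partition \<kappa> \<Longrightarrow> sf_coeff f a = sf_coeff f (pmon \<kappa>)"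
  by (rule sf_coeff_cong_exponents) (simp add: exponents_mon)

lemma size_mon: "is_partition \<kappa> \<Longrightarrow> size (pmon \<kappa>) = sum_list \<kappa>"
  by (metis exponents_mon sum_mset_exponents sum_mset_sum_list)

context macdonald_params
begin

definition gl :: "nat list \<Rightarrow> 'a symfun" where
  "gl \<kappa> = prod_mset (image_mset (newton w) (mset \<kappa>))"

text \<open>
  Zero entries contribute the factor \<open>gi 0 = 1\<close>, and the order of the factors is irrelevant.
\<close>

lemma gm_nonneg:
  assumes nn: "\<And>i. i < n \<Longrightarrow> Poly_Mapping.lookup \<beta> i \<ge> 0"
  shows "gm n \<beta> = gl (pof n \<beta>)"
proof -
  let ?f = "\<lambda>i. nat (Poly_Mapping.lookup \<beta> i)"
  have "gl (pof n \<beta>) = prod_mset (image_mset (newton w) (filter_mset (\<lambda>x. x > 0) (mset (map ?f [0..<n]))))"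
    by (simp add: gl_def pof_def)
  also have "\<dots> = prod_mset (image_mset (newton w) (mset (map ?f [0..<n])))"
  proof -
    have "prod_mset (image_mset (newton w) (filter_mset (\<lambda>x. x > 0) M)) = prod_mset (image_mset (newton w) M)" for M
      by (induction M) auto
    then show ?thesis by blast
  qed
  also have "\<dots> = (\<Prod>i<n. newton w (?f i))" by (induction n) (auto simp: mult.commute)
  also have "\<dots> = gm n \<beta>" unfolding gm_def by (intro prod.cong) (simp_all add: gi_def leD[OF nn])
  finally show ?thesis by simp
qed

lemma gm_pvec: "length \<kappa> \<le> n \<Longrightarrow> gm n (pvec \<kappa>) = gl \<kappa>"
proof -
  assume l: "length \<kappa> \<le> n"
  have "gm n (pvec \<kappa>) = (\<Prod>i<length \<kappa>. newton w (\<kappa> ! i))"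
    unfolding gm_def using l by (intro prod.mono_neutral_cong_right) (auto simp: lookup_pvec gi_nat)
  also have "\<dots> = prod_list (map (newton w) \<kappa>)"
    by (simp add: prod.list_conv_set_nth lessThan_atLeast0)
  also have "\<dots> = gl \<kappa>" unfolding gl_def by (induction \<kappa>) auto
  finally show ?thesis .
qed

lemma sf_deg_gl: "sf_deg (sum_list \<kappa>) (gl \<kappa>)"
  unfolding gl_def by (induction \<kappa>) (auto intro: sf_deg_1 sf_deg_mult sf_deg_newton)

lemma B_1_power_sum: "k > 0 \<Longrightarrow> B 1 (power_sum k * f) = 0"
  using B_power_sum_mult[of k f 1] B_sym[of 1] by (simp add: dps_one[OF c0] B_zero_right)

lemma B_1_gi: "a > 0 \<Longrightarrow> B 1 (gi a * f) = 0"
proof -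
  assume "a > 0"
  then obtain n where n: "a = int n" "n > 0" using zero_less_imp_eq_int by blast
  have "B 1 (newton w n * f) = 0"
    using n by (subst newton.simps) (simp add: sf_scale_mult sum_distrib_right B_simps mult.assoc B_1_power_sum)
  then show ?thesis using n by (simp add: gi_nat)
qed

lemma B_1_1: "B 1 1 = 1"
  using B_psum[of "{#}" "{#}"] by (simp add: zeta_def zm_def)

text \<open>
  The products of one-row functions are dual to the monomial functions. On \<open>f = psum M\<close> the pairing is reduced by
  \<open>B_power_sum_mult\<close>: the derivative of the product is the sum over all ways to lower one index, and the
  coefficient of a product with a power sum satisfies the same recursion.
\<close>

theorem B_gm:
  assumes nn: "\<And>i. i < n \<Longrightarrow> Poly_Mapping.lookup \<beta> i \<ge> 0"
  shows "B f (gm n \<beta>) = sf_coeff f (vm n \<beta>)"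
  using c0 nn
proof (induction f arbitrary: \<beta> rule: psum_induct)
  case (psum M)
  then show ?case
  proof (induction M arbitrary: \<beta>)
    case empty
    show ?case
    proof (cases "\<exists>i<n. Poly_Mapping.lookup \<beta> i > 0")
      case True
      then obtain i where i: "i < n" "Poly_Mapping.lookup \<beta> i > 0" by blast
      then have "count (vm n \<beta>) i \<noteq> 0" by (simp add: count_vm)
      then have "vm n \<beta> \<noteq> {#}" by auto
      then show ?thesis using i by (simp add: gm_remove[of i] B_1_gi sf_coeff_one)
    next
      case False
      then have z: "Poly_Mapping.lookup \<beta> i = 0" if "i < n" for i using empty(2)[OF that] that by force
      then have "vm n \<beta> = {#}" "gm n \<beta> = 1" by (auto simp: vm_def gm_def)
      then show ?thesis by (simp add: B_1_1 sf_coeff_one)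
    qed
  next
    case (add k M)
    then have k: "k > 0" and M: "0 \<notin># M" by auto
    have "B (psum (add_mset k M)) (gm n \<beta>) = (\<Sum>i<n. B (psum M) (gm n (Poly_Mapping.single i (- int k) + \<beta>)))"
      using w_nz[OF k] of_nat_nz[OF k] by (simp add: psum_add_mset B_power_sum_mult[OF k] dps_gm[OF k] B_simps)
    also have "\<dots> = (\<Sum>i\<in>{i. k \<le> count (vm n \<beta>) i}. sf_coeff (psum M) (vm n \<beta> - replicate_mset k i))"
    proof (rule sum.mono_neutral_cong_right)
      show "{i. k \<le> count (vm n \<beta>) i} \<subseteq> {..<n}" using k by (auto simp: count_vm split: if_splits)
      show "\<forall>i\<in>{..<n} - {i. k \<le> count (vm n \<beta>) i}. B (psum M) (gm n (Poly_Mapping.single i (- int k) + \<beta>)) = 0"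
      proof
        fix i assume "i \<in> {..<n} - {i. k \<le> count (vm n \<beta>) i}"
        then have "i < n" "- int k + Poly_Mapping.lookup \<beta> i < 0" by (auto simp: count_vm)
        then show "B (psum M) (gm n (Poly_Mapping.single i (- int k) + \<beta>)) = 0"
          by (simp only: gm_shift_remove gi_neg mult_zero_left B_zero_right)
      qed
      fix i assume i: "i \<in> {i. k \<le> count (vm n \<beta>) i}"
      then have i': "i < n" "int k \<le> Poly_Mapping.lookup \<beta> i" using k by (auto simp: count_vm le_nat_iff split: if_splits)
      have "vm n (Poly_Mapping.single i (- int k) + \<beta>) = vm n \<beta> - replicate_mset k i"
        by (rule multiset_eqI) (use i' in \<open>auto simp: count_vm lookup_single_plus nat_diff_distrib\<close>)
      moreover have "B (psum M) (gm n (Poly_Mapping.single i (- int k) + \<beta>)) = sf_coeff (psum M) (vm n (Poly_Mapping.single i (- int k) + \<beta>))"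
        using add.prems(2) i' M by (intro add.IH) (auto simp: lookup_single_plus)
      ultimately show "B (psum M) (gm n (Poly_Mapping.single i (- int k) + \<beta>)) = sf_coeff (psum M) (vm n \<beta> - replicate_mset k i)"
        by simp
    qed simp
    also have "\<dots> = sf_coeff (psum (add_mset k M)) (vm n \<beta>)"
      by (simp add: psum_add_mset sf_coeff_power_sum_times[OF k])
    finally show ?case .
  qed
next
  case (add f g)
  then show ?case by (simp add: B_simps sf_coeff_add)
next
  case (scale c f)
  then show ?case by (simp add: B_simps sf_coeff_scale)
qed

lemma B_gl: "B f (gl \<kappa>) = sf_coeff f (pmon \<kappa>)"
  using B_gm[of "length \<kappa>" "pvec \<kappa>" f] gm_pvec[of \<kappa> "length \<kappa>"] by (simp add: pmon_def lookup_pvec)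

text \<open>
  By duality the pairings with the products are all coefficients of \<open>f\<close>.
\<close>

lemma eq_0_if_orthogonal_gl:
  assumes "\<And>\<kappa>. is_partition \<kappa> \<Longrightarrow> B f (gl \<kappa>) = 0"
  shows "f = 0"
proof (rule sf_eqI)
  fix a
  have p: "is_partition (part_of (exponents a))" by (rule is_partition_part_of[OF zero_notin_exponents])
  have "sf_coeff f a = sf_coeff f (pmon (part_of (exponents a)))" by (rule sf_coeff_eq_mon[OF _ p]) simp
  also have "\<dots> = 0" using assms[OF p] by (simp add: B_gl)
  finally show "sf_coeff f a = sf_coeff 0 a" by (simp add: sf_coeff_zero)
qed

lemma B_deg: "sf_deg d f \<Longrightarrow> sum_list \<kappa> \<noteq> d \<Longrightarrow> is_partition \<kappa> \<Longrightarrow> B f (gl \<kappa>) = 0"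
proof -
  assume *: "sf_deg d f" "sum_list \<kappa> \<noteq> d" "is_partition \<kappa>"
  have "sf_coeff f (pmon \<kappa>) \<noteq> 0 \<longrightarrow> size (pmon \<kappa>) = d" using *(1) unfolding sf_deg_def ..
  then show ?thesis using *(2) size_mon[OF *(3)] by (auto simp: B_gl)
qed

lemma B_monomial_gl: "is_partition \<kappa> \<Longrightarrow> is_partition \<mu> \<Longrightarrow> B (monomial_sf \<mu>) (gl \<kappa>) = (if \<kappa> = \<mu> then 1 else 0)"
  by (simp add: B_gl sf_coeff_monomial exponents_mon partition_eq_iff)

subsection \<open>Triangularity\<close>

definition ev :: "nat list \<Rightarrow> 'a" where
  "ev \<kappa> = (\<Sum>i<length \<kappa>. u ^ i * (q ^ (\<kappa> ! i) - 1))"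

abbreviation upspan :: "nat list \<Rightarrow> 'a symfun set" where
  "upspan \<kappa> \<equiv> sf.span (gl ` ups \<kappa>)"

lemma upspan_trans: "is_partition \<kappa> \<Longrightarrow> \<mu> \<in> ups \<kappa> \<Longrightarrow> upspan \<mu> \<subseteq> upspan \<kappa>"
  by (intro sf.span_mono image_mono) (use ups_trans in blast)

text \<open>
  Every monomial of \<open>P\<close> other than the constant moves \<open>\<kappa>\<close> up in dominance order.
\<close>

lemma G_coned:
  assumes k: "is_partition \<kappa>" "length \<kappa> \<le> n" and P: "coned n c P"
  shows "G n (P * Poly_Mapping.single (pvec \<kappa>) 1) - sf_scale c (gl \<kappa>) \<in> upspan \<kappa>"
proof -
  let ?K = "Poly_Mapping.keys P - {0}"
  let ?t = "\<lambda>\<beta>. sf_scale (Poly_Mapping.lookup P \<beta>) (gm n (pvec \<kappa> + \<beta>))"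
  have "G n (P * Poly_Mapping.single (pvec \<kappa>) 1) = (\<Sum>\<beta>\<in>Poly_Mapping.keys P. ?t \<beta>)"
    unfolding G_def mult.commute[of P] lext_shift by (simp add: lext_eq_sum)
  also have "\<dots> = (\<Sum>\<beta>\<in>insert 0 ?K. ?t \<beta>)"
    by (rule sum.mono_neutral_left) (auto simp: in_keys_iff)
  also have "\<dots> = ?t 0 + (\<Sum>\<beta>\<in>?K. ?t \<beta>)"
    by (rule sum.insert) auto
  also have "?t 0 = sf_scale c (gl \<kappa>)"
    using P k by (simp add: coned_def gm_pvec)
  finally have e: "G n (P * Poly_Mapping.single (pvec \<kappa>) 1) - sf_scale c (gl \<kappa>) = (\<Sum>\<beta>\<in>?K. ?t \<beta>)" by simp
  have "gm n (pvec \<kappa> + \<beta>) \<in> upspan \<kappa>" if b: "\<beta> \<in> ?K" for \<beta>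
  proof (cases "\<forall>i<n. Poly_Mapping.lookup (pvec \<kappa> + \<beta>) i \<ge> 0")
    case True
    then have "pof n (pvec \<kappa> + \<beta>) \<in> ups \<kappa>" using pof_in_ups[OF k, of \<beta>] b P by (auto simp: coned_def)
    then show ?thesis using gm_nonneg[of n "pvec \<kappa> + \<beta>"] True by (auto intro: sf.span_base)
  next
    case False
    then obtain i where "i < n" "Poly_Mapping.lookup (pvec \<kappa> + \<beta>) i < 0" by force
    then have "gm n (pvec \<kappa> + \<beta>) = 0" by (simp add: gm_remove[of i] gi_neg)
    then show ?thesis by (simp add: sf.span_zero)
  qed
  then show ?thesis unfolding e by (intro sf.span_sum sf.span_scale)
qed

lemma tw_yv: "tw i (yv j e) = (if j = i then lcst (q powi e) else 1) * yv j e"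
  by (simp add: yv_def tw_single lookup_single when_def lcst_def mult_single)

lemmas tw_mult = laurent_hom.lev_mult[OF laurent_hom_tw, folded tw_def]
lemmas tw_diff = laurent_hom.lev_diff[OF laurent_hom_tw, folded tw_def]
lemmas tw_prod = laurent_hom.lev_prod[OF laurent_hom_tw, folded tw_def]
lemmas tw_lcst = laurent_hom.lev_lcst[OF laurent_hom_tw, folded tw_def]

lemma coned_tw_lvandA:
  assumes i: "i < n"
  shows "coned n (u ^ i) (tw i (lvandA u n i))"
proof -
  have t1: "tw i (rt a b) = rt a b" if "a \<noteq> i" "b \<noteq> i" for a b
    using that by (simp add: rt_def tw_mult tw_yv)
  have t2: "tw i (rt i j) = lcst q * rt i j" "tw i (rt j i) = lcst (inverse q) * rt j i" if "j \<noteq> i" for j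
    using that by (simp_all add: rt_def tw_mult tw_yv power_int_minus mult_ac)
  have "coned n ((\<Prod>(a, b)\<in>{p \<in> prs n. fst p \<noteq> i \<and> snd p \<noteq> i}. 1) * (\<Prod>j\<in>{..<n} - {i}. if i < j then 1 else u))
    (tw i (lvandA u n i))"
    unfolding lvandA_def tw_mult tw_prod
  proof (intro coned_mult coned_prod)
    fix p assume "p \<in> {p \<in> prs n. fst p \<noteq> i \<and> snd p \<noteq> i}"
    then show "coned n (case p of (a, b) \<Rightarrow> 1) (tw i (case p of (a, b) \<Rightarrow> 1 - rt a b))"
      using coned_diff[OF coned_1 coned_rt] by (auto simp: prs_def tw_diff tw_1 t1)
  next
    fix j assume j: "j \<in> {..<n} - {i}"
    show "coned n (if i < j then 1 else u) (tw i (lcf u i j))"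
    proof (cases "i < j")
      case True
      have "coned n (1 - u * (q * 0)) (1 - lcst u * (lcst q * rt i j))"
        using True j by (intro coned_diff coned_1 coned_mult coned_lcst coned_rt) auto
      then show ?thesis using True j by (simp add: lcf_def tw_diff tw_mult tw_lcst tw_1 t2)
    next
      case False
      have "coned n (u - inverse q * 0) (lcst u - lcst (inverse q) * rt j i)"
        using False j i by (intro coned_diff coned_mult coned_lcst coned_rt) auto
      then show ?thesis using False j by (simp add: lcf_def tw_diff tw_mult tw_lcst tw_1 t2)
    qed
  qed
  moreover have "(\<Prod>j\<in>{..<n} - {i}. if i < j then 1 else u) = (\<Prod>j<i. u)"
    using i by (intro prod.mono_neutral_cong_right) auto
  ultimately show ?thesis by (simp add: case_prod_unfold)
qed

text \<open>
  Apply \<open>Dop_G\<close> to \<open>P = y\<^sup>\<kappa>\<close>: all Laurent polynomials that occur are supported in the cone of positive roots, so the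
  operator is triangular, and the constant terms give the eigenvalue.
\<close>

lemma Dop_gl:
  assumes "is_partition \<kappa>"
  shows "Dop (sum_list \<kappa>) (gl \<kappa>) - sf_scale ((1 - u) * ev \<kappa>) (gl \<kappa>) \<in> upspan \<kappa>"
  using assms
proof (induction rule: partition_induct_up)
  case (step \<kappa>)
  let ?N = "sum_list \<kappa>" and ?n = "length \<kappa>" and ?P = "Poly_Mapping.single (pvec \<kappa>) 1 :: 'a laurent"
  define x1 where "x1 = G ?n (lvand ?n * ?P) - gl \<kappa>"
  define x2 where "x2 i = G ?n (tw i (lvandA u ?n i) * ?P) - sf_scale (u ^ i) (gl \<kappa>)" for i
  have x1: "x1 \<in> upspan \<kappa>"
    using G_coned[OF step(1) order_refl coned_lvand] by (simp add: x1_def)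
  have x2: "x2 i \<in> upspan \<kappa>" if "i < ?n" for i
    using G_coned[OF step(1) order_refl coned_tw_lvandA[OF that]] by (simp add: x2_def)
  have DX: "Dop ?N y \<in> upspan \<kappa>" if "y \<in> upspan \<kappa>" for y
    using that
  proof (induction rule: sf.span_induct_alt)
    case base show ?case by (simp add: Dop_zero sf.span_zero)
  next
    case (step c x y)
    then obtain \<mu> where m: "\<mu> \<in> ups \<kappa>" "x = gl \<mu>" by auto
    have "Dop ?N (gl \<mu>) - sf_scale ((1 - u) * ev \<mu>) (gl \<mu>) \<in> upspan \<kappa>"
      using \<open>\<And>\<mu>. \<mu> \<in> ups \<kappa> \<Longrightarrow> _\<close>[OF m(1)] upspan_trans[OF \<open>is_partition \<kappa>\<close> m(1)] ups_sum[OF m(1)] by auto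
    moreover have "sf_scale ((1 - u) * ev \<mu>) (gl \<mu>) \<in> upspan \<kappa>"
      using m by (intro sf.span_scale sf.span_base imageI)
    ultimately have "Dop ?N (gl \<mu>) \<in> upspan \<kappa>" using sf.span_add by fastforce
    then show ?case using step m by (simp add: Dop_add Dop_scale sf.span_add sf.span_scale)
  qed
  have hP: "homog ?n (int ?N) ?P"
    by (rule homog_single) (simp add: sum_pvec)
  have twP: "tw i ?P = lcst (q ^ (\<kappa> ! i)) * ?P" if "i < ?n" for i
    using that by (simp add: tw_single lookup_pvec lcst_def mult_single)
  have G2: "G ?n (tw i (lvandA u ?n i * ?P)) = sf_scale (q ^ (\<kappa> ! i)) (sf_scale (u ^ i) (gl \<kappa>) + x2 i)" if "i < ?n" for i
    unfolding tw_mult twP[OF that] mult.left_commute[of _ "lcst _"] G_lcst by (simp add: x2_def)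
  have gp: "(1 - u ^ ?n) / (1 - u) = (\<Sum>i<?n. u ^ i)"
    using u_neq_1 by (simp add: one_diff_power_eq)
  have "(\<Sum>i<?n. sf_scale (q ^ (\<kappa> ! i)) (sf_scale (u ^ i) (gl \<kappa>) + x2 i)) =
     sf_scale (\<Sum>i<?n. u ^ i) (gl \<kappa> + x1) + sf_scale (1 / (1 - u)) (Dop ?N (gl \<kappa> + x1))"
    using Dop_G[OF hP] by (simp add: G2 gp x1_def)
  then have "sf_scale (1 / (1 - u)) (Dop ?N (gl \<kappa>)) = (\<Sum>i<?n. sf_scale (q ^ (\<kappa> ! i)) (sf_scale (u ^ i) (gl \<kappa>) + x2 i)) -
     sf_scale (\<Sum>i<?n. u ^ i) (gl \<kappa> + x1) - sf_scale (1 / (1 - u)) (Dop ?N x1)"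
    by (simp add: Dop_add sf.scale_right_distrib algebra_simps)
  also have "\<dots> = sf_scale (ev \<kappa>) (gl \<kappa>) + ((\<Sum>i<?n. sf_scale (q ^ (\<kappa> ! i)) (x2 i)) - sf_scale (\<Sum>i<?n. u ^ i) x1 - sf_scale (1 / (1 - u)) (Dop ?N x1))"
    by (simp add: ev_def sf.scale_right_distrib sum.distrib sf.scale_sum_left sum_subtractf algebra_simps)
  finally have "sf_scale (1 - u) (sf_scale (1 / (1 - u)) (Dop ?N (gl \<kappa>))) = sf_scale (1 - u) (sf_scale (ev \<kappa>) (gl \<kappa>)) +
     sf_scale (1 - u) ((\<Sum>i<?n. sf_scale (q ^ (\<kappa> ! i)) (x2 i)) - sf_scale (\<Sum>i<?n. u ^ i) x1 - sf_scale (1 / (1 - u)) (Dop ?N x1))"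
    by (simp add: sf.scale_right_distrib)
  then have "Dop ?N (gl \<kappa>) - sf_scale ((1 - u) * ev \<kappa>) (gl \<kappa>) =
     sf_scale (1 - u) ((\<Sum>i<?n. sf_scale (q ^ (\<kappa> ! i)) (x2 i)) - sf_scale (\<Sum>i<?n. u ^ i) x1 - sf_scale (1 / (1 - u)) (Dop ?N x1))"
    using u_neq_1 by simp
  also have "\<dots> \<in> upspan \<kappa>"
    by (intro sf.span_scale sf.span_diff sf.span_sum x1 DX x2) auto
  finally show ?case .
qed

end

section \<open>Macdonald functions as eigenvectors\<close>

text \<open>
  The additional assumption says that the eigenvalues of the operator separate the partitions of each number. It
  holds both for independent \<open>q, t\<close> and for \<open>t = q\<^sup>m\<close>.
\<close>

locale macdonald_distinct = macdonald_params +
  assumes ev_distinct: "is_partition \<kappa> \<Longrightarrow> is_partition \<mu> \<Longrightarrow> sum_list \<kappa> = sum_list \<mu> \<Longrightarrow>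
     (\<Sum>i<length \<kappa>. inverse t ^ i * (q ^ (\<kappa> ! i) - 1)) = (\<Sum>i<length \<mu>. inverse t ^ i * (q ^ (\<mu> ! i) - 1)) \<Longrightarrow> \<kappa> = \<mu>"
begin

lemma ev_inj: "is_partition \<kappa> \<Longrightarrow> is_partition \<mu> \<Longrightarrow> sum_list \<kappa> = sum_list \<mu> \<Longrightarrow> ev \<kappa> = ev \<mu> \<Longrightarrow> \<kappa> = \<mu>"
  unfolding ev_def by (rule ev_distinct)

lemma ev_ups: "is_partition \<kappa> \<Longrightarrow> \<mu> \<in> ups \<kappa> \<Longrightarrow> ev \<kappa> \<noteq> ev \<mu>"
  using ev_inj[of \<kappa> \<mu>] ups_sum ups_partition ups_irrefl by metis

definition is_eigen :: "nat list \<Rightarrow> 'a symfun \<Rightarrow> bool" where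
  "is_eigen \<kappa> f \<longleftrightarrow> f - gl \<kappa> \<in> upspan \<kappa> \<and> Dop (sum_list \<kappa>) f = sf_scale ((1 - u) * ev \<kappa>) f"

lemma span_unitriangular:
  assumes k: "is_partition \<kappa>" and Q: "\<And>\<mu>. \<mu> \<in> ups \<kappa> \<Longrightarrow> Q \<mu> - gl \<mu> \<in> upspan \<mu>"
    and m: "\<mu> \<in> ups \<kappa>"
  shows "gl \<mu> \<in> sf.span (Q ` ups \<kappa>)"
  using ups_partition[OF m] m
proof (induction rule: partition_induct_up)
  case (step \<mu>)
  have "Q \<mu> - gl \<mu> \<in> sf.span (Q ` ups \<kappa>)"
  proof (rule span_subset_span[OF _ Q[OF step.prems]])
    fix x assume "x \<in> gl ` ups \<mu>"
    then show "x \<in> sf.span (Q ` ups \<kappa>)" using step.IH ups_trans[OF k step.prems] by auto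
  qed
  moreover have "Q \<mu> \<in> sf.span (Q ` ups \<kappa>)" using step.prems by (intro sf.span_base imageI)
  ultimately have "Q \<mu> - (Q \<mu> - gl \<mu>) \<in> sf.span (Q ` ups \<kappa>)" by (rule sf.span_diff[rotated])
  then show ?case by simp
qed

text \<open>
  The operator is triangular with distinct diagonal entries, so \<open>gl \<kappa>\<close> can be corrected by the eigenvectors of the
  larger partitions.
\<close>

lemma ex_eigen: "is_partition \<kappa> \<Longrightarrow> \<exists>f. is_eigen \<kappa> f"
proof (induction rule: partition_induct_up)
  case (step \<kappa>)
  then obtain Q where Q: "\<And>\<mu>. \<mu> \<in> ups \<kappa> \<Longrightarrow> is_eigen \<mu> (Q \<mu>)" by metis
  let ?N = "sum_list \<kappa>" and ?E = "\<lambda>\<mu>. (1 - u) * ev \<mu>"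
  have "Dop ?N (gl \<kappa>) - sf_scale (?E \<kappa>) (gl \<kappa>) \<in> sf.span (Q ` ups \<kappa>)"
  proof (rule span_subset_span[OF _ Dop_gl[OF step(1)]])
    fix x assume "x \<in> gl ` ups \<kappa>"
    then show "x \<in> sf.span (Q ` ups \<kappa>)"
      using span_unitriangular[OF step(1), of Q] Q by (auto simp: is_eigen_def)
  qed
  then obtain a where a: "Dop ?N (gl \<kappa>) - sf_scale (?E \<kappa>) (gl \<kappa>) = (\<Sum>\<mu>\<in>ups \<kappa>. sf_scale (a \<mu>) (Q \<mu>))"
    using span_image_finite[OF _ finite_ups] by blast
  define b where "b \<mu> = a \<mu> / (?E \<kappa> - ?E \<mu>)" for \<mu>
  have ab: "a \<mu> = b \<mu> * (?E \<kappa> - ?E \<mu>)" if "\<mu> \<in> ups \<kappa>" for \<mu>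
  proof -
    have "?E \<kappa> - ?E \<mu> = (1 - u) * (ev \<kappa> - ev \<mu>)" by (simp add: algebra_simps)
    then have "?E \<kappa> - ?E \<mu> \<noteq> 0" using ev_ups[OF step(1) that] u_neq_1 by simp
    then show ?thesis by (simp add: b_def)
  qed
  define f where "f = gl \<kappa> + (\<Sum>\<mu>\<in>ups \<kappa>. sf_scale (b \<mu>) (Q \<mu>))"
  have DQ: "Dop ?N (Q \<mu>) = sf_scale (?E \<mu>) (Q \<mu>)" if "\<mu> \<in> ups \<kappa>" for \<mu>
    using Q[OF that] ups_sum[OF that] by (simp add: is_eigen_def)
  have "Dop ?N f = Dop ?N (gl \<kappa>) + (\<Sum>\<mu>\<in>ups \<kappa>. sf_scale (b \<mu> * ?E \<mu>) (Q \<mu>))"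
    by (simp add: f_def Dop_add Dop_sum Dop_scale DQ)
  also have "Dop ?N (gl \<kappa>) = sf_scale (?E \<kappa>) (gl \<kappa>) + (\<Sum>\<mu>\<in>ups \<kappa>. sf_scale (b \<mu> * (?E \<kappa> - ?E \<mu>)) (Q \<mu>))"
    using a ab by (simp add: algebra_simps)
  also have "\<dots> + (\<Sum>\<mu>\<in>ups \<kappa>. sf_scale (b \<mu> * ?E \<mu>) (Q \<mu>)) =
     sf_scale (?E \<kappa>) (gl \<kappa>) + (\<Sum>\<mu>\<in>ups \<kappa>. sf_scale (b \<mu> * (?E \<kappa> - ?E \<mu>) + b \<mu> * ?E \<mu>) (Q \<mu>))"
    by (simp only: sf.scale_left_distrib sum.distrib add.assoc)
  also have "\<dots> = sf_scale (?E \<kappa>) f"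
    by (simp add: f_def sf.scale_right_distrib sf.scale_sum_right algebra_simps)
  finally have D: "Dop ?N f = sf_scale (?E \<kappa>) f" .
  have "Q \<mu> \<in> upspan \<kappa>" if "\<mu> \<in> ups \<kappa>" for \<mu>
  proof -
    have "Q \<mu> - gl \<mu> \<in> upspan \<kappa>" using Q[OF that] upspan_trans[OF step(1) that] by (auto simp: is_eigen_def)
    moreover have "gl \<mu> \<in> upspan \<kappa>" using that by (intro sf.span_base imageI)
    ultimately show ?thesis using sf.span_add by fastforce
  qed
  then have "f - gl \<kappa> \<in> upspan \<kappa>" by (auto simp: f_def intro!: sf.span_sum sf.span_scale)
  then show ?case using D by (auto simp: is_eigen_def)
qed

definition mQ :: "nat list \<Rightarrow> 'a symfun" where
  "mQ \<kappa> = (SOME f. is_eigen \<kappa> f)"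

lemma mQ_eigen: "is_partition \<kappa> \<Longrightarrow> is_eigen \<kappa> (mQ \<kappa>)"
  unfolding mQ_def by (rule someI_ex) (rule ex_eigen)

lemma mQ_upspan: "is_partition \<kappa> \<Longrightarrow> mQ \<kappa> - gl \<kappa> \<in> upspan \<kappa>"
  using mQ_eigen by (simp add: is_eigen_def)

lemma gl_in_span_mQ: "is_partition \<kappa> \<Longrightarrow> \<mu> \<in> ups \<kappa> \<Longrightarrow> gl \<mu> \<in> sf.span (mQ ` ups \<kappa>)"
  by (rule span_unitriangular) (auto intro: mQ_upspan ups_partition)

lemma upspan_mQ: "is_partition \<kappa> \<Longrightarrow> x \<in> upspan \<kappa> \<Longrightarrow> x \<in> sf.span (mQ ` ups \<kappa>)"
  by (rule span_subset_span[of "gl ` ups \<kappa>"]) (auto intro: gl_in_span_mQ)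

lemma gl_mQ: "is_partition \<kappa> \<Longrightarrow> gl \<kappa> - mQ \<kappa> \<in> sf.span (mQ ` ups \<kappa>)"
  using sf.span_neg[OF upspan_mQ[OF _ mQ_upspan]] by simp

lemma sf_deg_mQ:
  assumes "is_partition \<kappa>" shows "sf_deg (sum_list \<kappa>) (mQ \<kappa>)"
proof -
  have "sf_deg (sum_list \<kappa>) (mQ \<kappa> - gl \<kappa>)"
    by (rule sf_deg_span[OF _ mQ_upspan[OF assms]]) (metis imageE sf_deg_gl ups_sum)
  from sf_deg_add[OF this sf_deg_gl] show ?thesis by simp
qed

lemma B_span_0: "(\<And>y. y \<in> S \<Longrightarrow> B x y = 0) \<Longrightarrow> y \<in> sf.span S \<Longrightarrow> B x y = 0"
proof -
  assume S: "\<And>y. y \<in> S \<Longrightarrow> B x y = 0" and y: "y \<in> sf.span S"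
  from y show "B x y = 0" by (induction rule: sf.span_induct_alt) (auto simp: B_simps S)
qed

text \<open>
  Eigenvectors of a self-adjoint operator for different eigenvalues; for partitions of different numbers the degrees
  differ.
\<close>

lemma mQ_orthogonal:
  assumes k: "is_partition \<kappa>" and m: "is_partition \<mu>" and ne: "\<kappa> \<noteq> \<mu>"
  shows "B (mQ \<kappa>) (mQ \<mu>) = 0"
proof (cases "sum_list \<kappa> = sum_list \<mu>")
  case True
  have "(1 - u) * ev \<kappa> * B (mQ \<kappa>) (mQ \<mu>) = B (Dop (sum_list \<kappa>) (mQ \<kappa>)) (mQ \<mu>)"
    using mQ_eigen[OF k] by (simp add: is_eigen_def B_simps)
  also have "\<dots> = B (mQ \<kappa>) (Dop (sum_list \<mu>) (mQ \<mu>))"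
    unfolding True by (rule Dop_selfadjoint)
  also have "\<dots> = (1 - u) * ev \<mu> * B (mQ \<kappa>) (mQ \<mu>)"
    using mQ_eigen[OF m] by (simp add: is_eigen_def B_simps)
  finally have "(1 - u) * (ev \<kappa> - ev \<mu>) * B (mQ \<kappa>) (mQ \<mu>) = 0" by (simp add: algebra_simps)
  then show ?thesis using u_neq_1 ev_inj[OF k m True] ne by auto
next
  case False
  have d: "B (mQ \<kappa>) (gl \<nu>) = 0" if "is_partition \<nu>" "sum_list \<nu> = sum_list \<mu>" for \<nu>
    using B_deg[OF sf_deg_mQ[OF k]] that False by simp
  have "B (mQ \<kappa>) (mQ \<mu> - gl \<mu>) = 0"
    by (rule B_span_0[OF _ mQ_upspan[OF m]]) (auto intro!: d ups_partition simp: ups_sum)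
  then show ?thesis using d[OF m] by (simp add: B_simps)
qed

lemma B_mQ_gl: "is_partition \<kappa> \<Longrightarrow> is_partition \<nu> \<Longrightarrow> \<kappa> \<noteq> \<nu> \<Longrightarrow> \<kappa> \<notin> ups \<nu> \<Longrightarrow> B (mQ \<kappa>) (gl \<nu>) = 0"
proof -
  assume *: "is_partition \<kappa>" "is_partition \<nu>" "\<kappa> \<noteq> \<nu>" "\<kappa> \<notin> ups \<nu>"
  have "B (mQ \<kappa>) (gl \<nu> - mQ \<nu>) = 0"
    by (rule B_span_0[OF _ gl_mQ]) (use * in \<open>auto intro!: mQ_orthogonal ups_partition\<close>)
  then show ?thesis using mQ_orthogonal[OF *(1-3)] by (simp add: B_simps)
qed

lemma B_mQ_gl_same: "is_partition \<kappa> \<Longrightarrow> B (mQ \<kappa>) (gl \<kappa>) = B (mQ \<kappa>) (mQ \<kappa>)"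
proof -
  assume *: "is_partition \<kappa>"
  have "B (mQ \<kappa>) (gl \<kappa> - mQ \<kappa>) = 0"
    by (rule B_span_0[OF _ gl_mQ]) (use * ups_irrefl in \<open>auto intro!: mQ_orthogonal ups_partition\<close>)
  then show ?thesis by (simp add: B_simps)
qed

text \<open>
  Monomial functions are dual to the products \<open>gl\<close>, so the pairing is the coefficient of \<open>gl \<mu>\<close>.
\<close>

lemma B_monomial_upspan:
  assumes "is_partition \<mu>" "\<mu> \<notin> ups \<kappa>" "x \<in> upspan \<kappa>"
  shows "B (monomial_sf \<mu>) x = 0"
  by (rule B_span_0[OF _ assms(3)]) (use assms in \<open>auto simp: B_monomial_gl ups_partition\<close>)

lemma mQ_nz: "is_partition \<kappa> \<Longrightarrow> mQ \<kappa> \<noteq> 0"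
proof
  assume *: "is_partition \<kappa>" "mQ \<kappa> = 0"
  have "B (monomial_sf \<kappa>) (mQ \<kappa> - gl \<kappa>) = 0"
    by (rule B_monomial_upspan[OF *(1) ups_irrefl mQ_upspan[OF *(1)]])
  then show False using * by (simp add: B_simps B_monomial_gl)
qed

text \<open>
  Otherwise \<open>mQ \<kappa>\<close> would be orthogonal to a spanning family, although it is nonzero.
\<close>

lemma mQ_norm: 
  assumes k: "is_partition \<kappa>" shows "B (mQ \<kappa>) (mQ \<kappa>) \<noteq> 0"
proof
  assume z: "B (mQ \<kappa>) (mQ \<kappa>) = 0"
  then have o: "B (mQ \<kappa>) (mQ \<nu>) = 0" if "is_partition \<nu>" for \<nu>
    using mQ_orthogonal[OF k that] by (cases "\<kappa> = \<nu>") auto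
  have "mQ \<kappa> = 0"
  proof (rule eq_0_if_orthogonal_gl)
    fix \<nu> assume n: "is_partition \<nu>"
    have "B (mQ \<kappa>) (gl \<nu> - mQ \<nu>) = 0"
      by (rule B_span_0[OF _ gl_mQ[OF n]]) (use o in \<open>auto intro!: o ups_partition\<close>)
    then show "B (mQ \<kappa>) (gl \<nu>) = 0" using o[OF n] by (simp add: B_simps)
  qed
  then show False using mQ_nz[OF k] by simp
qed

text \<open>
  The eigenvalues that occur on the span belong to partitions above \<open>\<kappa>\<close> and differ from the one of \<open>x\<close>. So \<open>x\<close> is
  orthogonal to an orthogonal basis of the span, whose vectors have nonzero norm.
\<close>

lemma eigen_unique:
  assumes k: "is_partition \<kappa>" and x: "x \<in> upspan \<kappa>" and D: "Dop (sum_list \<kappa>) x = sf_scale ((1 - u) * ev \<kappa>) x"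
  shows "x = 0"
proof -
  have o: "B x (mQ \<nu>) = 0" if n: "\<nu> \<in> ups \<kappa>" for \<nu>
  proof -
    have "(1 - u) * ev \<kappa> * B x (mQ \<nu>) = B x (Dop (sum_list \<nu>) (mQ \<nu>))"
      using D Dop_selfadjoint[of "sum_list \<kappa>" x "mQ \<nu>"] ups_sum[OF n] by (simp add: B_simps)
    also have "\<dots> = (1 - u) * ev \<nu> * B x (mQ \<nu>)"
      using mQ_eigen[OF ups_partition[OF n]] by (simp add: is_eigen_def B_simps)
    finally have "(1 - u) * (ev \<kappa> - ev \<nu>) * B x (mQ \<nu>) = 0" by (simp add: algebra_simps)
    then show ?thesis using u_neq_1 ev_ups[OF k n] by auto
  qed
  obtain a where a: "x = (\<Sum>\<nu>\<in>ups \<kappa>. sf_scale (a \<nu>) (mQ \<nu>))"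
    using span_image_finite[OF upspan_mQ[OF k x] finite_ups] by blast
  have "a \<nu> = 0" if n: "\<nu> \<in> ups \<kappa>" for \<nu>
  proof -
    have "B x (mQ \<nu>) = (\<Sum>\<nu>'\<in>ups \<kappa>. if \<nu>' = \<nu> then a \<nu> * B (mQ \<nu>) (mQ \<nu>) else 0)"
      unfolding a B_sum_left by (intro sum.cong) (use n mQ_orthogonal ups_partition in \<open>auto simp: B_simps\<close>)
    also have "\<dots> = a \<nu> * B (mQ \<nu>) (mQ \<nu>)" using n finite_ups by simp
    finally show ?thesis using o[OF n] mQ_norm[OF ups_partition[OF n]] by simp
  qed
  then show ?thesis unfolding a by (intro sum.neutral) auto
qed

subsection \<open>The Macdonald functions\<close>

definition mP :: "nat list \<Rightarrow> 'a symfun" where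
  "mP \<kappa> = sf_scale (inverse (B (mQ \<kappa>) (mQ \<kappa>))) (mQ \<kappa>)"

text \<open>
  The coefficients in the monomial functions are the pairings with the products \<open>gl\<close>.
\<close>

lemma downs_expand:
  assumes k: "is_partition \<kappa>" and d: "sf_deg (sum_list \<kappa>) f"
    and 1: "B f (gl \<kappa>) = 1"
    and 0: "\<And>\<nu>. is_partition \<nu> \<Longrightarrow> \<nu> \<noteq> \<kappa> \<Longrightarrow> \<not> dominance_le \<nu> \<kappa> \<Longrightarrow> B f (gl \<nu>) = 0"
  shows "f = monomial_sf \<kappa> + (\<Sum>\<nu> | is_partition \<nu> \<and> dominance_le \<nu> \<kappa> \<and> \<nu> \<noteq> \<kappa>. sf_scale (B f (gl \<nu>)) (monomial_sf \<nu>))"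
proof (rule sf_eqI)
  fix a
  let ?D = "{\<nu>. is_partition \<nu> \<and> dominance_le \<nu> \<kappa> \<and> \<nu> \<noteq> \<kappa>}"
  have fin: "finite ?D"
    by (rule finite_subset[OF _ finite_partitions[of "sum_list \<kappa>"]]) (auto simp: dominance_le_def)
  define \<mu> where "\<mu> = part_of (exponents a)"
  have m: "is_partition \<mu>" unfolding \<mu>_def by (rule is_partition_part_of[OF zero_notin_exponents])
  have e: "exponents a = mset \<mu>" by (simp add: \<mu>_def)
  have c: "sf_coeff f a = B f (gl \<mu>)" unfolding B_gl by (rule sf_coeff_eq_mon[OF e m])
  have "sf_coeff (monomial_sf \<kappa> + (\<Sum>\<nu>\<in>?D. sf_scale (B f (gl \<nu>)) (monomial_sf \<nu>))) a
     = (if \<mu> = \<kappa> then 1 else 0) + (\<Sum>\<nu>\<in>?D. if \<nu> = \<mu> then B f (gl \<mu>) else 0)"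
    using partition_eq_iff[OF m] k
    by (simp add: sf_coeff_add sf_coeff_sum sf_coeff_scale sf_coeff_monomial e) (auto intro!: sum.cong)
  also have "\<dots> = (if \<mu> = \<kappa> then 1 else 0) + (if \<mu> \<in> ?D then B f (gl \<mu>) else 0)"
    using fin by (simp add: sum.delta)
  also have "\<dots> = B f (gl \<mu>)" using 1 0[OF m] m by auto
  finally show "sf_coeff f a = sf_coeff (monomial_sf \<kappa> + (\<Sum>\<nu>\<in>?D. sf_scale (B f (gl \<nu>)) (monomial_sf \<nu>))) a"
    using c by simp
qed

lemma mP_family: "is_macdonald_family q t mP"
  unfolding is_macdonald_family_def
proof (intro conjI allI impI)
  fix \<kappa> assume k: "is_partition \<kappa>"
  have "mP \<kappa> = monomial_sf \<kappa> + (\<Sum>\<nu> | is_partition \<nu> \<and> dominance_le \<nu> \<kappa> \<and> \<nu> \<noteq> \<kappa>. sf_scale (B (mP \<kappa>) (gl \<nu>)) (monomial_sf \<nu>))"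
  proof (rule downs_expand[OF k])
    show "sf_deg (sum_list \<kappa>) (mP \<kappa>)" unfolding mP_def by (intro sf_deg_scale sf_deg_mQ k)
    show "B (mP \<kappa>) (gl \<kappa>) = 1" using mQ_norm[OF k] by (simp add: mP_def B_simps B_mQ_gl_same[OF k])
    show "B (mP \<kappa>) (gl \<nu>) = 0" if "is_partition \<nu>" "\<nu> \<noteq> \<kappa>" "\<not> dominance_le \<nu> \<kappa>" for \<nu>
      using B_mQ_gl[OF k that(1)] that by (simp add: mP_def B_simps ups_def)
  qed
  then show "\<exists>u. mP \<kappa> = monomial_sf \<kappa> + (\<Sum>\<nu> | is_partition \<nu> \<and> dominance_le \<nu> \<kappa> \<and> \<nu> \<noteq> \<kappa>. sf_scale (u \<nu>) (monomial_sf \<nu>))"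
    by (intro exI[of _ "\<lambda>\<nu>. B (mP \<kappa>) (gl \<nu>)"])
next
  fix \<nu> \<mu> assume "is_partition \<nu>" "is_partition \<mu>" "\<nu> \<noteq> \<mu>"
  then show "B (mP \<nu>) (mP \<mu>) = 0" by (simp add: mP_def B_simps mQ_orthogonal)
qed

text \<open>
  Triangularity and orthogonality together leave no freedom in the coefficients.
\<close>

lemma family_unique:
  assumes P: "is_macdonald_family q t P" and k: "is_partition \<kappa>"
  shows "P \<kappa> = mP \<kappa>"
proof -
  have gl: "B (P \<mu>) (gl \<nu>) = (if \<nu> = \<mu> then 1 else 0)" if m: "is_partition \<mu>" and n: "is_partition \<nu>" and nd: "\<nu> = \<mu> \<or> \<not> dominance_le \<nu> \<mu>" for \<mu> \<nu>
  proof -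
    obtain v where v: "P \<mu> = monomial_sf \<mu> + (\<Sum>\<nu> | is_partition \<nu> \<and> dominance_le \<nu> \<mu> \<and> \<nu> \<noteq> \<mu>. sf_scale (v \<nu>) (monomial_sf \<nu>))"
      using P m unfolding is_macdonald_family_def by blast
    have "(\<Sum>\<nu>' | is_partition \<nu>' \<and> dominance_le \<nu>' \<mu> \<and> \<nu>' \<noteq> \<mu>. v \<nu>' * B (monomial_sf \<nu>') (gl \<nu>)) = 0"
      by (rule sum.neutral) (use n nd in \<open>auto simp: B_monomial_gl\<close>)
    then show ?thesis unfolding v B_add_left B_sum_left B_scale_left using m n by (simp add: B_monomial_gl)
  qed
  have mQ: "B (P \<mu>) (mQ \<nu>) = (if \<nu> = \<mu> then 1 else 0)" if m: "is_partition \<mu>" and n: "is_partition \<nu>" and nd: "\<nu> = \<mu> \<or> \<mu> \<notin> ups \<nu>" for \<mu> \<nu>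
  proof -
    have nu: "\<not> dominance_le \<kappa>' \<mu>" if "\<kappa>' \<in> ups \<nu>" for \<kappa>'
    proof
      assume d: "dominance_le \<kappa>' \<mu>"
      show False
      proof (cases "\<mu> = \<kappa>'")
        case True
        then show ?thesis using that nd ups_irrefl by auto
      next
        case False
        then have "\<mu> \<in> ups \<kappa>'" using d m by (auto simp: ups_def)
        then have "\<mu> \<in> ups \<nu>" using ups_trans[OF n that] by simp
        then show False using nd ups_irrefl by auto
      qed
    qed
    have "B (P \<mu>) (mQ \<nu> - gl \<nu>) = 0"
    proof (rule B_span_0[OF _ mQ_upspan[OF n]])
      fix y assume "y \<in> gl ` ups \<nu>"
      then obtain \<kappa>' where "\<kappa>' \<in> ups \<nu>" "y = gl \<kappa>'" by auto
      moreover have "\<kappa>' \<noteq> \<mu>" using nu[OF \<open>\<kappa>' \<in> ups \<nu>\<close>] by (auto simp: dominance_le_def)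
      ultimately show "B (P \<mu>) y = 0" using gl[OF m ups_partition] nu by auto
    qed
    moreover have "\<nu> = \<mu> \<or> \<not> dominance_le \<nu> \<mu>" using nd m by (auto simp: ups_def)
    ultimately show ?thesis using gl[OF m n] by (simp add: B_simps)
  qed
  have main: "B (P \<mu>) (mQ \<nu>) = (if \<nu> = \<mu> then 1 else 0)" if "is_partition \<mu>" "is_partition \<nu>" for \<mu> \<nu>
    using that(2,1)
  proof (induction "card {\<nu>'. is_partition \<nu>' \<and> dominance_le \<nu>' \<mu> \<and> \<nu>' \<noteq> \<mu>}" arbitrary: \<mu> \<nu> rule: less_induct)
    case less
    show ?case
    proof (cases "\<nu> = \<mu> \<or> \<mu> \<notin> ups \<nu>")
      case True
      then show ?thesis using mQ less.prems by blast
    next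
      case False
      let ?d = "\<lambda>\<mu>. {\<nu>'. is_partition \<nu>' \<and> dominance_le \<nu>' \<mu> \<and> \<nu>' \<noteq> \<mu>}"
      have fin: "finite (?d \<mu>)" for \<mu>
        by (rule finite_subset[OF _ finite_partitions[of "sum_list \<mu>"]]) (auto simp: dominance_le_def)
      have deq: "?d \<mu> = {\<nu>'. is_partition \<nu>' \<and> \<mu> \<in> ups \<nu>'}" if "is_partition \<mu>" for \<mu> using that by (auto simp: ups_def)
      have "?d \<nu> \<subset> ?d \<mu>"
        unfolding deq[OF less.prems(1)] deq[OF less.prems(2)]
        using False less.prems ups_trans ups_irrefl by blast
      then have c: "card (?d \<nu>) < card (?d \<mu>)" using fin by (intro psubset_card_mono)
      have Pnu: "P \<nu> = mP \<nu>"
      proof -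
        have "B (P \<nu> - mP \<nu>) (mQ \<kappa>') = 0" if k': "is_partition \<kappa>'" for \<kappa>'
          using less.hyps[OF c k' less.prems(1)] mQ_orthogonal[OF less.prems(1) k'] mQ_norm[OF less.prems(1)]
          by (auto simp: mP_def B_simps)
        note z = this
        have "P \<nu> - mP \<nu> = 0"
        proof (rule eq_0_if_orthogonal_gl)
          fix \<kappa>' assume k': "is_partition \<kappa>'"
          have "B (P \<nu> - mP \<nu>) (gl \<kappa>' - mQ \<kappa>') = 0"
            by (rule B_span_0[OF _ gl_mQ[OF k']]) (auto intro!: z ups_partition)
          then show "B (P \<nu> - mP \<nu>) (gl \<kappa>') = 0" using z[OF k'] by (simp add: B_simps)
        qed
        then show ?thesis by simp
      qed
      have "B (P \<mu>) (P \<nu>) = 0" using P less.prems False unfolding is_macdonald_family_def by blast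
      then have "B (P \<mu>) (mQ \<nu>) = 0" unfolding Pnu mP_def using mQ_norm[OF less.prems(1)] by (simp add: B_simps)
      then show ?thesis using False by simp
    qed
  qed
  have z: "B (P \<kappa> - mP \<kappa>) (mQ \<kappa>') = 0" if k': "is_partition \<kappa>'" for \<kappa>'
    using main[OF k k'] mQ_orthogonal[OF k k'] mQ_norm[OF k]
    by (auto simp: mP_def B_simps)
  have "P \<kappa> - mP \<kappa> = 0"
  proof (rule eq_0_if_orthogonal_gl)
    fix \<kappa>' assume k': "is_partition \<kappa>'"
    have "B (P \<kappa> - mP \<kappa>) (gl \<kappa>' - mQ \<kappa>') = 0"
      by (rule B_span_0[OF _ gl_mQ[OF k']]) (auto intro!: z ups_partition)
    then show "B (P \<kappa> - mP \<kappa>) (gl \<kappa>') = 0" using z[OF k'] by (simp add: B_simps)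
  qed
  then show ?thesis by simp
qed

theorem macdonald_Q_eq:
  assumes k: "is_partition \<kappa>"
  shows "macdonald_Q q t \<kappa> = mQ \<kappa>"
proof -
  have "is_macdonald_family q t (macdonald_P q t)"
    unfolding macdonald_P_def by (rule someI[of _ mP]) (rule mP_family)
  then have "macdonald_P q t \<kappa> = mP \<kappa>" using k by (rule family_unique)
  then show ?thesis
    using mQ_norm[OF k] by (simp add: macdonald_Q_def mP_def B_simps)
qed

lemma ups_row:
  assumes j: "j > 0"
  shows "ups [j] = {}"
proof (rule ccontr)
  assume "ups [j] \<noteq> {}"
  then obtain \<mu> where m: "is_partition \<mu>" "dominance_le [j] \<mu>" "\<mu> \<noteq> [j]" by (auto simp: ups_def)
  have s: "sum_list \<mu> = j" using m(2) by (simp add: dominance_le_def)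
  have "sum_list (take 1 [j]) \<le> sum_list (take 1 \<mu>)" using m(2) unfolding dominance_le_def by blast
  then have h: "j \<le> sum_list (take 1 \<mu>)" by simp
  show False
  proof (cases \<mu>)
    case Nil
    then show ?thesis using s j by simp
  next
    case (Cons x xs)
    then have "sum_list xs = 0" using s h by (simp del: sum_list_eq_0_iff)
    moreover have "\<forall>y\<in>set xs. y > 0" using m(1) Cons by (simp add: is_partition_def)
    ultimately have "xs = []" by (cases xs) auto
    then show ?thesis using s m(3) Cons by simp
  qed
qed

text \<open>
  No partition dominates a single row strictly, so there is no correction term.
\<close>

lemma mQ_row: "j > 0 \<Longrightarrow> mQ [j] = newton w j"
  using mQ_upspan[of "[j]"] by (simp add: ups_row gl_def is_partition_def)

end

section \<open>The \<open>q\<close>-Dyson product and the symmetric weight\<close>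

subsection \<open>Manipulations of \<open>q\<close>-shifted factorials\<close>

lemma qpoch_Suc: "qpoch a q (Suc n) = qpoch a q n * (1 - a * q ^ n)"
  by (simp add: qpoch_def)

lemma qpoch_Suc': "qpoch a q (Suc n) = (1 - a) * qpoch (q * a) q n"
  unfolding qpoch_def by (simp add: prod.lessThan_Suc_shift mult_ac del: prod.lessThan_Suc)

text \<open>
  Here \<open>Q\<close> stands for \<open>q\<close>, \<open>r\<close> for a quotient of two variables, and \<open>U\<close> for \<open>1/t\<close> with \<open>t = q\<^sup>m\<close>. The factors of
  the shifted product telescope against the unshifted ones; this and \<open>qpoch_shift_down\<close> make the weight function an
  eigenfunction of the shifts.
\<close>

lemma qpoch_shift_up:
  fixes Q :: "'b::comm_ring_1"
  assumes q: "Qi * Q = 1" and u: "U * Q ^ m = 1" and r: "r * r' = 1" and m: "m > 0"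
  shows "(1 - U * (Q * r)) * (qpoch (Q * (Q * r)) Q (m - 1) * qpoch (Qi * r') Q m) = (U - r) * (qpoch (Q * r) Q (m - 1) * qpoch r' Q m)"
proof -
  obtain p where p: "m = Suc p" using m by (cases m) auto
  have 1: "qpoch (Qi * r') Q m = (1 - Qi * r') * qpoch r' Q p"
    unfolding p qpoch_Suc' using q by (simp add: mult.assoc[symmetric] mult.commute[of Q])
  have 2: "qpoch r' Q m = qpoch r' Q p * (1 - r' * Q ^ p)" unfolding p qpoch_Suc ..
  have 3: "(1 - Q * r) * qpoch (Q * (Q * r)) Q p = qpoch (Q * r) Q p * (1 - Q * r * Q ^ p)"
    using qpoch_Suc[of "Q * r" Q p] qpoch_Suc'[of "Q * r" Q p] by simp
  have UQ: "U * Q ^ p = Qi"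
  proof -
    have "U * Q ^ p = (Qi * Q) * (U * Q ^ p)" using q by simp
    also have "\<dots> = Qi * (U * Q ^ m)" unfolding p by (simp add: mult_ac)
    finally show ?thesis using u by simp
  qed
  have 4: "(1 - U * (Q * r)) * (1 - Qi * r') = (1 - Q * r) * (U - Qi * r')"
  proof -
    have "U * (Q * r) * (Qi * r') = U * ((Qi * Q) * (r * r'))" "Q * r * (Qi * r') = (Qi * Q) * (r * r')"
      by (simp_all only: mult_ac)
    then have "U * (Q * r) * (Qi * r') = U" "Q * r * (Qi * r') = 1" by (simp_all only: q r mult_1_right)
    then show ?thesis by (simp add: algebra_simps)
  qed
  have 5: "(U - r) * (1 - r' * Q ^ p) = (1 - Q * r * Q ^ p) * (U - Qi * r')"
  proof -
    have "U * (r' * Q ^ p) = (U * Q ^ p) * r'" by (simp only: mult_ac)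
    then have "U * (r' * Q ^ p) = Qi * r'" by (simp only: UQ)
    moreover have "r * (r' * Q ^ p) = Q ^ p" using r by (simp add: mult.assoc[symmetric])
    moreover have "Q * r * Q ^ p * U = r"
    proof -
      have "Q * r * Q ^ p * U = (U * Q ^ m) * r" unfolding p by (simp add: mult_ac)
      then show ?thesis using u by simp
    qed
    moreover have "Q * r * Q ^ p * (Qi * r') = Q ^ p"
    proof -
      have "Q * r * Q ^ p * (Qi * r') = (Qi * Q) * (r * r') * Q ^ p" by (simp only: mult_ac)
      then show ?thesis using q r by simp
    qed
    ultimately show ?thesis by (simp add: algebra_simps)
  qed
  have "(1 - U * (Q * r)) * (qpoch (Q * (Q * r)) Q (m - 1) * qpoch (Qi * r') Q m)
      = ((1 - U * (Q * r)) * (1 - Qi * r')) * qpoch (Q * (Q * r)) Q p * qpoch r' Q p"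
    unfolding 1 by (simp add: p mult_ac)
  also have "\<dots> = (U - Qi * r') * ((1 - Q * r) * qpoch (Q * (Q * r)) Q p) * qpoch r' Q p"
    unfolding 4 by (simp add: mult_ac)
  also have "\<dots> = ((1 - Q * r * Q ^ p) * (U - Qi * r')) * qpoch (Q * r) Q p * qpoch r' Q p"
    unfolding 3 by (simp only: mult_ac)
  also have "\<dots> = (U - r) * (qpoch (Q * r) Q (m - 1) * qpoch r' Q m)"
    unfolding 5[symmetric] 2 by (simp add: p mult_ac)
  finally show ?thesis .
qed

lemma qpoch_shift_down:
  fixes Q :: "'b::comm_ring_1"
  assumes q: "Qi * Q = 1" and u: "U * Q ^ m = 1" and r: "r * r' = 1" and m: "m > 0"
  shows "(U - Qi * r) * (qpoch r Q (m - 1) * qpoch (Q * r') Q m) = (1 - U * r) * (qpoch (Q * r) Q (m - 1) * qpoch r' Q m)"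
proof -
  obtain p where p: "m = Suc p" using m by (cases m) auto
  have UQ: "U * Q ^ p = Qi"
  proof -
    have "U * Q ^ p = (Qi * Q) * (U * Q ^ p)" using q by simp
    also have "\<dots> = Qi * (U * Q ^ m)" unfolding p by (simp add: mult_ac)
    finally show ?thesis using u by simp
  qed
  have 1: "U - Qi * r = U * (1 - r * Q ^ p)" unfolding UQ[symmetric] by (simp add: algebra_simps)
  have 2: "qpoch (Q * r') Q m = qpoch (Q * r') Q p * (1 - Q * r' * Q ^ p)" unfolding p qpoch_Suc ..
  have 3: "qpoch r' Q m = (1 - r') * qpoch (Q * r') Q p" unfolding p qpoch_Suc' ..
  have 4: "qpoch r Q p * (1 - r * Q ^ p) = (1 - r) * qpoch (Q * r) Q p"
    using qpoch_Suc[of r Q p] qpoch_Suc'[of r Q p] by simp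
  have 5: "U * (1 - Q * r' * Q ^ p) * (1 - r) = (1 - U * r) * (1 - r')"
  proof -
    have a: "U * (Q * r' * Q ^ p) = r'"
    proof -
      have "U * (Q * r' * Q ^ p) = (U * Q ^ m) * r'" unfolding p by (simp add: mult_ac)
      then show ?thesis using u by simp
    qed
    have "U * (1 - Q * r' * Q ^ p) = U - r'" unfolding right_diff_distrib a by simp
    then have "U * (1 - Q * r' * Q ^ p) * (1 - r) = U - U * r - r' + r * r'" by (simp add: algebra_simps)
    also have "\<dots> = (1 - U * r) * (1 - r')"
    proof -
      have "U * r * r' = U" using r by (simp add: mult.assoc)
      then show ?thesis using r by (simp add: algebra_simps)
    qed
    finally show ?thesis .
  qed
  have "(U - Qi * r) * (qpoch r Q (m - 1) * qpoch (Q * r') Q m) = U * (1 - Q * r' * Q ^ p) * (qpoch r Q p * (1 - r * Q ^ p)) * qpoch (Q * r') Q p"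
    unfolding 1 2 by (simp add: p mult_ac)
  also have "\<dots> = (U * (1 - Q * r' * Q ^ p) * (1 - r)) * qpoch (Q * r) Q p * qpoch (Q * r') Q p"
    unfolding 4 by (simp only: mult_ac)
  also have "\<dots> = (1 - U * r) * (qpoch (Q * r) Q (m - 1) * qpoch r' Q m)"
    unfolding 5 3 by (simp add: p mult_ac)
  finally show ?thesis .
qed

lemma HL_A_sum:
  fixes Y :: "nat \<Rightarrow> 'a::field"
  assumes u0: "u \<noteq> 0" and inj: "inj_on Y {..<n}" and nz: "\<And>i. i < n \<Longrightarrow> Y i \<noteq> 0"
  shows "(1 - u) * (\<Sum>i<n. HL_A u n Y i) = 1 - u ^ n"
proof -
  have T: "inverse u * u = 1" using u0 by simp
  have p0: "poly (\<Prod>i\<in>A. [:1, - c i:]) 0 = (1 :: 'a)" for A and c :: "nat \<Rightarrow> 'a" by (simp add: poly_prod)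
  have "poly (\<Prod>i<n. [:1, - Y i:]) 0 = u ^ n + (\<Sum>i<n. (1 - u) * HL_A u n Y i)"
    using arg_cong[OF HL_partial_fraction[OF T inj nz], of "\<lambda>p. poly p 0"] by (simp add: poly_sum p0)
  then show ?thesis unfolding p0 by (simp add: sum_distrib_left algebra_simps)
qed

subsection \<open>Permuting two variables\<close>

definition tsw :: "nat \<Rightarrow> nat \<Rightarrow> nat \<Rightarrow> nat" where
  "tsw i j k = (if k = i then j else if k = j then i else k)"

lemma tsw_tsw [simp]: "tsw i j (tsw i j k) = k" by (simp add: tsw_def)
lemma inj_tsw: "inj (tsw i j)" by (metis injI tsw_tsw)
lemma inj_on_tsw: "inj_on (tsw i j) S" using inj_tsw by (rule inj_on_subset) simp

lemma tsw_image: "i \<in> S \<Longrightarrow> j \<in> S \<Longrightarrow> tsw i j ` S = S"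
proof -
  assume ij: "i \<in> S" "j \<in> S"
  have sub: "tsw i j ` S \<subseteq> S" using ij by (auto simp: tsw_def)
  then have "tsw i j ` (tsw i j ` S) \<subseteq> tsw i j ` S" by (rule image_mono)
  then show ?thesis using sub by (auto simp: image_image)
qed

lemma prod_tsw: "tsw i j ` A = A \<Longrightarrow> (\<Prod>a\<in>A. g (tsw i j a)) = prod g A"
  using prod.reindex[OF inj_on_tsw[of i j A], of g] by (simp add: comp_def)

lemma lookup_map_key: "inj f \<Longrightarrow> Poly_Mapping.lookup (Poly_Mapping.map_key f p) i = Poly_Mapping.lookup p (f i)"
  by (simp add: map_key.rep_eq)

text \<open>
  The exchange of two variables.
\<close>

definition lsw :: "nat \<Rightarrow> nat \<Rightarrow> 'a::comm_ring_1 laurent \<Rightarrow> 'a laurent" where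
  "lsw i j = laurent_hom.lev lcst (\<lambda>\<beta>. Poly_Mapping.single (Poly_Mapping.map_key (tsw i j) \<beta>) 1)"

lemma laurent_hom_lsw: "laurent_hom (lcst :: 'a::comm_ring_1 \<Rightarrow> _) (\<lambda>\<beta>. Poly_Mapping.single (Poly_Mapping.map_key (tsw i j) \<beta>) 1)"
  by unfold_locales (auto simp: lcst_add lcst_mult mult_single map_key_plus[OF inj_tsw] inj_tsw)

lemmas lsw_mult = laurent_hom.lev_mult[OF laurent_hom_lsw, folded lsw_def]
lemmas lsw_add = laurent_hom.lev_add[OF laurent_hom_lsw, folded lsw_def]
lemmas lsw_diff = laurent_hom.lev_diff[OF laurent_hom_lsw, folded lsw_def]
lemmas lsw_prod = laurent_hom.lev_prod[OF laurent_hom_lsw, folded lsw_def]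
lemmas lsw_lcst = laurent_hom.lev_lcst[OF laurent_hom_lsw, folded lsw_def]
lemmas lsw_1 = laurent_hom.lev_1[OF laurent_hom_lsw, folded lsw_def]
lemmas lsw_power = laurent_hom.lev_power[OF laurent_hom_lsw, folded lsw_def]
lemmas lsw_single = laurent_hom.lev_single[OF laurent_hom_lsw, folded lsw_def]

lemma lsw_yv: "lsw i j (yv a e) = yv (tsw i j a) e"
proof -
  have "Poly_Mapping.map_key (tsw i j) (Poly_Mapping.single a e) = Poly_Mapping.single (tsw i j a) e"
    by (rule poly_mapping_eqI) (auto simp: lookup_map_key[OF inj_tsw] lookup_single when_def)
  then show ?thesis by (simp add: yv_def lsw_single)
qed

lemma lsw_rt: "lsw i j (rt a b) = rt (tsw i j a) (tsw i j b)"
  by (simp add: rt_def lsw_mult lsw_yv)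

lemma lsw_qpoch: "lsw i j (qpoch x (lcst c) m) = qpoch (lsw i j x) (lcst c) m"
  by (simp add: qpoch_def lsw_prod lsw_diff lsw_1 lsw_mult lsw_power lsw_lcst)

text \<open>
  Products of one-row functions commute, so \<open>G\<close> sees only the symmetrization of its argument.
\<close>

lemma (in macdonald_params) G_lsw:
  assumes "i < n" "j < n"
  shows "G n (lsw i j P) = G n P"
proof -
  have g: "gm n (Poly_Mapping.map_key (tsw i j) \<beta>) = gm n \<beta>" for \<beta>
  proof -
    have "gm n (Poly_Mapping.map_key (tsw i j) \<beta>) = (\<Prod>a\<in>{..<n}. gi (Poly_Mapping.lookup \<beta> (tsw i j a)))"
      by (simp add: gm_def lookup_map_key[OF inj_tsw])
    also have "\<dots> = (\<Prod>a\<in>tsw i j ` {..<n}. gi (Poly_Mapping.lookup \<beta> a))"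
      by (simp add: prod.reindex[OF inj_on_tsw])
    also have "tsw i j ` {..<n} = {..<n}" by (rule tsw_image) (use assms in auto)
    finally show ?thesis by (simp add: gm_def)
  qed
  show ?thesis
    by (induction P rule: laurent_induct)
       (simp_all add: lsw_single lsw_add G_add lcst_def mult_single G_single g)
qed

subsection \<open>The \<open>q\<close>-Dyson products\<close>

text \<open>
  The product of \<open>dk q m a b\<close> over all ordered pairs of variables is the symmetric weight of the finite
  dimensional scalar product of Macdonald polynomials. For \<open>t = q\<^sup>m\<close> the factor \<open>dth q m i j\<close> differs from
  \<open>dk q m i j * dk q m j i\<close> by \<open>(y\<^sub>i - t y\<^sub>j) / (y\<^sub>i - y\<^sub>j)\<close>; with it one obtains the \<open>q\<close>-Dyson product.
\<close>

definition dk :: "'a::comm_ring_1 \<Rightarrow> nat \<Rightarrow> nat \<Rightarrow> nat \<Rightarrow> 'a laurent" where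
  "dk q m a b = qpoch (rt a b) (lcst q) m"

definition dth :: "'a::comm_ring_1 \<Rightarrow> nat \<Rightarrow> nat \<Rightarrow> nat \<Rightarrow> 'a laurent" where
  "dth q m i j = qpoch (lcst q * rt j i) (lcst q) m * qpoch (rt i j) (lcst q) m"

definition DS :: "'a::comm_ring_1 \<Rightarrow> nat \<Rightarrow> nat set \<Rightarrow> 'a laurent" where
  "DS q m S = (\<Prod>(a, b)\<in>{(a, b). a \<in> S \<and> b \<in> S \<and> a \<noteq> b}. dk q m a b)"

text \<open>
  The first \<open>r\<close> variables carry the symmetric weight and the others \<open>q\<close>-Dyson factors: \<open>r = 0\<close> is the \<open>q\<close>-Dyson
  product and \<open>r = n\<close> the symmetric weight.
\<close>

definition DP :: "'a::comm_ring_1 \<Rightarrow> nat \<Rightarrow> nat \<Rightarrow> nat \<Rightarrow> 'a laurent" where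
  "DP q m n r = DS q m {..<r} * (\<Prod>b\<in>{r..<n}. \<Prod>a<b. dth q m b a)"

lemma finite_offdiag: "finite S \<Longrightarrow> finite {(a, b). a \<in> S \<and> b \<in> S \<and> a \<noteq> b}"
  by (rule finite_subset[of _ "S \<times> S"]) auto

lemma DS_insert:
  assumes "finite S" "i \<notin> S"
  shows "DS q m (insert i S) = DS q m S * (\<Prod>j\<in>S. dk q m i j * dk q m j i)"
proof -
  have "{(a, b). a \<in> insert i S \<and> b \<in> insert i S \<and> a \<noteq> b} =
     {(a, b). a \<in> S \<and> b \<in> S \<and> a \<noteq> b} \<union> ((\<lambda>j. (i, j)) ` S \<union> (\<lambda>j. (j, i)) ` S)"
    using assms by auto
  moreover have "(\<Prod>(a, b)\<in>(\<lambda>j. (i, j)) ` S \<union> (\<lambda>j. (j, i)) ` S. dk q m a b) = (\<Prod>j\<in>S. dk q m i j * dk q m j i)"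
    using assms by (subst prod.union_disjoint) (auto simp: prod.reindex inj_on_def prod.distrib)
  moreover have "(\<Prod>(a, b)\<in>{(a, b). a \<in> S \<and> b \<in> S \<and> a \<noteq> b} \<union> ((\<lambda>j. (i, j)) ` S \<union> (\<lambda>j. (j, i)) ` S). dk q m a b) =
     (\<Prod>(a, b)\<in>{(a, b). a \<in> S \<and> b \<in> S \<and> a \<noteq> b}. dk q m a b) * (\<Prod>(a, b)\<in>(\<lambda>j. (i, j)) ` S \<union> (\<lambda>j. (j, i)) ` S. dk q m a b)"
    by (rule prod.union_disjoint) (use assms finite_offdiag[of S] in auto)
  ultimately show ?thesis unfolding DS_def by (simp only:)
qed

lemma DS_lsw: "i \<notin> S \<Longrightarrow> lsw i j (DS q m (tsw i j ` S)) = DS q m S"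
proof -
  have "bij_betw (map_prod (tsw i j) (tsw i j)) {(a, b). a \<in> S \<and> b \<in> S \<and> a \<noteq> b} {(a, b). a \<in> tsw i j ` S \<and> b \<in> tsw i j ` S \<and> a \<noteq> b}"
    by (rule bij_betwI[of _ _ _ "map_prod (tsw i j) (tsw i j)"]) (auto dest: injD[OF inj_tsw])
  note r = prod.reindex_bij_betw[OF this, of "\<lambda>(a, b). lsw i j (dk q m a b)"]
  have "lsw i j (DS q m (tsw i j ` S)) = (\<Prod>(a, b)\<in>{(a, b). a \<in> tsw i j ` S \<and> b \<in> tsw i j ` S \<and> a \<noteq> b}. lsw i j (dk q m a b))"
    unfolding DS_def lsw_prod by (intro prod.cong) auto
  also have "\<dots> = (\<Prod>(a, b)\<in>{(a, b). a \<in> S \<and> b \<in> S \<and> a \<noteq> b}. lsw i j (dk q m (tsw i j a) (tsw i j b)))"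
    unfolding r[symmetric] by (intro prod.cong) auto
  also have "\<dots> = DS q m S"
    unfolding DS_def by (intro prod.cong) (auto simp: dk_def lsw_qpoch lsw_rt)
  finally show ?thesis .
qed

lemma DS_prs: "DS q m {..<n} = (\<Prod>(a, b)\<in>prs n. dk q m a b * dk q m b a)"
proof -
  have "{(a, b). a \<in> {..<n} \<and> b \<in> {..<n} \<and> a \<noteq> b} = prs n \<union> prod.swap ` prs n"
    by (force simp: prs_def)
  moreover have "prs n \<inter> prod.swap ` prs n = {}" by (auto simp: prs_def)
  moreover have "(\<Prod>(a, b)\<in>prod.swap ` prs n. dk q m a b) = (\<Prod>(a, b)\<in>prs n. dk q m b a)"
    by (subst prod.reindex) (auto intro!: prod.cong)
  ultimately show ?thesis unfolding DS_def
    by (simp add: prod.union_disjoint prod.distrib case_prod_unfold)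
qed

lemma lsw_dth: "lsw i j (dth q m a b) = dth q m (tsw i j a) (tsw i j b)"
  by (simp add: dth_def lsw_mult lsw_qpoch lsw_rt lsw_lcst)

lemma rt_inverse: "rt a b * rt b a = 1"
proof -
  have "rt a b * rt b a = (yv a 1 * yv a (- 1)) * (yv b 1 * yv b (- 1))" by (simp add: rt_def mult_ac)
  then show ?thesis by (simp add: yv_inverse)
qed

lemma dth_relation: "(1 - rt j i) * dth q m i j = dk q m i j * dk q m j i * (1 - lcst (q ^ m) * rt j i)"
proof -
  have e: "(1 - rt j i) * qpoch (lcst q * rt j i) (lcst q) m = qpoch (rt j i) (lcst q) m * (1 - rt j i * lcst q ^ m)"
    unfolding qpoch_Suc[symmetric] qpoch_Suc'[symmetric] ..
  show ?thesis unfolding dth_def mult.assoc[symmetric] e by (simp add: dk_def lcst_power mult_ac)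
qed

lemma to_fract_rt: "to_fract (rt a b :: 'a::field laurent) = to_fract (yv a 1) / to_fract (yv b 1)"
  by (simp add: rt_def to_fract_yv_inverse divide_inverse)

lemma yv_fract_neq: "i \<noteq> j \<Longrightarrow> to_fract (yv i 1 :: 'a::field laurent) \<noteq> to_fract (yv j 1)"
  using inj_yv[of i 1 j] by auto

lemma solve_for_factor:
  fixes x y :: "'a::field"
  assumes "x \<noteq> 0" "x - y \<noteq> 0" "(1 - y / x) * D = K * (1 - T * (y / x))"
  shows "D = K * ((x - T * y) / (x - y))"
proof -
  have e: "1 - y / x = (x - y) / x" "1 - T * (y / x) = (x - T * y) / x"
    using assms(1) by (simp_all add: diff_divide_distrib)
  have "(x - y) * D = K * (x - T * y)"
    using assms(3) assms(1) unfolding e by simp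
  then show ?thesis using assms(2) by (simp add: nonzero_eq_divide_eq mult.commute)
qed

lemma to_fract_dth:
  assumes "i \<noteq> j"
  shows "to_fract (dth q m i j :: 'a::field laurent) = to_fract (dk q m i j * dk q m j i) *
    ((to_fract (yv i 1) - to_fract (lcst (q ^ m)) * to_fract (yv j 1)) / (to_fract (yv i 1) - to_fract (yv j 1)))"
proof -
  let ?y = "\<lambda>i. to_fract (yv i 1 :: 'a laurent)" and ?t = "to_fract (lcst (q ^ m) :: 'a laurent)"
  have n: "?y i \<noteq> 0" "?y i - ?y j \<noteq> 0" using yv_fract_neq[OF assms] by (auto simp: yv_nz)
  have "(1 - ?y j / ?y i) * to_fract (dth q m i j) = to_fract (dk q m i j * dk q m j i) * (1 - ?t * (?y j / ?y i))"
    using arg_cong[OF dth_relation[of j i q m], of to_fract] by (simp add: to_fract_rt)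
  then show ?thesis by (rule solve_for_factor[OF n])
qed

definition ymon :: "nat \<Rightarrow> int \<Rightarrow> 'a::comm_ring_1 laurent" where
  "ymon n k = (\<Prod>i<n. yv i k)"

lemma lsw_ymon: "i < n \<Longrightarrow> j < n \<Longrightarrow> lsw i j (ymon n k) = ymon n k"
proof -
  assume "i < n" "j < n"
  then have "tsw i j ` {..<n} = {..<n}" by (intro tsw_image) auto
  then show ?thesis using prod_tsw[of i j "{..<n}" "\<lambda>a. yv a k"]
    by (simp add: ymon_def lsw_prod lsw_yv)
qed

context macdonald_params
begin

text \<open>
  Averaging over the exchanges of \<open>y\<^sub>r\<close> with the earlier variables does not change \<open>G\<close>. The ratio of the two weights is the
  product of the \<open>(y\<^sub>i - t y\<^sub>j) / (y\<^sub>i - y\<^sub>j)\<close>, and the sum of these over \<open>i\<close> is a constant.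
\<close>

lemma G_DP_Suc:
  assumes m: "t = q ^ m" and r: "r < n"
  shows "sf_scale (of_nat (Suc r)) (G n (ymon n k * DP q m n r)) =
     sf_scale ((1 - t ^ Suc r) / (1 - t)) (G n (ymon n k * DP q m n (Suc r)))"
proof -
  let ?Z = "\<Prod>b\<in>{Suc r..<n}. \<Prod>a<b. dth q m b a"
  define X where "X i = DS q m ({..<Suc r} - {i}) * (\<Prod>j\<in>{..<Suc r} - {i}. dth q m i j) * ?Z" for i
  have Xr: "X r = DP q m n r"
  proof -
    have "{..<Suc r} - {r} = {..<r}" by auto
    moreover have "(\<Prod>b\<in>{r..<n}. \<Prod>a<b. dth q m b a) = (\<Prod>a<r. dth q m r a) * ?Z"
      using r by (rule prod.atLeast_Suc_lessThan)
    ultimately show ?thesis by (simp add: X_def DP_def mult.assoc)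
  qed
  have sw: "lsw i r (X r) = X i" if i: "i < Suc r" for i
  proof -
    have im: "tsw i r ` ({..<Suc r} - {i}) = {..<Suc r} - {r}"
      using i by (subst inj_on_image_set_diff[OF inj_on_tsw[of i r UNIV]]) (auto simp: tsw_image, auto simp: tsw_def)
    have "lsw i r (DS q m ({..<Suc r} - {r})) = DS q m ({..<Suc r} - {i})"
      unfolding im[symmetric] by (rule DS_lsw) simp
    moreover have "lsw i r (\<Prod>j\<in>{..<Suc r} - {r}. dth q m r j) = (\<Prod>j\<in>{..<Suc r} - {i}. dth q m i j)"
      unfolding im[symmetric] lsw_prod prod.reindex[OF inj_on_tsw] comp_def lsw_dth
      by (simp add: tsw_def[of i r r])
    moreover have "lsw i r ?Z = ?Z"
      unfolding lsw_prod
    proof (rule prod.cong)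
      fix b assume b: "b \<in> {Suc r..<n}"
      have "tsw i r ` {..<b} = {..<b}" using i b by (intro tsw_image) auto
      moreover have "tsw i r b = b" using i b by (simp add: tsw_def)
      ultimately show "(\<Prod>a<b. lsw i r (dth q m b a)) = (\<Prod>a<b. dth q m b a)"
        using prod_tsw[of i r "{..<b}" "\<lambda>a. dth q m b a"] by (simp add: lsw_dth)
    qed simp
    ultimately show ?thesis by (simp add: X_def lsw_mult)
  qed
  let ?y = "\<lambda>i. to_fract (yv i 1 :: 'a laurent)"
  have Xf: "to_fract (X i) = to_fract (DP q m n (Suc r)) * HL_A (to_fract (lcst t)) (Suc r) ?y i" if i: "i < Suc r" for i
  proof -
    have "DS q m {..<Suc r} = DS q m ({..<Suc r} - {i}) * (\<Prod>j\<in>{..<Suc r} - {i}. dk q m i j * dk q m j i)"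
      using DS_insert[of "{..<Suc r} - {i}" i q m] i by (simp add: insert_absorb)
    moreover have "to_fract (\<Prod>j\<in>{..<Suc r} - {i}. dth q m i j) =
       to_fract (\<Prod>j\<in>{..<Suc r} - {i}. dk q m i j * dk q m j i) * HL_A (to_fract (lcst t)) (Suc r) ?y i"
      unfolding HL_A_def to_fract_prod prod.distrib[symmetric]
      by (intro prod.cong) (simp_all add: to_fract_dth m)
    ultimately show ?thesis by (simp add: X_def DP_def mult_ac)
  qed
  have "(\<Sum>i<Suc r. X i) = lcst ((1 - t ^ Suc r) / (1 - t)) * DP q m n (Suc r)"
  proof -
    have t1': "1 - t \<noteq> 0" using t1[of 1] by simp
    have inj: "inj_on ?y {..<Suc r}" using yv_fract_neq by (auto simp: inj_on_def)
    have "(1 - to_fract (lcst t)) * (\<Sum>i<Suc r. HL_A (to_fract (lcst t)) (Suc r) ?y i) = 1 - to_fract (lcst t) ^ Suc r"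
      by (rule HL_A_sum[OF _ inj]) (use t0 yv_nz lcst_eq_iff[of t 0] in auto)
    then have "to_fract (lcst (1 - t) * (\<Sum>i<Suc r. X i)) = to_fract (lcst (1 - t ^ Suc r) * DP q m n (Suc r))"
      by (simp add: to_fract_sum Xf sum_distrib_left[symmetric] lcst_diff lcst_power to_fract_power mult_ac del: sum.lessThan_Suc power_Suc)
    then have e: "lcst (1 - t) * (\<Sum>i<Suc r. X i) = lcst (1 - t ^ Suc r) * DP q m n (Suc r)" by (simp only: to_fract_eq_iff)
    have "(\<Sum>i<Suc r. X i) = lcst (1 / (1 - t)) * (lcst (1 - t) * (\<Sum>i<Suc r. X i))"
      using t1' by (simp add: mult.assoc[symmetric] lcst_mult[symmetric] del: sum.lessThan_Suc)
    then show ?thesis unfolding e by (simp add: mult.assoc[symmetric] lcst_mult[symmetric])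
  qed
  then have "G n (ymon n k * (\<Sum>i<Suc r. X i)) = sf_scale ((1 - t ^ Suc r) / (1 - t)) (G n (ymon n k * DP q m n (Suc r)))"
    by (simp add: mult.left_commute[of "ymon n k"] G_lcst)
  moreover have Xeq: "G n (ymon n k * X i) = G n (ymon n k * X r)" if i: "i < Suc r" for i
  proof -
    have "ymon n k * X i = lsw i r (ymon n k * X r)" using i r by (simp add: lsw_mult lsw_ymon sw)
    then show ?thesis using i r by (simp add: G_lsw)
  qed
  then have "G n (ymon n k * (\<Sum>i<Suc r. X i)) = (\<Sum>i<Suc r. G n (ymon n k * X r))"
    unfolding sum_distrib_left G_sum by (intro sum.cong refl Xeq) simp
  moreover have "\<dots> = sf_scale (of_nat (Suc r)) (G n (ymon n k * X r))"
    by (simp only: sum_constant card_lessThan sf_scale_of_nat)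
  ultimately show ?thesis unfolding Xr by simp
qed

lemma G_DP:
  assumes m: "t = q ^ m"
  shows "r \<le> n \<Longrightarrow> \<exists>c. G n (ymon n k * DP q m n 0) = sf_scale c (G n (ymon n k * DP q m n r))"
proof (induction r)
  case 0
  show ?case by (intro exI[of _ 1]) simp
next
  case (Suc r)
  then obtain c where c: "G n (ymon n k * DP q m n 0) = sf_scale c (G n (ymon n k * DP q m n r))" by auto
  have nz: "(of_nat (Suc r) :: 'a) \<noteq> 0" by (rule of_nat_nz) simp
  have "G n (ymon n k * DP q m n r) = sf_scale (1 / of_nat (Suc r)) (sf_scale (of_nat (Suc r)) (G n (ymon n k * DP q m n r)))"
    using nz by (simp del: of_nat_Suc)
  also have "\<dots> = sf_scale (1 / of_nat (Suc r) * ((1 - t ^ Suc r) / (1 - t))) (G n (ymon n k * DP q m n (Suc r)))"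
    unfolding G_DP_Suc[OF m Suc_le_lessD[OF Suc.prems]] by (simp only: sf.scale_scale)
  finally show ?case using c by (intro exI[of _ "c * (1 / of_nat (Suc r) * ((1 - t ^ Suc r) / (1 - t)))"]) simp
qed

end

section \<open>The \<open>q\<close>-Dyson constant term\<close>

subsection \<open>Coefficient extraction by interpolation\<close>

text \<open>
  The coefficient of degree \<open>d\<close> in the Lagrange interpolation of the monomial of degree \<open>e\<close>.
\<close>

lemma lagrange_power_sum:
  fixes x :: "nat \<Rightarrow> 'a::field"
  assumes inj: "inj_on x {..d}" and e: "e \<le> d"
  shows "(\<Sum>j\<le>d. x j ^ e / (\<Prod>l\<in>{..d} - {j}. x j - x l)) = (if e = d then 1 else 0)"
proof -
  let ?L = "\<lambda>j. \<Prod>l\<in>{..d} - {j}. [:- x l, 1:]" and ?w = "\<lambda>j. \<Prod>l\<in>{..d} - {j}. x j - x l"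
  let ?R = "Polynomial.monom 1 e - (\<Sum>j\<le>d. Polynomial.smult (x j ^ e / ?w j) (?L j))"
  have w: "?w j \<noteq> 0" if "j \<le> d" for j using inj that by (auto simp: inj_on_def)
  have mon: "Polynomial.degree (\<Prod>l\<in>A. [:- x l, 1:]) = card A \<and> Polynomial.coeff (\<Prod>l\<in>A. [:- x l, 1:]) (card A) = 1" if "finite A" for A
    using that
  proof (induction A rule: finite_induct)
    case (insert a A)
    let ?p = "\<Prod>l\<in>A. [:- x l, 1:]"
    have "?p \<noteq> 0" by (simp add: prod_zero_iff insert)
    then have "Polynomial.degree ([:- x a, 1:] * ?p) = Suc (card A)"
      using insert by (subst degree_mult_eq) auto
    moreover have "Polynomial.lead_coeff ([:- x a, 1:] * ?p) = 1"
      unfolding lead_coeff_mult using insert by simp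
    ultimately show ?case using insert by simp
  qed simp
  have dL: "Polynomial.degree (?L j) = d" "Polynomial.coeff (?L j) d = 1" if "j \<le> d" for j
    using mon[of "{..d} - {j}"] that by auto
  have "?R = 0"
  proof (rule poly_eq_0_if_roots[of "x ` {..d}"])
    have "Polynomial.degree ?R \<le> d"
      using e dL by (intro degree_diff_le degree_sum_le order.trans[OF degree_smult_le]) (auto simp: degree_monom_eq)
    then show "Polynomial.degree ?R < card (x ` {..d})" using inj by (simp add: card_image)
    fix y assume "y \<in> x ` {..d}"
    then obtain i where i: "i \<le> d" "y = x i" by auto
    have "poly (?L j) y = (if j = i then ?w i else 0)" if "j \<le> d" for j
      using i that by (auto simp: poly_prod intro!: prod.cong)
    then have "poly (\<Sum>j\<le>d. Polynomial.smult (x j ^ e / ?w j) (?L j)) y = (\<Sum>j\<le>d. if j = i then x i ^ e else 0)"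
      unfolding poly_sum poly_smult using w by (intro sum.cong) auto
    then show "poly ?R y = 0" using i by (simp add: poly_monom)
  qed simp
  then have "0 = Polynomial.coeff ?R d" by simp
  also have "\<dots> = (if e = d then 1 else 0) - (\<Sum>j\<le>d. x j ^ e / ?w j)"
    using dL by (simp add: coeff_sum)
  finally show ?thesis by simp
qed

text \<open>Evaluation of a Laurent polynomial at a point, and homogeneous polynomials in the first
  \<open>n\<close> variables.\<close>

definition leval :: "nat \<Rightarrow> (nat \<Rightarrow> 'a::field) \<Rightarrow> 'a laurent \<Rightarrow> 'a" where
  "leval n x = laurent_hom.lev id (\<lambda>\<beta>. \<Prod>i<n. x i powi Poly_Mapping.lookup \<beta> i)"

lemma laurent_hom_leval:
  assumes "\<And>i. i < n \<Longrightarrow> x i \<noteq> (0 :: 'a::field)"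
  shows "laurent_hom id (\<lambda>\<beta>. \<Prod>i<n. x i powi Poly_Mapping.lookup \<beta> i)"
  by unfold_locales (use assms in \<open>auto simp: lookup_add power_int_add prod.distrib[symmetric] intro!: prod.cong\<close>)

definition lpoly :: "nat \<Rightarrow> int \<Rightarrow> 'a::comm_ring_1 laurent \<Rightarrow> bool" where
  "lpoly n d P \<longleftrightarrow> (\<forall>\<beta>\<in>Poly_Mapping.keys P. Poly_Mapping.keys \<beta> \<subseteq> {..<n} \<and> (\<forall>i. Poly_Mapping.lookup \<beta> i \<ge> 0) \<and> (\<Sum>i<n. Poly_Mapping.lookup \<beta> i) = d)"

lemma lpoly_mult:
  assumes "lpoly n a P" "lpoly n b R" shows "lpoly n (a + b) (P * R)"
  unfolding lpoly_def
proof
  fix \<gamma> assume "\<gamma> \<in> Poly_Mapping.keys (P * R)"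
  then obtain \<alpha> \<beta> where *: "\<gamma> = \<alpha> + \<beta>" "\<alpha> \<in> Poly_Mapping.keys P" "\<beta> \<in> Poly_Mapping.keys R"
    using Poly_Mapping.keys_mult[of P R] by auto
  then have p: "Poly_Mapping.keys \<alpha> \<subseteq> {..<n}" "\<And>i. Poly_Mapping.lookup \<alpha> i \<ge> 0" "(\<Sum>i<n. Poly_Mapping.lookup \<alpha> i) = a"
    "Poly_Mapping.keys \<beta> \<subseteq> {..<n}" "\<And>i. Poly_Mapping.lookup \<beta> i \<ge> 0" "(\<Sum>i<n. Poly_Mapping.lookup \<beta> i) = b"
    using assms by (auto simp: lpoly_def)
  have "Poly_Mapping.keys \<gamma> \<subseteq> {..<n}" using p(1,4) Poly_Mapping.keys_add[of \<alpha> \<beta>] *(1) by blast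
  then show "Poly_Mapping.keys \<gamma> \<subseteq> {..<n} \<and> (\<forall>i. Poly_Mapping.lookup \<gamma> i \<ge> 0) \<and> (\<Sum>i<n. Poly_Mapping.lookup \<gamma> i) = a + b"
    using p *(1) by (simp add: lookup_add sum.distrib)
qed

lemma lpoly_prod: "finite A \<Longrightarrow> (\<And>x. x \<in> A \<Longrightarrow> lpoly n (d x) (f x)) \<Longrightarrow> lpoly n (sum d A) (prod f A)"
proof (induction A rule: finite_induct)
  case empty
  show ?case by (simp add: lpoly_def)
qed (simp add: lpoly_mult)

lemma lpoly_linear:
  assumes "a < n" "b < n"
  shows "lpoly n 1 (yv a 1 - lcst c * yv b 1)"
  unfolding lpoly_def
proof
  fix \<beta> :: "nat \<Rightarrow>\<^sub>0 int" assume "\<beta> \<in> Poly_Mapping.keys (yv a 1 - lcst c * yv b 1)"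
  then have "Poly_Mapping.lookup (yv a 1 - lcst c * yv b 1) \<beta> \<noteq> 0" by (simp add: in_keys_iff)
  then have "\<beta> = Poly_Mapping.single a 1 \<or> \<beta> = Poly_Mapping.single b 1"
    by (auto simp: lookup_minus lookup_lcst_mult yv_def lookup_single when_def split: if_splits)
  then obtain i where "\<beta> = Poly_Mapping.single i 1" "i < n" using assms by blast
  then show "Poly_Mapping.keys \<beta> \<subseteq> {..<n} \<and> (\<forall>i. Poly_Mapping.lookup \<beta> i \<ge> 0) \<and> (\<Sum>i<n. Poly_Mapping.lookup \<beta> i) = 1"
    by (auto simp: lookup_single when_def)
qed

text \<open>
  Use \<open>lagrange_power_sum\<close> in each variable. In a monomial of total degree \<open>n * d\<close> other than the one with all
  exponents equal to \<open>d\<close>, some exponent is smaller than \<open>d\<close>, and its factor vanishes.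
\<close>

lemma coeff_by_interpolation:
  fixes x :: "nat \<Rightarrow> 'a::field"
  assumes inj: "inj_on x {..d}" and nz: "\<And>j. j \<le> d \<Longrightarrow> x j \<noteq> 0" and P: "lpoly n (int n * int d) P"
    and \<delta>: "\<And>i. Poly_Mapping.lookup \<delta> i = (if i < n then int d else 0)"
  shows "Poly_Mapping.lookup P \<delta> =
    (\<Sum>\<alpha>\<in>PiE {..<n} (\<lambda>_. {..d}). leval n (\<lambda>i. x (\<alpha> i)) P / (\<Prod>i<n. \<Prod>l\<in>{..d} - {\<alpha> i}. x (\<alpha> i) - x l))"
proof -
  let ?w = "\<lambda>j. \<Prod>l\<in>{..d} - {j}. x j - x l" and ?A = "PiE {..<n} (\<lambda>_. {..d})"
  have ev: "leval n (\<lambda>i. x (\<alpha> i)) P = (\<Sum>\<beta>\<in>Poly_Mapping.keys P. Poly_Mapping.lookup P \<beta> * (\<Prod>i<n. x (\<alpha> i) powi Poly_Mapping.lookup \<beta> i))"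
    if "\<alpha> \<in> ?A" for \<alpha>
  proof -
    have "laurent_hom id (\<lambda>\<beta>. \<Prod>i<n. x (\<alpha> i) powi Poly_Mapping.lookup \<beta> i)"
      by (rule laurent_hom_leval) (use nz that in auto)
    then show ?thesis unfolding leval_def by (simp add: laurent_hom.lev_def lsum_def)
  qed
  have mono: "(\<Sum>\<alpha>\<in>?A. (\<Prod>i<n. x (\<alpha> i) powi Poly_Mapping.lookup \<beta> i) / (\<Prod>i<n. ?w (\<alpha> i))) = (if \<beta> = \<delta> then 1 else 0)"
    if b: "\<beta> \<in> Poly_Mapping.keys P" for \<beta>
  proof -
    have p: "Poly_Mapping.keys \<beta> \<subseteq> {..<n}" "\<And>i. Poly_Mapping.lookup \<beta> i \<ge> 0" "(\<Sum>i<n. Poly_Mapping.lookup \<beta> i) = int n * int d"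
      using P b by (auto simp: lpoly_def)
    let ?e = "\<lambda>i. nat (Poly_Mapping.lookup \<beta> i)"
    have "(\<Sum>\<alpha>\<in>?A. (\<Prod>i<n. x (\<alpha> i) powi Poly_Mapping.lookup \<beta> i) / (\<Prod>i<n. ?w (\<alpha> i))) = (\<Sum>\<alpha>\<in>?A. \<Prod>i<n. x (\<alpha> i) ^ ?e i / ?w (\<alpha> i))"
      using p(2) by (simp add: prod_dividef power_int_def)
    also have "\<dots> = (\<Prod>i<n. \<Sum>j\<le>d. x j ^ ?e i / ?w j)"
      by (rule prod_sum_PiE[symmetric]) auto
    also have "\<dots> = (if \<beta> = \<delta> then 1 else 0)"
    proof (cases "\<exists>i<n. ?e i < d")
      case True
      then obtain i where i: "i < n" "?e i < d" by blast
      then have "(\<Sum>j\<le>d. x j ^ ?e i / ?w j) = 0" using lagrange_power_sum[OF inj, of "?e i"] by simp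
      then have "(\<Prod>i<n. \<Sum>j\<le>d. x j ^ ?e i / ?w j) = 0" using i by (intro prod_zero) auto
      moreover have "\<beta> \<noteq> \<delta>" using i \<delta>[of i] by auto
      ultimately show ?thesis by simp
    next
      case False
      then have ge: "Poly_Mapping.lookup \<beta> i \<ge> int d" if "i < n" for i using that p(2)[of i] by (metis le_nat_iff not_less)
      have "(\<Sum>i<n. Poly_Mapping.lookup \<beta> i - int d) = 0" using p(3) by (simp add: sum_subtractf)
      then have eq: "Poly_Mapping.lookup \<beta> i = int d" if "i < n" for i
        using sum_nonneg_eq_0_iff[of "{..<n}" "\<lambda>i. Poly_Mapping.lookup \<beta> i - int d"] ge that by auto
      have "\<beta> = \<delta>"
      proof (rule poly_mapping_eqI)
        fix i show "Poly_Mapping.lookup \<beta> i = Poly_Mapping.lookup \<delta> i"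
          using eq[of i] \<delta>[of i] p(1) by (cases "i < n") (auto simp: in_keys_iff)
      qed
      moreover have "(\<Sum>j\<le>d. x j ^ ?e i / ?w j) = 1" if "i < n" for i
        using lagrange_power_sum[OF inj, of d] eq[OF that] by simp
      ultimately show ?thesis by simp
    qed
    finally show ?thesis .
  qed
  have "(\<Sum>\<alpha>\<in>?A. leval n (\<lambda>i. x (\<alpha> i)) P / (\<Prod>i<n. ?w (\<alpha> i)))
     = (\<Sum>\<alpha>\<in>?A. \<Sum>\<beta>\<in>Poly_Mapping.keys P. Poly_Mapping.lookup P \<beta> * ((\<Prod>i<n. x (\<alpha> i) powi Poly_Mapping.lookup \<beta> i) / (\<Prod>i<n. ?w (\<alpha> i))))"
    by (intro sum.cong) (auto simp: ev sum_divide_distrib)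
  also have "\<dots> = (\<Sum>\<beta>\<in>Poly_Mapping.keys P. Poly_Mapping.lookup P \<beta> * (\<Sum>\<alpha>\<in>?A. (\<Prod>i<n. x (\<alpha> i) powi Poly_Mapping.lookup \<beta> i) / (\<Prod>i<n. ?w (\<alpha> i))))"
    by (subst sum.swap) (simp add: sum_distrib_left)
  also have "\<dots> = (\<Sum>\<beta>\<in>Poly_Mapping.keys P. if \<beta> = \<delta> then Poly_Mapping.lookup P \<delta> else 0)"
    by (intro sum.cong) (auto simp: mono)
  also have "\<dots> = Poly_Mapping.lookup P \<delta>" by (simp add: in_keys_iff)
  finally show ?thesis by simp
qed

subsection \<open>The only point of the grid that contributes\<close>

text \<open>
  The gaps force the values to be at least \<open>m\<close> apart, so there is just enough room for them, and no gap may exceed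
  \<open>m\<close>. A smaller index with a smaller value would cost \<open>m + 1\<close>, so the values decrease.
\<close>

lemma unique_grid_point:
  assumes "finite S" "S \<noteq> {}" and m: "m > 0"
    and gap: "\<And>a b. a \<in> S \<Longrightarrow> b \<in> S \<Longrightarrow> a < b \<Longrightarrow> \<alpha> a \<ge> \<alpha> b + m \<or> \<alpha> b \<ge> \<alpha> a + m + (1 :: nat)"
    and bound: "\<And>a. a \<in> S \<Longrightarrow> \<alpha> a \<le> (card S - 1) * m"
    and i: "i \<in> S"
  shows "\<alpha> i = m * card {j \<in> S. j > (i :: nat)}"
  using assms(1,2) gap bound i
proof (induction "card S" arbitrary: S i)
  case 0
  then show ?case by simp
next
  case (Suc n)
  show ?case
  proof (cases "n = 0")
    case True
    then have "card S = 1" using Suc by simp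
    then obtain z where z: "S = {z}" by (auto simp: card_1_singleton_iff)
    then have a0: "\<alpha> i = 0" and e: "{j \<in> S. j > i} = {}" using Suc.prems by auto
    show ?thesis unfolding e a0 by simp
  next
    case False
    have "Max (\<alpha> ` S) \<in> \<alpha> ` S" using Suc.prems by (intro Max_in) auto
    then obtain M where M: "M \<in> S" "\<alpha> M = Max (\<alpha> ` S)" by auto
    have Mmax: "\<alpha> j \<le> \<alpha> M" if "j \<in> S" for j unfolding M(2) using Suc.prems that by auto
    let ?T = "S - {M}"
    have T1: "finite ?T" "card ?T = n" using Suc M by (auto simp: card_Diff_singleton)
    then have "?T \<noteq> {}" using False by (metis card.empty)
    note T = T1 this
    have Mj: "\<alpha> M \<ge> \<alpha> j + m" if "j \<in> ?T" for j
    proof (cases "j < M")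
      case True
      then show ?thesis using Suc.prems(3)[of j M] that M Mmax[of j] m by auto
    next
      case False
      then have "M < j" using that by auto
      then show ?thesis using Suc.prems(3)[of M j] that M Mmax[of j] m by auto
    qed
    have MB: "\<alpha> M \<le> n * m" using Suc.prems(4)[OF M(1)] Suc.hyps(2) by (metis diff_Suc_1)
    have IH: "\<alpha> j = m * card {j' \<in> ?T. j' > j}" if "j \<in> ?T" for j
    proof (rule Suc.hyps(1))
      fix a assume "a \<in> ?T"
      then have "\<alpha> a + m \<le> n * m" using Mj[of a] MB by simp
      then show "\<alpha> a \<le> (card ?T - 1) * m" using T by (simp add: diff_mult_distrib)
    qed (use T Suc.prems that in auto)
    let ?z = "Min ?T"
    have z: "?z \<in> ?T" using T by (intro Min_in) auto
    have "{j' \<in> ?T. j' > ?z} = ?T - {?z}" using T(1) by (auto simp: order.strict_iff_order)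
    then have az: "\<alpha> ?z = m * (n - 1)" using IH[OF z] z T by (simp add: card_Diff_singleton)
    have aM: "\<alpha> M = n * m"
    proof -
      have "m * (n - 1) + m = n * m" using False by (cases n) auto
      then show ?thesis using Mj[OF z] az MB by simp
    qed
    have nm: "n * m = m * (n - 1) + m" using False by (cases n) auto
    have Mz: "M < ?z"
    proof (rule ccontr)
      assume "\<not> M < ?z"
      then have "?z < M" using z by auto
      then show False using Suc.prems(3)[of ?z M] z M aM az nm m by auto
    qed
    have Ml: "M < j" if "j \<in> ?T" for j using Mz T(1) that by (meson Min_le less_le_trans)
    show ?thesis
    proof (cases "i = M")
      case True
      have "{j \<in> S. j > M} = ?T" using Ml by auto
      then show ?thesis using True T aM by (simp add: mult.commute)
    next
      case False
      then have "{j \<in> S. j > i} = {j \<in> ?T. j > i}" using Ml[of i] Suc.prems by auto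
      then show ?thesis using IH[of i] False Suc.prems by simp
    qed
  qed
qed

subsection \<open>The constant term\<close>

lemma prod_pairs_prs: "(\<Prod>b<n. \<Prod>a<b. f a b) = (\<Prod>(a, b)\<in>prs n. f a b)"
proof -
  have "(\<Prod>b<n. \<Prod>a<b. f a b) = (\<Prod>(b, a)\<in>(SIGMA b:{..<n}. {..<b}). f a b)"
    by (rule prod.Sigma) auto
  also have "\<dots> = (\<Prod>(a, b)\<in>prs n. f a b)"
    by (rule prod.reindex_bij_witness[of _ prod.swap prod.swap]) (auto simp: prs_def)
  finally show ?thesis .
qed

lemma prod_prs_reverse: "(\<Prod>(a, b)\<in>prs n. f a b) = (\<Prod>(a, b)\<in>prs n. f (n - Suc b) (n - Suc a))"
  by (rule prod.reindex_bij_witness[of _ "\<lambda>(a, b). (n - Suc b, n - Suc a)" "\<lambda>(a, b). (n - Suc b, n - Suc a)"])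
     (auto simp: prs_def)

lemma prod_pairs_power: "(\<Prod>b<n. \<Prod>a<b. f a * f b) = (\<Prod>i<n. f i ^ (n - 1) :: 'b::comm_monoid_mult)"
proof (induction n)
  case (Suc n)
  show ?case
  proof (cases n)
    case (Suc n')
    have "(\<Prod>i<n. f i ^ (n - 1)) * ((\<Prod>a<n. f a) * f n ^ n) = (\<Prod>i<n. f i ^ (n - 1) * f i) * f n ^ n"
      by (simp add: prod.distrib mult.assoc)
    moreover have "f i ^ (n - 1) * f i = f i ^ n" for i using Suc by (simp add: mult.commute)
    ultimately have "(\<Prod>i<n. f i ^ (n - 1)) * ((\<Prod>a<n. f a) * f n ^ n) = (\<Prod>i<n. f i ^ n) * f n ^ n" by simp
    moreover have "(\<Prod>a<n. f a * f n) = (\<Prod>a<n. f a) * f n ^ n" by (simp add: prod.distrib)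
    ultimately show ?thesis unfolding prod.lessThan_Suc[of _ n] Suc.IH by simp
  qed simp
qed simp

lemma prod_blocks: "(\<Prod>c<k. \<Prod>r<m. f (m * c + r)) = (\<Prod>l<m * k. f (l :: nat))"
proof (induction k)
  case (Suc k)
  have "{..<m * Suc k} = {..<m * k} \<union> (\<lambda>r. m * k + r) ` {..<m}"
  proof (intro equalityI subsetI)
    fix l assume "l \<in> {..<m * Suc k}"
    then have "l < m * k \<or> l = m * k + (l - m * k) \<and> l - m * k < m" by auto
    then show "l \<in> {..<m * k} \<union> (\<lambda>r. m * k + r) ` {..<m}" by blast
  qed auto
  moreover have "(\<Prod>l\<in>{..<m * k} \<union> (\<lambda>r. m * k + r) ` {..<m}. f l) = (\<Prod>l<m * k. f l) * (\<Prod>r<m. f (m * k + r))"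
    by (subst prod.union_disjoint) (auto simp: prod.reindex inj_on_def)
  ultimately show ?case using Suc by simp
qed simp

lemma prod_blocks_from: "c \<le> n \<Longrightarrow> (\<Prod>b\<in>{c..<n}. \<Prod>r<m. f (m * b + r)) = (\<Prod>l\<in>{m * c..<m * n}. f (l :: nat) :: 'b::comm_monoid_mult)"
proof -
  assume c: "c \<le> n"
  have "(\<Prod>b\<in>{c..<n}. \<Prod>r<m. f (m * b + r)) = (\<Prod>b<n - c. \<Prod>r<m. f (m * c + (m * b + r)))"
    by (rule prod.reindex_bij_witness[of _ "\<lambda>b. b + c" "\<lambda>b. b - c"]) (use c in \<open>auto simp: le_iff_add algebra_simps\<close>)
  also have "\<dots> = (\<Prod>l<m * (n - c). f (m * c + l))" by (rule prod_blocks)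
  also have "\<dots> = (\<Prod>l\<in>{m * c..<m * n}. f l)"
    using c by (intro prod.reindex_bij_witness[of _ "\<lambda>l. l - m * c" "\<lambda>l. m * c + l"]) (auto simp: diff_mult_distrib2)
  finally show ?thesis .
qed

lemma prod_pairs_swap: "(\<Prod>b<n. \<Prod>a<b. f a b) = (\<Prod>a<n. \<Prod>b\<in>{Suc a..<n}. f a b)"
proof -
  have "(\<Prod>a<n. \<Prod>b\<in>{Suc a..<n}. f a b) = (\<Prod>(a, b)\<in>(SIGMA a:{..<n}. {Suc a..<n}). f a b)"
    by (rule prod.Sigma) auto
  also have "(SIGMA a:{..<n}. {Suc a..<n}) = prs n" by (auto simp: prs_def)
  finally show ?thesis by (simp add: prod_pairs_prs)
qed

lemma qpoch_power_nz:
  fixes q :: "'a::field"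
  assumes "\<And>i. i > 0 \<Longrightarrow> q ^ i \<noteq> 1"
  shows "qpoch q q n \<noteq> 0"
  using assms[of "Suc _"] by (auto simp: qpoch_def)

lemma qpoch_q: "qpoch q q n = (\<Prod>l\<in>{1..n}. 1 - (q :: 'a::comm_ring_1) ^ l)"
  unfolding qpoch_def by (rule prod.reindex_bij_witness[of _ "\<lambda>l. l - 1" Suc]) auto

lemma qpoch_q_split: "(\<Prod>l\<in>{Suc a..a + n}. 1 - (q :: 'a::field) ^ l) * qpoch q q a = qpoch q q (a + n)"
proof -
  have "{1..a + n} = {1..a} \<union> {Suc a..a + n}" by auto
  then show ?thesis unfolding qpoch_q by (simp add: prod.union_disjoint mult.commute)
qed

text \<open>
  The proof of Karolyi and Nagy. After multiplication by a monomial the product is a homogeneous polynomial whose linear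
  factors are \<open>y\<^sub>b - q\<^sup>r y\<^sub>a\<close>. On the grid of powers of \<open>q\<close> it vanishes at all points except one, and there both the value and
  the interpolation weights are products of \<open>q\<close>-factorials.
\<close>

theorem q_dyson:
  fixes q :: "'a::field"
  assumes q0: "q \<noteq> 0" and q1: "\<And>i. i > 0 \<Longrightarrow> q ^ i \<noteq> 1" and m: "m > 0" and n: "n > 0"
  shows "Poly_Mapping.lookup (DP q m n 0) 0 = qpoch q q (n * m) / qpoch q q m ^ n"
proof -
  let ?d = "(n - 1) * m" and ?x = "\<lambda>j :: nat. q ^ j"
  have qinj: "q ^ i = q ^ j \<longleftrightarrow> i = j" for i j
  proof -
    have *: "i = j" if "q ^ i = q ^ j" "i \<le> j" for i j
    proof (rule ccontr)
      assume "i \<noteq> j"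
      then have "j - i > 0" using that by simp
      have "q ^ j = q ^ i * q ^ (j - i)" using that(2) by (simp flip: power_add)
      then have "q ^ (j - i) = 1" using that q0 by simp
      then show False using q1 \<open>j - i > 0\<close> by blast
    qed
    show ?thesis using *[of i j] *[of j i] by (metis nat_le_linear)
  qed
  have inj: "inj_on ?x {..?d}" by (auto simp: inj_on_def qinj)
  define F where "F a b = (\<Prod>r<m. (yv b 1 - lcst (q ^ Suc r) * yv a 1) * (yv a 1 - lcst (q ^ r) * yv b 1 :: 'a laurent))" for a b
  define P where "P = (\<Prod>(a, b)\<in>prs n. F a b)"
  have FD: "F a b = yv a (int m) * yv b (int m) * dth q m b a" for a b
  proof -
    have "yv b 1 - lcst (q ^ Suc r) * yv a 1 = yv b 1 * (1 - lcst q * rt a b * lcst q ^ r)" for r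
      by (simp add: rt_def right_diff_distrib lcst_mult lcst_power yv_inverse mult_ac)
    moreover have "yv a 1 - lcst (q ^ r) * yv b 1 = yv a 1 * (1 - rt b a * lcst q ^ r)" for r
      by (simp add: rt_def right_diff_distrib lcst_power yv_inverse mult_ac)
    ultimately have "F a b = (\<Prod>r<m. yv b 1) * (\<Prod>r<m. yv a 1) * dth q m b a"
      unfolding F_def dth_def qpoch_def by (simp add: prod.distrib mult_ac)
    then show ?thesis by (simp add: yv_power mult_ac)
  qed
  have PD: "P = ymon n (int ?d) * DP q m n 0"
  proof -
    have "P = (\<Prod>b<n. \<Prod>a<b. yv a (int m) * yv b (int m)) * (\<Prod>b<n. \<Prod>a<b. dth q m b a)"
      unfolding P_def FD prod_pairs_prs[symmetric] by (simp add: prod.distrib)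
    also have "(\<Prod>b<n. \<Prod>a<b. yv a (int m) * yv b (int m)) = ymon n (int ?d)"
      unfolding prod_pairs_power ymon_def by (simp add: yv_power)
    also have "(\<Prod>b<n. \<Prod>a<b. dth q m b a) = DP q m n 0" by (simp add: DP_def DS_def lessThan_atLeast0)
    finally show ?thesis .
  qed
  define \<delta> where "\<delta> = (\<Sum>i<n. Poly_Mapping.single i (int ?d))"
  have \<delta>: "Poly_Mapping.lookup \<delta> i = (if i < n then int ?d else 0)" for i
    by (simp add: \<delta>_def lookup_sum lookup_single when_def)
  have ym: "ymon n (int ?d) = Poly_Mapping.single \<delta> (1 :: 'a)"
  proof -
    have "(\<Prod>i\<in>A. yv i e :: 'a laurent) = Poly_Mapping.single (\<Sum>i\<in>A. Poly_Mapping.single i e) 1" if "finite A" for A e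
      using that by (induction A rule: finite_induct) (auto simp: yv_def mult_single)
    then show ?thesis by (simp add: ymon_def \<delta>_def)
  qed
  have coeff: "Poly_Mapping.lookup P \<delta> = Poly_Mapping.lookup (DP q m n 0) 0"
  proof -
    have "Poly_Mapping.lookup (Poly_Mapping.single \<delta> 1 * X) \<delta> = Poly_Mapping.lookup X 0" for X :: "'a laurent"
      by (induction X rule: laurent_induct) (simp_all add: mult_single lookup_single distrib_left lookup_add when_def)
    then show ?thesis unfolding PD ym .
  qed
  have lp: "lpoly n (int n * int ?d) P"
  proof -
    have "lpoly n (\<Sum>r<m. 1 + 1) (F a b)" if "(a, b) \<in> prs n" for a b
      unfolding F_def using that by (intro lpoly_prod lpoly_mult lpoly_linear) (auto simp: prs_def)
    then have "lpoly n (\<Sum>p\<in>prs n. \<Sum>r<m. 1 + 1) P"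
      unfolding P_def by (intro lpoly_prod) auto
    moreover have "(\<Sum>p\<in>prs n. \<Sum>r<m. 1 + 1 :: int) = int n * int ?d"
    proof -
      have "card (prs n) = (\<Sum>b<n. b)"
      proof -
        have "card (prs n) = card (SIGMA b:{..<n}. {..<b})"
          by (rule bij_betw_same_card[of prod.swap]) (auto simp: bij_betw_def prs_def inj_on_def image_iff)
        then show ?thesis by simp
      qed
      moreover have "2 * (\<Sum>b<n. b) = n * (n - 1)"
      proof (induction n)
        case (Suc n)
        then show ?case by (cases n) (auto simp: algebra_simps)
      qed simp
      ultimately have "2 * card (prs n) = n * (n - 1)" by simp
      then have "int (2 * card (prs n)) = int (n * (n - 1))" by simp
      then have "2 * int (card (prs n)) = int n * int (n - 1)" by simp
      then have "int m * (2 * int (card (prs n))) = int m * (int n * int (n - 1))" by simp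
      then show ?thesis by (simp add: mult_ac)
    qed
    ultimately show ?thesis by (simp only:)
  qed
  let ?W = "\<lambda>j. \<Prod>l\<in>{..?d} - {j}. q ^ j - q ^ l"
  define v where "v \<alpha> = (\<Prod>(a, b)\<in>prs n. \<Prod>r<m. (q ^ \<alpha> b - q ^ Suc r * q ^ \<alpha> a) * (q ^ \<alpha> a - q ^ r * q ^ \<alpha> b))" for \<alpha> :: "nat \<Rightarrow> nat"
  have evP: "leval n (\<lambda>i. q ^ \<alpha> i) P = v \<alpha>" for \<alpha>
  proof -
    have h: "laurent_hom id (\<lambda>\<beta>. \<Prod>i<n. (q ^ \<alpha> i) powi Poly_Mapping.lookup \<beta> i)"
      by (rule laurent_hom_leval) (use q0 in auto)
    have y: "leval n (\<lambda>i. q ^ \<alpha> i) (yv a 1) = q ^ \<alpha> a" if "a < n" for a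
    proof -
      have "(\<Prod>i<n. (q ^ \<alpha> i) powi Poly_Mapping.lookup (Poly_Mapping.single a 1) i) = (\<Prod>i<n. if i = a then q ^ \<alpha> a else 1)"
        by (intro prod.cong) (auto simp: lookup_single when_def)
      then show ?thesis using that by (simp add: leval_def laurent_hom.lev_yv[OF h])
    qed
    have "leval n (\<lambda>i. q ^ \<alpha> i) P = (\<Prod>p\<in>prs n. leval n (\<lambda>i. q ^ \<alpha> i) (case p of (a, b) \<Rightarrow> F a b))"
      unfolding P_def by (simp add: leval_def laurent_hom.lev_prod[OF h])
    also have "\<dots> = v \<alpha>"
      unfolding v_def F_def
      by (intro prod.cong)
         (auto simp: prs_def y laurent_hom.lev_prod[OF h, folded leval_def] laurent_hom.lev_mult[OF h, folded leval_def] laurent_hom.lev_diff[OF h, folded leval_def] laurent_hom.lev_lcst[OF h, folded leval_def])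
    finally show ?thesis .
  qed
  \<comment> \<open>The surviving grid point; a nonzero value satisfies the hypotheses of \<open>unique_grid_point\<close>.\<close>
  define \<alpha>0 where "\<alpha>0 = (\<lambda>i\<in>{..<n}. m * (n - Suc i))"
  have v0: "\<alpha> = \<alpha>0" if \<alpha>: "\<alpha> \<in> PiE {..<n} (\<lambda>_. {..?d})" and nz: "v \<alpha> \<noteq> 0" for \<alpha>
  proof (rule PiE_ext[OF \<alpha>])
    show "\<alpha>0 \<in> PiE {..<n} (\<lambda>_. {..?d})" by (auto simp: \<alpha>0_def mult.commute)
    fix i assume i: "i \<in> {..<n}"
    \<comment> \<open>If two values are too close, one of the linear factors vanishes.\<close>
    have gap: "\<alpha> a \<ge> \<alpha> b + m \<or> \<alpha> b \<ge> \<alpha> a + m + 1" if "a \<in> {..<n}" "b \<in> {..<n}" "a < b" for a b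
    proof (rule ccontr)
      assume c: "\<not> (\<alpha> a \<ge> \<alpha> b + m \<or> \<alpha> b \<ge> \<alpha> a + m + 1)"
      have "(\<Prod>r<m. (q ^ \<alpha> b - q ^ Suc r * q ^ \<alpha> a) * (q ^ \<alpha> a - q ^ r * q ^ \<alpha> b)) = 0"
      proof (cases "\<alpha> b \<le> \<alpha> a")
        case True
        then have "\<alpha> a - \<alpha> b < m" "\<alpha> a = (\<alpha> a - \<alpha> b) + \<alpha> b" using c by auto
        moreover from this(2) have "q ^ \<alpha> a - q ^ (\<alpha> a - \<alpha> b) * q ^ \<alpha> b = 0" by (metis eq_iff_diff_eq_0 power_add)
        ultimately show ?thesis by (intro prod_zero) (auto intro!: bexI[of _ "\<alpha> a - \<alpha> b"])
      next
        case False
        then have *: "\<alpha> b - Suc (\<alpha> a) < m" "\<alpha> b = Suc (\<alpha> b - Suc (\<alpha> a)) + \<alpha> a" using c by auto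
        from *(2) have "q ^ \<alpha> b - q ^ Suc (\<alpha> b - Suc (\<alpha> a)) * q ^ \<alpha> a = 0" by (metis eq_iff_diff_eq_0 power_add)
        then show ?thesis using *(1) by (intro prod_zero bexI[of _ "\<alpha> b - Suc (\<alpha> a)"]) auto
      qed
      moreover have "(a, b) \<in> prs n" using that by (auto simp: prs_def)
      ultimately have "v \<alpha> = 0" unfolding v_def by (intro prod_zero bexI[of _ "(a, b)"]) auto
      then show False using nz by simp
    qed
    have "\<alpha> i = m * card {j \<in> {..<n}. j > i}"
      by (rule unique_grid_point[OF _ _ m gap]) (use \<alpha> i n in auto)
    moreover have "{j \<in> {..<n}. j > i} = {Suc i..<n}" by auto
    ultimately show "\<alpha> i = \<alpha>0 i" using i by (simp add: \<alpha>0_def)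
  qed
  have "Poly_Mapping.lookup (DP q m n 0) 0 = (\<Sum>\<alpha>\<in>PiE {..<n} (\<lambda>_. {..?d}). v \<alpha> / (\<Prod>i<n. ?W (\<alpha> i)))"
    unfolding coeff[symmetric] evP[symmetric]
    by (rule coeff_by_interpolation[OF inj _ lp \<delta>]) (use q0 in auto)
  also have "\<dots> = v \<alpha>0 / (\<Prod>i<n. ?W (\<alpha>0 i))"
  proof -
    have "\<alpha>0 \<in> PiE {..<n} (\<lambda>_. {..?d})" by (auto simp: \<alpha>0_def mult.commute)
    moreover have "finite (PiE {..<n} (\<lambda>_. {..?d}))" by (intro finite_PiE) auto
    ultimately have "(\<Sum>\<alpha>\<in>PiE {..<n} (\<lambda>_. {..?d}). v \<alpha> / (\<Prod>i<n. ?W (\<alpha> i))) = (\<Sum>\<alpha>\<in>{\<alpha>0}. v \<alpha> / (\<Prod>i<n. ?W (\<alpha> i)))"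
      using v0 by (intro sum.mono_neutral_right) auto
    then show ?thesis by simp
  qed
  also have "(\<Prod>i<n. ?W (\<alpha>0 i)) = (\<Prod>c<n. ?W (m * c))"
  proof -
    have "(\<Prod>i<n. ?W (\<alpha>0 i)) = (\<Prod>i<n. ?W (m * (n - Suc i)))" by (intro prod.cong) (auto simp: \<alpha>0_def)
    also have "\<dots> = (\<Prod>c<n. ?W (m * c))" by (rule prod.nat_diff_reindex)
    finally show ?thesis .
  qed
  also have "v \<alpha>0 = (\<Prod>(c', c)\<in>prs n. \<Prod>r<m. (q ^ (m * c') - q ^ (m * c + Suc r)) * (q ^ (m * c) - q ^ (m * c' + r)))"
    unfolding v_def by (subst prod_prs_reverse) (auto simp: prs_def \<alpha>0_def power_add mult_ac intro!: prod.cong)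
  also have "\<dots> = (\<Prod>c'<n. \<Prod>c\<in>{Suc c'..<n}. \<Prod>r<m. q ^ (m * c') - q ^ (m * c + Suc r)) * (\<Prod>c<n. \<Prod>c'<c. \<Prod>r<m. q ^ (m * c) - q ^ (m * c' + r))"
    unfolding prod_pairs_swap[symmetric] prod_pairs_prs by (simp add: prod.distrib case_prod_unfold)
  also have "(\<Prod>c'<n. \<Prod>c\<in>{Suc c'..<n}. \<Prod>r<m. q ^ (m * c') - q ^ (m * c + Suc r)) = (\<Prod>c<n. \<Prod>l\<in>{m * Suc c..<m * n}. q ^ (m * c) - q ^ Suc l)"
  proof (rule prod.cong[OF refl])
    fix c assume "c \<in> {..<n}"
    then show "(\<Prod>c'\<in>{Suc c..<n}. \<Prod>r<m. q ^ (m * c) - q ^ (m * c' + Suc r)) = (\<Prod>l\<in>{m * Suc c..<m * n}. q ^ (m * c) - q ^ Suc l)"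
      using prod_blocks_from[of "Suc c" n "\<lambda>l. q ^ (m * c) - q ^ Suc l" m] by simp
  qed
  also have "(\<Prod>c<n. \<Prod>c'<c. \<Prod>r<m. q ^ (m * c) - q ^ (m * c' + r)) = (\<Prod>c<n. \<Prod>l<m * c. q ^ (m * c) - q ^ l)"
    by (rule prod.cong[OF refl]) (rule prod_blocks)
  also have "(\<Prod>c<n. \<Prod>l\<in>{m * Suc c..<m * n}. q ^ (m * c) - q ^ Suc l) * (\<Prod>c<n. \<Prod>l<m * c. q ^ (m * c) - q ^ l) / (\<Prod>c<n. ?W (m * c))
     = (\<Prod>c<n. qpoch q q (m * Suc (n - Suc c)) / (qpoch q q m * qpoch q q (m * (n - Suc c))))"
    unfolding prod.distrib[symmetric] prod_dividef[symmetric]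
  proof (rule prod.cong)
    fix c assume "c \<in> {..<n}"
    then have c: "c < n" by simp
    define c' where "c' = n - Suc c"
    have nc: "n = Suc c + c'" using c by (simp add: c'_def)
    have d: "?d = m * c + m * c'" by (simp add: nc algebra_simps)
    have W: "?W (m * c) = (\<Prod>l<m * c. q ^ (m * c) - q ^ l) * (\<Prod>l\<in>{1..m * c'}. q ^ (m * c) - q ^ (m * c + l))"
    proof -
      have "{..?d} - {m * c} = {..<m * c} \<union> (\<lambda>l. m * c + l) ` {1..m * c'}"
        unfolding d
      proof (intro equalityI subsetI)
        fix l assume "l \<in> {..m * c + m * c'} - {m * c}"
        then have "l < m * c \<or> l = m * c + (l - m * c) \<and> l - m * c \<in> {1..m * c'}" by auto
        then show "l \<in> {..<m * c} \<union> (\<lambda>l. m * c + l) ` {1..m * c'}" by blast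
      qed auto
      moreover have "(\<Prod>l\<in>{..<m * c} \<union> (\<lambda>l. m * c + l) ` {1..m * c'}. q ^ (m * c) - q ^ l) =
         (\<Prod>l<m * c. q ^ (m * c) - q ^ l) * (\<Prod>l\<in>{1..m * c'}. q ^ (m * c) - q ^ (m * c + l))"
      proof -
        have "(\<Prod>l\<in>(\<lambda>l. m * c + l) ` {1..m * c'}. q ^ (m * c) - q ^ l) = (\<Prod>l\<in>{1..m * c'}. q ^ (m * c) - q ^ (m * c + l))"
          by (rule prod.reindex_cong[OF _ refl]) (auto simp: inj_on_def)
        moreover have "{..<m * c} \<inter> (\<lambda>l. m * c + l) ` {1..m * c'} = {}" by auto
        ultimately show ?thesis by (simp only: prod.union_disjoint finite_lessThan finite_imageI finite_atLeastAtMost)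
      qed
      ultimately show ?thesis by (simp only:)
    qed
    have nz: "(\<Prod>l<m * c. q ^ (m * c) - q ^ l) \<noteq> 0" by (auto simp: qinj)
    have A: "(\<Prod>l\<in>{m * Suc c..<m * n}. q ^ (m * c) - q ^ Suc l) = (\<Prod>l\<in>{Suc m..m + m * c'}. q ^ (m * c) - q ^ (m * c + l))"
      by (rule prod.reindex_bij_witness[of _ "\<lambda>l. m * c + l - 1" "\<lambda>l. Suc l - m * c"]) (auto simp: nc algebra_simps)
    have f: "q ^ (m * c) - q ^ (m * c + l) = q ^ (m * c) * (1 - q ^ l)" for l by (simp add: power_add algebra_simps)
    have B: "(\<Prod>l\<in>{Suc m..m + m * c'}. q ^ (m * c) - q ^ (m * c + l)) = (q ^ (m * c)) ^ (m * c') * (\<Prod>l\<in>{Suc m..m + m * c'}. 1 - q ^ l)"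
      "(\<Prod>l\<in>{1..m * c'}. q ^ (m * c) - q ^ (m * c + l)) = (q ^ (m * c)) ^ (m * c') * qpoch q q (m * c')"
      unfolding f prod.distrib by (simp_all add: qpoch_q)
    have qn: "qpoch q q j \<noteq> 0" for j by (rule qpoch_power_nz[OF q1])
    have "(\<Prod>l\<in>{m * Suc c..<m * n}. q ^ (m * c) - q ^ Suc l) * (\<Prod>l<m * c. q ^ (m * c) - q ^ l) / ?W (m * c) =
       (\<Prod>l\<in>{Suc m..m + m * c'}. 1 - q ^ l) / qpoch q q (m * c')"
      unfolding W A B using nz q0 by (simp add: field_simps)
    also have "(\<Prod>l\<in>{Suc m..m + m * c'}. 1 - q ^ l) = qpoch q q (m + m * c') / qpoch q q m"
      using qpoch_q_split[where a = m and n = "m * c'" and q = q] qn[of m] by (simp add: field_simps)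
    finally show "(\<Prod>l\<in>{m * Suc c..<m * n}. q ^ (m * c) - q ^ Suc l) * (\<Prod>l<m * c. q ^ (m * c) - q ^ l) / ?W (m * c) =
       qpoch q q (m * Suc (n - Suc c)) / (qpoch q q m * qpoch q q (m * (n - Suc c)))"
      by (simp add: c'_def)
  qed simp
  also have "\<dots> = (\<Prod>c<n. qpoch q q (m * Suc c) / (qpoch q q m * qpoch q q (m * c)))"
    by (rule prod.nat_diff_reindex)
  also have "\<dots> = qpoch q q (n * m) / qpoch q q m ^ n"
  proof -
    have "(\<Prod>c<n. qpoch q q (m * Suc c) / (qpoch q q m * qpoch q q (m * c))) = qpoch q q (m * n) / qpoch q q m ^ n" for n
      using qpoch_power_nz[OF q1, of "m * _"] by (induction n) (auto simp: qpoch_def[of _ _ 0] field_simps)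
    then show ?thesis by (simp add: mult.commute)
  qed
  finally show ?thesis .
qed

section \<open>Rectangular Macdonald functions\<close>

subsection \<open>The symmetric weight gives an eigenvector\<close>

context macdonald_params
begin

lemma tw_rt: "tw i (rt a b) = (if a = i \<and> b \<noteq> i then lcst q * rt a b else if b = i \<and> a \<noteq> i then lcst (inverse q) * rt a b else rt a b)"
proof -
  have "q powi 1 = q" "q powi (- 1) = inverse q" by (simp_all add: power_int_minus)
  moreover have "lcst q * lcst (inverse q) = 1" using q0 by (simp flip: lcst_mult)
  ultimately show ?thesis
    by (auto simp: rt_def tw_mult tw_yv mult_ac)
qed

lemma tw_qpoch: "tw i (qpoch x (lcst c) m) = qpoch (tw i x) (lcst c) m"
  by (simp add: qpoch_def tw_prod tw_diff tw_1 tw_mult laurent_hom.lev_power[OF laurent_hom_tw, folded tw_def] tw_lcst)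

text \<open>The symmetric weight of a pair, divided by the Vandermonde factor.\<close>

definition dw :: "nat \<Rightarrow> nat \<Rightarrow> nat \<Rightarrow> 'a laurent" where
  "dw m a b = qpoch (lcst q * rt a b) (lcst q) (m - 1) * qpoch (rt b a) (lcst q) m"

lemma dw_vandermonde: "m > 0 \<Longrightarrow> (1 - rt a b) * dw m a b = dk q m a b * dk q m b a"
  using qpoch_Suc'[of "rt a b" "lcst q" "m - 1"] by (simp add: dw_def dk_def mult.assoc[symmetric])

definition lcf' :: "nat \<Rightarrow> nat \<Rightarrow> 'a laurent" where
  "lcf' i j = (if i < j then lcst u - rt i j else 1 - lcst u * rt j i)"

text \<open>
  The shift exchanges the two forms of the rational coefficient: the weight \<open>dw\<close> is self-reciprocal under it.
\<close>

lemma tw_dw: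
  assumes m: "m > 0" and t: "t = q ^ m" and ij: "j \<noteq> i"
  shows "tw i (lcf u i j * dw m (min i j) (max i j)) = lcf' i j * dw m (min i j) (max i j)"
proof -
  let ?Q = "lcst q" and ?Qi = "lcst (inverse q)" and ?U = "lcst u"
  have q: "?Qi * ?Q = 1" using q0 by (simp flip: lcst_mult)
  have uu: "?U * ?Q ^ m = 1" using t t0 by (simp flip: lcst_mult lcst_power)
  show ?thesis
  proof (cases "i < j")
    case True
    have "tw i (lcf u i j * dw m (min i j) (max i j)) =
      (1 - ?U * (?Q * rt i j)) * (qpoch (?Q * (?Q * rt i j)) ?Q (m - 1) * qpoch (?Qi * rt j i) ?Q m)"
      using True by (simp add: lcf_def dw_def tw_mult tw_diff tw_1 tw_lcst tw_qpoch tw_rt)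
    also have "\<dots> = (?U - rt i j) * (qpoch (?Q * rt i j) ?Q (m - 1) * qpoch (rt j i) ?Q m)"
      by (rule qpoch_shift_up[OF q uu rt_inverse m])
    finally show ?thesis using True by (simp add: lcf'_def dw_def)
  next
    case False
    then have l: "j < i" using ij by simp
    have qq: "?Q * (?Qi * rt j i) = rt j i" using q by (simp add: mult.assoc[symmetric] mult.commute[of ?Q])
    have "tw i (lcf u i j * dw m (min i j) (max i j)) =
      (?U - ?Qi * rt j i) * (qpoch (rt j i) ?Q (m - 1) * qpoch (?Q * rt i j) ?Q m)"
      using l by (simp add: lcf_def dw_def tw_mult tw_diff tw_1 tw_lcst tw_qpoch tw_rt qq)
    also have "\<dots> = (1 - ?U * rt j i) * (qpoch (?Q * rt j i) ?Q (m - 1) * qpoch (rt i j) ?Q m)"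
      by (rule qpoch_shift_down[OF q uu rt_inverse m])
    finally show ?thesis using l by (simp add: lcf'_def dw_def)
  qed
qed

lemma to_fract_lcf':
  assumes "i \<noteq> j"
  shows "to_fract (lcf' i j) = to_fract (1 - rt (min i j) (max i j)) *
    ((to_fract (yv i 1) - to_fract (lcst u) * to_fract (yv j 1)) / (to_fract (yv i 1) - to_fract (yv j 1)))"
proof -
  let ?y = "\<lambda>i. to_fract (yv i 1 :: 'a laurent)" and ?u = "to_fract (lcst u)"
  have n: "?y i \<noteq> 0" "?y j \<noteq> 0" "?y i - ?y j \<noteq> 0" using yv_fract_neq[OF assms] by (auto simp: yv_nz)
  show ?thesis
  proof (cases "i < j")
    case True
    have "to_fract (lcf' i j) = - ((?y i - ?u * ?y j) / ?y j)"
      using True n by (simp add: lcf'_def to_fract_rt diff_divide_distrib)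
    moreover have "to_fract (1 - rt (min i j) (max i j) :: 'a laurent) = - ((?y i - ?y j) / ?y j)"
      using True n by (simp add: to_fract_rt diff_divide_distrib)
    ultimately show ?thesis using n by simp
  next
    case False
    then have l: "j < i" using assms by simp
    have "to_fract (lcf' i j) = (?y i - ?u * ?y j) / ?y i"
      using l n by (simp add: lcf'_def to_fract_rt diff_divide_distrib)
    moreover have "to_fract (1 - rt (min i j) (max i j) :: 'a laurent) = (?y i - ?y j) / ?y i"
      using l n by (simp add: to_fract_rt diff_divide_distrib)
    ultimately show ?thesis using n by simp
  qed
qed

lemma tw_ymon: "i < n \<Longrightarrow> tw i (ymon n k) = lcst (q powi k) * ymon n k"
proof -
  assume i: "i < n"
  have "tw i (ymon n k) = (\<Prod>j<n. (if j = i then lcst (q powi k) else 1) * yv j k)"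
    by (simp add: ymon_def tw_prod tw_yv)
  also have "\<dots> = (\<Prod>j<n. if j = i then lcst (q powi k) else 1) * ymon n k"
    unfolding prod.distrib ymon_def ..
  finally show ?thesis using i by simp
qed

lemma homog_ymon: "homog n (int n * k) (ymon n k)"
proof -
  have "homog n (int (card A) * k) (\<Prod>i\<in>A. yv i k :: 'b::comm_ring_1 laurent)" if "A \<subseteq> {..<n}" "finite A" for A
    using that(2,1)
  proof (induction A rule: finite_induct)
    case empty
    show ?case by (simp add: homog_1)
  next
    case (insert a A)
    then have "homog n (k + int (card A) * k) (yv a k * (\<Prod>i\<in>A. yv i k :: 'b laurent))"
      by (intro homog_mult homog_yv) auto
    then show ?case using insert by (simp add: algebra_simps)
  qed
  from this[of "{..<n}"] show ?thesis by (simp add: ymon_def)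
qed

lemma homog_qpoch: "homog n 0 x \<Longrightarrow> homog n 0 (qpoch x (lcst c) m)"
  unfolding qpoch_def lcst_power[symmetric]
  by (intro homog_prod homog_diff homog_1) (metis homog_mult0 homog_lcst mult.commute)

lemma homog_dw: "a < n \<Longrightarrow> b < n \<Longrightarrow> homog n 0 (dw m a b)"
  unfolding dw_def by (intro homog_mult0 homog_qpoch homog_rt homog_lcst)

text \<open>
  The \<open>q\<close>-shift of coefficient times weight is the same weight with the opposite coefficient, whose sum over \<open>i\<close> is a
  constant. By \<open>Dop_G\<close> the operator therefore multiplies the image of the weight under \<open>G\<close> by a scalar.
\<close>

theorem Dop_symmetric_weight:
  assumes m: "m > 0" and t: "t = q ^ m"
  shows "Dop (n * k) (G n (ymon n (int k) * DP q m n n)) =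
     sf_scale ((1 - u ^ n) * (q ^ k - 1)) (G n (ymon n (int k) * DP q m n n))"
proof -
  let ?D = "DP q m n n" and ?Y = "ymon n (int k) :: 'a laurent"
  let ?W = "\<Prod>(a, b)\<in>prs n. dw m a b"
  let ?P = "?Y * ?W"
  let ?S = "\<lambda>i. {p \<in> prs n. fst p \<noteq> i \<and> snd p \<noteq> i}"
  have VW: "lvand n * ?W = ?D"
  proof -
    have "lvand n * ?W = (\<Prod>(a, b)\<in>prs n. (1 - rt a b) * dw m a b)"
      unfolding lvand_def prod.distrib[symmetric] by (simp add: case_prod_unfold)
    then show ?thesis by (simp add: dw_vandermonde[OF m] DP_def DS_prs)
  qed
  define X where "X i = (\<Prod>(a, b)\<in>?S i. 1 - rt a b) * (\<Prod>j\<in>{..<n} - {i}. lcf' i j)" for i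
  have tP: "tw i (lvandA u n i * ?P) = lcst (q ^ k) * (?Y * (X i * ?W))" if i: "i < n" for i
  proof -
    have W: "?W = (\<Prod>(a, b)\<in>?S i. dw m a b) * (\<Prod>j\<in>{..<n} - {i}. dw m (min i j) (max i j))"
      using prod_prs_split[OF i, of "\<lambda>(a, b). dw m a b"] by simp
    have A: "lvandA u n i * ?W = (\<Prod>(a, b)\<in>?S i. (1 - rt a b) * dw m a b) * (\<Prod>j\<in>{..<n} - {i}. lcf u i j * dw m (min i j) (max i j))"
      unfolding lvandA_def W by (simp add: prod.distrib case_prod_unfold mult_ac)
    have "tw i (lvandA u n i * ?W) = (\<Prod>(a, b)\<in>?S i. (1 - rt a b) * dw m a b) * (\<Prod>j\<in>{..<n} - {i}. lcf' i j * dw m (min i j) (max i j))"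
    proof -
      have "tw i (\<Prod>(a, b)\<in>?S i. (1 - rt a b) * dw m a b) = (\<Prod>(a, b)\<in>?S i. (1 - rt a b) * dw m a b)"
        unfolding tw_prod
        by (intro prod.cong) (auto simp: tw_mult tw_diff tw_1 tw_lcst tw_qpoch tw_rt dw_def)
      moreover have "tw i (\<Prod>j\<in>{..<n} - {i}. lcf u i j * dw m (min i j) (max i j)) = (\<Prod>j\<in>{..<n} - {i}. lcf' i j * dw m (min i j) (max i j))"
        unfolding tw_prod by (intro prod.cong refl tw_dw[OF m t]) auto
      ultimately show ?thesis unfolding A tw_mult by simp
    qed
    also have "\<dots> = X i * ?W" unfolding X_def W by (simp add: prod.distrib case_prod_unfold mult_ac)
    finally have e: "tw i (lvandA u n i * ?W) = X i * ?W" .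
    have "tw i (lvandA u n i * ?P) = tw i ?Y * tw i (lvandA u n i * ?W)" by (simp add: tw_mult mult_ac)
    then show ?thesis unfolding e tw_ymon[OF i] by (simp add: mult_ac)
  qed
  \<comment> \<open>The partial fraction coefficients sum to a constant.\<close>
  have XS: "(\<Sum>i<n. X i) = lcst ((1 - u ^ n) / (1 - u)) * lvand n"
  proof -
    let ?y = "\<lambda>i. to_fract (yv i 1 :: 'a laurent)" and ?u = "to_fract (lcst u)"
    have u1: "1 - u \<noteq> 0" using u_neq_1 by simp
    have Xf: "to_fract (X i) = to_fract (lvand n) * HL_A ?u n ?y i" if i: "i < n" for i
    proof -
      have "to_fract (\<Prod>j\<in>{..<n} - {i}. lcf' i j) = to_fract (\<Prod>j\<in>{..<n} - {i}. 1 - rt (min i j) (max i j)) * HL_A ?u n ?y i"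
        unfolding HL_A_def to_fract_prod prod.distrib[symmetric] by (intro prod.cong refl to_fract_lcf') auto
      then show ?thesis unfolding X_def lvand_def prod_prs_split[OF i, of "\<lambda>(a, b). 1 - rt a b"] by (simp add: mult.assoc)
    qed
    have "(1 - ?u) * (\<Sum>i<n. HL_A ?u n ?y i) = 1 - ?u ^ n"
      by (rule HL_A_sum) (use t0 yv_nz yv_fract_neq lcst_eq_iff[of u 0] in \<open>auto simp: inj_on_def\<close>)
    then have "to_fract (lcst (1 - u) * (\<Sum>i<n. X i)) = to_fract (lcst (1 - u ^ n) * lvand n)"
      by (simp add: to_fract_sum Xf sum_distrib_left[symmetric] lcst_diff lcst_power to_fract_power mult.left_commute[of _ "to_fract (lvand n)"] mult.commute)
    then have e: "lcst (1 - u) * (\<Sum>i<n. X i) = lcst (1 - u ^ n) * lvand n" by (simp only: to_fract_eq_iff)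
    have "(\<Sum>i<n. X i) = lcst (1 / (1 - u)) * (lcst (1 - u) * (\<Sum>i<n. X i))"
      using u1 by (simp add: mult.assoc[symmetric] lcst_mult[symmetric])
    then show ?thesis unfolding e by (simp add: mult.assoc[symmetric] lcst_mult[symmetric])
  qed
  have hP: "homog n (int (n * k)) ?P"
  proof -
    have "homog n 0 ?W" by (intro homog_prod) (auto simp: prs_def intro!: homog_dw)
    from homog_mult[OF homog_ymon[of n "int k"] this] show ?thesis by simp
  qed
  let ?c = "(1 - u ^ n) / (1 - u)"
  have "(\<Sum>i<n. G n (tw i (lvandA u n i * ?P))) = sf_scale (q ^ k) (G n (?Y * ((\<Sum>i<n. X i) * ?W)))"
    by (simp add: tP G_lcst G_sum sf.scale_sum_right sum_distrib_left sum_distrib_right)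
  also have "\<dots> = sf_scale (q ^ k * ?c) (G n (?Y * ?D))"
    unfolding XS mult.assoc VW by (simp add: mult.left_commute[of ?Y] G_lcst)
  finally have "sf_scale (q ^ k * ?c) (G n (?Y * ?D)) = sf_scale ?c (G n (?Y * ?D)) + sf_scale (1 / (1 - u)) (Dop (n * k) (G n (?Y * ?D)))"
    unfolding Dop_G[OF hP] mult.left_commute[of "lvand n" ?Y] VW by simp
  then have e: "sf_scale (1 / (1 - u)) (Dop (n * k) (G n (?Y * ?D))) = sf_scale (q ^ k * ?c - ?c) (G n (?Y * ?D))"
    by (simp add: sf.scale_left_diff_distrib)
  have "Dop (n * k) (G n (?Y * ?D)) = sf_scale (1 - u) (sf_scale (1 / (1 - u)) (Dop (n * k) (G n (?Y * ?D))))"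
    using u_neq_1 by simp
  also have "\<dots> = sf_scale ((1 - u ^ n) * (q ^ k - 1)) (G n (?Y * ?D))"
  proof -
    have gen: "a * (x * c - c) = (a * c) * (x - 1)" for a x c :: 'a by (simp add: algebra_simps)
    have "(1 - u) * ?c = 1 - u ^ n" using u_neq_1 by simp
    then have "(1 - u) * (q ^ k * ?c - ?c) = (1 - u ^ n) * (q ^ k - 1)" unfolding gen by (simp only:)
    then show ?thesis unfolding e sf.scale_scale by (simp only:)
  qed
  finally show ?thesis .
qed

end

subsection \<open>The rectangular Macdonald function\<close>

lemma is_partition_replicate: "k > 0 \<Longrightarrow> is_partition (replicate n k)"
  unfolding is_partition_def by (auto simp: sorted_wrt_iff_nth_less)

text \<open>
  Since \<open>gm n\<close> produces only partitions with at most \<open>n\<close> parts, all terms other than the leading one lie above the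
  rectangle.
\<close>

lemma rectangle_least:
  assumes mu: "is_partition \<mu>" "length \<mu> \<le> n" "sum_list \<mu> = n * k"
  shows "dominance_le (replicate n k) \<mu>"
proof -
  have ge: "length xs * c \<le> sum_list xs" if "\<And>x. x \<in> set xs \<Longrightarrow> c \<le> x" for xs :: "nat list" and c
    using that by (induction xs) (auto, fastforce)
  have le: "sum_list xs \<le> length xs * c" if "\<And>x. x \<in> set xs \<Longrightarrow> x \<le> c" for xs :: "nat list" and c
    using that by (induction xs) (auto, fastforce)
  have "sum_list (take j (replicate n k)) \<le> sum_list (take j \<mu>)" for j
  proof (cases "j < length \<mu>")
    case True
    have ord: "\<mu> ! b \<le> \<mu> ! a" if "a \<le> b" "b < length \<mu>" for a b
      using mu(1) that by (cases "a = b") (auto simp: is_partition_def sorted_wrt_iff_nth_less)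
    have 1: "j * (\<mu> ! j) \<le> sum_list (take j \<mu>)"
    proof -
      have "\<mu> ! j \<le> x" if "x \<in> set (take j \<mu>)" for x
        using that True by (auto simp: in_set_conv_nth intro!: ord)
      then show ?thesis using ge[of "take j \<mu>" "\<mu> ! j"] True by simp
    qed
    have 2: "sum_list (drop j \<mu>) \<le> (length \<mu> - j) * (\<mu> ! j)"
    proof -
      have "x \<le> \<mu> ! j" if "x \<in> set (drop j \<mu>)" for x
        using that True by (auto simp: in_set_conv_nth intro!: ord)
      then show ?thesis using le[of "drop j \<mu>" "\<mu> ! j"] by simp
    qed
    have 3: "sum_list (take j \<mu>) + sum_list (drop j \<mu>) = n * k"
      using mu(3) by (metis append_take_drop_id sum_list_append)
    have 4: "j * k \<le> sum_list (take j \<mu>)"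
    proof (cases "k \<le> \<mu> ! j")
      case True
      then have "j * k \<le> j * (\<mu> ! j)" by (rule mult_le_mono2)
      then show ?thesis using 1 by (rule le_trans)
    next
      case False
      then have "(length \<mu> - j) * (\<mu> ! j) \<le> (n - j) * k" using mu(2) by (intro mult_mono) auto
      then have "sum_list (drop j \<mu>) \<le> (n - j) * k" using 2 by simp
      moreover have "(n - j) * k + j * k = n * k"
        unfolding add_mult_distrib[symmetric] using True mu(2) by simp
      ultimately show ?thesis using 3 by linarith
    qed
    then show ?thesis using True mu(2) by (simp add: sum_list_replicate)
  next
    case False
    then show ?thesis using mu(3) by (simp add: sum_list_replicate)
  qed
  then show ?thesis using mu(3) by (simp add: dominance_le_def sum_list_replicate)
qed

lemma pof_eq_rectangle:
  assumes e: "pof n \<gamma> = replicate n k" and i: "i < n" and nn: "Poly_Mapping.lookup \<gamma> i \<ge> 0"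
  shows "Poly_Mapping.lookup \<gamma> i = int k"
proof -
  let ?xs = "map (\<lambda>i. nat (Poly_Mapping.lookup \<gamma> i)) [0..<n]"
  have x: "nat (Poly_Mapping.lookup \<gamma> i) \<in> set ?xs" using i by auto
  have "length (filter (\<lambda>x. x > 0) ?xs) = length ?xs"
    using arg_cong[OF e, of length] by (simp add: pof_def)
  then have "nat (Poly_Mapping.lookup \<gamma> i) > 0" using length_filter_less[OF x, of "\<lambda>x. x > 0"] by auto
  then have "nat (Poly_Mapping.lookup \<gamma> i) \<in> set (pof n \<gamma>)" using x unfolding pof_def by auto
  then show ?thesis unfolding e using nn by auto
qed

context macdonald_distinct
begin

text \<open>
  By \<open>G_DP\<close> and \<open>Dop_symmetric_weight\<close> the right hand side is an eigenvector with the eigenvalue of the rectangle, and its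
  leading coefficient is the constant term of the \<open>q\<close>-Dyson product.
\<close>

theorem rectangle_as_constant_term:
  assumes m: "m > 0" and t: "t = q ^ m" and k: "k > 0" and n: "n > 0"
  shows "sf_scale (qpoch q q (n * m) / qpoch q q m ^ n) (mQ (replicate n k)) = G n (ymon n (int k) * DP q m n 0)"
proof -
  let ?r = "replicate n k" and ?R = "G n (ymon n (int k) * DP q m n 0)"
  let ?c = "qpoch q q (n * m) / qpoch q q m ^ n"
  have r: "is_partition ?r" using k by (rule is_partition_replicate)
  have ev: "(1 - u) * ev ?r = (1 - u ^ n) * (q ^ k - 1)"
  proof -
    have "(1 - u) * (\<Sum>i<n. u ^ i) = 1 - u ^ n" by (simp add: one_diff_power_eq)
    moreover have "ev ?r = (\<Sum>i<n. u ^ i) * (q ^ k - 1)" by (simp add: ev_def sum_distrib_right)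
    ultimately show ?thesis by (metis mult.assoc)
  qed
  have s: "sum_list ?r = n * k" by (simp add: sum_list_replicate)
  obtain c where c: "?R = sf_scale c (G n (ymon n (int k) * DP q m n n))" using G_DP[OF t, of n n "int k"] by blast
  have DR: "Dop (sum_list ?r) ?R = sf_scale ((1 - u) * ev ?r) ?R"
    unfolding s ev c Dop_scale Dop_symmetric_weight[OF m t] by (simp add: mult.commute)
  have up: "?R - sf_scale ?c (gl ?r) \<in> upspan ?r"
  proof -
    let ?D = "DP q m n 0 :: 'a laurent"
    have q_dys: "Poly_Mapping.lookup ?D 0 = ?c" by (rule q_dyson[OF q0 _ m n]) (rule q1)
    have hD: "homog n' 0 ?D" if "n \<le> n'" for n'
    proof -
      have "homog n' 0 (dth q m b a)" if "a < n'" "b < n'" for a b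
        unfolding dth_def using that by (intro homog_mult0 homog_qpoch homog_rt homog_lcst)
      then have "homog n' 0 (\<Prod>b\<in>{0..<n}. \<Prod>a<b. dth q m b a)" using that by (intro homog_prod) auto
      then show ?thesis by (simp add: DP_def DS_def)
    qed
    define \<delta> where "\<delta> = pvec ?r"
    have ld: "Poly_Mapping.lookup \<delta> i = (if i < n then int k else 0)" for i by (simp add: \<delta>_def lookup_pvec)
    have ym: "ymon n (int k) = Poly_Mapping.single \<delta> (1 :: 'a)"
    proof -
      have "(\<Prod>i\<in>A. yv i e :: 'a laurent) = Poly_Mapping.single (\<Sum>i\<in>A. Poly_Mapping.single i e) 1" if "finite A" for A e
        using that by (induction A rule: finite_induct) (auto simp: yv_def mult_single)
      moreover have "(\<Sum>i<n. Poly_Mapping.single i (int k)) = \<delta>" by (simp add: \<delta>_def pvec_def)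
      ultimately show ?thesis by (simp add: ymon_def)
    qed
    let ?K = "Poly_Mapping.keys ?D - {0}"
    let ?t = "\<lambda>\<beta>. sf_scale (Poly_Mapping.lookup ?D \<beta>) (gm n (\<delta> + \<beta>))"
    have "?R = (\<Sum>\<beta>\<in>Poly_Mapping.keys ?D. ?t \<beta>)"
      unfolding ym G_def lext_shift by (simp add: lext_eq_sum)
    also have "\<dots> = (\<Sum>\<beta>\<in>insert 0 ?K. ?t \<beta>)"
      by (rule sum.mono_neutral_left) (auto simp: in_keys_iff)
    also have "\<dots> = ?t 0 + (\<Sum>\<beta>\<in>?K. ?t \<beta>)" by (rule sum.insert) auto
    also have "?t 0 = sf_scale ?c (gl ?r)" by (simp add: q_dys \<delta>_def gm_pvec)
    finally have e: "?R - sf_scale ?c (gl ?r) = (\<Sum>\<beta>\<in>?K. ?t \<beta>)" by simp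
    have kD: "Poly_Mapping.keys \<beta> \<subseteq> {..<n}" if b: "\<beta> \<in> Poly_Mapping.keys ?D" for \<beta>
    proof
      fix i assume i: "i \<in> Poly_Mapping.keys \<beta>"
      show "i \<in> {..<n}"
      proof (rule ccontr)
        assume "i \<notin> {..<n}"
        then have "(\<Sum>i<i. Poly_Mapping.lookup \<beta> i) = 0" "(\<Sum>i<Suc i. Poly_Mapping.lookup \<beta> i) = 0"
          using hD[of i] hD[of "Suc i"] b unfolding homog_def by auto
        then show False using i by (simp add: in_keys_iff)
      qed
    qed
    have "gm n (\<delta> + \<beta>) \<in> upspan ?r" if b: "\<beta> \<in> ?K" for \<beta>
    proof (cases "\<forall>i<n. Poly_Mapping.lookup (\<delta> + \<beta>) i \<ge> 0")
      case True
      let ?\<mu> = "pof n (\<delta> + \<beta>)"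
      have mu: "is_partition ?\<mu>" by (rule is_partition_pof)
      have "int (sum_list ?\<mu>) = (\<Sum>i<n. Poly_Mapping.lookup (\<delta> + \<beta>) i)" by (rule pof_sum) (use True in auto)
      also have "\<dots> = int (n * k) + (\<Sum>i<n. Poly_Mapping.lookup \<beta> i)" by (simp add: lookup_add sum.distrib ld)
      also have "(\<Sum>i<n. Poly_Mapping.lookup \<beta> i) = 0" using hD[OF order_refl] b by (simp add: homog_def)
      finally have "int (sum_list ?\<mu>) = int (n * k)" by (simp only: add_0_right)
      then have sm: "sum_list ?\<mu> = n * k" by (simp only: of_nat_eq_iff)
      have "?\<mu> \<noteq> ?r"
      proof
        assume e: "?\<mu> = ?r"
        have h: "Poly_Mapping.lookup (\<delta> + \<beta>) i = int k" if i: "i < n" for i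
          by (rule pof_eq_rectangle[OF e i]) (use True i in auto)
        have z: "Poly_Mapping.lookup \<beta> i = 0" if "i < n" for i using h[OF that] ld[of i] that by (simp add: lookup_add)
        have "\<beta> = 0"
        proof (rule poly_mapping_eqI)
          fix i show "Poly_Mapping.lookup \<beta> i = Poly_Mapping.lookup 0 i"
          proof (cases "i < n")
            case False
            then have "i \<notin> Poly_Mapping.keys \<beta>" using kD[of \<beta>] b by auto
            then show ?thesis by (simp add: in_keys_iff)
          qed (simp add: z)
        qed
        then show False using b by simp
      qed
      then have "?\<mu> \<in> ups ?r" using rectangle_least[OF mu length_pof sm] mu by (simp add: ups_def)
      then show ?thesis using gm_nonneg[of n "\<delta> + \<beta>"] True by (auto intro: sf.span_base)
    next
      case False
      then obtain i where "i < n" "Poly_Mapping.lookup (\<delta> + \<beta>) i < 0" by force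
      then have "gm n (\<delta> + \<beta>) = 0" by (simp add: gm_remove[of i] gi_neg)
      then show ?thesis by (simp add: sf.span_zero)
    qed
    then show ?thesis unfolding e by (intro sf.span_sum sf.span_scale)
  qed
  have "?R - sf_scale ?c (mQ ?r) = 0"
  proof (rule eigen_unique[OF r])
    have "sf_scale ?c (mQ ?r - gl ?r) \<in> upspan ?r" by (intro sf.span_scale mQ_upspan r)
    from sf.span_diff[OF up this] show "?R - sf_scale ?c (mQ ?r) \<in> upspan ?r"
      by (simp add: sf.scale_right_diff_distrib)
    have "Dop (sum_list ?r) (sf_scale ?c (mQ ?r)) = sf_scale ((1 - u) * ev ?r) (sf_scale ?c (mQ ?r))"
      using mQ_eigen[OF r] by (simp add: is_eigen_def Dop_scale mult.commute)
    moreover have "Dop N (x - y) = Dop N x - Dop N y" for N x y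
      using Dop_add[of N "x - y" y] by simp
    ultimately show "Dop (sum_list ?r) (?R - sf_scale ?c (mQ ?r)) = sf_scale ((1 - u) * ev ?r) (?R - sf_scale ?c (mQ ?r))"
      by (simp only: DR sf.scale_right_diff_distrib)
  qed
  then show ?thesis by simp
qed

end

section \<open>Alternants and interlacing sets\<close>

subsection \<open>Alternants\<close>

definition alternant :: "nat \<Rightarrow> (nat \<Rightarrow> 'a::comm_ring_1) \<Rightarrow> (nat \<Rightarrow> nat) \<Rightarrow> 'a" where
  "alternant k x b = det (mat k k (\<lambda>(i, j). x j ^ b i))"

lemma det_mat: "det (mat k k (\<lambda>(i, j). f i j)) = (\<Sum>p\<in>{p. p permutes {0..<k}}. signof p * (\<Prod>i = 0..<k. f i (p i)))"
proof -
  have "(\<Prod>i = 0..<k. mat k k (\<lambda>(i, j). f i j) $$ (i, p i)) = (\<Prod>i = 0..<k. f i (p i))" if "p permutes {0..<k}" for p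
    using that by (intro prod.cong) (auto simp: permutes_in_image)
  then show ?thesis by (subst det_def'[of _ k]) auto
qed

lemma det_scale_columns: "(\<Prod>j<k. c j) * det (mat k k (\<lambda>(i, j). f i j)) = det (mat k k (\<lambda>(i, j). c j * f i j :: 'a::comm_ring_1))"
proof -
  have "(\<Prod>j<k. c j) = (\<Prod>i = 0..<k. c (p i))" if "p permutes {0..<k}" for p
    using prod.permute[OF that, of c] by (simp add: comp_def lessThan_atLeast0)
  then show ?thesis unfolding det_mat sum_distrib_left
    by (intro sum.cong) (auto simp: prod.distrib mult_ac)
qed

lemma det_multilinear_rows:
  assumes "\<And>i. i < k \<Longrightarrow> finite (I i)"
  shows "det (mat k k (\<lambda>(i, j). \<Sum>a\<in>I i. g i a * h a j)) =
    (\<Sum>a\<in>PiE {..<k} I. (\<Prod>i<k. g i (a i)) * det (mat k k (\<lambda>(i, j). h (a i) j :: 'a::comm_ring_1)))"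
proof -
  have "(\<Prod>i = 0..<k. \<Sum>a\<in>I i. g i a * h a (p i)) = (\<Sum>a\<in>PiE {..<k} I. (\<Prod>i<k. g i (a i)) * (\<Prod>i = 0..<k. h (a i) (p i)))" for p
    unfolding lessThan_atLeast0 by (subst prod_sum_PiE) (use assms in \<open>auto simp: prod.distrib\<close>)
  then have "det (mat k k (\<lambda>(i, j). \<Sum>a\<in>I i. g i a * h a j)) =
    (\<Sum>p\<in>{p. p permutes {0..<k}}. \<Sum>a\<in>PiE {..<k} I. signof p * ((\<Prod>i<k. g i (a i)) * (\<Prod>i = 0..<k. h (a i) (p i))))"
    unfolding det_mat by (simp add: sum_distrib_left)
  also have "\<dots> = (\<Sum>a\<in>PiE {..<k} I. (\<Prod>i<k. g i (a i)) * (\<Sum>p\<in>{p. p permutes {0..<k}}. signof p * (\<Prod>i = 0..<k. h (a i) (p i))))"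
    by (subst sum.swap) (simp add: sum_distrib_left mult_ac)
  finally show ?thesis unfolding det_mat .
qed

lemma alternant_Suc:
  fixes x :: "nat \<Rightarrow> 'a::comm_ring_1"
  assumes b: "\<And>i. i < k \<Longrightarrow> b i \<le> b (Suc i)"
  shows "alternant (Suc k) x b = x k ^ b 0 * det (mat k k (\<lambda>(i, j). x k ^ (b (Suc i) - b i) * x j ^ b i - x j ^ b (Suc i)))"
proof -
  let ?y = "x k"
  define M where "M = mat (Suc k) (Suc k) (\<lambda>(i, j). x j ^ b i)"
  define U where "U = mat (Suc k) (Suc k) (\<lambda>(i, j). if i = j then 1 else if i = Suc j then - (?y ^ (b i - b j)) else 0)"
  have cM: "M \<in> carrier_mat (Suc k) (Suc k)" "U \<in> carrier_mat (Suc k) (Suc k)" by (auto simp: M_def U_def)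
  have dU: "det U = 1"
  proof -
    have "det U = prod_list (diag_mat U)"
      by (rule det_lower_triangular[OF _ cM(2)]) (auto simp: U_def)
    also have "diag_mat U = replicate (Suc k) 1"
      by (rule nth_equalityI) (auto simp: diag_mat_def U_def simp del: upt_Suc replicate_Suc)
    finally show ?thesis by simp
  qed
  have UM: "(U * M) $$ (i, j) = (if i = 0 then x j ^ b 0 else x j ^ b i - ?y ^ (b i - b (i - 1)) * x j ^ b (i - 1))"
    if "i < Suc k" "j < Suc k" for i j
  proof -
    have "(U * M) $$ (i, j) = (\<Sum>l = 0..<Suc k. U $$ (i, l) * M $$ (l, j))"
      using that cM by (simp add: scalar_prod_def del: sum.op_ivl_Suc)
    also have "\<dots> = (\<Sum>l\<in>(if i = 0 then {0} else {i, i - 1}). U $$ (i, l) * M $$ (l, j))"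
      using that by (intro sum.mono_neutral_right) (auto simp: U_def split: if_splits)
    also have "\<dots> = (if i = 0 then x j ^ b 0 else x j ^ b i - ?y ^ (b i - b (i - 1)) * x j ^ b (i - 1))"
      using that by (auto simp: U_def M_def)
    finally show ?thesis .
  qed
  have cUM: "U * M \<in> carrier_mat (Suc k) (Suc k)" using cM by simp
  obtain N where N: "N = U * M" by blast
  have dN: "dim_row N = Suc k" "dim_col N = Suc k" using cUM by (auto simp: N)
  have "alternant (Suc k) x b = det (U * M)"
    unfolding alternant_def M_def[symmetric] det_mult[OF cM(2,1)] dU by simp
  also have "\<dots> = (\<Sum>i<Suc k. (U * M) $$ (i, k) * cofactor (U * M) i k)"
    by (rule laplace_expansion_column[OF cUM]) simp
  also have "\<dots> = (\<Sum>i<Suc k. if i = 0 then ?y ^ b 0 * cofactor (U * M) 0 k else 0)"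
  proof (rule sum.cong)
    fix i assume i: "i \<in> {..<Suc k}"
    show "(U * M) $$ (i, k) * cofactor (U * M) i k = (if i = 0 then ?y ^ b 0 * cofactor (U * M) 0 k else 0)"
    proof (cases "i = 0")
      case True then show ?thesis using UM[of 0 k] by simp
    next
      case False
      then obtain i' where i': "i = Suc i'" "i' < k" using i by (cases i) auto
      have "?y ^ b i = ?y ^ (b i - b i') * ?y ^ b i'" using b[OF i'(2)] i'(1) by (simp flip: power_add)
      then show ?thesis using UM[of i k] i' by simp
    qed
  qed simp
  also have "\<dots> = ?y ^ b 0 * cofactor (U * M) 0 k" by simp
  also have "cofactor (U * M) 0 k = (- 1) ^ k * det (mat k k (\<lambda>(i, j). x j ^ b (Suc i) - ?y ^ (b (Suc i) - b i) * x j ^ b i))"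
  proof -
    have "mat_delete (U * M) 0 k = mat k k (\<lambda>(i, j). x j ^ b (Suc i) - ?y ^ (b (Suc i) - b i) * x j ^ b i)"
      unfolding N[symmetric] by (intro eq_matI) (simp_all add: mat_delete_def dN UM[folded N])
    then show ?thesis by (simp add: cofactor_def)
  qed
  also have "(- 1) ^ k * det (mat k k (\<lambda>(i, j). x j ^ b (Suc i) - ?y ^ (b (Suc i) - b i) * x j ^ b i)) =
     det (mat k k (\<lambda>(i, j). ?y ^ (b (Suc i) - b i) * x j ^ b i - x j ^ b (Suc i)))"
    using det_scale_columns[of "\<lambda>_. - 1" k "\<lambda>i j. x j ^ b (Suc i) - ?y ^ (b (Suc i) - b i) * x j ^ b i"] by simp
  finally show ?thesis .
qed

lemma alternant_vandermonde: "alternant k x (\<lambda>i. i) = (\<Prod>j<k. \<Prod>i<j. x j - x i)"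
proof (induction k)
  case 0
  show ?case by (simp add: alternant_def)
next
  case (Suc k)
  have "alternant (Suc k) x (\<lambda>i. i) = det (mat k k (\<lambda>(i, j). (x k - x j) * x j ^ i))"
    by (subst alternant_Suc) (auto simp: algebra_simps intro!: arg_cong[of _ _ det])
  also have "\<dots> = (\<Prod>j<k. x k - x j) * alternant k x (\<lambda>i. i)"
    unfolding alternant_def det_scale_columns ..
  finally show ?case using Suc by (simp add: mult.commute)
qed

lemma alternant_eq_0:
  assumes "i < k" "j < k" "i \<noteq> j" "b i = b j"
  shows "alternant k x b = 0"
  unfolding alternant_def
  by (rule det_identical_rows[of _ k i j]) (use assms in \<open>auto intro!: eq_vecI\<close>)

subsection \<open>Branching of alternants over interlacing exponents\<close>

text \<open>
  The weight of an exponent \<open>a\<close> between two neighbours \<open>p < r\<close>; it distinguishes the two ends from the interior.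
\<close>

definition wgt :: "'a::comm_ring_1 \<Rightarrow> nat \<Rightarrow> nat \<Rightarrow> nat \<Rightarrow> 'a" where
  "wgt l p r a = (if a = r then l else if a = p then 1 else 1 + l)"

lemma wgt_sum:
  fixes X :: "'a::comm_ring_1"
  assumes "p < r"
  shows "(y - X) * (\<Sum>a\<in>{p..r}. wgt l p r a * y ^ (r - a) * X ^ a) = (y + l * X) * (y ^ (r - p) * X ^ p - X ^ r)"
proof -
  obtain d where d: "r = p + Suc d" using assms less_iff_Suc_add by (metis add_Suc_right)
  have "(\<Sum>a\<in>{p..r}. wgt l p r a * y ^ (r - a) * X ^ a) = (\<Sum>e\<in>{0..Suc d}. wgt l p r (p + e) * y ^ (Suc d - e) * X ^ (p + e))"
    by (rule sum.reindex_bij_witness[of _ "\<lambda>e. p + e" "\<lambda>a. a - p"]) (auto simp: d ac_simps)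
  also have "\<dots> = X ^ p * (\<Sum>e\<in>{0..Suc d}. wgt l 0 (Suc d) e * y ^ (Suc d - e) * X ^ e)"
    unfolding sum_distrib_left by (intro sum.cong) (auto simp: wgt_def d power_add mult_ac)
  also have "(\<Sum>e\<in>{0..Suc d}. wgt l 0 (Suc d) e * y ^ (Suc d - e) * X ^ e) = (y + l * X) * (\<Sum>e\<le>d. y ^ (d - e) * X ^ e)"
  proof -
    let ?S = "\<Sum>e\<le>d. y ^ (d - e) * X ^ e"
    have w: "wgt l 0 (Suc d) e = (if e = Suc d then 0 else 1) + (if e = 0 then 0 else l)" for e by (simp add: wgt_def)
    have "(\<Sum>e\<in>{0..Suc d}. wgt l 0 (Suc d) e * y ^ (Suc d - e) * X ^ e) =
      (\<Sum>e\<in>{0..Suc d}. (if e = Suc d then 0 else 1) * y ^ (Suc d - e) * X ^ e) + (\<Sum>e\<in>{0..Suc d}. (if e = 0 then 0 else l) * y ^ (Suc d - e) * X ^ e)"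
      unfolding w distrib_right sum.distrib ..
    also have "(\<Sum>e\<in>{0..Suc d}. (if e = Suc d then 0 else 1) * y ^ (Suc d - e) * X ^ e) = y * ?S"
      unfolding sum_distrib_left by (rule sum.mono_neutral_cong_right) (auto simp: Suc_diff_le mult.assoc)
    also have "(\<Sum>e\<in>{0..Suc d}. (if e = 0 then 0 else l) * y ^ (Suc d - e) * X ^ e) = l * X * ?S"
      by (subst sum.atLeast0_atMost_Suc_shift) (simp add: sum_distrib_left mult_ac atLeast0AtMost)
    finally show ?thesis by (simp add: algebra_simps)
  qed
  finally have "(y - X) * (\<Sum>a\<in>{p..r}. wgt l p r a * y ^ (r - a) * X ^ a) = X ^ p * (y + l * X) * ((y - X) * (\<Sum>e\<le>d. y ^ (d - e) * X ^ e))"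
    by (simp add: mult_ac)
  also have "(y - X) * (\<Sum>e\<le>d. y ^ (d - e) * X ^ e) = y ^ Suc d - X ^ Suc d"
  proof (induction d)
    case (Suc d)
    let ?S = "\<Sum>e\<le>d. y ^ (d - e) * X ^ e"
    have "(\<Sum>e\<le>Suc d. y ^ (Suc d - e) * X ^ e) = y * ?S + X ^ Suc d"
      unfolding sum.atMost_Suc sum_distrib_left by (intro arg_cong2[of _ _ _ _ "(+)"] sum.cong) (auto simp: Suc_diff_le)
    then have "(y - X) * (\<Sum>e\<le>Suc d. y ^ (Suc d - e) * X ^ e) = y * ((y - X) * ?S) + (y - X) * X ^ Suc d"
      by (simp add: algebra_simps)
    then show ?case unfolding Suc.IH by (simp add: algebra_simps)
  qed simp
  finally show ?thesis by (simp add: d power_add algebra_simps)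
qed

text \<open>
  Both sides are determinants: multilinearity turns the sum over independent \<open>a i\<close> into a determinant of geometric
  sums, which \<open>wgt_sum\<close> evaluates, and successive row subtractions bring the larger alternant to the same entries.
\<close>

theorem alternant_branching:
  fixes x :: "nat \<Rightarrow> 'a::comm_ring_1"
  assumes b: "\<And>i. i < k \<Longrightarrow> b i < b (Suc i)"
  shows "(\<Prod>i<k. x k - x i) * (\<Sum>a\<in>PiE {..<k} (\<lambda>i. {b i..b (Suc i)}).
      (\<Prod>i<k. wgt l (b i) (b (Suc i)) (a i)) * (x k ^ b 0 * (\<Prod>i<k. x k ^ (b (Suc i) - a i))) * alternant k x a)
    = (\<Prod>i<k. x k + l * x i) * alternant (Suc k) x b"
proof -
  let ?y = "x k" and ?I = "\<lambda>i. {b i..b (Suc i)}"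
  let ?g = "\<lambda>i a. wgt l (b i) (b (Suc i)) a * ?y ^ (b (Suc i) - a)"
  have "(\<Sum>a\<in>PiE {..<k} ?I. (\<Prod>i<k. wgt l (b i) (b (Suc i)) (a i)) * (?y ^ b 0 * (\<Prod>i<k. ?y ^ (b (Suc i) - a i))) * alternant k x a)
    = ?y ^ b 0 * (\<Sum>a\<in>PiE {..<k} ?I. (\<Prod>i<k. ?g i (a i)) * det (mat k k (\<lambda>(i, j). x j ^ a i)))"
    unfolding sum_distrib_left by (intro sum.cong) (auto simp: alternant_def prod.distrib mult_ac)
  also have "\<dots> = ?y ^ b 0 * det (mat k k (\<lambda>(i, j). \<Sum>a\<in>?I i. ?g i a * x j ^ a))"
    by (subst det_multilinear_rows[of k ?I ?g "\<lambda>a j. x j ^ a"]) auto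
  finally have "(\<Prod>i<k. ?y - x i) * (\<Sum>a\<in>PiE {..<k} ?I. (\<Prod>i<k. wgt l (b i) (b (Suc i)) (a i)) * (?y ^ b 0 * (\<Prod>i<k. ?y ^ (b (Suc i) - a i))) * alternant k x a)
     = ?y ^ b 0 * ((\<Prod>i<k. ?y - x i) * det (mat k k (\<lambda>(i, j). \<Sum>a\<in>?I i. ?g i a * x j ^ a)))"
    by (simp only: mult_ac)
  also have "(\<Prod>i<k. ?y - x i) * det (mat k k (\<lambda>(i, j). \<Sum>a\<in>?I i. ?g i a * x j ^ a)) =
     det (mat k k (\<lambda>(i, j). (?y + l * x j) * (?y ^ (b (Suc i) - b i) * x j ^ b i - x j ^ b (Suc i))))"
    unfolding det_scale_columns
    by (intro arg_cong[of _ _ det] eq_matI) (simp_all add: wgt_sum[OF b])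
  also have "\<dots> = (\<Prod>i<k. ?y + l * x i) * det (mat k k (\<lambda>(i, j). ?y ^ (b (Suc i) - b i) * x j ^ b i - x j ^ b (Suc i)))"
    unfolding det_scale_columns ..
  also have "?y ^ b 0 * \<dots> = (\<Prod>i<k. ?y + l * x i) * alternant (Suc k) x b"
    by (subst alternant_Suc) (use b in \<open>auto intro: less_imp_le\<close>)
  finally show ?thesis .
qed

subsection \<open>Interlacing sets\<close>

definition en :: "nat set \<Rightarrow> nat \<Rightarrow> nat" where
  "en S i = sorted_list_of_set S ! i"

text \<open>
  Counting functions describe interlacing without an enumeration, which suits column sums of matrices.
\<close>

definition cnt :: "nat set \<Rightarrow> nat \<Rightarrow> nat" where
  "cnt S c = card {s \<in> S. s < c}"

lemma en_bij: "finite S \<Longrightarrow> bij_betw (en S) {..<card S} S"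
  unfolding en_def
  using bij_betw_nth[of "sorted_list_of_set S" "{..<card S}" S] by simp

lemma en_mono: "finite S \<Longrightarrow> i < j \<Longrightarrow> j < card S \<Longrightarrow> en S i < en S j"
  unfolding en_def by (metis length_sorted_list_of_set sorted_wrt_nth_less strict_sorted_list_of_set)

lemma en_less_iff: "finite S \<Longrightarrow> i < card S \<Longrightarrow> j < card S \<Longrightarrow> en S i < en S j \<longleftrightarrow> i < j"
  using en_mono[of S i j] en_mono[of S j i] by (metis linorder_neqE_nat order_less_asym)

lemma en_image:
  assumes "\<And>i j. i < j \<Longrightarrow> j < k \<Longrightarrow> a i < (a j :: nat)" "i < k"
  shows "en (a ` {..<k}) i = a i"
proof -
  have "sorted (map a [0..<k])" "distinct (map a [0..<k])"
    using assms(1) by (auto simp: sorted_wrt_iff_nth_less distinct_conv_nth less_imp_le) (metis linorder_neqE_nat less_irrefl)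
  then have "sorted_list_of_set (set (map a [0..<k])) = map a [0..<k]"
    by (rule sorted_list_of_set.idem_if_sorted_distinct)
  then show ?thesis using assms(2) by (simp add: en_def lessThan_atLeast0)
qed

lemma less_cnt_iff:
  assumes "finite S" "i < card S"
  shows "i < cnt S c \<longleftrightarrow> en S i < c"
proof -
  have "{s \<in> S. s < c} = en S ` {j. j < card S \<and> en S j < c}"
    using en_bij[OF assms(1)] by (force simp: bij_betw_def)
  moreover have "inj_on (en S) {j. j < card S \<and> en S j < c}"
    using en_bij[OF assms(1)] by (auto simp: bij_betw_def inj_on_def)
  ultimately have c: "cnt S c = card {j. j < card S \<and> en S j < c}" by (simp add: cnt_def card_image)
  show ?thesis
  proof
    assume "en S i < c"
    have "{..i} \<subseteq> {j. j < card S \<and> en S j < c}"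
    proof (rule subsetI)
      fix j assume "j \<in> {..i}"
      then have "j = i \<or> j < i" "j < card S" using assms(2) by auto
      then have "j = i \<or> en S j < en S i" "j < card S" using assms(2) en_mono[OF assms(1), of j i] by blast+
      then show "j \<in> {j. j < card S \<and> en S j < c}" using \<open>en S i < c\<close> by auto
    qed
    then have "card {..i} \<le> cnt S c" unfolding c by (intro card_mono) auto
    then show "i < cnt S c" by simp
  next
    assume i: "i < cnt S c"
    show "en S i < c"
    proof (rule ccontr)
      assume n: "\<not> en S i < c"
      have "{j. j < card S \<and> en S j < c} \<subseteq> {..<i}"
      proof
        fix j assume j: "j \<in> {j. j < card S \<and> en S j < c}"
        then have "en S j < en S i" using n by simp
        then show "j \<in> {..<i}" using en_less_iff[OF assms(1), of j i] j assms(2) by simp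
      qed
      then have "cnt S c \<le> card {..<i}" unfolding c by (intro card_mono) auto
      then show False using i by simp
    qed
  qed
qed

definition il :: "nat set \<Rightarrow> nat set \<Rightarrow> bool" where
  "il A B \<longleftrightarrow> finite A \<and> finite B \<and> card B = Suc (card A) \<and> (\<forall>c. cnt A c \<le> cnt B c \<and> cnt B c \<le> Suc (cnt A c))"

lemma il_en:
  assumes "finite A" "finite B" "card B = Suc (card A)"
  shows "il A B \<longleftrightarrow> (\<forall>i<card A. en B i \<le> en A i \<and> en A i \<le> en B (Suc i))"
proof
  assume il: "il A B"
  show "\<forall>i<card A. en B i \<le> en A i \<and> en A i \<le> en B (Suc i)"
  proof (intro allI impI conjI)
    fix i assume i: "i < card A"
    have "i < cnt A (Suc (en A i))" using less_cnt_iff[OF assms(1) i] by simp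
    also have "\<dots> \<le> cnt B (Suc (en A i))" using il by (simp add: il_def)
    finally show "en B i \<le> en A i" using less_cnt_iff[OF assms(2), of i] i assms(3) by simp
    have "Suc i < cnt B (Suc (en B (Suc i)))" using less_cnt_iff[OF assms(2), of "Suc i"] i assms(3) by simp
    also have "\<dots> \<le> Suc (cnt A (Suc (en B (Suc i))))" using il by (simp add: il_def)
    finally show "en A i \<le> en B (Suc i)" using less_cnt_iff[OF assms(1) i] by simp
  qed
next
  assume r: "\<forall>i<card A. en B i \<le> en A i \<and> en A i \<le> en B (Suc i)"
  have le: "cnt S c \<le> card S" if "finite S" for S c unfolding cnt_def using that by (intro card_mono) auto
  have 1: "cnt A c \<le> cnt B c" for c
  proof (cases "cnt A c = 0")
    case False
    then obtain i where i: "cnt A c = Suc i" using not0_implies_Suc by blast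
    then have "i < card A" using le[OF assms(1), of c] by simp
    then have "en A i < c" using less_cnt_iff[OF assms(1), of i c] i by simp
    then have "en B i < c" using r \<open>i < card A\<close> by (meson le_less_trans)
    then show ?thesis using less_cnt_iff[OF assms(2), of i c] \<open>i < card A\<close> assms(3) i by simp
  qed simp
  have 2: "cnt B c \<le> Suc (cnt A c)" for c
  proof (rule ccontr)
    assume "\<not> cnt B c \<le> Suc (cnt A c)"
    then have c: "Suc (cnt A c) < cnt B c" by simp
    then have i: "Suc (cnt A c) < card B" using le[OF assms(2), of c] by simp
    then have "en B (Suc (cnt A c)) < c" using less_cnt_iff[OF assms(2) i, of c] c by simp
    moreover have "cnt A c < card A" using i assms(3) by simp
    then have "en A (cnt A c) \<le> en B (Suc (cnt A c))" using r by blast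
    ultimately have "en A (cnt A c) < c" by linarith
    then show False using less_cnt_iff[OF assms(1), of "cnt A c" c] i assms(3) by simp
  qed
  show "il A B" unfolding il_def using assms 1 2 by simp
qed

definition iwgt :: "'a::comm_ring_1 \<Rightarrow> nat set \<Rightarrow> nat set \<Rightarrow> 'a" where
  "iwgt l A B = (\<Prod>i<card A. wgt l (en B i) (en B (Suc i)) (en A i))"

lemma sum_en: "finite S \<Longrightarrow> (\<Sum>s\<in>S. f s) = (\<Sum>i<card S. f (en S i))"
  using sum.reindex_bij_betw[OF en_bij, of S f] by simp

lemma il_le_sum:
  assumes "il A B"
  shows "\<Sum>A \<le> \<Sum>B" "\<Sum>B - \<Sum>A = en B 0 + (\<Sum>i<card A. en B (Suc i) - en A i)"
proof -
  have f: "finite A" "finite B" "card B = Suc (card A)" using assms by (auto simp: il_def)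
  have r: "en A i \<le> en B (Suc i)" if "i < card A" for i using assms il_en[OF f] that by blast
  have B: "\<Sum>B = en B 0 + (\<Sum>i<card A. en B (Suc i))"
    using sum_en[OF f(2), of "\<lambda>x. x"] unfolding f(3) sum.lessThan_Suc_shift .
  have A: "\<Sum>A = (\<Sum>i<card A. en A i)" using sum_en[OF f(1), of "\<lambda>x. x"] .
  have "(\<Sum>i<card A. en B (Suc i)) = (\<Sum>i<card A. en A i) + (\<Sum>i<card A. en B (Suc i) - en A i)"
    unfolding sum.distrib[symmetric] using r by (intro sum.cong) auto
  then have "\<Sum>B = \<Sum>A + (en B 0 + (\<Sum>i<card A. en B (Suc i) - en A i))" using A B by linarith
  then show "\<Sum>A \<le> \<Sum>B" "\<Sum>B - \<Sum>A = en B 0 + (\<Sum>i<card A. en B (Suc i) - en A i)" by linarith+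
qed

text \<open>
  In \<open>alternant_branching\<close> the exponents may also coincide, but then the alternant vanishes; the remaining choices are
  the sets that interlace \<open>B\<close>.
\<close>

lemma il_branching:
  fixes x :: "nat \<Rightarrow> 'a::comm_ring_1"
  assumes B: "finite B" "card B = Suc k"
  shows "(\<Prod>i<k. x k - x i) * (\<Sum>A\<in>{A. il A B}. iwgt l A B * x k ^ (\<Sum>B - \<Sum>A) * alternant k x (en A))
    = (\<Prod>i<k. x k + l * x i) * alternant (Suc k) x (en B)"
proof -
  let ?b = "en B"
  let ?I = "PiE {..<k} (\<lambda>i. {?b i..?b (Suc i)})"
  let ?t = "\<lambda>a. (\<Prod>i<k. wgt l (?b i) (?b (Suc i)) (a i)) * (x k ^ ?b 0 * (\<Prod>i<k. x k ^ (?b (Suc i) - a i))) * alternant k x a"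
  let ?s = "\<lambda>A. iwgt l A B * x k ^ (\<Sum>B - \<Sum>A) * alternant k x (en A)"
  let ?J = "{a \<in> ?I. \<forall>i j. i < j \<longrightarrow> j < k \<longrightarrow> a i < a j}"
  have bm: "?b i < ?b (Suc i)" if "i < k" for i using en_mono[OF B(1), of i "Suc i"] that B(2) by simp
  have "(\<Sum>a\<in>?I. ?t a) = (\<Sum>a\<in>?J. ?t a)"
  proof (rule sum.mono_neutral_right)
    show "finite ?I" by (intro finite_PiE) auto
    show "\<forall>a\<in>?I - ?J. ?t a = 0"
    proof
      fix a assume a: "a \<in> ?I - ?J"
      have "\<exists>i. Suc i < k \<and> a i = a (Suc i)"
      proof (rule ccontr)
        assume n: "\<nexists>i. Suc i < k \<and> a i = a (Suc i)"
        have step: "a i < a (Suc i)" if "Suc i < k" for i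
        proof -
          have "a i \<le> ?b (Suc i)" "?b (Suc i) \<le> a (Suc i)" using a that by (auto simp: PiE_def Pi_def)
          then show ?thesis using n that by (metis le_trans nat_less_le)
        qed
        have "a i < a j" if "i < j" "j < k" for i j
          using that
        proof (induction j)
          case (Suc j)
          then show ?case using step[of j] by (cases "i = j") auto
        qed simp
        then show False using a by blast
      qed
      then obtain i where "Suc i < k" "a i = a (Suc i)" by blast
      then have "alternant k x a = 0" by (intro alternant_eq_0[of i k "Suc i"]) auto
      then show "?t a = 0" by simp
    qed
  qed auto
  also have "\<dots> = (\<Sum>A\<in>{A. il A B}. ?s A)"
  proof (rule sum.reindex_bij_witness[of _ "\<lambda>A. restrict (en A) {..<k}" "\<lambda>a. a ` {..<k}"])
    fix a assume a: "a \<in> ?J"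
    have ea: "en (a ` {..<k}) i = a i" if "i < k" for i by (rule en_image[OF _ that]) (use a in auto)
    have inj: "inj_on a {..<k}" using a by (auto simp: inj_on_def) (metis linorder_neqE_nat less_irrefl)
    then have c: "card (a ` {..<k}) = k" by (simp add: card_image)
    show "restrict (en (a ` {..<k})) {..<k} = a"
      using a ea by (auto simp: fun_eq_iff PiE_def extensional_def)
    have il: "il (a ` {..<k}) B"
      by (subst il_en) (use a ea B c in \<open>auto simp: PiE_def Pi_def\<close>)
    then show "a ` {..<k} \<in> {A. il A B}" by simp
    have "x k ^ (\<Sum>B - \<Sum>(a ` {..<k})) = x k ^ ?b 0 * (\<Prod>i<k. x k ^ (?b (Suc i) - a i))"
      unfolding il_le_sum(2)[OF il] c by (simp add: power_add power_sum ea cong: prod.cong)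
    moreover have "iwgt l (a ` {..<k}) B = (\<Prod>i<k. wgt l (?b i) (?b (Suc i)) (a i))"
      unfolding iwgt_def c by (intro prod.cong) (auto simp: ea)
    moreover have "alternant k x (en (a ` {..<k})) = alternant k x a"
      unfolding alternant_def by (intro arg_cong[of _ _ det] eq_matI) (auto simp: ea)
    ultimately show "?s (a ` {..<k}) = ?t a" by simp
  next
    fix A assume A: "A \<in> {A. il A B}"
    then have f: "finite A" "card A = k" using B by (auto simp: il_def)
    show "restrict (en A) {..<k} ` {..<k} = A"
      using en_bij[OF f(1)] f(2) by (auto simp: bij_betw_def)
    show "restrict (en A) {..<k} \<in> ?J"
      using A il_en[OF f(1) B(1)] B f en_mono[OF f(1)] by (auto simp: PiE_def Pi_def)
  qed
  finally show ?thesis using alternant_branching[of k ?b x l] bm by simp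
qed

section \<open>Alternating sign matrices\<close>

subsection \<open>Chains of interlacing sets\<close>

text \<open>
  Monotone triangles: chains of sets in which each interlaces the next.
\<close>

definition chains :: "nat \<Rightarrow> nat \<Rightarrow> nat set \<Rightarrow> (nat \<Rightarrow> nat set) set" where
  "chains n k B = {C \<in> PiE {..k} (\<lambda>_. Pow {..<n}). C 0 = {} \<and> C k = B \<and> (\<forall>i<k. il (C i) (C (Suc i)))}"

definition chain_wgt :: "'a::comm_ring_1 \<Rightarrow> (nat \<Rightarrow> 'a) \<Rightarrow> nat \<Rightarrow> (nat \<Rightarrow> nat set) \<Rightarrow> 'a" where
  "chain_wgt l x k C = (\<Prod>i<k. iwgt l (C i) (C (Suc i)) * x i ^ (\<Sum>(C (Suc i)) - \<Sum>(C i)))"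

lemma finite_chains: "finite (chains n k B)"
  by (rule finite_subset[of _ "PiE {..k} (\<lambda>_. Pow {..<n})"]) (auto simp: chains_def intro!: finite_PiE)

lemma il_subset:
  assumes "il A B" "B \<subseteq> {..<n}"
  shows "A \<subseteq> {..<n}"
proof
  fix a assume a: "a \<in> A"
  have f: "finite A" "finite B" "card B = Suc (card A)" using assms by (auto simp: il_def)
  obtain i where i: "i < card A" "a = en A i" using en_bij[OF f(1)] a by (auto simp: bij_betw_def)
  then have "a \<le> en B (Suc i)" using il_en[OF f] assms by auto
  moreover have "en B (Suc i) \<in> B" using en_bij[OF f(2)] i f(3) by (auto simp: bij_betw_def)
  ultimately show "a \<in> {..<n}" using assms(2) by auto
qed

lemma chains_Suc_sum:
  assumes B: "B \<subseteq> {..<n}"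
  shows "(\<Sum>C\<in>chains n (Suc k) B. chain_wgt l x (Suc k) C) =
    (\<Sum>A\<in>{A. il A B}. iwgt l A B * x k ^ (\<Sum>B - \<Sum>A) * (\<Sum>C\<in>chains n k A. chain_wgt l x k C))"
proof -
  have fin: "finite {A. il A B}" by (rule finite_subset[of _ "Pow {..<n}"]) (use il_subset B in auto)
  have "(\<Sum>A\<in>{A. il A B}. iwgt l A B * x k ^ (\<Sum>B - \<Sum>A) * (\<Sum>C\<in>chains n k A. chain_wgt l x k C)) =
    (\<Sum>(A, C)\<in>(SIGMA A:{A. il A B}. chains n k A). iwgt l A B * x k ^ (\<Sum>B - \<Sum>A) * chain_wgt l x k C)"
    unfolding sum_distrib_left by (rule sum.Sigma) (use fin finite_chains in auto)
  also have "\<dots> = (\<Sum>C\<in>chains n (Suc k) B. chain_wgt l x (Suc k) C)"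
  proof (rule sum.reindex_bij_witness[of _ "\<lambda>C. (C k, restrict C {..k})" "\<lambda>(A, C). C(Suc k := B)"])
    fix p assume "p \<in> (SIGMA A:{A. il A B}. chains n k A)"
    then obtain A C where p: "p = (A, C)" "il A B" "C \<in> chains n k A" by auto
    have C: "C \<in> PiE {..k} (\<lambda>_. Pow {..<n})" "C 0 = {}" "C k = A" "\<And>i. i < k \<Longrightarrow> il (C i) (C (Suc i))"
      using p(3) by (auto simp: chains_def)
    have r: "restrict (C(Suc k := B)) {..k} = C" using C(1) by (auto simp: fun_eq_iff PiE_def extensional_def)
    show "(\<lambda>C. (C k, restrict C {..k})) (case p of (A, C) \<Rightarrow> C(Suc k := B)) = p" using p r C(3) by simp
    show "(case p of (A, C) \<Rightarrow> C(Suc k := B)) \<in> chains n (Suc k) B"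
      using C B p by (auto simp: chains_def PiE_def Pi_def extensional_def less_Suc_eq)
    have "chain_wgt l x k (C(Suc k := B)) = chain_wgt l x k C" unfolding chain_wgt_def by (intro prod.cong) auto
    then show "chain_wgt l x (Suc k) (case p of (A, C) \<Rightarrow> C(Suc k := B)) =
       (case p of (A, C) \<Rightarrow> iwgt l A B * x k ^ (\<Sum>B - \<Sum>A) * chain_wgt l x k C)"
      using p C(3) by (simp add: chain_wgt_def mult.commute)
  next
    fix C assume C: "C \<in> chains n (Suc k) B"
    then have C': "C \<in> PiE {..Suc k} (\<lambda>_. Pow {..<n})" "C 0 = {}" "C (Suc k) = B" "\<And>i. i < Suc k \<Longrightarrow> il (C i) (C (Suc i))"
      by (auto simp: chains_def)
    show "(case (C k, restrict C {..k}) of (A, C) \<Rightarrow> C(Suc k := B)) = C"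
      using C' by (auto simp: fun_eq_iff PiE_def extensional_def)
    show "(C k, restrict C {..k}) \<in> (SIGMA A:{A. il A B}. chains n k A)"
      using C' C'(4)[of k] by (auto simp: chains_def)
  qed
  finally show ?thesis by simp
qed

text \<open>
  Iterate the branching rule, one variable at a time.
\<close>

theorem chains_alternant:
  fixes x :: "nat \<Rightarrow> 'a::comm_ring_1"
  assumes "B \<subseteq> {..<n}" "card B = k"
  shows "(\<Prod>j<k. \<Prod>i<j. x j - x i) * (\<Sum>C\<in>chains n k B. chain_wgt l x k C)
    = (\<Prod>j<k. \<Prod>i<j. x j + l * x i) * alternant k x (en B)"
  using assms
proof (induction k arbitrary: B)
  case 0
  then have "B = {}" using finite_subset[OF 0(1)] by simp
  then have "chains n 0 B = {\<lambda>i\<in>{..0}. {}}" by (auto simp: chains_def PiE_def extensional_def fun_eq_iff)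
  then show ?case by (simp add: chain_wgt_def alternant_def)
next
  case (Suc k)
  have fB: "finite B" using Suc.prems finite_subset by blast
  let ?V = "\<Prod>j<k. \<Prod>i<j. x j - x i" and ?P = "\<Prod>j<k. \<Prod>i<j. x j + l * x i"
  have "(\<Prod>j<Suc k. \<Prod>i<j. x j - x i) * (\<Sum>C\<in>chains n (Suc k) B. chain_wgt l x (Suc k) C)
    = (\<Prod>i<k. x k - x i) * (\<Sum>A\<in>{A. il A B}. iwgt l A B * x k ^ (\<Sum>B - \<Sum>A) * (?V * (\<Sum>C\<in>chains n k A. chain_wgt l x k C)))"
    unfolding chains_Suc_sum[OF Suc.prems(1)] by (simp add: sum_distrib_left mult_ac)
  also have "\<dots> = (\<Prod>i<k. x k - x i) * (\<Sum>A\<in>{A. il A B}. iwgt l A B * x k ^ (\<Sum>B - \<Sum>A) * (?P * alternant k x (en A)))"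
  proof -
    have "?V * (\<Sum>C\<in>chains n k A. chain_wgt l x k C) = ?P * alternant k x (en A)" if "il A B" for A
      using Suc.prems il_subset[OF that] that by (intro Suc.IH) (auto simp: il_def)
    then show ?thesis by simp
  qed
  also have "\<dots> = ?P * ((\<Prod>i<k. x k - x i) * (\<Sum>A\<in>{A. il A B}. iwgt l A B * x k ^ (\<Sum>B - \<Sum>A) * alternant k x (en A)))"
    by (simp add: sum_distrib_left mult_ac)
  also have "\<dots> = ?P * ((\<Prod>i<k. x k + l * x i) * alternant (Suc k) x (en B))"
    unfolding il_branching[OF fB Suc.prems(2)] ..
  finally show ?case by (simp add: mult.assoc)
qed

text \<open>
  For the full set the alternant is the Vandermonde determinant, which cancels.
\<close>

lemma chains_sum:
  fixes x :: "nat \<Rightarrow> 'a::idom"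
  assumes inj: "inj_on x {..<n}"
  shows "(\<Sum>C\<in>chains n n {..<n}. chain_wgt l x n C) = (\<Prod>j<n. \<Prod>i<j. x j + l * x i)"
proof -
  let ?V = "\<Prod>j<n. \<Prod>i<j. x j - x i"
  have "en {..<n} i = i" if "i < n" for i using en_image[of n "\<lambda>i. i" i] that by simp
  then have "alternant n x (en {..<n}) = alternant n x (\<lambda>i. i)"
    unfolding alternant_def by (intro arg_cong[of _ _ det] eq_matI) auto
  then have "?V * (\<Sum>C\<in>chains n n {..<n}. chain_wgt l x n C) = (\<Prod>j<n. \<Prod>i<j. x j + l * x i) * ?V"
    using chains_alternant[of "{..<n}" n n x l] by (simp add: alternant_vandermonde)
  moreover have "x j - x i \<noteq> 0" if "j < n" "i < j" for i j
    using inj_on_eq_iff[OF inj, of j i] that by auto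
  then have "?V \<noteq> 0" by auto
  ultimately show ?thesis by (simp add: mult.commute)
qed

subsection \<open>Alternating sign matrices as chains\<close>

text \<open>
  Nonzero entries alternate, so a partial sum is determined by the sign of its last nonzero entry. The total 1 forces the
  last, and hence the first, sign to be positive.
\<close>

lemma alt_prefix_sums:
  fixes x :: "nat \<Rightarrow> int"
  assumes e: "\<And>i. i < n \<Longrightarrow> x i \<in> {0, 1, -1}" and s1: "(\<Sum>i<n. x i) = 1"
    and alt: "\<And>j k. j < k \<Longrightarrow> k < n \<Longrightarrow> x j \<noteq> 0 \<Longrightarrow> x k \<noteq> 0 \<Longrightarrow> (\<And>i. j < i \<Longrightarrow> i < k \<Longrightarrow> x i = 0) \<Longrightarrow> sgn (x k) = - sgn (x j)"
    and c: "c \<le> n"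
  shows "(\<Sum>i<c. x i) \<in> {0, 1}"
proof -
  have "\<exists>i. i < n \<and> x i \<noteq> 0"
  proof (rule ccontr)
    assume "\<not> ?thesis"
    then have "(\<Sum>i<n. x i) = 0" by (intro sum.neutral) auto
    then show False using s1 by simp
  qed
  define f where "f = (LEAST i. i < n \<and> x i \<noteq> 0)"
  have f: "f < n" "x f \<noteq> 0" "\<And>i. i < n \<Longrightarrow> x i \<noteq> 0 \<Longrightarrow> f \<le> i"
    using LeastI_ex[OF \<open>\<exists>i. i < n \<and> x i \<noteq> 0\<close>] unfolding f_def[symmetric] by (auto simp: f_def intro: Least_le)
  define s where "s = x f"
  have inv: "((\<forall>i<c. x i = 0) \<and> (\<Sum>i<c. x i) = 0) \<or>
    (\<exists>j<c. x j \<noteq> 0 \<and> (\<forall>i. j < i \<longrightarrow> i < c \<longrightarrow> x i = 0) \<and> ((x j = s \<and> (\<Sum>i<c. x i) = s) \<or> (x j = - s \<and> (\<Sum>i<c. x i) = 0)))"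
    if "c \<le> n" for c
    using that
  proof (induction c)
    case (Suc c)
    have cn: "c < n" using Suc by simp
    have IH: "((\<forall>i<c. x i = 0) \<and> (\<Sum>i<c. x i) = 0) \<or>
      (\<exists>j<c. x j \<noteq> 0 \<and> (\<forall>i. j < i \<longrightarrow> i < c \<longrightarrow> x i = 0) \<and> ((x j = s \<and> (\<Sum>i<c. x i) = s) \<or> (x j = - s \<and> (\<Sum>i<c. x i) = 0)))"
      using Suc by simp
    show ?case
    proof (cases "x c = 0")
      case True
      from IH show ?thesis
      proof
        assume "(\<forall>i<c. x i = 0) \<and> (\<Sum>i<c. x i) = 0"
        then show ?thesis using True by (auto simp: less_Suc_eq)
      next
        assume "\<exists>j<c. x j \<noteq> 0 \<and> (\<forall>i. j < i \<longrightarrow> i < c \<longrightarrow> x i = 0) \<and> ((x j = s \<and> (\<Sum>i<c. x i) = s) \<or> (x j = - s \<and> (\<Sum>i<c. x i) = 0))"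
        then obtain j where "j < c" "x j \<noteq> 0" "\<forall>i. j < i \<longrightarrow> i < c \<longrightarrow> x i = 0" "(x j = s \<and> (\<Sum>i<c. x i) = s) \<or> (x j = - s \<and> (\<Sum>i<c. x i) = 0)" by blast
        then show ?thesis using True by (intro disjI2 exI[of _ j]) (auto simp: less_Suc_eq)
      qed
    next
      case False
      from IH show ?thesis
      proof
        assume z: "(\<forall>i<c. x i = 0) \<and> (\<Sum>i<c. x i) = 0"
        then have "f = c" using f(3)[OF cn False] f(2) by (meson nat_less_le)
        then show ?thesis using z False by (intro disjI2 exI[of _ c]) (auto simp: s_def)
      next
        assume "\<exists>j<c. x j \<noteq> 0 \<and> (\<forall>i. j < i \<longrightarrow> i < c \<longrightarrow> x i = 0) \<and> ((x j = s \<and> (\<Sum>i<c. x i) = s) \<or> (x j = - s \<and> (\<Sum>i<c. x i) = 0))"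
        then obtain j where j: "j < c" "x j \<noteq> 0" "\<forall>i. j < i \<longrightarrow> i < c \<longrightarrow> x i = 0" "(x j = s \<and> (\<Sum>i<c. x i) = s) \<or> (x j = - s \<and> (\<Sum>i<c. x i) = 0)" by blast
        have "sgn (x c) = - sgn (x j)" by (rule alt) (use j cn False in auto)
        moreover have "x j \<in> {1, -1}" "x c \<in> {1, -1}" using e[of j] e[of c] j cn False by auto
        ultimately have "x c = - x j" by auto
        then show ?thesis using j(4) False by (intro disjI2 exI[of _ c]) auto
      qed
    qed
  qed simp
  have "s = 1" using inv[of n] s1 e[OF f(1)] f(2) by (auto simp: s_def)
  then show ?thesis using inv[OF c] by auto
qed

lemma prefix_sums_alt:
  fixes x :: "nat \<Rightarrow> int"
  assumes p: "\<And>c. c \<le> n \<Longrightarrow> (\<Sum>i<c. x i) \<in> {0, 1}"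
    and jk: "j < k" "k < n" "x j \<noteq> 0" "x k \<noteq> 0" "\<And>i. j < i \<Longrightarrow> i < k \<Longrightarrow> x i = 0"
  shows "sgn (x k) = - sgn (x j)"
proof -
  have "(\<Sum>i<k. x i) = (\<Sum>i<Suc j. x i)"
    by (rule sum.mono_neutral_right) (use jk in auto)
  moreover have "(\<Sum>i<Suc j. x i) = (\<Sum>i<j. x i) + x j" "(\<Sum>i<Suc k. x i) = (\<Sum>i<k. x i) + x k" by simp_all
  ultimately show ?thesis using p[of j] p[of "Suc j"] p[of k] p[of "Suc k"] jk by auto
qed

lemma alt_signs_iff:
  "alt_signs (list_of_vec v) \<longleftrightarrow> (\<forall>j k. j < k \<longrightarrow> k < dim_vec v \<longrightarrow> v $ j \<noteq> 0 \<longrightarrow> v $ k \<noteq> 0 \<longrightarrow>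
     (\<forall>l. j < l \<longrightarrow> l < k \<longrightarrow> v $ l = 0) \<longrightarrow> sgn (v $ k) = - sgn (v $ j))"
  unfolding alt_signs_def by (auto simp: list_of_vec_index)

lemma Alt_iff:
  "X \<in> Alt n \<longleftrightarrow> X \<in> carrier_mat n n \<and>
     (\<forall>i<n. \<forall>c\<le>n. (\<Sum>j<c. X $$ (i, j)) \<in> {0, 1}) \<and> (\<forall>j<n. \<forall>c\<le>n. (\<Sum>i<c. X $$ (i, j)) \<in> {0, 1}) \<and>
     (\<forall>i<n. (\<Sum>j<n. X $$ (i, j)) = 1) \<and> (\<forall>j<n. (\<Sum>i<n. X $$ (i, j)) = 1)"
  (is "_ \<longleftrightarrow> ?R")
proof
  assume X: "X \<in> Alt n"
  then have c: "X \<in> carrier_mat n n" and e: "\<And>i j. i < n \<Longrightarrow> j < n \<Longrightarrow> X $$ (i, j) \<in> {0, 1, -1}"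
    and s: "\<And>i. i < n \<Longrightarrow> (\<Sum>j<n. X $$ (i, j)) = 1" "\<And>j. j < n \<Longrightarrow> (\<Sum>i<n. X $$ (i, j)) = 1"
    and a: "\<And>i. i < n \<Longrightarrow> alt_signs (list_of_vec (row X i))" "\<And>j. j < n \<Longrightarrow> alt_signs (list_of_vec (col X j))"
    by (auto simp: Alt_def)
  have "(\<Sum>j<k. X $$ (i, j)) \<in> {0, 1}" if i: "i < n" and k: "k \<le> n" for i k
  proof (rule alt_prefix_sums[OF _ s(1)[OF i] _ k])
    fix j k assume jk: "j < k" "k < n" "X $$ (i, j) \<noteq> 0" "X $$ (i, k) \<noteq> 0" "\<And>l. j < l \<Longrightarrow> l < k \<Longrightarrow> X $$ (i, l) = 0"
    then show "sgn (X $$ (i, k)) = - sgn (X $$ (i, j))" using a(1)[OF i] i c unfolding alt_signs_iff by auto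
  qed (use e i in auto)
  moreover have "(\<Sum>i<k. X $$ (i, j)) \<in> {0, 1}" if j: "j < n" and k: "k \<le> n" for j k
  proof (rule alt_prefix_sums[OF _ s(2)[OF j] _ k])
    fix i k assume ik: "i < k" "k < n" "X $$ (i, j) \<noteq> 0" "X $$ (k, j) \<noteq> 0" "\<And>l. i < l \<Longrightarrow> l < k \<Longrightarrow> X $$ (l, j) = 0"
    then show "sgn (X $$ (k, j)) = - sgn (X $$ (i, j))" using a(2)[OF j] j c unfolding alt_signs_iff by auto
  qed (use e j in auto)
  ultimately show ?R using c s by auto
next
  assume R: ?R
  then have c: "X \<in> carrier_mat n n" and pr: "\<And>i k. i < n \<Longrightarrow> k \<le> n \<Longrightarrow> (\<Sum>j<k. X $$ (i, j)) \<in> {0, 1}"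
    and pc: "\<And>j k. j < n \<Longrightarrow> k \<le> n \<Longrightarrow> (\<Sum>i<k. X $$ (i, j)) \<in> {0, 1}" by auto
  have e: "X $$ (i, j) \<in> {0, 1, -1}" if "i < n" "j < n" for i j
    using pr[OF that(1), of j] pr[OF that(1), of "Suc j"] that by auto
  have "alt_signs (list_of_vec (row X i))" if i: "i < n" for i
    unfolding alt_signs_iff using prefix_sums_alt[of n "\<lambda>j. X $$ (i, j)", OF pr[OF i]] c i by auto
  moreover have "alt_signs (list_of_vec (col X j))" if j: "j < n" for j
    unfolding alt_signs_iff using prefix_sums_alt[of n "\<lambda>i. X $$ (i, j)", OF pc[OF j]] c j by auto
  ultimately show "X \<in> Alt n" using R e by (auto simp: Alt_def)
qed

text \<open>
  The inverse of taking column sums: the set \<open>C k\<close> consists of the columns in which the first \<open>k\<close> rows have sum 1.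
\<close>

definition cmat :: "nat \<Rightarrow> (nat \<Rightarrow> nat set) \<Rightarrow> int mat" where
  "cmat n C = mat n n (\<lambda>(i, j). of_bool (j \<in> C (Suc i)) - of_bool (j \<in> C i))"

lemma cmat_col_sum: "j < n \<Longrightarrow> c \<le> n \<Longrightarrow> (\<Sum>i<c. cmat n C $$ (i, j)) = of_bool (j \<in> C c) - of_bool (j \<in> C 0)"
  by (induction c) (auto simp: cmat_def)

lemma cnt_sum: "finite S \<Longrightarrow> int (cnt S c) = (\<Sum>j<c. of_bool (j \<in> S))"
proof -
  have "{s \<in> S. s < c} = {j \<in> {..<c}. j \<in> S}" by auto
  then show ?thesis by (simp add: cnt_def of_bool_def sum.If_cases Int_def)
qed

lemma cmat_row_sum: "i < n \<Longrightarrow> c \<le> n \<Longrightarrow> finite (C i) \<Longrightarrow> finite (C (Suc i)) \<Longrightarrow>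
   (\<Sum>j<c. cmat n C $$ (i, j)) = int (cnt (C (Suc i)) c) - int (cnt (C i) c)"
  by (simp add: cnt_sum cmat_def sum_subtractf)

text \<open>
  The partial column sums of an alternating sign matrix are indicators of sets, and the partial row sums being 0 or 1 says
  that consecutive sets interlace.
\<close>

lemma bij_chains_Alt: "bij_betw (cmat n) (chains n n {..<n}) (Alt n)"
proof (rule bij_betwI[of _ _ _ "\<lambda>X. \<lambda>k\<in>{..n}. {j \<in> {..<n}. (\<Sum>i<k. X $$ (i, j)) = 1}"])
  have fin: "finite (C k)" if "C \<in> chains n n {..<n}" "k \<le> n" for C k
    using that by (auto simp: chains_def PiE_def Pi_def intro: finite_subset)
  have cnt_all: "cnt S n = card S" if "S \<subseteq> {..<n}" for S
    unfolding cnt_def using that by (intro arg_cong[of _ _ card]) auto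
  show "cmat n \<in> chains n n {..<n} \<rightarrow> Alt n"
  proof
    fix C assume C: "C \<in> chains n n {..<n}"
    then have C': "\<And>k. k \<le> n \<Longrightarrow> C k \<subseteq> {..<n}" "C 0 = {}" "C n = {..<n}" "\<And>i. i < n \<Longrightarrow> il (C i) (C (Suc i))"
      by (auto simp: chains_def PiE_def Pi_def)
    show "cmat n C \<in> Alt n"
      unfolding Alt_iff
    proof (intro conjI allI impI)
      fix i c assume i: "i < n" and c: "c \<le> n"
      show "(\<Sum>j<c. cmat n C $$ (i, j)) \<in> {0, 1}"
      proof -
        have "cnt (C i) c \<le> cnt (C (Suc i)) c \<and> cnt (C (Suc i)) c \<le> Suc (cnt (C i) c)"
          using C'(4)[OF i] unfolding il_def by blast
        then have "int (cnt (C (Suc i)) c) - int (cnt (C i) c) \<in> {0, 1}" by auto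
        then show ?thesis using cmat_row_sum[OF i c fin[OF C] fin[OF C]] i by simp
      qed
    next
      fix j c assume j: "j < n" and c: "c \<le> n"
      show "(\<Sum>i<c. cmat n C $$ (i, j)) \<in> {0, 1}" using cmat_col_sum[OF j c] C'(2) by auto
    next
      fix i assume i: "i < n"
      show "(\<Sum>j<n. cmat n C $$ (i, j)) = 1"
        using C'(4)[OF i] cmat_row_sum[OF i order_refl fin[OF C] fin[OF C]] i C'(1) cnt_all by (auto simp: il_def)
    next
      fix j assume j: "j < n"
      show "(\<Sum>i<n. cmat n C $$ (i, j)) = 1" using cmat_col_sum[OF j order_refl] C' j by simp
    qed (simp add: cmat_def)
  qed
  show "(\<lambda>X. \<lambda>k\<in>{..n}. {j \<in> {..<n}. (\<Sum>i<k. X $$ (i, j)) = 1}) \<in> Alt n \<rightarrow> chains n n {..<n}"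
  proof
    fix X :: "int mat" assume "X \<in> Alt n"
    then have X: "X \<in> carrier_mat n n" "\<And>i k. i < n \<Longrightarrow> k \<le> n \<Longrightarrow> (\<Sum>j<k. X $$ (i, j)) \<in> {0, 1}"
      "\<And>j k. j < n \<Longrightarrow> k \<le> n \<Longrightarrow> (\<Sum>i<k. X $$ (i, j)) \<in> {0, 1}"
      "\<And>i. i < n \<Longrightarrow> (\<Sum>j<n. X $$ (i, j)) = 1" "\<And>j. j < n \<Longrightarrow> (\<Sum>i<n. X $$ (i, j)) = 1"
      unfolding Alt_iff by auto
    let ?C = "\<lambda>k. {j \<in> {..<n}. (\<Sum>i<k. X $$ (i, j)) = 1}"
    have d: "of_bool (j \<in> ?C (Suc i)) - of_bool (j \<in> ?C i) = X $$ (i, j)" if "i < n" "j < n" for i j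
      using X(3)[OF that(2), of i] X(3)[OF that(2), of "Suc i"] that by auto
    have il: "il (?C i) (?C (Suc i))" if i: "i < n" for i
    proof -
      have cn: "int (cnt (?C (Suc i)) c) - int (cnt (?C i) c) \<in> {0, 1}" for c
      proof -
        have m: "cnt (?C k) c = cnt (?C k) (min c n)" for k unfolding cnt_def by (intro arg_cong[of _ _ card]) auto
        have "int (cnt (?C (Suc i)) (min c n)) - int (cnt (?C i) (min c n)) = (\<Sum>j<min c n. of_bool (j \<in> ?C (Suc i)) - of_bool (j \<in> ?C i))"
          by (simp add: cnt_sum sum_subtractf)
        also have "\<dots> = (\<Sum>j<min c n. X $$ (i, j))" using d[OF i] by (intro sum.cong) auto
        finally have "int (cnt (?C (Suc i)) c) - int (cnt (?C i) c) = (\<Sum>j<min c n. X $$ (i, j))"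
          by (simp only: m[of i] m[of "Suc i"])
        moreover have "(\<Sum>j<min c n. X $$ (i, j)) \<in> {0, 1}" by (rule X(2)[OF i]) simp
        ultimately show ?thesis by (simp only:)
      qed
      have "int (cnt (?C (Suc i)) n) - int (cnt (?C i) n) = (\<Sum>j<n. of_bool (j \<in> ?C (Suc i)) - of_bool (j \<in> ?C i))"
        by (simp add: cnt_sum sum_subtractf)
      also have "\<dots> = (\<Sum>j<n. X $$ (i, j))" using d[OF i] by (intro sum.cong) auto
      finally have cX: "int (cnt (?C (Suc i)) n) - int (cnt (?C i) n) = (\<Sum>j<n. X $$ (i, j))" .
      have "int (card (?C (Suc i))) - int (card (?C i)) = 1"
      proof -
        have "cnt (?C k) n = card (?C k)" for k by (rule cnt_all) auto
        then show ?thesis using cX unfolding X(4)[OF i] by (simp only:)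
      qed
      then have "card (?C (Suc i)) = Suc (card (?C i))" by linarith
      moreover have "cnt (?C i) c \<le> cnt (?C (Suc i)) c \<and> cnt (?C (Suc i)) c \<le> Suc (cnt (?C i) c)" for c using cn[of c] by auto
      ultimately show ?thesis unfolding il_def by simp
    qed
    show "(\<lambda>k\<in>{..n}. ?C k) \<in> chains n n {..<n}"
      unfolding chains_def using il X(5) by auto
  qed
  fix C assume C: "C \<in> chains n n {..<n}"
  show "(\<lambda>k\<in>{..n}. {j \<in> {..<n}. (\<Sum>i<k. cmat n C $$ (i, j)) = 1}) = C"
  proof
    fix k show "(\<lambda>k\<in>{..n}. {j \<in> {..<n}. (\<Sum>i<k. cmat n C $$ (i, j)) = 1}) k = C k"
    proof (cases "k \<le> n")
      case True
      have "C 0 = {}" "C k \<subseteq> {..<n}" using C True by (auto simp: chains_def PiE_def Pi_def)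
      then show ?thesis using True cmat_col_sum[of _ n k C] by auto
    next
      case False
      then show ?thesis using C by (auto simp: chains_def PiE_def extensional_def)
    qed
  qed
next
  fix X :: "int mat" assume "X \<in> Alt n"
  then have X: "X \<in> carrier_mat n n" "\<And>j k. j < n \<Longrightarrow> k \<le> n \<Longrightarrow> (\<Sum>i<k. X $$ (i, j)) \<in> {0, 1}"
    unfolding Alt_iff by auto
  show "cmat n (\<lambda>k\<in>{..n}. {j \<in> {..<n}. (\<Sum>i<k. X $$ (i, j)) = 1}) = X"
  proof (rule eq_matI)
    fix i j assume "i < dim_row X" "j < dim_col X"
    then have ij: "i < n" "j < n" using X by auto
    show "cmat n (\<lambda>k\<in>{..n}. {j \<in> {..<n}. (\<Sum>i<k. X $$ (i, j)) = 1}) $$ (i, j) = X $$ (i, j)"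
      using X(2)[OF ij(2), of i] X(2)[OF ij(2), of "Suc i"] ij by (auto simp: cmat_def)
  qed (use X in \<open>auto simp: cmat_def\<close>)
qed

subsection \<open>The statistics of an alternating sign matrix\<close>

lemma cmat_gen_perm:
  assumes C: "C \<in> chains n n {..<n}" and i: "i < n"
  shows "gen_perm n (cmat n C) i = int (\<Sum>(C (Suc i)) - \<Sum>(C i)) + 1"
proof -
  have C': "C i \<subseteq> {..<n}" "C (Suc i) \<subseteq> {..<n}" "il (C i) (C (Suc i))"
    using C i by (auto simp: chains_def PiE_def Pi_def)
  have s: "(\<Sum>j<n. (int j + 1) * of_bool (j \<in> S)) = int (\<Sum>S) + int (card S)" if "S \<subseteq> {..<n}" for S
  proof -
    have "(\<Sum>j<n. (int j + 1) * of_bool (j \<in> S)) = (\<Sum>j\<in>S. int j + 1)"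
      by (rule sum.mono_neutral_cong_right) (use that in auto)
    then show ?thesis by (simp add: sum.distrib)
  qed
  have "gen_perm n (cmat n C) i = (\<Sum>j<n. (int j + 1) * of_bool (j \<in> C (Suc i))) - (\<Sum>j<n. (int j + 1) * of_bool (j \<in> C i))"
    unfolding gen_perm_def sum_subtractf[symmetric] using i by (intro sum.cong) (auto simp: cmat_def)
  also have "\<dots> = int (\<Sum>(C (Suc i))) - int (\<Sum>(C i)) + 1"
    using s[OF C'(1)] s[OF C'(2)] C'(3) by (simp add: il_def)
  finally show ?thesis using il_le_sum(1)[OF C'(3)] by (simp add: of_nat_diff)
qed

lemma asm_neg_cmat: "asm_neg n (cmat n C) = (\<Sum>i<n. card {j \<in> {..<n}. j \<in> C i \<and> j \<notin> C (Suc i)})"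
proof -
  have "{(i, j). i < n \<and> j < n \<and> cmat n C $$ (i, j) = -1} = (SIGMA i:{..<n}. {j \<in> {..<n}. j \<in> C i \<and> j \<notin> C (Suc i)})"
    by (auto simp: cmat_def of_bool_def split: if_splits)
  then show ?thesis by (simp add: asm_neg_def)
qed

lemma asm_inv_rows:
  "asm_inv n X = (\<Sum>a<n. \<Sum>b<n. X $$ (a, b) * (\<Sum>j\<in>{Suc b..<n}. \<Sum>i<a. X $$ (i, j)))"
proof -
  have "asm_inv n X = (\<Sum>((a, b), (j, i))\<in>(SIGMA ab:{..<n} \<times> {..<n}. {Suc (snd ab)..<n} \<times> {..<fst ab}). X $$ (a, b) * X $$ (i, j))"
    unfolding asm_inv_def
    by (rule sum.reindex_bij_witness[of _ "\<lambda>((a, b), (j, i)). ((i, j), (a, b))" "\<lambda>((i, j), (a, b)). ((a, b), (j, i))"]) auto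
  also have "\<dots> = (\<Sum>ab\<in>{..<n} \<times> {..<n}. \<Sum>ji\<in>{Suc (snd ab)..<n} \<times> {..<fst ab}. X $$ ab * X $$ (snd ji, fst ji))"
    by (subst sum.Sigma) (auto intro!: sum.cong)
  also have "\<dots> = (\<Sum>ab\<in>{..<n} \<times> {..<n}. X $$ ab * (\<Sum>j\<in>{Suc (snd ab)..<n}. \<Sum>i<fst ab. X $$ (i, j)))"
    by (simp add: sum_distrib_left[symmetric] sum.cartesian_product')
  also have "\<dots> = (\<Sum>a<n. \<Sum>b<n. X $$ (a, b) * (\<Sum>j\<in>{Suc b..<n}. \<Sum>i<a. X $$ (i, j)))"
    by (simp add: sum.cartesian_product')
  finally show ?thesis .
qed

text \<open>
  The elements of \<open>A\<close> that do not sit at the lower end of their interval in \<open>B\<close>.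
\<close>

definition lefts :: "nat set \<Rightarrow> nat set \<Rightarrow> nat set" where
  "lefts A B = {i. i < card A \<and> en A i \<noteq> en B i}"

text \<open>
  The contribution of one row to the inversion number, by comparing how many elements of \<open>A\<close> lie above the \<open>j\<close>-th
  element of \<open>B\<close> and of \<open>A\<close>.
\<close>

lemma row_inversions:
  assumes il: "il A B" and A: "A \<subseteq> {..<n}" and B: "B \<subseteq> {..<n}"
  shows "(\<Sum>b<n. (of_bool (b \<in> B) - of_bool (b \<in> A)) * (\<Sum>j\<in>{Suc b..<n}. of_bool (j \<in> A))) = int (card (lefts A B))"
proof -
  have f: "finite A" "finite B" "card B = Suc (card A)" using il by (auto simp: il_def)
  let ?k = "card A"
  define G where "G b = (\<Sum>i<?k. of_bool (b < en A i) :: int)" for b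
  have G: "(\<Sum>j\<in>{Suc b..<n}. of_bool (j \<in> A)) = G b" for b
  proof -
    have "(\<Sum>j\<in>{Suc b..<n}. of_bool (j \<in> A) :: int) = (\<Sum>j\<in>A. of_bool (b < j))"
      by (rule sum.mono_neutral_cong) (use A f in auto)
    then show ?thesis unfolding G_def sum_en[OF f(1)] .
  qed
  have S: "(\<Sum>b<n. of_bool (b \<in> S) * G b) = (\<Sum>i<card S. G (en S i))" if "S \<subseteq> {..<n}" for S
  proof -
    have fS: "finite S" using that finite_subset by blast
    have "(\<Sum>b<n. of_bool (b \<in> S) * G b) = (\<Sum>b\<in>S. G b)"
      by (rule sum.mono_neutral_cong_right) (use that in auto)
    then show ?thesis unfolding sum_en[OF fS] .
  qed
  have r: "en B i \<le> en A i" "en A i \<le> en B (Suc i)" if "i < ?k" for i using il il_en[OF f] that by auto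
  have gB: "G (en B j) = G (en A j) + of_bool (en A j \<noteq> en B j)" if j: "j < ?k" for j
  proof -
    have "of_bool (en B j < en A i) = of_bool (en A j < en A i) + (if i = j then of_bool (en A j \<noteq> en B j) else 0 :: int)" if i: "i < ?k" for i
    proof -
      consider "i < j" | "i = j" | "j < i" by linarith
      then show ?thesis
      proof cases
        case 1
        have "en A i \<le> en B j"
        proof -
          have "en B (Suc i) \<le> en B j" using 1 j en_mono[OF f(2), of "Suc i" j] f(3) by (cases "Suc i = j") auto
          then show ?thesis using r(2)[OF i] by simp
        qed
        then show ?thesis using 1 en_less_iff[OF f(1) j i] by simp
      next
        case 2
        then show ?thesis using r(1)[OF i] by auto
      next
        case 3
        have "en B j < en A i" using r(1)[OF j] en_mono[OF f(1) 3 i] by simp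
        then show ?thesis using 3 en_mono[OF f(1) 3 i] by simp
      qed
    qed
    then have "G (en B j) = (\<Sum>i<?k. of_bool (en A j < en A i) + (if i = j then of_bool (en A j \<noteq> en B j) else 0))"
      unfolding G_def by (intro sum.cong) auto
    then show ?thesis using j by (simp add: sum.distrib G_def)
  qed
  have gk: "G (en B ?k) = 0"
  proof -
    have "en A i \<le> en B ?k" if i: "i < ?k" for i
      using r(2)[OF i] en_mono[OF f(2), of "Suc i" ?k] f(3) i by (cases "Suc i = ?k") auto
    then show ?thesis unfolding G_def by (intro sum.neutral) (auto simp: not_less)
  qed
  have "(\<Sum>b<n. (of_bool (b \<in> B) - of_bool (b \<in> A)) * (\<Sum>j\<in>{Suc b..<n}. of_bool (j \<in> A)))
     = (\<Sum>b<n. of_bool (b \<in> B) * G b) - (\<Sum>b<n. of_bool (b \<in> A) * G b)"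
    unfolding G by (simp add: left_diff_distrib sum_subtractf)
  also have "\<dots> = (\<Sum>i<?k. of_bool (en A i \<noteq> en B i))"
    unfolding S[OF A] S[OF B] f(3) by (simp add: gk gB sum.distrib)
  also have "\<dots> = int (card (lefts A B))"
    unfolding lefts_def by (simp add: of_bool_def sum.If_cases Int_def)
  finally show ?thesis .
qed

lemma asm_inv_cmat:
  assumes C: "C \<in> chains n n {..<n}"
  shows "asm_inv n (cmat n C) = (\<Sum>i<n. int (card (lefts (C i) (C (Suc i)))))"
proof -
  have C': "C 0 = {}" "\<And>k. k \<le> n \<Longrightarrow> C k \<subseteq> {..<n}" "\<And>i. i < n \<Longrightarrow> il (C i) (C (Suc i))"
    using C by (auto simp: chains_def PiE_def Pi_def)
  show ?thesis unfolding asm_inv_rows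
  proof (rule sum.cong)
    fix a assume "a \<in> {..<n}"
    then have a: "a < n" by simp
    have "(\<Sum>b<n. cmat n C $$ (a, b) * (\<Sum>j\<in>{Suc b..<n}. \<Sum>i<a. cmat n C $$ (i, j))) =
      (\<Sum>b<n. (of_bool (b \<in> C (Suc a)) - of_bool (b \<in> C a)) * (\<Sum>j\<in>{Suc b..<n}. of_bool (j \<in> C a)))"
      using a C'(1) by (intro sum.cong arg_cong2[of _ _ _ _ "(*)"]) (auto simp: cmat_col_sum, simp_all add: cmat_def)
    also have "\<dots> = int (card (lefts (C a) (C (Suc a))))"
      by (rule row_inversions) (use C' a in auto)
    finally show "(\<Sum>b<n. cmat n C $$ (a, b) * (\<Sum>j\<in>{Suc b..<n}. \<Sum>i<a. cmat n C $$ (i, j))) = int (card (lefts (C a) (C (Suc a))))" .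
  qed simp
qed

text \<open>
  An element in the interior of its interval has weight \<open>1 + l = l (1 + 1/l)\<close>: it is counted by \<open>lefts\<close> and is an
  entry \<open>-1\<close>. At the upper end the weight is \<open>l\<close>, at the lower end 1.
\<close>

lemma iwgt_statistics:
  fixes l :: "'a::field"
  assumes il: "il A B" and l: "l \<noteq> 0" and A: "A \<subseteq> {..<n}"
  shows "iwgt l A B = l ^ card (lefts A B) * (1 + inverse l) ^ card {j \<in> {..<n}. j \<in> A \<and> j \<notin> B}"
proof -
  have f: "finite A" "finite B" "card B = Suc (card A)" using il by (auto simp: il_def)
  let ?k = "card A"
  have r: "en B i \<le> en A i" "en A i \<le> en B (Suc i)" if "i < ?k" for i using il il_en[OF f] that by auto
  have nB: "en A i \<notin> B \<longleftrightarrow> en A i \<noteq> en B i \<and> en A i \<noteq> en B (Suc i)" if i: "i < ?k" for i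
  proof
    assume "en A i \<notin> B"
    then show "en A i \<noteq> en B i \<and> en A i \<noteq> en B (Suc i)"
      using en_bij[OF f(2)] i f(3) by (metis Suc_lessI Suc_less_eq bij_betwE le_imp_less_Suc lessThan_iff less_imp_le_nat less_SucI)
  next
    assume n: "en A i \<noteq> en B i \<and> en A i \<noteq> en B (Suc i)"
    show "en A i \<notin> B"
    proof
      assume "en A i \<in> B"
      then obtain j where j: "j < card B" "en A i = en B j" using en_bij[OF f(2)] by (auto simp: bij_betw_def)
      then have "en B i < en B j" "en B j < en B (Suc i)" using n r[OF i] by auto
      then have "i < j" "j < Suc i" using en_less_iff[OF f(2)] j i f(3) by auto
      then show False by simp
    qed
  qed
  have step: "wgt l (en B i) (en B (Suc i)) (en A i) = (if en A i \<noteq> en B i then l else 1) * (if en A i \<notin> B then 1 + inverse l else 1)"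
    if i: "i < ?k" for i
  proof -
    have "en B i < en B (Suc i)" using en_mono[OF f(2), of i "Suc i"] i f(3) by simp
    then show ?thesis unfolding nB[OF i] using l by (auto simp: wgt_def field_simps)
  qed
  have "iwgt l A B = (\<Prod>i<?k. if en A i \<noteq> en B i then l else 1) * (\<Prod>i<?k. if en A i \<notin> B then 1 + inverse l else 1)"
    unfolding iwgt_def prod.distrib[symmetric] by (intro prod.cong) (use step in auto)
  also have "(\<Prod>i<?k. if en A i \<noteq> en B i then l else 1) = l ^ card (lefts A B)"
    by (simp add: prod.If_cases lefts_def Int_def)
  also have "(\<Prod>i<?k. if en A i \<notin> B then 1 + inverse l else 1) = (\<Prod>a\<in>A. if a \<notin> B then 1 + inverse l else 1)"
    using prod.reindex_bij_betw[OF en_bij[OF f(1)], of "\<lambda>a. if a \<notin> B then 1 + inverse l else 1"] by simp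
  also have "\<dots> = (1 + inverse l) ^ card {j \<in> {..<n}. j \<in> A \<and> j \<notin> B}"
  proof -
    have "A \<inter> {a. a \<notin> B} = {j \<in> {..<n}. j \<in> A \<and> j \<notin> B}" using A by auto
    then show ?thesis using f by (simp add: prod.If_cases)
  qed
  finally show ?thesis .
qed

text \<open>
  The \<open>\<lambda>\<close>-determinant of a Vandermonde matrix (Robbins and Rumsey). Translate matrices into chains: the weight of a chain
  becomes inversion number and number of entries \<open>-1\<close>, and the differences of the sums of consecutive sets become the
  generalized permutation. The map \<open>\<iota>\<close> allows parameters and variables from different rings.
\<close>

theorem robbins_rumsey:
  fixes x :: "nat \<Rightarrow> 'b::idom" and l :: "'a::field" and \<iota> :: "'a \<Rightarrow> 'b"
  assumes l: "l \<noteq> 0" and inj: "inj_on x {..<n}"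
    and hom: "\<iota> 0 = 0" "\<iota> 1 = 1" "\<And>a b. \<iota> (a + b) = \<iota> a + \<iota> b" "\<And>a b. \<iota> (a * b) = \<iota> a * \<iota> b"
  shows "(\<Sum>X\<in>Alt n. \<iota> (l powi asm_inv n X * (1 + inverse l) ^ asm_neg n X) * (\<Prod>i<n. x i ^ nat (gen_perm n X i - 1)))
     = (\<Prod>j<n. \<Prod>i<j. x j + \<iota> l * x i)"
proof -
  have hprod: "\<iota> (prod f S) = (\<Prod>s\<in>S. \<iota> (f s))" for f :: "nat \<Rightarrow> 'a" and S
    by (induction S rule: infinite_finite_induct) (auto simp: hom)
  have "(\<Sum>X\<in>Alt n. \<iota> (l powi asm_inv n X * (1 + inverse l) ^ asm_neg n X) * (\<Prod>i<n. x i ^ nat (gen_perm n X i - 1))) =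
    (\<Sum>C\<in>chains n n {..<n}. \<iota> (l powi asm_inv n (cmat n C) * (1 + inverse l) ^ asm_neg n (cmat n C)) * (\<Prod>i<n. x i ^ nat (gen_perm n (cmat n C) i - 1)))"
    by (rule sum.reindex_bij_betw[OF bij_chains_Alt, symmetric])
  also have "\<dots> = (\<Sum>C\<in>chains n n {..<n}. chain_wgt (\<iota> l) x n C)"
  proof (rule sum.cong)
    fix C assume C: "C \<in> chains n n {..<n}"
    then have C': "\<And>k. k \<le> n \<Longrightarrow> C k \<subseteq> {..<n}" "\<And>i. i < n \<Longrightarrow> il (C i) (C (Suc i))"
      by (auto simp: chains_def PiE_def Pi_def)
    have "l powi asm_inv n (cmat n C) * (1 + inverse l) ^ asm_neg n (cmat n C) =
      l ^ (\<Sum>i<n. card (lefts (C i) (C (Suc i)))) * (1 + inverse l) ^ (\<Sum>i<n. card {j \<in> {..<n}. j \<in> C i \<and> j \<notin> C (Suc i)})"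
      unfolding asm_inv_cmat[OF C] asm_neg_cmat of_nat_sum[symmetric] by (simp only: power_int_of_nat)
    also have "\<dots> = (\<Prod>i<n. iwgt l (C i) (C (Suc i)))"
      unfolding power_sum prod.distrib[symmetric] using C' l by (intro prod.cong refl iwgt_statistics[symmetric]) auto
    finally have "\<iota> (l powi asm_inv n (cmat n C) * (1 + inverse l) ^ asm_neg n (cmat n C)) = (\<Prod>i<n. \<iota> (iwgt l (C i) (C (Suc i))))"
      by (simp only: hprod)
    moreover have "\<iota> (iwgt l S T) = iwgt (\<iota> l) S T" for S T
      unfolding iwgt_def hprod by (intro prod.cong) (auto simp: wgt_def hom)
    moreover have "(\<Prod>i<n. x i ^ nat (gen_perm n (cmat n C) i - 1)) = (\<Prod>i<n. x i ^ (\<Sum>(C (Suc i)) - \<Sum>(C i)))"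
      by (intro prod.cong) (auto simp: cmat_gen_perm[OF C])
    ultimately show "\<iota> (l powi asm_inv n (cmat n C) * (1 + inverse l) ^ asm_neg n (cmat n C)) * (\<Prod>i<n. x i ^ nat (gen_perm n (cmat n C) i - 1)) = chain_wgt (\<iota> l) x n C"
      by (simp add: chain_wgt_def prod.distrib)
  qed simp
  also have "\<dots> = (\<Prod>j<n. \<Prod>i<j. x j + \<iota> l * x i)" by (rule chains_sum[OF inj])
  finally show ?thesis .
qed

lemma gen_perm_pos:
  assumes "X \<in> Alt n" "i < n" shows "gen_perm n X i \<ge> 1"
proof -
  obtain C where "C \<in> chains n n {..<n}" "X = cmat n C" using bij_chains_Alt[of n] assms(1) by (auto simp: bij_betw_def)
  then show ?thesis using cmat_gen_perm[of C n i] assms(2) by simp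
qed

lemma finite_Alt: "finite (Alt n)"
  using bij_betw_finite[OF bij_chains_Alt] finite_chains by blast

section \<open>The specialization \<open>t = q\<^sup>m\<close>\<close>

context macdonald_distinct
begin

lemma sf_coeff_mQ_same_nz: "is_partition \<nu> \<Longrightarrow> sf_coeff (mQ \<nu>) (pmon \<nu>) \<noteq> 0"
  using mQ_norm[of \<nu>] B_mQ_gl_same[of \<nu>] by (simp add: B_gl)

text \<open>
  Gram--Schmidt. The coefficients are quotients of single coefficients of symmetric functions whose denominators are norms,
  so regularity under a specialization passes from larger to smaller partitions.
\<close>

lemma mQ_gram_schmidt:
  assumes k: "is_partition \<kappa>"
  shows "mQ \<kappa> = gl \<kappa> - (\<Sum>\<nu>\<in>ups \<kappa>. sf_scale (sf_coeff (mQ \<nu>) (pmon \<kappa>) / sf_coeff (mQ \<nu>) (pmon \<nu>)) (mQ \<nu>))"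
proof -
  obtain a where a: "gl \<kappa> - mQ \<kappa> = (\<Sum>\<nu>\<in>ups \<kappa>. sf_scale (a \<nu>) (mQ \<nu>))"
    using span_image_finite[OF gl_mQ[OF k] finite_ups] by blast
  have "a \<nu> = sf_coeff (mQ \<nu>) (pmon \<kappa>) / sf_coeff (mQ \<nu>) (pmon \<nu>)" if n: "\<nu> \<in> ups \<kappa>" for \<nu>
  proof -
    have p: "is_partition \<nu>" "\<nu> \<noteq> \<kappa>" using n by (auto simp: ups_def)
    have "B (mQ \<nu>) (gl \<kappa> - mQ \<kappa>) = sf_coeff (mQ \<nu>) (pmon \<kappa>)"
      using mQ_orthogonal[OF p(1) k p(2)] by (simp add: B_diff_right B_gl)
    moreover have "B (mQ \<nu>) (gl \<kappa> - mQ \<kappa>) = (\<Sum>\<mu>\<in>ups \<kappa>. a \<mu> * B (mQ \<nu>) (mQ \<mu>))"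
      unfolding a by (simp add: B_sum_right B_scale_right)
    moreover have "\<dots> = (\<Sum>\<mu>\<in>{\<nu>}. a \<mu> * B (mQ \<nu>) (mQ \<mu>))"
      by (rule sum.mono_neutral_right) (use n finite_ups in \<open>auto simp: mQ_orthogonal[OF p(1)] ups_partition\<close>)
    moreover have "B (mQ \<nu>) (mQ \<nu>) = sf_coeff (mQ \<nu>) (pmon \<nu>)"
      using B_mQ_gl_same[OF p(1)] by (simp add: B_gl)
    ultimately show ?thesis using sf_coeff_mQ_same_nz[OF p(1)] by (simp add: field_simps)
  qed
  then have "gl \<kappa> - mQ \<kappa> = (\<Sum>\<nu>\<in>ups \<kappa>. sf_scale (sf_coeff (mQ \<nu>) (pmon \<kappa>) / sf_coeff (mQ \<nu>) (pmon \<nu>)) (mQ \<nu>))"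
    unfolding a by (intro sum.cong) auto
  then show ?thesis by (metis diff_diff_eq2 add_diff_cancel_left' diff_add_cancel)
qed

end

text \<open>
  A relation, because unlike the function \<open>spec_t\<close> it is compatible with the field operations without side
  conditions on definedness; by \<open>specializes_spec_t\<close> it determines the value of that function.
\<close>

definition specializes :: "nat \<Rightarrow> Qqt \<Rightarrow> Qq \<Rightarrow> bool" where
  "specializes m r v \<longleftrightarrow> (\<exists>a b. r = Fract a b \<and> poly b (monom 1 m) \<noteq> 0 \<and>
     v = Fract (poly a (monom 1 m)) (poly b (monom 1 m)))"

lemma specializes_spec_t: "specializes m r v \<Longrightarrow> spec_t m r = v"
  unfolding specializes_def using spec_t_Fract by blast

lemma specializes_unique: "specializes m r v \<Longrightarrow> specializes m r v' \<Longrightarrow> v = v'"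
  using specializes_spec_t by metis

lemma specializes_poly: "specializes m (to_fract a) (to_fract (poly a (monom 1 m)))"
  unfolding specializes_def to_fract_def by (rule exI[of _ a], rule exI[of _ 1]) simp

lemma specializes_0: "specializes m 0 0" and specializes_1: "specializes m 1 1"
  using specializes_poly[of m 0] specializes_poly[of m 1] by simp_all

lemma specializes_of_nat: "specializes m (of_nat n) (of_nat n)"
  using specializes_poly[of m "of_nat n"] by (simp add: to_fract_of_nat)

lemma specializes_add:
  assumes "specializes m r v" "specializes m r' v'"
  shows "specializes m (r + r') (v + v')"
proof -
  obtain a b a' b' where *: "r = Fract a b" "poly b (monom 1 m) \<noteq> 0" "v = Fract (poly a (monom 1 m)) (poly b (monom 1 m))"
    "r' = Fract a' b'" "poly b' (monom 1 m) \<noteq> 0" "v' = Fract (poly a' (monom 1 m)) (poly b' (monom 1 m))"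
    using assms unfolding specializes_def by blast
  then have "b \<noteq> 0" "b' \<noteq> 0" by auto
  then show ?thesis unfolding specializes_def
    by (intro exI[of _ "a * b' + a' * b"] exI[of _ "b * b'"]) (use * in simp)
qed

lemma specializes_mult:
  assumes "specializes m r v" "specializes m r' v'"
  shows "specializes m (r * r') (v * v')"
proof -
  obtain a b a' b' where *: "r = Fract a b" "poly b (monom 1 m) \<noteq> 0" "v = Fract (poly a (monom 1 m)) (poly b (monom 1 m))"
    "r' = Fract a' b'" "poly b' (monom 1 m) \<noteq> 0" "v' = Fract (poly a' (monom 1 m)) (poly b' (monom 1 m))"
    using assms unfolding specializes_def by blast
  show ?thesis unfolding specializes_def
    by (intro exI[of _ "a * a'"] exI[of _ "b * b'"]) (use * in simp)
qed

lemma specializes_inverse: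
  assumes "specializes m r v" "v \<noteq> 0"
  shows "specializes m (inverse r) (inverse v)"
proof -
  obtain a b where *: "r = Fract a b" "poly b (monom 1 m) \<noteq> 0" "v = Fract (poly a (monom 1 m)) (poly b (monom 1 m))"
    using assms unfolding specializes_def by blast
  have "poly a (monom 1 m) \<noteq> 0"
    using * assms(2) by (auto simp: fract_collapse)
  then show ?thesis unfolding specializes_def
    by (intro exI[of _ b] exI[of _ a]) (use * in simp)
qed

lemma specializes_divide:
  "specializes m r v \<Longrightarrow> specializes m r' v' \<Longrightarrow> v' \<noteq> 0 \<Longrightarrow> specializes m (r / r') (v / v')"
  unfolding divide_inverse by (intro specializes_mult specializes_inverse)

lemma specializes_diff:
  assumes "specializes m r v" "specializes m r' v'"
  shows "specializes m (r - r') (v - v')"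
proof -
  have "specializes m (- 1) (- 1)"
    using specializes_poly[of m "- 1"] by (simp add: to_fract_uminus)
  from specializes_add[OF assms(1) specializes_mult[OF this assms(2)]] show ?thesis by simp
qed

lemma specializes_power: "specializes m r v \<Longrightarrow> specializes m (r ^ n) (v ^ n)"
  by (induction n) (auto intro: specializes_1 specializes_mult)

lemma specializes_sum: "(\<And>x. x \<in> A \<Longrightarrow> specializes m (f x) (g x)) \<Longrightarrow> specializes m (sum f A) (sum g A)"
  by (induction A rule: infinite_finite_induct) (auto intro: specializes_0 specializes_add)

lemma var_q_power: "var_q ^ i = to_fract (monom 1 i)"
  by (simp add: var_q_def to_fract_def[symmetric] monom_altdef flip: to_fract_power)

lemma specializes_q: "specializes m var_q2 var_q"
proof -
  have "var_q2 = to_fract [:[:0, 1:]:]" "var_q = to_fract (poly [:[:0, 1:]:] (monom 1 m))"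
    by (simp_all add: var_q_def var_q2_def to_fract_def)
  then show ?thesis by (metis specializes_poly)
qed

lemma specializes_t: "specializes m var_t2 (var_q ^ m)"
proof -
  have "var_t2 = to_fract [:0, 1:]" "var_q ^ m = to_fract (poly [:0, 1:] (monom 1 m))"
    by (simp_all add: var_q_power var_t2_def to_fract_def)
  then show ?thesis by (metis specializes_poly)
qed

lemma var_q_power_inj: "var_q ^ i = var_q ^ j \<longleftrightarrow> i = j"
  by (simp add: var_q_power monom_eq_iff')

lemma char0_fract: "char0 TYPE(rat poly fract)" "char0 TYPE(rat poly poly fract)"
proof -
  have "(of_nat n :: rat poly fract) \<noteq> 0" if "n > 0" for n
    using that by (simp flip: to_fract_of_nat)
  moreover have "(of_nat n :: rat poly poly fract) \<noteq> 0" if "n > 0" for n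
    using that by (simp flip: to_fract_of_nat)
  ultimately show "char0 TYPE(rat poly fract)" "char0 TYPE(rat poly poly fract)" by (auto simp: char0_def)
qed

lemma macdonald_params_q: "m \<ge> 1 \<Longrightarrow> macdonald_params var_q (var_q ^ m)"
proof -
  assume m: "m \<ge> 1"
  have q: "var_q ^ i \<noteq> 1" if "i > 0" for i using var_q_power_inj[of i 0] that by simp
  have "var_q \<noteq> 0" using var_q_power_inj[of 1 2] by auto
  then show ?thesis
    using m q by unfold_locales (auto simp: char0_fract simp flip: power_mult)
qed

lemma macdonald_params_qt: "macdonald_params var_q2 var_t2"
proof -
  interpret S: macdonald_params var_q "var_q ^ 1" by (rule macdonald_params_q) simp
  have "var_q2 ^ i \<noteq> 1" "var_t2 ^ i \<noteq> 1" if "i > 0" for i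
    using specializes_unique[OF specializes_power[OF specializes_q[of 1], of i], of 1] S.q1[OF that]
      specializes_unique[OF specializes_power[OF specializes_t[of 1], of i], of 1] S.t1[OF that] specializes_1 by auto
  moreover have "var_q2 \<noteq> 0" "var_t2 \<noteq> 0"
    using specializes_unique[OF specializes_q[of 1], of 0] S.q0
      specializes_unique[OF specializes_t[of 1], of 0] S.t0 specializes_0 by auto
  ultimately show ?thesis by unfold_locales (auto simp: char0_fract)
qed

lemma decreasing_eqI:
  fixes e f :: "nat \<Rightarrow> nat"
  assumes e: "\<And>i j. i < j \<Longrightarrow> j < N \<Longrightarrow> e j < e i" and f: "\<And>i j. i < j \<Longrightarrow> j < N \<Longrightarrow> f j < f i"
    and im: "e ` {..<N} = f ` {..<N}" and i: "i < N"
  shows "e i = f i"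
proof -
  have c: "card {x \<in> g ` {..<N}. g k < x} = k" if g: "\<And>i j. i < j \<Longrightarrow> j < N \<Longrightarrow> g j < g i" and k: "k < N" for g :: "nat \<Rightarrow> nat" and k
  proof -
    have "j < k" if "j < N" "g k < g j" for j using g[of k j] that by (metis linorder_neqE_nat order_less_asym)
    then have "{x \<in> g ` {..<N}. g k < x} = g ` {..<k}" using g k by fastforce
    moreover have "inj_on g {..<k}"
      by (rule linorder_inj_onI) (use g k in \<open>fastforce+\<close>)
    ultimately show ?thesis by (simp add: card_image)
  qed
  obtain j where j: "j < N" "e i = f j" using im i by blast
  have "i = card {x \<in> e ` {..<N}. e i < x}" using c[of e i] e i by simp
  also have "\<dots> = j" unfolding im j(2) using c[of f j] f j(1) by simp
  finally show ?thesis using j by simp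
qed

text \<open>
  At \<open>t = q\<^sup>m\<close> the eigenvalue of a partition is, up to a common shift and a common power of \<open>q\<close>, the sum of
  the distinct powers \<open>q ^ (m (N - i) + \<kappa> ! i)\<close>, which determines the set of these exponents.
\<close>

lemma macdonald_distinct_q:
  assumes m: "m \<ge> 1"
  shows "macdonald_distinct var_q (var_q ^ m)"
proof -
  interpret macdonald_params var_q "var_q ^ m" by (rule macdonald_params_q[OF m])
  show ?thesis
  proof unfold_locales
    fix \<kappa> \<mu> :: "nat list"
    assume k: "is_partition \<kappa>" "is_partition \<mu>" and
      eq: "(\<Sum>i<length \<kappa>. inverse (var_q ^ m) ^ i * (var_q ^ (\<kappa> ! i) - 1)) = (\<Sum>i<length \<mu>. inverse (var_q ^ m) ^ i * (var_q ^ (\<mu> ! i) - 1))"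
    define N where "N = length \<kappa> + length \<mu>"
    define p where "p \<nu> i = (if i < length \<nu> then \<nu> ! i else 0)" for \<nu> :: "nat list" and i
    define e where "e \<nu> i = m * (N - i) + p \<nu> i" for \<nu> i
    have ev: "(\<Sum>i<length \<nu>. inverse (var_q ^ m) ^ i * (var_q ^ (\<nu> ! i) - 1)) * var_q ^ (m * N) + (\<Sum>i<N. var_q ^ (m * (N - i)))
        = to_fract (\<Sum>i<N. monom 1 (e \<nu> i))" if "length \<nu> \<le> N" for \<nu>
    proof -
      have "(\<Sum>i<length \<nu>. inverse (var_q ^ m) ^ i * (var_q ^ (\<nu> ! i) - 1)) = (\<Sum>i<N. inverse (var_q ^ m) ^ i * (var_q ^ p \<nu> i - 1))"
        by (rule sum.mono_neutral_cong_left) (use that in \<open>auto simp: p_def\<close>)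
      also have "\<dots> * var_q ^ (m * N) + (\<Sum>i<N. var_q ^ (m * (N - i))) = (\<Sum>i<N. inverse (var_q ^ m) ^ i * (var_q ^ p \<nu> i - 1) * var_q ^ (m * N) + var_q ^ (m * (N - i)))"
        by (simp add: sum.distrib sum_distrib_right)
      also have "\<dots> = (\<Sum>i<N. var_q ^ e \<nu> i)"
      proof (rule sum.cong)
        fix i assume "i \<in> {..<N}"
        then have N: "m * N = m * i + m * (N - i)" by (simp add: algebra_simps flip: add_mult_distrib2)
        have "inverse (var_q ^ m) ^ i * var_q ^ (m * N) = var_q ^ (m * (N - i))"
          unfolding N power_add using q0 by (simp add: power_mult power_inverse)
        then show "inverse (var_q ^ m) ^ i * (var_q ^ p \<nu> i - 1) * var_q ^ (m * N) + var_q ^ (m * (N - i)) = var_q ^ e \<nu> i"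
          unfolding e_def power_add by (simp add: algebra_simps)
      qed simp
      finally show ?thesis by (simp add: to_fract_sum var_q_power)
    qed
    have dec: "e \<nu> j < e \<nu> i" if n: "is_partition \<nu>" and ij: "i < j" "j < N" for \<nu> i j
    proof -
      have "p \<nu> j \<le> p \<nu> i" using n ij by (auto simp: p_def is_partition_def sorted_wrt_iff_nth_less)
      moreover have "m * (N - j) < m * (N - i)" using m ij by auto
      ultimately show ?thesis unfolding e_def by (intro add_less_le_mono)
    qed
    have "to_fract (\<Sum>i<N. monom 1 (e \<kappa> i) :: rat poly) = to_fract (\<Sum>i<N. monom 1 (e \<mu> i))"
      using ev[of \<kappa>] ev[of \<mu>] eq by (simp add: N_def)
    then have pe: "(\<Sum>i<N. monom 1 (e \<kappa> i) :: rat poly) = (\<Sum>i<N. monom 1 (e \<mu> i))" by (simp only: to_fract_eq_iff)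
    have im: "d \<in> e \<nu> ` {..<N} \<longleftrightarrow> coeff (\<Sum>i<N. monom 1 (e \<nu> i) :: rat poly) d \<noteq> 0" for \<nu> d
    proof -
      have "coeff (\<Sum>i<N. monom 1 (e \<nu> i) :: rat poly) d = of_nat (card {i \<in> {..<N}. e \<nu> i = d})"
        by (simp add: coeff_sum sum.If_cases Int_def)
      then show ?thesis by auto
    qed
    have "e \<kappa> ` {..<N} = e \<mu> ` {..<N}" by (intro equalityI subsetI) (simp_all only: im pe not_False_eq_True)
    then have "e \<kappa> i = e \<mu> i" if "i < N" for i
      by (rule decreasing_eqI[rotated 2]) (use dec k that in auto)
    then have pp: "p \<kappa> i = p \<mu> i" for i
      by (cases "i < N") (auto simp: e_def p_def N_def)
    show "\<kappa> = \<mu>"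
    proof (rule partition_eqI[OF k])
      have "sum_list (take c \<nu>) = (\<Sum>i<c. p \<nu> i)" for c \<nu>
        by (induction c) (auto simp: sum_take_Suc p_def simp del: take_Suc)
      then show "sum_list (take c \<kappa>) = sum_list (take c \<mu>)" for c by (simp add: pp)
    qed
  qed
qed

text \<open>
  Equal eigenvalues would specialize to equal eigenvalues at \<open>t = q\<close>.
\<close>

lemma macdonald_distinct_qt: "macdonald_distinct var_q2 var_t2"
proof -
  interpret S: macdonald_distinct var_q "var_q ^ 1" by (rule macdonald_distinct_q) simp
  interpret macdonald_params var_q2 var_t2 by (rule macdonald_params_qt)
  show ?thesis
  proof unfold_locales
    fix \<kappa> \<mu> :: "nat list"
    assume k: "is_partition \<kappa>" "is_partition \<mu>" "sum_list \<kappa> = sum_list \<mu>" and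
      eq: "(\<Sum>i<length \<kappa>. inverse var_t2 ^ i * (var_q2 ^ (\<kappa> ! i) - 1)) = (\<Sum>i<length \<mu>. inverse var_t2 ^ i * (var_q2 ^ (\<mu> ! i) - 1))"
    have sp: "specializes 1 (\<Sum>i<length \<nu>. inverse var_t2 ^ i * (var_q2 ^ (\<nu> ! i) - 1))
        (\<Sum>i<length \<nu>. inverse (var_q ^ 1) ^ i * (var_q ^ (\<nu> ! i) - 1))" for \<nu>
      by (intro specializes_sum specializes_mult specializes_power specializes_diff specializes_inverse
          specializes_1 specializes_q specializes_t S.t0)
    show "\<kappa> = \<mu>"
      by (rule S.ev_distinct[OF k], rule specializes_unique[OF sp]) (unfold eq, rule sp)
  qed
qed

definition sf_specializes :: "nat \<Rightarrow> Qqt symfun \<Rightarrow> Qq symfun \<Rightarrow> bool" where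
  "sf_specializes m F f \<longleftrightarrow> (\<forall>a. specializes m (sf_coeff F a) (sf_coeff f a))"

lemma sf_specializes_coeff: "sf_specializes m F f \<Longrightarrow> specializes m (sf_coeff F a) (sf_coeff f a)"
  by (simp add: sf_specializes_def)

lemma sf_specializes_spec_sf: "sf_specializes m F f \<Longrightarrow> spec_sf m F = f"
  by (rule sf_eqI) (simp add: spec_sf.rep_eq sf_specializes_def specializes_spec_t)

lemma sf_specializes_1: "sf_specializes m 1 1"
  by (simp add: sf_specializes_def sf_coeff_one specializes_0 specializes_1)

lemma sf_specializes_power_sum: "sf_specializes m (power_sum r) (power_sum r)"
  by (simp add: sf_specializes_def power_sum.rep_eq specializes_0 specializes_1)

lemma sf_specializes_diff: "sf_specializes m F f \<Longrightarrow> sf_specializes m G g \<Longrightarrow> sf_specializes m (F - G) (f - g)"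
  by (simp add: sf_specializes_def sf_coeff_diff specializes_diff)

lemma sf_specializes_sum: "(\<And>x. x \<in> A \<Longrightarrow> sf_specializes m (F x) (f x)) \<Longrightarrow> sf_specializes m (sum F A) (sum f A)"
  by (simp add: sf_specializes_def sf_coeff_sum specializes_sum)

lemma sf_specializes_scale: "specializes m c d \<Longrightarrow> sf_specializes m F f \<Longrightarrow> sf_specializes m (sf_scale c F) (sf_scale d f)"
  by (simp add: sf_specializes_def sf_coeff_scale specializes_mult)

lemma sf_specializes_mult: "sf_specializes m F f \<Longrightarrow> sf_specializes m G g \<Longrightarrow> sf_specializes m (F * G) (f * g)"
  by (auto simp: sf_specializes_def sf_coeff_times intro!: specializes_sum specializes_mult)

lemma sf_specializes_newton:
  assumes v: "\<And>k. k > 0 \<Longrightarrow> specializes m (V k) (v k)"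
  shows "sf_specializes m (newton V n) (newton v n)"
proof (induction n rule: less_induct)
  case (less n)
  show ?case
  proof (cases "n = 0")
    case False
    then have "(of_nat n :: rat poly fract) \<noteq> 0" using char0_fract by (auto simp: char0_def)
    then show ?thesis using False
      by (subst (1 2) newton.simps)
         (auto intro!: sf_specializes_scale sf_specializes_sum sf_specializes_mult sf_specializes_power_sum
            specializes_divide specializes_1 specializes_of_nat v less)
  qed (simp add: sf_specializes_1)
qed

text \<open>
  The Macdonald functions have no pole at \<open>t = q\<^sup>m\<close>, and their values there are the Macdonald functions
  built directly over \<open>\<rat>(q)\<close>.
\<close>

theorem Q_spec_eq:
  assumes m: "m \<ge> 1" and k: "is_partition \<kappa>"
  shows "Q_spec m \<kappa> = macdonald_distinct.mQ var_q (var_q ^ m) \<kappa>"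
proof -
  interpret A: macdonald_distinct var_q2 var_t2 by (rule macdonald_distinct_qt)
  interpret S: macdonald_distinct var_q "var_q ^ m" by (rule macdonald_distinct_q[OF m])
  have newton: "sf_specializes m (newton A.w n) (newton S.w n)" for n
    unfolding wt_def
    by (intro sf_specializes_newton specializes_divide specializes_diff specializes_1 specializes_power specializes_q specializes_t)
       (use S.q1 in auto)
  have gl: "sf_specializes m (A.gl \<kappa>) (S.gl \<kappa>)" for \<kappa>
  proof -
    have "sf_specializes m (prod_mset (image_mset (newton A.w) M)) (prod_mset (image_mset (newton S.w) M))" for M
      by (induction M) (auto intro: sf_specializes_1 sf_specializes_mult newton)
    then show ?thesis by (simp add: A.gl_def S.gl_def)
  qed
  have "sf_specializes m (A.mQ \<kappa>) (S.mQ \<kappa>)"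
    using k
  proof (induction rule: partition_induct_up)
    case (step \<kappa>)
    show ?case
      unfolding A.mQ_gram_schmidt[OF step(1)] S.mQ_gram_schmidt[OF step(1)]
      by (intro sf_specializes_diff gl sf_specializes_sum sf_specializes_scale specializes_divide sf_specializes_coeff step
          S.sf_coeff_mQ_same_nz) (auto simp: ups_partition)
  qed
  then show ?thesis
    unfolding Q_spec_def A.macdonald_Q_eq[OF k] by (rule sf_specializes_spec_sf)
qed

lemma Q_row_eq:
  assumes m: "m \<ge> 1"
  shows "Q_row m j = macdonald_params.gi var_q (var_q ^ m) j"
proof -
  interpret S: macdonald_distinct var_q "var_q ^ m" by (rule macdonald_distinct_q[OF m])
  show ?thesis
  proof (cases "j > 0")
    case True
    then have "is_partition [nat j]" by (simp add: is_partition_def)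
    then show ?thesis using True Q_spec_eq[OF m] S.mQ_row[of "nat j"] by (simp add: Q_row_def S.gi_def)
  qed (auto simp: Q_row_def S.gi_def)
qed

section \<open>The hyperdeterminant\<close>

definition asm_weight :: "'a::field \<Rightarrow> nat \<Rightarrow> int mat \<Rightarrow> 'a" where
  "asm_weight l n X = l powi asm_inv n X * (1 + inverse l) ^ asm_neg n X"

text \<open>
  Both \<open>y\<^sub>i\<close> and \<open>1 / y\<^sub>i\<close> are needed as variables, which is the role of the sign \<open>e\<close>.
\<close>

lemma asm_laurent_sum:
  fixes l :: "'a::field"
  assumes l: "l \<noteq> 0" and e: "e \<noteq> 0"
  shows "(\<Sum>X\<in>Alt n. lcst (asm_weight l n X) * (\<Prod>i<n. yv i (e * (gen_perm n X i - 1))))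
    = (\<Prod>j<n. \<Prod>i<j. yv j e + lcst l * yv i e)"
proof -
  have pw: "yv i (e * (gen_perm n X i - 1)) = (yv i e ^ nat (gen_perm n X i - 1) :: 'a laurent)" if "X \<in> Alt n" "i < n" for X i
    using gen_perm_pos[OF that] by (simp add: yv_power mult.commute)
  have "(\<Sum>X\<in>Alt n. lcst (asm_weight l n X) * (\<Prod>i<n. yv i (e * (gen_perm n X i - 1))))
    = (\<Sum>X\<in>Alt n. lcst (l powi asm_inv n X * (1 + inverse l) ^ asm_neg n X) * (\<Prod>i<n. yv i e ^ nat (gen_perm n X i - 1)))"
    unfolding asm_weight_def
    by (intro sum.cong refl arg_cong2[of _ _ _ _ "(*)"] prod.cong) (simp add: pw)
  also have "\<dots> = (\<Prod>j<n. \<Prod>i<j. yv j e + lcst l * yv i e)"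
    by (rule robbins_rumsey) (use l e inj_yv[of _ e] in \<open>auto simp: lcst_add lcst_mult inj_on_def\<close>)
  finally show ?thesis .
qed

lemma yv_pair_factor:
  fixes c :: "'a::comm_ring_1"
  shows "(yv j (- 1) - lcst c * yv i (- 1)) * (yv j 1 - lcst d * yv i 1) = (1 - lcst c * rt j i) * (1 - lcst d * rt i j)"
proof -
  have k: "yv j 1 * yv j (- 1) = 1" using yv_inverse[of j "1"] by simp
  have "yv j (- 1) * (1 - lcst c * rt j i) = yv j (- 1) - lcst c * yv i (- 1) * (yv j 1 * yv j (- 1))"
    unfolding rt_def by (simp add: right_diff_distrib mult_ac)
  then have 1: "yv j (- 1) - lcst c * yv i (- 1) = yv j (- 1) * (1 - lcst c * rt j i)" unfolding k by simp
  have "yv j 1 * (1 - lcst d * rt i j) = yv j 1 - lcst d * yv i 1 * (yv j 1 * yv j (- 1))"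
    unfolding rt_def by (simp add: right_diff_distrib mult_ac)
  then have 2: "yv j 1 - lcst d * yv i 1 = yv j 1 * (1 - lcst d * rt i j)" unfolding k by simp
  have "yv j (- 1) * A * (yv j 1 * C) = (yv j 1 * yv j (- 1)) * (A * C)" for A C :: "'a laurent"
    by (simp only: mult_ac)
  then have "yv j (- 1) * A * (yv j 1 * C) = A * C" for A C :: "'a laurent" unfolding k by simp
  then show ?thesis unfolding 1 2 .
qed

lemma double_range: "{1..2 * m} = {1..m} \<union> (\<lambda>r. m + r) ` {1..m :: nat}"
proof (intro equalityI subsetI)
  fix r assume "r \<in> {1..2 * m}"
  then have "r \<in> {1..m} \<or> r = m + (r - m) \<and> r - m \<in> {1..m}" by auto
  then show "r \<in> {1..m} \<union> (\<lambda>r. m + r) ` {1..m}" by blast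
qed auto

lemma prod_split_double:
  "(\<Prod>r\<in>{1..2 * m}. f r) = (\<Prod>r = 1..m. f r * f (m + r :: nat) :: 'a::comm_monoid_mult)"
proof -
  have "{1..2 * m} = {1..m} \<union> (\<lambda>r. m + r) ` {1..m}" by (rule double_range)
  moreover have "prod f ((\<lambda>r. m + r) ` {1..m}) = (\<Prod>r = 1..m. f (m + r))"
    by (rule prod.reindex_cong[OF _ refl]) (auto simp: inj_on_def)
  moreover have "{1..m} \<inter> (\<lambda>r. m + r) ` {1..m} = {}" by auto
  ultimately show ?thesis by (simp only: prod.union_disjoint finite_imageI finite_atLeastAtMost prod.distrib)
qed

text \<open>
  In a tuple of \<open>2 m\<close> matrices the \<open>r\<close>-th one carries the variables \<open>1 / y\<^sub>i\<close> and the parameter \<open>- q\<^sup>r\<^sup>-\<^sup>1\<close>, and the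
  \<open>(m + r)\<close>-th one the variables \<open>y\<^sub>i\<close> and the parameter \<open>- q\<^sup>r\<close>, for \<open>1 \<le> r \<le> m\<close>.
\<close>

definition hsgn :: "nat \<Rightarrow> nat \<Rightarrow> int" where
  "hsgn m r = (if r \<le> m then - 1 else 1)"

definition hpar :: "'a::field \<Rightarrow> nat \<Rightarrow> nat \<Rightarrow> 'a" where
  "hpar q m r = (if r \<le> m then - (q ^ (r - 1)) else - (q ^ (r - m)))"

text \<open>
  The \<open>r\<close>-th and the \<open>(m + r)\<close>-th product combine to the \<open>r\<close>-th factors of the two \<open>q\<close>-shifted factorials of each pair.
\<close>

lemma prod_kernels:
  fixes q :: "'a::field"
  shows "(\<Prod>r\<in>{1..2 * m}. \<Prod>j<n. \<Prod>i<j. yv j (hsgn m r) + lcst (hpar q m r) * yv i (hsgn m r)) = DP q m n 0"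
proof -
  have "(\<Prod>r\<in>{1..2 * m}. \<Prod>j<n. \<Prod>i<j. yv j (hsgn m r) + lcst (hpar q m r) * yv i (hsgn m r))
    = (\<Prod>r = 1..m. \<Prod>j<n. \<Prod>i<j. (1 - lcst (q ^ (r - 1)) * rt j i) * (1 - lcst (q ^ r) * rt i j))"
    unfolding prod_split_double prod.distrib[symmetric]
  proof (intro prod.cong refl)
    fix r j i assume "r \<in> {1..m}"
    then show "(yv j (hsgn m r) + lcst (hpar q m r) * yv i (hsgn m r)) *
        (yv j (hsgn m (m + r)) + lcst (hpar q m (m + r)) * yv i (hsgn m (m + r))) =
        (1 - lcst (q ^ (r - 1)) * rt j i) * (1 - lcst (q ^ r) * rt i j)"
      using yv_pair_factor[of j "q ^ (r - 1)" i "q ^ r"] by (simp add: hsgn_def hpar_def lcst_uminus)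
  qed
  also have "\<dots> = (\<Prod>j<n. \<Prod>i<j. \<Prod>r = 1..m. (1 - lcst (q ^ (r - 1)) * rt j i) * (1 - lcst (q ^ r) * rt i j))"
    by (subst prod.swap) (intro prod.cong refl prod.swap)
  also have "\<dots> = (\<Prod>j<n. \<Prod>i<j. dth q m j i)"
  proof (intro prod.cong refl)
    fix j i
    have "(\<Prod>r = 1..m. (1 - lcst (q ^ (r - 1)) * rt j i) * (1 - lcst (q ^ r) * rt i j))
      = (\<Prod>r<m. (1 - lcst (q ^ r) * rt j i) * (1 - lcst (q ^ Suc r) * rt i j))"
      by (rule prod.reindex_bij_witness[of _ Suc "\<lambda>r. r - 1"]) auto
    also have "\<dots> = dth q m j i"
      unfolding dth_def qpoch_def prod.distrib[symmetric]
      by (intro prod.cong refl) (simp add: lcst_mult lcst_power mult_ac)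
    finally show "(\<Prod>r = 1..m. (1 - lcst (q ^ (r - 1)) * rt j i) * (1 - lcst (q ^ r) * rt i j)) = dth q m j i" .
  qed
  also have "\<dots> = DP q m n 0" by (simp add: DP_def DS_def lessThan_atLeast0)
  finally show ?thesis .
qed

lemma phi_weight_eq: "phi_weight q m n X = (\<Prod>r\<in>{1..2 * m}. asm_weight (hpar q m r) n (X r))"
  unfolding phi_weight_def prod_split_double
  by (intro prod.cong) (auto simp: asm_weight_def hpar_def mult_ac)

lemma sum_split_double:
  fixes g :: "nat \<Rightarrow> int"
  shows "(\<Sum>r\<in>{1..2 * m}. hsgn m r * (g r - 1)) = (\<Sum>r = 1..m. g (m + r) - g r)"
proof -
  have "(\<Sum>r\<in>{1..2 * m}. f r) = (\<Sum>r = 1..m. f r + f (m + r))" for f :: "nat \<Rightarrow> int"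
  proof -
    have "{1..2 * m} = {1..m} \<union> (\<lambda>r. m + r) ` {1..m}" by (rule double_range)
    moreover have "sum f ((\<lambda>r. m + r) ` {1..m}) = (\<Sum>r = 1..m. f (m + r))"
      by (rule sum.reindex_cong[OF _ refl]) (auto simp: inj_on_def)
    moreover have "{1..m} \<inter> (\<lambda>r. m + r) ` {1..m} = {}" by auto
    ultimately show ?thesis by (simp only: sum.union_disjoint finite_imageI finite_atLeastAtMost sum.distrib)
  qed
  then show ?thesis by (auto simp: hsgn_def intro!: sum.cong)
qed

lemma prod_yv_sum: "finite A \<Longrightarrow> (\<Prod>r\<in>A. yv i (f r)) = yv i (\<Sum>r\<in>A. f r)"
  by (induction A rule: finite_induct) (auto simp: yv_add)

lemma (in macdonald_params) G_prod_yv: "G n (\<Prod>i<n. yv i (e i)) = (\<Prod>i<n. gi (e i))"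
proof -
  have s: "(\<Prod>i\<in>A. yv i (e i) :: 'a laurent) = Poly_Mapping.single (\<Sum>i\<in>A. Poly_Mapping.single i (e i)) 1" if "finite A" for A
    using that by (induction A rule: finite_induct) (auto simp: yv_def mult_single)
  show ?thesis
    by (simp add: s G_single gm_def lookup_sum lookup_single when_def)
qed

text \<open>
  The weight \<open>phi_weight\<close> is a product over the \<open>2 m\<close> matrices, so before \<open>G\<close> is applied the sum over tuples factors
  into \<open>2 m\<close> sums over alternating sign matrices.
\<close>

theorem (in macdonald_params) hyperdeterminant_as_constant_term:
  shows "(\<Sum>X\<in>PiE {1..2 * m} (\<lambda>_. Alt n). sf_scale (phi_weight q m n X)
      (\<Prod>i<n. gi (k + (\<Sum>r = 1..m. gen_perm n (X (m + r)) i - gen_perm n (X r) i)))) = G n (ymon n k * DP q m n 0)"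
proof -
  let ?S = "\<Sum>X\<in>PiE {1..2 * m} (\<lambda>_. Alt n). \<Prod>r\<in>{1..2 * m}. lcst (asm_weight (hpar q m r) n (X r)) * (\<Prod>i<n. yv i (hsgn m r * (gen_perm n (X r) i - 1)))"
  have "DP q m n 0 = (\<Prod>r\<in>{1..2 * m}. \<Sum>X\<in>Alt n. lcst (asm_weight (hpar q m r) n X) * (\<Prod>i<n. yv i (hsgn m r * (gen_perm n X i - 1))))"
    unfolding prod_kernels[symmetric]
    by (intro prod.cong refl asm_laurent_sum[symmetric]) (use q0 in \<open>auto simp: hpar_def hsgn_def\<close>)
  also have "\<dots> = ?S"
    by (rule prod_sum_PiE) (auto simp: finite_Alt)
  finally have DP: "DP q m n 0 = ?S" .
  have e: "ymon n k * ?S = (\<Sum>X\<in>PiE {1..2 * m} (\<lambda>_. Alt n). lcst (phi_weight q m n X) *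
      (\<Prod>i<n. yv i (k + (\<Sum>r = 1..m. gen_perm n (X (m + r)) i - gen_perm n (X r) i))))"
    unfolding sum_distrib_left
  proof (rule sum.cong)
    fix X
    have "(\<Prod>r\<in>{1..2 * m}. \<Prod>i<n. yv i (hsgn m r * (gen_perm n (X r) i - 1)) :: 'a laurent) =
        (\<Prod>i<n. yv i (\<Sum>r = 1..m. gen_perm n (X (m + r)) i - gen_perm n (X r) i))"
      by (subst prod.swap) (simp only: prod_yv_sum finite_atLeastAtMost sum_split_double)
    then show "ymon n k * (\<Prod>r\<in>{1..2 * m}. lcst (asm_weight (hpar q m r) n (X r)) * (\<Prod>i<n. yv i (hsgn m r * (gen_perm n (X r) i - 1)))) =
      lcst (phi_weight q m n X) * (\<Prod>i<n. yv i (k + (\<Sum>r = 1..m. gen_perm n (X (m + r)) i - gen_perm n (X r) i)))"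
      unfolding prod.distrib ymon_def yv_add phi_weight_eq lcst_prod by (simp only: mult_ac)
  qed simp
  show ?thesis unfolding DP e G_sum G_lcst G_prod_yv ..
qed

theorem theorem3p2:
  fixes k s m :: nat
  assumes "k \<ge> 1" and "s \<ge> 1" and "m \<ge> 1"
  shows "sf_scale (qpoch var_q var_q (s * m) / qpoch var_q var_q m ^ s) (Q_spec m (replicate s k)) =
         sf_scale (qpoch var_q var_q s / (1 - var_q) ^ s)
           (hyperdet var_q m s (\<lambda>i. Q_row m (int k + (\<Sum>r = 1..m. i (m + r) - i r))))"
proof -
  interpret macdonald_distinct var_q "var_q ^ m" by (rule macdonald_distinct_q[OF assms(3)])
  have Q: "Q_spec m (replicate s k) = mQ (replicate s k)"
    using Q_spec_eq[OF assms(3) is_partition_replicate] assms(1) by simp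
  have "qpoch var_q var_q s \<noteq> 0" by (rule qpoch_power_nz[OF q1])
  moreover have "1 - var_q \<noteq> 0" using q1[of 1] by simp
  ultimately have c: "(qpoch var_q var_q s / (1 - var_q) ^ s) * ((1 - var_q) ^ s / qpoch var_q var_q s) = 1"
    by simp
  have "sf_scale (qpoch var_q var_q s / (1 - var_q) ^ s)
      (hyperdet var_q m s (\<lambda>i. Q_row m (int k + (\<Sum>r = 1..m. i (m + r) - i r)))) =
    (\<Sum>X\<in>PiE {1..2 * m} (\<lambda>_. Alt s). sf_scale (phi_weight var_q m s X)
      (\<Prod>i<s. gi (int k + (\<Sum>r = 1..m. gen_perm s (X (m + r)) i - gen_perm s (X r) i))))"
    unfolding hyperdet_def sf.scale_scale c sf.scale_one Q_row_eq[OF assms(3)]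
    by (intro sum.cong refl arg_cong2[of _ _ _ _ sf_scale] prod.cong arg_cong[of _ _ gi] arg_cong2[of _ _ _ _ "(+)"]) auto
  also have "\<dots> = G s (ymon s (int k) * DP var_q m s 0)" by (rule hyperdeterminant_as_constant_term)
  also have "\<dots> = sf_scale (qpoch var_q var_q (s * m) / qpoch var_q var_q m ^ s) (mQ (replicate s k))"
    using assms by (intro rectangle_as_constant_term[symmetric]) auto
  finally show ?thesis unfolding Q ..
qed

end
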